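(* (Enough Subcountable Projectives.) In the v-set interpretation, every set $x$ is the image of a surjection $f:y\to x$ from a set $y\subseteq\omega$ which is projective: for every set $g$ that is a binary relation whose domain includes $y$, there is a set $h\subseteq g$ which is a function with domain $y$.
   Context: Work in Heyting arithmetic extended by unary predicates $\mathcal V$ ("v-set"), $\mathcal M$ ("Meaningful condition"), $\mathcal T$ ("True condition"). $\langle\cdot,\cdot\rangle$ is Cantor pairing with projections $(\cdot)_L,(\cdot)_R$; $en$ is Kleene application, $en\!\downarrow$ means it is defined. Write $\mathrm{cd}_x(n)=(xn)_R$, $\mathrm{el}_x(n)=(xn)_L$. $\Xi(f,g)$ is a fixed primitive recursive injective coding of pairs. Axioms: (V1) $\forall x\,[\forall n\,(xn\!\downarrow\wedge\mathcal M(\mathrm{cd}_x(n))\wedge(\mathcal T(\mathrm{cd}_x(n))\to\mathcal V(\mathrm{el}_x(n))))]\to\mathcal V(x)$; (V2) for every formula $\phi$: if the antecedent of (V1) with $\mathcal V$ replaced by $\phi$ implies $\phi(x)$ for all $x$, then $\forall x(\mathcal V(x)\to\phi(x))$; (X1) $\mathcal M(\Xi(f,g))\to(\mathcal T(\Xi(f,g))\leftrightarrow\forall n(fn\!\downarrow\wedge\mathcal T(fn)\to gn\!\downarrow\wedge\mathcal T(gn)))$; (X2) if $\forall n(fn\!\downarrow\to\mathcal M(fn))$ and $\forall n(fn\!\downarrow\wedge gn\!\downarrow\wedge\mathcal T(fn)\to\mathcal M(gn))$ then $\mathcal M(\Xi(f,g))$; ($\mathsf{ECT}_V$) $(\forall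 n(\phi(n)\to\exists m\,\psi(n,m)))\to\exists e\,\forall n(\phi(n)\to en\!\downarrow\wedge\psi(n,en))$ for arbitrary $\psi$ and almost-negative $\phi$ (built from $\Sigma_1$ formulas and atoms $\mathcal V(t),\mathcal M(t),\mathcal T(t)$ by $\wedge,\to,\forall_{\mathbb N}$). Sets are interpreted as v-sets (numbers $x$ with $\mathcal V(x)$); $EL(x)=\{\mathrm{el}_x(n):\mathcal T(\mathrm{cd}_x(n))\}$. Set equality is extensional equality $\simeq$ of v-sets, characterized by $x\simeq y\iff(\forall a\in EL(x)\exists b\in EL(y)\,a\simeq b)\wedge(\forall b\in EL(y)\exists a\in EL(x)\,b\simeq a)$ (in the system it is defined via a condition built from $\Xi$). Unbounded set quantifiers range over v-sets, bounded quantifiers $\forall a\in x$, $\exists a\in x$ range over $EL(x)$, and $x\in y$ means $\exists y'\in EL(y)\,x\simeq y'$. $\omega$, ordered pairs, functions etc. are as usual in set theory. A set-theoretic statement holds in the v-set interpretation if its interpretation is provable in this system. *)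

theory Defs
  imports "HOL-Library.Nat_Bijection"
begin

section \<open>Primitive recursive function symbols\<close>

text \<open>Symbols are variadic: at every length of the argument list a symbol denotes a primitive
  recursive function of that arity, where missing arguments are read as \<open>0\<close> and superfluous ones
  are ignored. So every symbol makes sense on every list, and no arity side conditions are needed.\<close>

datatype prfun =
    PZero
  | PSucc
  | PProj nat
  | PComp prfun "prfun list"
  | PRec prfun prfun

definition arg :: "'a \<Rightarrow> 'a list \<Rightarrow> nat \<Rightarrow> 'a" where
  "arg z xs i = (if i < length xs then xs ! i else z)"

primrec peval :: "prfun \<Rightarrow> nat list \<Rightarrow> nat" where
  "peval PZero xs = 0"
| "peval PSucc xs = Suc (arg 0 xs 0)"
| "peval (PProj i) xs = arg 0 xs i"
| "peval (PComp f gs) xs = peval f (map (\<lambda>h. h xs) (map peval gs))"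
| "peval (PRec f g) xs =
     rec_nat (peval f (tl xs)) (\<lambda>n r. peval g (n # r # tl xs)) (arg 0 xs 0)"

definition p_add :: prfun where
  "p_add = PRec (PProj 0) (PComp PSucc [PProj 1])"

definition p_pred :: prfun where
  "p_pred = PRec PZero (PProj 0)"

text \<open>Truncated subtraction with reversed arguments.\<close>
definition p_rsub :: prfun where
  "p_rsub = PRec (PProj 0) (PComp p_pred [PProj 1])"

definition p_if0 :: prfun where
  "p_if0 = PRec (PProj 0) (PProj 3)"

definition p_tri :: prfun where
  "p_tri = PRec PZero (PComp p_add [PComp PSucc [PProj 0], PProj 1])"

definition p_pair :: prfun where
  "p_pair = PComp p_add [PComp p_tri [p_add], PProj 0]"

text \<open>The number of the diagonal on which the argument lies in the Cantor enumeration.\<close>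
definition p_diag :: prfun where
  "p_diag = PRec PZero
     (PComp p_if0
        [PComp p_rsub [PComp PSucc [PProj 0], PComp p_tri [PComp PSucc [PProj 1]]],
         PComp PSucc [PProj 1],
         PProj 1])"

definition p_left :: prfun where
  "p_left = PComp p_rsub [PComp p_tri [p_diag], PProj 0]"

definition p_right :: prfun where
  "p_right = PComp p_rsub [p_left, p_diag]"

text \<open>A number codes the infinite sequence whose \<open>i\<close>-th entry is obtained from it by \<open>i\<close> right
  projections followed by a left one; the index is the first argument.\<close>
definition p_nth :: prfun where
  "p_nth = PComp p_left [PRec (PProj 0) (PComp p_right [PProj 1])]"

lemma peval_add [simp]: "peval p_add [m, n] = m + n"
  by (induction m) (simp_all add: p_add_def arg_def)

lemma peval_pred [simp]: "peval p_pred [n] = n - 1"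
  by (cases n) (simp_all add: p_pred_def arg_def)

lemma peval_rsub [simp]: "peval p_rsub [m, n] = n - m"
  by (induction m) (simp_all add: p_rsub_def arg_def)

lemma peval_if0 [simp]: "peval p_if0 [n, a, b] = (if n = 0 then a else b)"
  by (cases n) (simp_all add: p_if0_def arg_def)

lemma peval_tri [simp]: "peval p_tri [n] = triangle n"
  by (induction n) (simp_all add: p_tri_def arg_def)

lemma peval_pair [simp]: "peval p_pair [m, n] = prod_encode (m, n)"
  by (simp add: p_pair_def prod_encode_def arg_def)

lemma peval_diag_Suc:
  "peval p_diag [Suc z] =
     (if triangle (Suc (peval p_diag [z])) \<le> Suc z
      then Suc (peval p_diag [z]) else peval p_diag [z])"
  by (simp add: p_diag_def arg_def)

lemma peval_diag:
  "triangle (peval p_diag [z]) \<le> z \<and> z < triangle (Suc (peval p_diag [z]))"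
proof (induction z)
  case 0
  show ?case by (simp add: p_diag_def arg_def)
next
  case (Suc z)
  then show ?case by (auto simp: peval_diag_Suc simp del: triangle_Suc) simp
qed

lemma triangle_mono: "m \<le> n \<Longrightarrow> triangle m \<le> triangle n"
  by (induction n) (auto simp: le_Suc_eq)

lemma peval_diag_pair [simp]: "peval p_diag [prod_encode (m, n)] = m + n"
proof -
  let ?d = "peval p_diag [prod_encode (m, n)]"
  have 1: "triangle ?d \<le> triangle (m + n) + m" "triangle (m + n) + m < triangle (Suc ?d)"
    using peval_diag[of "prod_encode (m, n)"] by (simp_all add: prod_encode_def)
  have 2: "triangle (m + n) + m < triangle (Suc (m + n))" by simp
  have "\<not> ?d < m + n"
    using 1(2) triangle_mono[of "Suc ?d" "m + n"] by (auto simp del: triangle_Suc)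
  moreover have "\<not> m + n < ?d"
    using 1(1) 2 triangle_mono[of "Suc (m + n)" ?d] by (auto simp del: triangle_Suc)
  ultimately show ?thesis by simp
qed

lemma peval_left [simp]: "peval p_left [z] = fst (prod_decode z)"
proof -
  obtain m n where "z = prod_encode (m, n)" by (metis prod_decode_inverse surj_pair)
  then show ?thesis
    by (simp add: p_left_def arg_def) (simp add: prod_encode_def)
qed

lemma peval_right [simp]: "peval p_right [z] = snd (prod_decode z)"
proof -
  obtain m n where "z = prod_encode (m, n)" by (metis prod_decode_inverse surj_pair)
  then show ?thesis by (simp add: p_right_def arg_def)
qed


section \<open>Terms and formulas\<close>

text \<open>Variables are de Bruijn indices.\<close>

datatype tm =
    Var nat
  | Zero
  | Succ tm
  | Fn prfun "tm list"

datatype fm =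
    Equal tm tm
  | VV tm
  | MM tm
  | TT tm
  | Falsum
  | Conj fm fm
  | Disj fm fm
  | Impl fm fm
  | Forall fm
  | Exists fm

primrec sub_tm :: "(nat \<Rightarrow> tm) \<Rightarrow> tm \<Rightarrow> tm" where
  "sub_tm \<sigma> (Var i) = \<sigma> i"
| "sub_tm \<sigma> Zero = Zero"
| "sub_tm \<sigma> (Succ t) = Succ (sub_tm \<sigma> t)"
| "sub_tm \<sigma> (Fn f ts) = Fn f (map (sub_tm \<sigma>) ts)"

abbreviation lift_tm :: "tm \<Rightarrow> tm" where
  "lift_tm \<equiv> sub_tm (\<lambda>i. Var (Suc i))"

definition up :: "(nat \<Rightarrow> tm) \<Rightarrow> nat \<Rightarrow> tm" where
  "up \<sigma> = case_nat (Var 0) (\<lambda>i. lift_tm (\<sigma> i))"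

primrec sub :: "(nat \<Rightarrow> tm) \<Rightarrow> fm \<Rightarrow> fm" where
  "sub \<sigma> (Equal s t) = Equal (sub_tm \<sigma> s) (sub_tm \<sigma> t)"
| "sub \<sigma> (VV t) = VV (sub_tm \<sigma> t)"
| "sub \<sigma> (MM t) = MM (sub_tm \<sigma> t)"
| "sub \<sigma> (TT t) = TT (sub_tm \<sigma> t)"
| "sub \<sigma> Falsum = Falsum"
| "sub \<sigma> (Conj \<phi> \<psi>) = Conj (sub \<sigma> \<phi>) (sub \<sigma> \<psi>)"
| "sub \<sigma> (Disj \<phi> \<psi>) = Disj (sub \<sigma> \<phi>) (sub \<sigma> \<psi>)"
| "sub \<sigma> (Impl \<phi> \<psi>) = Impl (sub \<sigma> \<phi>) (sub \<sigma> \<psi>)"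
| "sub \<sigma> (Forall \<phi>) = Forall (sub (up \<sigma>) \<phi>)"
| "sub \<sigma> (Exists \<phi>) = Exists (sub (up \<sigma>) \<phi>)"

abbreviation lift :: "fm \<Rightarrow> fm" where
  "lift \<equiv> sub (\<lambda>i. Var (Suc i))"

definition inst :: "tm \<Rightarrow> fm \<Rightarrow> fm" where
  "inst t \<phi> = sub (case_nat t Var) \<phi>"

definition Iff :: "fm \<Rightarrow> fm \<Rightarrow> fm" where
  "Iff \<phi> \<psi> = Conj (Impl \<phi> \<psi>) (Impl \<psi> \<phi>)"

definition Neg :: "fm \<Rightarrow> fm" where
  "Neg \<phi> = Impl \<phi> Falsum"

primrec numt :: "nat \<Rightarrow> tm" where
  "numt 0 = Zero"
| "numt (Suc n) = Succ (numt n)"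

definition pairt :: "tm \<Rightarrow> tm \<Rightarrow> tm" where
  "pairt s t = Fn p_pair [s, t]"

definition leftt :: "tm \<Rightarrow> tm" where
  "leftt t = Fn p_left [t]"

definition rightt :: "tm \<Rightarrow> tm" where
  "rightt t = Fn p_right [t]"

definition predt :: "tm \<Rightarrow> tm" where
  "predt t = Fn p_pred [t]"

definition ntht :: "tm \<Rightarrow> tm \<Rightarrow> tm" where
  "ntht s i = Fn p_nth [i, s]"

definition lt :: "tm \<Rightarrow> tm \<Rightarrow> fm" where
  "lt s t = Equal (Fn p_rsub [t, Succ s]) Zero"

definition BForall :: "tm \<Rightarrow> fm \<Rightarrow> fm" where
  "BForall t \<phi> = Forall (Impl (lt (Var 0) (lift_tm t)) \<phi>)"

definition BExists :: "tm \<Rightarrow> fm \<Rightarrow> fm" where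
  "BExists t \<phi> = Exists (Conj (lt (Var 0) (lift_tm t)) \<phi>)"

inductive delta0 :: "fm \<Rightarrow> bool" where
  "delta0 (Equal s t)"
| "delta0 Falsum"
| "delta0 \<phi> \<Longrightarrow> delta0 \<psi> \<Longrightarrow> delta0 (Conj \<phi> \<psi>)"
| "delta0 \<phi> \<Longrightarrow> delta0 \<psi> \<Longrightarrow> delta0 (Disj \<phi> \<psi>)"
| "delta0 \<phi> \<Longrightarrow> delta0 \<psi> \<Longrightarrow> delta0 (Impl \<phi> \<psi>)"
| "delta0 \<phi> \<Longrightarrow> delta0 (BForall t \<phi>)"
| "delta0 \<phi> \<Longrightarrow> delta0 (BExists t \<phi>)"

inductive sigma1 :: "fm \<Rightarrow> bool" where
  "delta0 \<phi> \<Longrightarrow> sigma1 \<phi>"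
| "sigma1 \<phi> \<Longrightarrow> sigma1 (Exists \<phi>)"

inductive almost_negative :: "fm \<Rightarrow> bool" where
  "sigma1 \<phi> \<Longrightarrow> almost_negative \<phi>"
| "almost_negative (VV t)"
| "almost_negative (MM t)"
| "almost_negative (TT t)"
| "almost_negative \<phi> \<Longrightarrow> almost_negative \<psi> \<Longrightarrow> almost_negative (Conj \<phi> \<psi>)"
| "almost_negative \<phi> \<Longrightarrow> almost_negative \<psi> \<Longrightarrow> almost_negative (Impl \<phi> \<psi>)"
| "almost_negative \<phi> \<Longrightarrow> almost_negative (Forall \<phi>)"


section \<open>Kleene application\<close>

text \<open>Unary partial recursive functions are indexed as follows, an index \<open>\<langle>t, d\<rangle>\<close> with a tag \<open>t > 7\<close>
  being nowhere defined:

    \<^item> \<open>\<langle>0, _\<rangle> n = 0\<close>, \<open>\<langle>1, _\<rangle> n = n + 1\<close>, \<open>\<langle>2, _\<rangle> n = n\<^sub>L\<close>, \<open>\<langle>3, _\<rangle> n = n\<^sub>R\<close>;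
    \<^item> pairing: \<open>\<langle>4, \<langle>a, b\<rangle>\<rangle> n = \<langle>a n, b n\<rangle>\<close>;
    \<^item> composition: \<open>\<langle>5, \<langle>a, b\<rangle>\<rangle> n = a (b n)\<close>;
    \<^item> primitive recursion: for \<open>e = \<langle>6, \<langle>a, b\<rangle>\<rangle>\<close>, \<open>e \<langle>n, 0\<rangle> = a n\<close> and
      \<open>e \<langle>n, m + 1\<rangle> = b \<langle>\<langle>n, m\<rangle>, e \<langle>n, m\<rangle>\<rangle>\<close>;
    \<^item> minimization: \<open>\<langle>7, a\<rangle> \<langle>n, m\<rangle>\<close> is the least \<open>s \<ge> m\<close> with \<open>a \<langle>n, s\<rangle> = 0\<close>, provided that
      \<open>a \<langle>n, i\<rangle>\<close> is defined for all \<open>m \<le> i \<le> s\<close>.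

  A node \<open>\<langle>e, \<langle>n, k\<rangle>\<rangle>\<close> asserts that \<open>e n = k\<close>. A computation is a finite sequence of nodes each of
  which follows by one of these clauses from earlier nodes.\<close>

definition node_idx :: "tm \<Rightarrow> tm" where
  "node_idx c = leftt c"

definition node_arg :: "tm \<Rightarrow> tm" where
  "node_arg c = leftt (rightt c)"

definition node_val :: "tm \<Rightarrow> tm" where
  "node_val c = rightt (rightt c)"

definition has_tag :: "tm \<Rightarrow> nat \<Rightarrow> fm" where
  "has_tag c m = Equal (leftt (node_idx c)) (numt m)"

definition evaluates :: "tm \<Rightarrow> tm \<Rightarrow> tm \<Rightarrow> fm" where
  "evaluates p e n = Conj (Equal (node_idx p) e) (Equal (node_arg p) n)"

definition initial_step :: "tm \<Rightarrow> fm" where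
  "initial_step c =
     (let n = node_arg c; k = node_val c in
      Disj (Conj (has_tag c 0) (Equal k Zero))
     (Disj (Conj (has_tag c 1) (Equal k (Succ n)))
     (Disj (Conj (has_tag c 2) (Equal k (leftt n)))
           (Conj (has_tag c 3) (Equal k (rightt n))))))"

definition compound_step :: "tm \<Rightarrow> tm \<Rightarrow> tm \<Rightarrow> fm" where
  "compound_step c p q =
     (let e = node_idx c; n = node_arg c; k = node_val c;
          d = rightt e; a = leftt d; b = rightt d;
          m = pairt (leftt n) (predt (rightt n)) in
      Disj (Conj (has_tag c 4)
              (Conj (evaluates p a n) (Conj (evaluates q b n)
                 (Equal k (pairt (node_val p) (node_val q))))))
     (Disj (Conj (has_tag c 5)
              (Conj (evaluates p b n) (Conj (evaluates q a (node_val p))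
                 (Equal k (node_val q)))))
     (Disj (Conj (has_tag c 6)
              (Conj (Equal (rightt n) Zero)
                 (Conj (evaluates p a (leftt n)) (Equal k (node_val p)))))
     (Disj (Conj (has_tag c 6)
              (Conj (Neg (Equal (rightt n) Zero))
                 (Conj (evaluates p e m) (Conj (evaluates q b (pairt m (node_val p)))
                    (Equal k (node_val q))))))
     (Disj (Conj (has_tag c 7)
              (Conj (evaluates p d n) (Conj (Equal (node_val p) Zero)
                 (Equal k (rightt n)))))
           (Conj (has_tag c 7)
              (Conj (evaluates p d n) (Conj (Neg (Equal (node_val p) Zero))
                 (Conj (evaluates q e (pairt (leftt n) (Succ (rightt n))))
                    (Equal k (node_val q)))))))))))"

definition computation_step :: "tm \<Rightarrow> tm \<Rightarrow> fm" where
  "computation_step s i =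
     Disj (initial_step (ntht s i))
       (BExists i (BExists (lift_tm i)
          (compound_step (lift_tm (lift_tm (ntht s i)))
             (ntht (lift_tm (lift_tm s)) (Var 1))
             (ntht (lift_tm (lift_tm s)) (Var 0)))))"

text \<open>\<open>app e n k\<close> is the \<open>\<Sigma>\<^sub>1\<close> formula \<open>e n = k\<close>. The bound variable codes \<open>\<langle>l, s\<rangle>\<close> where \<open>s\<close> is a
  computation with nodes \<open>0, \<dots>, l\<close> the last of which asserts \<open>e n = k\<close>.\<close>
definition app :: "tm \<Rightarrow> tm \<Rightarrow> tm \<Rightarrow> fm" where
  "app e n k =
     Exists (Conj
       (BForall (Succ (leftt (Var 0))) (computation_step (rightt (Var 1)) (Var 0)))
       (Equal (ntht (rightt (Var 0)) (leftt (Var 0)))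
              (pairt (lift_tm e) (pairt (lift_tm n) (lift_tm k)))))"

lemma sigma1_app: "sigma1 (app e n k)"
  unfolding app_def computation_step_def compound_step_def initial_step_def Let_def
    has_tag_def evaluates_def Neg_def
  by (intro sigma1.intros delta0.intros)


section \<open>The axioms\<close>

text \<open>A formula about a partial term \<open>e n\<close> is expressed through the graph \<open>app\<close>.

  \<open>vset_step \<phi>\<close> is the antecedent of the closure axiom for v-sets with \<open>\<V>\<close> replaced by \<open>\<phi>\<close>. In both
  formulas \<open>Var 0\<close> is the set variable and the other variables are parameters.\<close>

definition vset_step :: "fm \<Rightarrow> fm" where
  "vset_step \<phi> =
     Forall (Exists (Conj (app (Var 2) (Var 1) (Var 0))
       (Conj (MM (rightt (Var 0)))
             (Impl (TT (rightt (Var 0)))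
                   (sub (case_nat (leftt (Var 0)) (\<lambda>i. Var (i + 3))) \<phi>)))))"

text \<open>In the extended Church's thesis below, \<open>Var 0\<close> is \<open>n\<close> in \<open>\<phi>\<close>, while \<open>Var 0\<close> is \<open>m\<close> and
  \<open>Var 1\<close> is \<open>n\<close> in \<open>\<psi>\<close>; the other variables are parameters.\<close>

inductive axiom :: "prfun \<Rightarrow> fm \<Rightarrow> bool" for Xi :: prfun where
  Succ_inject: "axiom Xi (Impl (Equal (Succ s) (Succ t)) (Equal s t))"
| Succ_not_Zero: "axiom Xi (Neg (Equal (Succ t) Zero))"
| PZero: "axiom Xi (Equal (Fn PZero ts) Zero)"
| PSucc: "axiom Xi (Equal (Fn PSucc ts) (Succ (arg Zero ts 0)))"
| PProj: "axiom Xi (Equal (Fn (PProj i) ts) (arg Zero ts i))"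
| PComp: "axiom Xi (Equal (Fn (PComp f gs) ts) (Fn f (map (\<lambda>g. Fn g ts) gs)))"
| PRec_Nil: "axiom Xi (Equal (Fn (PRec f g) []) (Fn f []))"
| PRec_Zero: "axiom Xi (Equal (Fn (PRec f g) (Zero # ts)) (Fn f ts))"
| PRec_Succ: "axiom Xi (Equal (Fn (PRec f g) (Succ t # ts))
                              (Fn g (t # Fn (PRec f g) (t # ts) # ts)))"
| induction: "axiom Xi
    (Impl (inst Zero \<phi>)
    (Impl (Forall (Impl \<phi> (sub (case_nat (Succ (Var 0)) (\<lambda>i. Var (Suc i))) \<phi>)))
          (Forall \<phi>)))"
| V1: "axiom Xi (Forall (Impl (vset_step (VV (Var 0))) (VV (Var 0))))"
| V2: "axiom Xi (Impl (Forall (Impl (vset_step \<phi>) \<phi>)) (Forall (Impl (VV (Var 0)) \<phi>)))"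
| X1: "axiom Xi (Forall (Forall
    (Impl (MM (Fn Xi [Var 1, Var 0]))
      (Iff (TT (Fn Xi [Var 1, Var 0]))
        (Forall
          (Impl (Exists (Conj (app (Var 3) (Var 1) (Var 0)) (TT (Var 0))))
                (Exists (Conj (app (Var 2) (Var 1) (Var 0)) (TT (Var 0))))))))))"
| X2: "axiom Xi (Forall (Forall
    (Impl (Conj
        (Forall (Forall (Impl (app (Var 3) (Var 1) (Var 0)) (MM (Var 0)))))
        (Forall (Forall (Forall
          (Impl (Conj (app (Var 4) (Var 2) (Var 1))
                  (Conj (app (Var 3) (Var 2) (Var 0)) (TT (Var 1))))
                (MM (Var 0)))))))
      (MM (Fn Xi [Var 1, Var 0])))))"
| ECT: "almost_negative \<phi> \<Longrightarrow> axiom Xi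
    (Impl (Forall (Impl \<phi> (Exists \<psi>)))
      (Exists (Forall
        (Impl (sub (case_nat (Var 0) (\<lambda>i. Var (i + 2))) \<phi>)
          (Exists (Conj (app (Var 2) (Var 1) (Var 0))
            (sub (case_nat (Var 0) (case_nat (Var 1) (\<lambda>i. Var (i + 3)))) \<psi>)))))))"


section \<open>Intuitionistic provability\<close>

inductive deduces :: "prfun \<Rightarrow> fm set \<Rightarrow> fm \<Rightarrow> bool" for Xi :: prfun where
  Ax: "axiom Xi \<phi> \<Longrightarrow> deduces Xi \<Gamma> \<phi>"
| Hyp: "\<phi> \<in> \<Gamma> \<Longrightarrow> deduces Xi \<Gamma> \<phi>"
| FalsumE: "deduces Xi \<Gamma> Falsum \<Longrightarrow> deduces Xi \<Gamma> \<phi>"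
| ConjI: "deduces Xi \<Gamma> \<phi> \<Longrightarrow> deduces Xi \<Gamma> \<psi> \<Longrightarrow> deduces Xi \<Gamma> (Conj \<phi> \<psi>)"
| ConjE1: "deduces Xi \<Gamma> (Conj \<phi> \<psi>) \<Longrightarrow> deduces Xi \<Gamma> \<phi>"
| ConjE2: "deduces Xi \<Gamma> (Conj \<phi> \<psi>) \<Longrightarrow> deduces Xi \<Gamma> \<psi>"
| DisjI1: "deduces Xi \<Gamma> \<phi> \<Longrightarrow> deduces Xi \<Gamma> (Disj \<phi> \<psi>)"
| DisjI2: "deduces Xi \<Gamma> \<psi> \<Longrightarrow> deduces Xi \<Gamma> (Disj \<phi> \<psi>)"
| DisjE: "deduces Xi \<Gamma> (Disj \<phi> \<psi>) \<Longrightarrow> deduces Xi (insert \<phi> \<Gamma>) \<chi> \<Longrightarrow>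
    deduces Xi (insert \<psi> \<Gamma>) \<chi> \<Longrightarrow> deduces Xi \<Gamma> \<chi>"
| ImplI: "deduces Xi (insert \<phi> \<Gamma>) \<psi> \<Longrightarrow> deduces Xi \<Gamma> (Impl \<phi> \<psi>)"
| ImplE: "deduces Xi \<Gamma> (Impl \<phi> \<psi>) \<Longrightarrow> deduces Xi \<Gamma> \<phi> \<Longrightarrow> deduces Xi \<Gamma> \<psi>"
| ForallI: "deduces Xi (lift ` \<Gamma>) \<phi> \<Longrightarrow> deduces Xi \<Gamma> (Forall \<phi>)"
| ForallE: "deduces Xi \<Gamma> (Forall \<phi>) \<Longrightarrow> deduces Xi \<Gamma> (inst t \<phi>)"
| ExistsI: "deduces Xi \<Gamma> (inst t \<phi>) \<Longrightarrow> deduces Xi \<Gamma> (Exists \<phi>)"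
| ExistsE: "deduces Xi \<Gamma> (Exists \<phi>) \<Longrightarrow> deduces Xi (insert \<phi> (lift ` \<Gamma>)) (lift \<psi>) \<Longrightarrow>
    deduces Xi \<Gamma> \<psi>"
| Equal_refl: "deduces Xi \<Gamma> (Equal t t)"
| Equal_subst: "deduces Xi \<Gamma> (Equal s t) \<Longrightarrow> deduces Xi \<Gamma> (inst s \<phi>) \<Longrightarrow>
    deduces Xi \<Gamma> (inst t \<phi>)"

definition provable :: "prfun \<Rightarrow> fm \<Rightarrow> bool" where
  "provable Xi \<phi> \<longleftrightarrow> deduces Xi {} \<phi>"


section \<open>Set-theoretic formulas and their v-set interpretation\<close>

text \<open>The bound of a bounded quantifier lies outside the scope of that quantifier.\<close>

datatype sfm =
    SEq nat nat
  | SMem nat nat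
  | SFalsum
  | SConj sfm sfm
  | SDisj sfm sfm
  | SImpl sfm sfm
  | SAll sfm
  | SEx sfm
  | SBAll nat sfm
  | SBEx nat sfm

text \<open>\<open>a \<in> EL(x)\<close>.\<close>
definition in_EL :: "tm \<Rightarrow> tm \<Rightarrow> fm" where
  "in_EL a x =
     Exists (Exists (Conj (app (lift_tm (lift_tm x)) (Var 1) (Var 0))
       (Conj (TT (rightt (Var 0))) (Equal (lift_tm (lift_tm a)) (leftt (Var 0))))))"

text \<open>A formula \<open>E\<close> is read as a binary relation between \<open>Var 0\<close> and \<open>Var 1\<close>; any further variable
  gets identified with \<open>Var 1\<close>, so that \<open>E\<close> has no parameters.\<close>
definition rel :: "fm \<Rightarrow> tm \<Rightarrow> tm \<Rightarrow> fm" where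
  "rel E s t = sub (case_nat s (\<lambda>_. t)) E"

primrec interp :: "fm \<Rightarrow> sfm \<Rightarrow> fm" where
  "interp E (SEq x y) = rel E (Var x) (Var y)"
| "interp E (SMem x y) =
     Exists (Conj (in_EL (Var 0) (Var (Suc y))) (rel E (Var (Suc x)) (Var 0)))"
| "interp E SFalsum = Falsum"
| "interp E (SConj \<phi> \<psi>) = Conj (interp E \<phi>) (interp E \<psi>)"
| "interp E (SDisj \<phi> \<psi>) = Disj (interp E \<phi>) (interp E \<psi>)"
| "interp E (SImpl \<phi> \<psi>) = Impl (interp E \<phi>) (interp E \<psi>)"
| "interp E (SAll \<phi>) = Forall (Impl (VV (Var 0)) (interp E \<phi>))"
| "interp E (SEx \<phi>) = Exists (Conj (VV (Var 0)) (interp E \<phi>))"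
| "interp E (SBAll x \<phi>) = Forall (Impl (in_EL (Var 0) (Var (Suc x))) (interp E \<phi>))"
| "interp E (SBEx x \<phi>) = Exists (Conj (in_EL (Var 0) (Var (Suc x))) (interp E \<phi>))"

text \<open>\<open>\<forall>x y. x \<simeq> y \<longleftrightarrow> (\<forall>a\<in>x. \<exists>b\<in>y. a \<simeq> b) \<and> (\<forall>b\<in>y. \<exists>a\<in>x. b \<simeq> a)\<close>\<close>
definition extensionality :: sfm where
  "extensionality =
     (let lhs = SEq 1 0;
          rhs = SConj (SBAll 1 (SBEx 1 (SEq 1 0))) (SBAll 0 (SBEx 2 (SEq 1 0)))
      in SAll (SAll (SConj (SImpl lhs rhs) (SImpl rhs lhs))))"

text \<open>\<open>E\<close> defines extensional equality of v-sets. By the induction axiom for v-sets, any two such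
  formulas are provably equivalent on v-sets.\<close>
definition vset_equality :: "prfun \<Rightarrow> fm \<Rightarrow> bool" where
  "vset_equality Xi E \<longleftrightarrow> provable Xi (interp E extensionality)"


section \<open>Set-theoretic notions\<close>

definition s_subset :: "nat \<Rightarrow> nat \<Rightarrow> sfm" where
  "s_subset x y = SBAll x (SMem 0 (Suc y))"

text \<open>\<open>u = {a, b}\<close>\<close>
definition s_upair :: "nat \<Rightarrow> nat \<Rightarrow> nat \<Rightarrow> sfm" where
  "s_upair u a b =
     SConj (SMem a u) (SConj (SMem b u) (SBAll u (SDisj (SEq 0 (Suc a)) (SEq 0 (Suc b)))))"

text \<open>\<open>p = {{a}, {a, b}}\<close>\<close>
definition s_opair :: "nat \<Rightarrow> nat \<Rightarrow> nat \<Rightarrow> sfm" where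
  "s_opair p a b =
     SEx (SEx (SConj (s_upair 1 (a + 2) (a + 2))
              (SConj (s_upair 0 (a + 2) (b + 2)) (s_upair (p + 2) 1 0))))"

text \<open>\<open>(a, b) \<in> g\<close>\<close>
definition s_related :: "nat \<Rightarrow> nat \<Rightarrow> nat \<Rightarrow> sfm" where
  "s_related g a b = SBEx g (s_opair 0 (Suc a) (Suc b))"

text \<open>\<open>s = n \<union> {n}\<close>\<close>
definition s_succ :: "nat \<Rightarrow> nat \<Rightarrow> sfm" where
  "s_succ s n =
     SConj (s_subset n s) (SConj (SMem n s) (SBAll s (SDisj (SMem 0 (Suc n)) (SEq 0 (Suc n)))))"

definition s_inductive :: "nat \<Rightarrow> sfm" where
  "s_inductive w =
     SConj (SBEx w (SBAll 0 SFalsum)) (SBAll w (SBEx (Suc w) (s_succ 0 1)))"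

definition s_omega :: "nat \<Rightarrow> sfm" where
  "s_omega w = SConj (s_inductive w) (SAll (SImpl (s_inductive 0) (s_subset (Suc w) 0)))"

definition s_subset_omega :: "nat \<Rightarrow> sfm" where
  "s_subset_omega y = SEx (SConj (s_omega 0) (s_subset (Suc y) 0))"

definition s_relation :: "nat \<Rightarrow> sfm" where
  "s_relation g = SBAll g (SEx (SEx (s_opair 2 1 0)))"

definition s_domain_includes :: "nat \<Rightarrow> nat \<Rightarrow> sfm" where
  "s_domain_includes g y = SBAll y (SEx (s_related (g + 2) 1 0))"

definition s_function_on :: "nat \<Rightarrow> nat \<Rightarrow> sfm" where
  "s_function_on h y =
     SConj (s_relation h)
    (SConj (SAll (SAll (SImpl (s_related (h + 2) 1 0) (SMem 1 (y + 2)))))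
    (SConj (s_domain_includes h y)
           (SAll (SAll (SAll (SImpl (SConj (s_related (h + 3) 2 1) (s_related (h + 3) 2 0))
                                    (SEq 1 0)))))))"

definition s_surjection :: "nat \<Rightarrow> nat \<Rightarrow> nat \<Rightarrow> sfm" where
  "s_surjection f y x =
     SConj (s_function_on f y)
    (SConj (SAll (SAll (SImpl (s_related (f + 2) 1 0) (SMem 0 (x + 2)))))
           (SBAll x (SBEx (Suc y) (s_related (f + 2) 0 1))))"

definition s_projective :: "nat \<Rightarrow> sfm" where
  "s_projective y =
     SAll (SImpl (SConj (s_relation 0) (s_domain_includes 0 (Suc y)))
                 (SEx (SConj (s_subset 0 1) (s_function_on 0 (y + 2)))))"

text \<open>\<open>\<forall>x. \<exists>y f. y \<subseteq> \<omega> \<and> f : y \<rightarrow> x\<close> is surjective \<open>\<and> y\<close> is projective\<close>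
definition enough_subcountable_projectives :: sfm where
  "enough_subcountable_projectives =
     SAll (SEx (SEx (SConj (s_subset_omega 1) (SConj (s_surjection 0 1 2) (s_projective 1)))))"

end

theory Submission
  imports Defs "HOL-Library.Countable" "HOL-Library.Sublist"
begin

text \<open>The theory is intuitionistic and refutes classical logic, so its theorems are derived semantically: by
  Kripke completeness it suffices to argue in an arbitrary Kripke model of the axioms, where conjunctions,
  disjunctions and existential quantifiers are evaluated at a single world.

  Extended Church's thesis supplies every index that is needed, so that only two facts about Kleene
  application matter: it is single-valued, and some index is nowhere defined. The latter starts the generation
  of meaningful conditions by \<open>\<Xi>\<close>. Extensional equality is bisimilarity.

  Given a v-set \<open>x\<close>, let \<open>y\<close> be the set of all numerals \<open>n\<close> with \<open>\<T>(cd\<^sub>x(n))\<close>. Then \<open>n \<mapsto> el\<^sub>x(n)\<close> maps \<open>y\<close> onto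
  \<open>x\<close>. If the domain of \<open>g\<close> includes \<open>y\<close>, every \<open>n\<close> with \<open>\<T>(cd\<^sub>x(n))\<close> is related by \<open>g\<close> to something; this
  premise is almost negative, so some index selects for every such \<open>n\<close> a pair in \<open>g\<close>. Distinct numbers have
  distinct numerals, hence the selected pairs form a function.\<close>

section \<open>Substitution\<close>

text \<open>Two restrictions shape the constructions. \<open>Xi\<close> offers only universally
  quantified implications, so a conjunction has to be spread over several inputs of one implication.
  And Church's thesis accepts only almost negative domains, where truth of a computed condition
  cannot be stated existentially: that the condition of the n-th entry of a v-set is true is
  therefore written as "every value at n has a true right component". The two readings agree where a
  value exists, because application is single-valued. An element whose condition becomes true only
  at a later world need not exist beforehand. An index for it is chosen on the domain where the
  condition is true, so families over \<open>x\<close> can keep the conditions of \<open>x\<close>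
  itself. The formula \<open>E\<close> for equality is arbitrary. Its extensionality is given as a
  provability, so soundness is used besides completeness; reflexivity and transitivity then come
  from induction on v-sets. That some such formula exists is a separate argument. Injectivity of
  numerals comes from irreflexivity of membership together with linearity of the order on
  numbers.\<close>

lemma up_Zero [simp]: "up \<sigma> 0 = Var 0"
  by (simp add: up_def)

lemma up_Suc [simp]: "up \<sigma> (Suc i) = lift_tm (\<sigma> i)"
  by (simp add: up_def)

lemma sub_tm_comp: "sub_tm \<sigma> (sub_tm \<tau> t) = sub_tm (\<lambda>i. sub_tm \<sigma> (\<tau> i)) t"
  by (induction t) simp_all

lemma sub_tm_Var [simp]: "sub_tm Var t = t"
  by (induction t) (simp_all add: map_idI)

lemma up_comp: "(\<lambda>i. sub_tm (up \<sigma>) (up \<tau> i)) = up (\<lambda>i. sub_tm \<sigma> (\<tau> i))"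
proof
  fix i show "sub_tm (up \<sigma>) (up \<tau> i) = up (\<lambda>i. sub_tm \<sigma> (\<tau> i)) i"
    by (cases i) (simp_all add: sub_tm_comp)
qed

lemma up_Var [simp]: "up Var = Var"
proof
  fix i show "up Var i = Var i" by (cases i) simp_all
qed

lemma sub_comp: "sub \<sigma> (sub \<tau> \<phi>) = sub (\<lambda>i. sub_tm \<sigma> (\<tau> i)) \<phi>"
  by (induction \<phi> arbitrary: \<sigma> \<tau>) (simp_all add: sub_tm_comp up_comp)

lemma sub_Var [simp]: "sub Var \<phi> = \<phi>"
  by (induction \<phi>) simp_all

lemma sub_tm_up_lift: "sub_tm (up \<sigma>) (lift_tm t) = lift_tm (sub_tm \<sigma> t)"
  by (simp add: sub_tm_comp)

lemma sub_up_lift: "sub (up \<sigma>) (lift \<phi>) = lift (sub \<sigma> \<phi>)"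
  by (simp add: sub_comp)

text \<open>The form in which the truth lemma meets a quantifier: instantiation below a binder adds
  one entry to the substitution, so the induction hypothesis applies to
  \<open>case_nat t \<sigma>\<close>.\<close>

lemma sub_inst_up: "inst t (sub (up \<sigma>) \<phi>) = sub (case_nat t \<sigma>) \<phi>"
proof -
  have "(\<lambda>i. sub_tm (case_nat t Var) (up \<sigma> i)) = case_nat t \<sigma>"
    by (auto simp: up_def sub_tm_comp split: nat.split)
  then show ?thesis by (simp add: inst_def sub_comp)
qed

lemma sub_inst: "sub \<sigma> (inst t \<phi>) = inst (sub_tm \<sigma> t) (sub (up \<sigma>) \<phi>)"
  unfolding sub_inst_up
  by (auto simp: inst_def sub_comp intro!: arg_cong[where f="\<lambda>\<sigma>. sub \<sigma> \<phi>"] split: nat.split)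

lemma sub_lt [simp]: "sub \<sigma> (lt s t) = lt (sub_tm \<sigma> s) (sub_tm \<sigma> t)"
  by (simp add: lt_def)

lemma sub_tm_numt [simp]: "sub_tm \<sigma> (numt n) = numt n"
  by (induction n) simp_all

lemma sub_BForall [simp]: "sub \<sigma> (BForall t \<phi>) = BForall (sub_tm \<sigma> t) (sub (up \<sigma>) \<phi>)"
  by (simp add: BForall_def sub_tm_up_lift)

lemma sub_BExists [simp]: "sub \<sigma> (BExists t \<phi>) = BExists (sub_tm \<sigma> t) (sub (up \<sigma>) \<phi>)"
  by (simp add: BExists_def sub_tm_up_lift)

lemma sub_Neg [simp]: "sub \<sigma> (Neg \<phi>) = Neg (sub \<sigma> \<phi>)"
  by (simp add: Neg_def)

lemma sub_Iff [simp]: "sub \<sigma> (Iff \<phi> \<psi>) = Iff (sub \<sigma> \<phi>) (sub \<sigma> \<psi>)"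
  by (simp add: Iff_def)

lemma sub_tm_pairt [simp]: "sub_tm \<sigma> (pairt s t) = pairt (sub_tm \<sigma> s) (sub_tm \<sigma> t)"
  by (simp add: pairt_def)

lemma sub_tm_leftt [simp]: "sub_tm \<sigma> (leftt t) = leftt (sub_tm \<sigma> t)"
  by (simp add: leftt_def)

lemma sub_tm_rightt [simp]: "sub_tm \<sigma> (rightt t) = rightt (sub_tm \<sigma> t)"
  by (simp add: rightt_def)

lemma sub_tm_predt [simp]: "sub_tm \<sigma> (predt t) = predt (sub_tm \<sigma> t)"
  by (simp add: predt_def)

lemma sub_tm_ntht [simp]: "sub_tm \<sigma> (ntht s i) = ntht (sub_tm \<sigma> s) (sub_tm \<sigma> i)"
  by (simp add: ntht_def)

lemma sub_initial_step [simp]: "sub \<sigma> (initial_step c) = initial_step (sub_tm \<sigma> c)"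
  by (simp add: initial_step_def Let_def has_tag_def node_idx_def node_arg_def node_val_def)

lemma sub_compound_step [simp]:
  "sub \<sigma> (compound_step c p q) = compound_step (sub_tm \<sigma> c) (sub_tm \<sigma> p) (sub_tm \<sigma> q)"
  by (simp add: compound_step_def Let_def has_tag_def evaluates_def
      node_idx_def node_arg_def node_val_def)

lemma sub_computation_step [simp]:
  "sub \<sigma> (computation_step s i) = computation_step (sub_tm \<sigma> s) (sub_tm \<sigma> i)"
  by (simp add: computation_step_def sub_tm_comp)

lemma sub_app [simp]: "sub \<sigma> (app e n k) = app (sub_tm \<sigma> e) (sub_tm \<sigma> n) (sub_tm \<sigma> k)"
  by (simp add: app_def sub_tm_comp)

lemma delta0_sub: "delta0 \<phi> \<Longrightarrow> delta0 (sub \<sigma> \<phi>)"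
  by (induction arbitrary: \<sigma> rule: delta0.induct) (auto intro: delta0.intros)

lemma sigma1_sub: "sigma1 \<phi> \<Longrightarrow> sigma1 (sub \<sigma> \<phi>)"
  by (induction arbitrary: \<sigma> rule: sigma1.induct) (auto intro: sigma1.intros delta0_sub)

lemma almost_negative_sub: "almost_negative \<phi> \<Longrightarrow> almost_negative (sub \<sigma> \<phi>)"
  by (induction arbitrary: \<sigma> rule: almost_negative.induct)
    (auto intro: almost_negative.intros sigma1_sub)


section \<open>Closure of the axioms under substitution\<close>

text \<open>\<open>up \<sigma>\<close> leaves the set variable \<open>Var 0\<close> alone and moves
  only the parameters, so an instance of the induction schema is sent to the instance for the
  substituted formula.\<close>

lemma sub_up_vset_step: "sub (up \<sigma>) (vset_step \<phi>) = vset_step (sub (up \<sigma>) \<phi>)"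
  by (auto simp: vset_step_def sub_comp sub_tm_comp numeral_eq_Suc up_def
      intro!: arg_cong[where f="\<lambda>\<sigma>. sub \<sigma> \<phi>"] split: nat.split)

lemma arg_map: "i < length ts \<or> f z = z' \<Longrightarrow> arg z' (map f ts) i = f (arg z ts i)"
  by (auto simp: arg_def)

text \<open>The schemas allow arbitrary terms and parameters, while \<open>V1\<close>,
  \<open>X1\<close> and \<open>X2\<close> are closed formulas. The canonical model uses this to
  satisfy an axiom in every environment.\<close>

lemma axiom_sub: "axiom Xi \<phi> \<Longrightarrow> axiom Xi (sub \<sigma> \<phi>)"
proof (induction rule: axiom.induct)
  case (PSucc ts)
  have "sub \<sigma> (Equal (Fn PSucc ts) (Succ (arg Zero ts 0)))
    = Equal (Fn PSucc (map (sub_tm \<sigma>) ts)) (Succ (arg Zero (map (sub_tm \<sigma>) ts) 0))"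
    by (simp add: arg_map[where z=Zero])
  then show ?case by (simp only: axiom.PSucc)
next
  case (PProj i ts)
  have "sub \<sigma> (Equal (Fn (PProj i) ts) (arg Zero ts i))
    = Equal (Fn (PProj i) (map (sub_tm \<sigma>) ts)) (arg Zero (map (sub_tm \<sigma>) ts) i)"
    by (simp add: arg_map[where z=Zero])
  then show ?case by (simp only: axiom.PProj)
next
  case (PComp f gs ts)
  show ?case using axiom.PComp[of Xi f gs "map (sub_tm \<sigma>) ts"] by (simp add: comp_def)
next
  case (induction \<phi>)
  have "sub (up \<sigma>) (sub (case_nat (Succ (Var 0)) (\<lambda>i. Var (Suc i))) \<phi>)
    = sub (case_nat (Succ (Var 0)) (\<lambda>i. Var (Suc i))) (sub (up \<sigma>) \<phi>)"
    by (auto simp: sub_comp sub_tm_comp up_def intro!: arg_cong[where f="\<lambda>\<sigma>. sub \<sigma> \<phi>"] split: nat.split)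
  then show ?case using axiom.induction[of Xi "sub (up \<sigma>) \<phi>"] by (simp add: sub_inst)
next
  case V1
  show ?case using axiom.V1[of Xi] by (simp add: sub_up_vset_step)
next
  case (V2 \<phi>)
  show ?case using axiom.V2[of Xi "sub (up \<sigma>) \<phi>"] by (simp add: sub_up_vset_step)
next
  case X1
  show ?case using axiom.X1[of Xi] by (simp add: numeral_eq_Suc)
next
  case X2
  show ?case using axiom.X2[of Xi] by (simp add: numeral_eq_Suc)
next
  case (ECT \<phi> \<psi>)
  have "sub (up (up \<sigma>)) (sub (case_nat (Var 0) (\<lambda>i. Var (i + 2))) \<phi>)
    = sub (case_nat (Var 0) (\<lambda>i. Var (i + 2))) (sub (up \<sigma>) \<phi>)"
    "sub (up (up (up \<sigma>))) (sub (case_nat (Var 0) (case_nat (Var 1) (\<lambda>i. Var (i + 3)))) \<psi>)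
    = sub (case_nat (Var 0) (case_nat (Var 1) (\<lambda>i. Var (i + 3)))) (sub (up (up \<sigma>)) \<psi>)"
    by (auto simp: sub_comp sub_tm_comp up_def numeral_eq_Suc
        intro!: arg_cong[where f="\<lambda>\<sigma>. sub \<sigma> \<phi>"] arg_cong[where f="\<lambda>\<sigma>. sub \<sigma> \<psi>"] split: nat.split)
  then show ?case
    using axiom.ECT[OF almost_negative_sub[OF ECT, of "up \<sigma>"], of Xi "sub (up (up \<sigma>)) \<psi>"]
    by (simp add: numeral_eq_Suc)
qed (auto simp: Neg_def intro: axiom.intros[unfolded Neg_def])

section \<open>Structural properties of deductions\<close>

lemma deduces_weaken: "deduces Xi \<Gamma> \<phi> \<Longrightarrow> \<Gamma> \<subseteq> \<Delta> \<Longrightarrow> deduces Xi \<Delta> \<phi>"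
proof (induction arbitrary: \<Delta> rule: deduces.induct)
  case (DisjE \<Gamma> \<phi> \<psi> \<chi>)
  then show ?case by (meson deduces.DisjE insert_mono)
next
  case (ImplI \<phi> \<Gamma> \<psi>)
  then show ?case by (meson deduces.ImplI insert_mono)
next
  case (ForallI \<Gamma> \<phi>)
  then show ?case by (simp add: deduces.ForallI image_mono)
next
  case (ExistsE \<Gamma> \<phi> \<psi>)
  from ExistsE.prems have "insert \<phi> (lift ` \<Gamma>) \<subseteq> insert \<phi> (lift ` \<Delta>)" by blast
  then show ?case using ExistsE.IH ExistsE.prems by (blast intro: deduces.ExistsE)
qed (meson deduces.intros subsetD)+

text \<open>Applied below to renamings other than liftings: they let an ordinary variable play the
  role of a bound one and move the variables of a formula between levels.\<close>

lemma deduces_sub: "deduces Xi \<Gamma> \<phi> \<Longrightarrow> deduces Xi (sub \<sigma> ` \<Gamma>) (sub \<sigma> \<phi>)"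
proof (induction arbitrary: \<sigma> rule: deduces.induct)
  case (Ax \<phi> \<Gamma>)
  then show ?case by (simp add: axiom_sub deduces.Ax)
next
  case (DisjE \<Gamma> \<phi> \<psi> \<chi>)
  show ?case
    by (rule deduces.DisjE[OF DisjE.IH(1)[of \<sigma>, simplified]]) (use DisjE.IH(2,3)[of \<sigma>] in simp_all)
next
  case (ImplI \<phi> \<Gamma> \<psi>)
  then show ?case by (simp add: deduces.ImplI)
next
  case (ForallI \<Gamma> \<phi>)
  have "sub (up \<sigma>) ` lift ` \<Gamma> = lift ` sub \<sigma> ` \<Gamma>"
    by (simp add: image_image sub_up_lift)
  then show ?case using ForallI.IH[of "up \<sigma>"] by (simp add: deduces.ForallI)
next
  case (ForallE \<Gamma> \<phi> t)
  then show ?case by (simp add: sub_inst deduces.ForallE)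
next
  case (ExistsI \<Gamma> t \<phi>)
  then show ?case using deduces.ExistsI[of Xi "sub \<sigma> ` \<Gamma>" "sub_tm \<sigma> t" "sub (up \<sigma>) \<phi>"] by (simp add: sub_inst)
next
  case (ExistsE \<Gamma> \<phi> \<psi>)
  have "sub (up \<sigma>) ` lift ` \<Gamma> = lift ` sub \<sigma> ` \<Gamma>"
    by (simp add: image_image sub_up_lift)
  then have "deduces Xi (insert (sub (up \<sigma>) \<phi>) (lift ` sub \<sigma> ` \<Gamma>)) (lift (sub \<sigma> \<psi>))"
    using ExistsE.IH(2)[of "up \<sigma>"] by (simp add: sub_up_lift)
  then show ?case using ExistsE.IH(1)[of \<sigma>] by (auto intro: deduces.ExistsE)
next
  case (Equal_subst \<Gamma> s t \<phi>)
  then show ?case by (simp add: sub_inst) (rule deduces.Equal_subst)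
next
  case (FalsumE \<Gamma> \<phi>)
  then show ?case by (simp add: deduces.FalsumE)
next
  case (ConjE1 \<Gamma> \<phi> \<psi>)
  show ?case using deduces.ConjE1[OF ConjE1.IH[of \<sigma>, simplified]] .
next
  case (ConjE2 \<Gamma> \<phi> \<psi>)
  show ?case using deduces.ConjE2[OF ConjE2.IH[of \<sigma>, simplified]] .
next
  case (ImplE \<Gamma> \<phi> \<psi>)
  show ?case using deduces.ImplE[OF ImplE.IH(1)[of \<sigma>, simplified] ImplE.IH(2)] .
qed (simp_all add: deduces.Hyp deduces.ConjI deduces.DisjI1 deduces.DisjI2 deduces.Equal_refl)

text \<open>Compactness, for the limit of the chain in \<open>prime_theory_extension\<close>. A rule
  that discharges a hypothesis removes it from the finite set found for its premise.\<close>

lemma deduces_finite: "deduces Xi \<Gamma> \<phi> \<Longrightarrow> \<exists>F. finite F \<and> F \<subseteq> \<Gamma> \<and> deduces Xi F \<phi>"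
proof (induction rule: deduces.induct)
  case (Hyp \<phi> \<Gamma>)
  then show ?case by (intro exI[of _ "{\<phi>}"]) (auto intro: deduces.Hyp)
next
  case (ConjI \<Gamma> \<phi> \<psi>)
  then obtain F G where "finite (F \<union> G)" "F \<union> G \<subseteq> \<Gamma>" "deduces Xi F \<phi>" "deduces Xi G \<psi>" by auto
  then show ?case by (metis deduces.ConjI deduces_weaken Un_upper1 Un_upper2)
next
  case (DisjE \<Gamma> \<phi> \<psi> \<chi>)
  then obtain F G H where *: "finite F" "F \<subseteq> \<Gamma>" "deduces Xi F (Disj \<phi> \<psi>)"
    "finite G" "G \<subseteq> insert \<phi> \<Gamma>" "deduces Xi G \<chi>" "finite H" "H \<subseteq> insert \<psi> \<Gamma>" "deduces Xi H \<chi>"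
    by blast
  let ?F = "F \<union> (G - {\<phi>}) \<union> (H - {\<psi>})"
  have "deduces Xi ?F \<chi>"
    by (rule deduces.DisjE[of _ _ \<phi> \<psi>]) (rule deduces_weaken[OF *(3)] deduces_weaken[OF *(6)] deduces_weaken[OF *(9)]; auto)+
  then show ?case using * by (intro exI[of _ ?F]) auto
next
  case (ImplI \<phi> \<Gamma> \<psi>)
  then obtain F where *: "finite F" "F \<subseteq> insert \<phi> \<Gamma>" "deduces Xi F \<psi>" by blast
  have "deduces Xi (F - {\<phi>}) (Impl \<phi> \<psi>)"
    by (rule deduces.ImplI, rule deduces_weaken[OF *(3)]) auto
  then show ?case using * by (intro exI[of _ "F - {\<phi>}"]) auto
next
  case (ImplE \<Gamma> \<phi> \<psi>)
  then obtain F G where "finite (F \<union> G)" "F \<union> G \<subseteq> \<Gamma>" "deduces Xi F (Impl \<phi> \<psi>)" "deduces Xi G \<phi>" by auto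
  then show ?case by (metis deduces.ImplE deduces_weaken Un_upper1 Un_upper2)
next
  case (ForallI \<Gamma> \<phi>)
  then obtain F where "finite F" "F \<subseteq> lift ` \<Gamma>" "deduces Xi F \<phi>" by blast
  then show ?case by (metis deduces.ForallI finite_subset_image)
next
  case (ExistsE \<Gamma> \<phi> \<psi>)
  then obtain F G where *: "finite F" "F \<subseteq> \<Gamma>" "deduces Xi F (Exists \<phi>)"
    "finite G" "G \<subseteq> insert \<phi> (lift ` \<Gamma>)" "deduces Xi G (lift \<psi>)" by blast
  \<comment> \<open>Apart from the discharged formula \<open>G\<close> consists of liftings, hence
    of liftings of finitely many original hypotheses.\<close>
  then obtain H where H: "finite H" "H \<subseteq> \<Gamma>" "G - {\<phi>} = lift ` H"
    by (metis Diff_subset_conv finite_Diff finite_subset_image insert_is_Un)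
  have "deduces Xi (F \<union> H) \<psi>"
    by (rule deduces.ExistsE[of _ _ \<phi>])
      (rule deduces_weaken[OF *(3)] deduces_weaken[OF *(6)]; use H in auto)+
  then show ?case using * H by (intro exI[of _ "F \<union> H"]) auto
next
  case (Equal_subst \<Gamma> s t \<phi>)
  then obtain F G where "finite (F \<union> G)" "F \<union> G \<subseteq> \<Gamma>" "deduces Xi F (Equal s t)" "deduces Xi G (inst s \<phi>)" by auto
  moreover from this have "deduces Xi (F \<union> G) (inst t \<phi>)"
    by (intro deduces.Equal_subst[of _ _ s t]) (auto elim: deduces_weaken)
  ultimately show ?case by blast
next
  case (Ax \<phi> \<Gamma>)
  then show ?case by (intro exI[of _ "{}"]) (simp add: deduces.Ax)
next
  case (Equal_refl \<Gamma> t)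
  show ?case by (intro exI[of _ "{}"]) (simp add: deduces.Equal_refl)
next
  case (FalsumE \<Gamma> \<phi>)
  then show ?case by (auto intro: deduces.FalsumE)
next
  case (ConjE1 \<Gamma> \<phi> \<psi>)
  then show ?case by (auto intro: deduces.ConjE1)
next
  case (ConjE2 \<Gamma> \<phi> \<psi>)
  then show ?case by (auto intro: deduces.ConjE2)
next
  case (DisjI1 \<Gamma> \<phi> \<psi>)
  then show ?case by (auto intro: deduces.DisjI1)
next
  case (DisjI2 \<Gamma> \<psi> \<phi>)
  then show ?case by (auto intro: deduces.DisjI2)
next
  case (ForallE \<Gamma> \<phi> t)
  then show ?case by (auto intro: deduces.ForallE)
next
  case (ExistsI \<Gamma> t \<phi>)
  then show ?case by (auto intro: deduces.ExistsI)
qed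

section \<open>Derived rules and decidability of equality\<close>

lemma deduces_cut: "deduces Xi \<Gamma> \<phi> \<Longrightarrow> deduces Xi (insert \<phi> \<Gamma>) \<psi> \<Longrightarrow> deduces Xi \<Gamma> \<psi>"
  by (rule deduces.ImplE[OF deduces.ImplI])

lemma deduces_Equal_sym: "deduces Xi \<Gamma> (Equal s t) \<Longrightarrow> deduces Xi \<Gamma> (Equal t s)"
  using deduces.Equal_subst[of Xi \<Gamma> s t "Equal (Var 0) (lift_tm s)"] deduces.Equal_refl
  by (simp add: inst_def sub_tm_comp)

lemma deduces_Equal_trans:
  "deduces Xi \<Gamma> (Equal s t) \<Longrightarrow> deduces Xi \<Gamma> (Equal t u) \<Longrightarrow> deduces Xi \<Gamma> (Equal s u)"
  using deduces.Equal_subst[of Xi \<Gamma> t u "Equal (lift_tm s) (Var 0)"]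
  by (simp add: inst_def sub_tm_comp)

text \<open>Arguments are replaced one at a time; \<open>us\<close> collects those that are already
  done.\<close>

lemma deduces_Equal_Fn:
  assumes "list_all2 (\<lambda>s t. deduces Xi \<Gamma> (Equal s t)) ss ts"
  shows "deduces Xi \<Gamma> (Equal (Fn f ss) (Fn f ts))"
proof -
  have "deduces Xi \<Gamma> (Equal (Fn f (us @ ss)) (Fn f (us @ ts)))" for us
    using assms
  proof (induction arbitrary: us rule: list_all2_induct)
    case Nil
    show ?case by (rule deduces.Equal_refl)
  next
    case (Cons s ss t ts)
    have "deduces Xi \<Gamma> (Equal (Fn f (us @ s # ss)) (Fn f (us @ t # ss)))"
      using deduces.Equal_subst[OF Cons(1), of "Equal (lift_tm (Fn f (us @ s # ss)))
          (Fn f (map lift_tm us @ Var 0 # map lift_tm ss))"] deduces.Equal_refl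
      by (simp add: inst_def sub_tm_comp comp_def)
    moreover have "deduces Xi \<Gamma> (Equal (Fn f (us @ t # ss)) (Fn f (us @ t # ts)))"
      using Cons(3)[of "us @ [t]"] by simp
    ultimately show ?case by (rule deduces_Equal_trans)
  qed
  from this[of "[]"] show ?thesis by simp
qed

lemma deduces_atom_cong:
  assumes "deduces Xi \<Gamma> (Equal s t)"
  shows "deduces Xi \<Gamma> (VV s) \<Longrightarrow> deduces Xi \<Gamma> (VV t)"
    and "deduces Xi \<Gamma> (MM s) \<Longrightarrow> deduces Xi \<Gamma> (MM t)"
    and "deduces Xi \<Gamma> (TT s) \<Longrightarrow> deduces Xi \<Gamma> (TT t)"
  using deduces.Equal_subst[OF assms, of "VV (Var 0)"] deduces.Equal_subst[OF assms, of "MM (Var 0)"]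
    deduces.Equal_subst[OF assms, of "TT (Var 0)"] by (simp_all add: inst_def)

lemma deduces_induction:
  assumes "deduces Xi \<Gamma> (inst Zero \<phi>)"
    and "deduces Xi (insert \<phi> (lift ` \<Gamma>)) (sub (case_nat (Succ (Var 0)) (\<lambda>i. Var (Suc i))) \<phi>)"
  shows "deduces Xi \<Gamma> (Forall \<phi>)"
  by (rule deduces.ImplE[OF deduces.ImplE[OF deduces.Ax[OF axiom.induction] assms(1)]])
    (rule deduces.ForallI deduces.ImplI assms(2))+

text \<open>Double induction. The inner induction acts as a case distinction on the second number,
  whose successor case is reduced by \<open>cong\<close> to the outer hypothesis.\<close>

lemma deduces_Equal_decidable: "deduces Xi \<Gamma> (Disj (Equal s t) (Neg (Equal s t)))"
proof -
  let ?D = "\<lambda>s t. Disj (Equal s t) (Neg (Equal s t))"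
  have neq: "deduces Xi \<Gamma> (Neg (Equal Zero (Succ t)))" for \<Gamma> t
    unfolding Neg_def
    by (rule deduces.ImplI, rule deduces.ImplE[OF deduces.Ax[OF axiom.Succ_not_Zero[where t=t, unfolded Neg_def]]])
      (rule deduces_Equal_sym, rule deduces.Hyp, simp)
  have cong: "deduces Xi \<Gamma> (?D (Succ s) (Succ t))" if "deduces Xi \<Gamma> (?D s t)" for \<Gamma> s t
  proof (rule deduces.DisjE[OF that])
    show "deduces Xi (insert (Equal s t) \<Gamma>) (?D (Succ s) (Succ t))"
      using deduces.Equal_subst[of Xi "insert (Equal s t) \<Gamma>" s t
          "Equal (Succ (lift_tm s)) (Succ (Var 0))"] deduces.Equal_refl deduces.Hyp
      by (simp add: inst_def sub_tm_comp deduces.DisjI1)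
    show "deduces Xi (insert (Neg (Equal s t)) \<Gamma>) (?D (Succ s) (Succ t))"
    proof (rule deduces.DisjI2, subst Neg_def, rule deduces.ImplI)
      let ?\<Delta> = "insert (Equal (Succ s) (Succ t)) (insert (Neg (Equal s t)) \<Gamma>)"
      have "deduces Xi ?\<Delta> (Equal s t)"
        by (rule deduces.ImplE[OF deduces.Ax[OF axiom.Succ_inject]]) (simp add: deduces.Hyp)
      moreover have "deduces Xi ?\<Delta> (Impl (Equal s t) Falsum)"
        by (rule deduces.Hyp) (simp add: Neg_def)
      ultimately show "deduces Xi ?\<Delta> Falsum" by (rule deduces.ImplE[rotated])
    qed
  qed
  have zero: "deduces Xi \<Gamma> (Forall (?D Zero (Var 0)))" for \<Gamma>
    by (rule deduces_induction)
      (simp_all add: inst_def deduces.Equal_refl deduces.DisjI1 deduces.DisjI2 neq)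
  have "deduces Xi \<Gamma> (Forall (Forall (?D (Var 1) (Var 0))))" for \<Gamma>
  proof (rule deduces_induction)
    show "deduces Xi \<Gamma> (inst Zero (Forall (?D (Var 1) (Var 0))))"
      using zero by (simp add: inst_def)
    let ?\<Delta> = "insert (Forall (?D (Var 1) (Var 0))) (lift ` \<Gamma>)"
    have "deduces Xi ?\<Delta> (Forall (?D (Succ (Var 1)) (Var 0)))"
    proof (rule deduces_induction)
      show "deduces Xi ?\<Delta> (inst Zero (?D (Succ (Var 1)) (Var 0)))"
        by (simp add: inst_def deduces.DisjI2 deduces.Ax axiom.Succ_not_Zero)
      have "deduces Xi (insert (?D (Succ (Var 1)) (Var 0)) (lift ` ?\<Delta>))
          (Forall (?D (Var 2) (Var 0)))"
        by (rule deduces.Hyp) (simp add: numeral_eq_Suc)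
      from cong[OF deduces.ForallE[OF this, of "Var 0", unfolded inst_def, simplified, folded inst_def]]
      show "deduces Xi (insert (?D (Succ (Var 1)) (Var 0)) (lift ` ?\<Delta>))
          (sub (case_nat (Succ (Var 0)) (\<lambda>i. Var (Suc i))) (?D (Succ (Var 1)) (Var 0)))"
        by (simp add: numeral_eq_Suc)
    qed
    then show "deduces Xi ?\<Delta> (sub (case_nat (Succ (Var 0)) (\<lambda>i. Var (Suc i))) (Forall (?D (Var 1) (Var 0))))"
      by simp
  qed
  from deduces.ForallE[OF deduces.ForallE[OF this[of \<Gamma>], of s, unfolded inst_def sub.simps], of t]
  show ?thesis by (simp add: inst_def sub_tm_comp)
qed

section \<open>Kripke models\<close>

text \<open>Only the domains and the three predicates vary with the world; equality and the function
  symbols are rigid. Completeness survives this restriction because the theory decides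
  equality.\<close>

locale kripke_structure =
  fixes le :: "'w \<Rightarrow> 'w \<Rightarrow> bool" (infix "\<preceq>" 50)
    and D :: "'w \<Rightarrow> 'd set"
    and fn :: "prfun \<Rightarrow> 'd list \<Rightarrow> 'd"
    and isV isM isT :: "'w \<Rightarrow> 'd \<Rightarrow> bool"
  assumes le_refl [simp, intro!]: "w \<preceq> w"
    and le_trans: "u \<preceq> v \<Longrightarrow> v \<preceq> w \<Longrightarrow> u \<preceq> w"
    and D_mono: "v \<preceq> w \<Longrightarrow> x \<in> D v \<Longrightarrow> x \<in> D w"
    and fn_D: "set ds \<subseteq> D w \<Longrightarrow> fn f ds \<in> D w"
    and isV_mono: "v \<preceq> w \<Longrightarrow> isV v x \<Longrightarrow> isV w x"
    and isM_mono: "v \<preceq> w \<Longrightarrow> isM v x \<Longrightarrow> isM w x"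
    and isT_mono: "v \<preceq> w \<Longrightarrow> isT v x \<Longrightarrow> isT w x"
begin

primrec tval :: "(nat \<Rightarrow> 'd) \<Rightarrow> tm \<Rightarrow> 'd" where
  "tval e (Var i) = e i"
| "tval e Zero = fn PZero []"
| "tval e (Succ t) = fn PSucc [tval e t]"
| "tval e (Fn f ts) = fn f (map (tval e) ts)"

primrec sat :: "'w \<Rightarrow> (nat \<Rightarrow> 'd) \<Rightarrow> fm \<Rightarrow> bool" where
  "sat w e (Equal s t) \<longleftrightarrow> tval e s = tval e t"
| "sat w e (VV t) \<longleftrightarrow> isV w (tval e t)"
| "sat w e (MM t) \<longleftrightarrow> isM w (tval e t)"
| "sat w e (TT t) \<longleftrightarrow> isT w (tval e t)"
| "sat w e Falsum \<longleftrightarrow> False"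
| "sat w e (Conj \<phi> \<psi>) \<longleftrightarrow> sat w e \<phi> \<and> sat w e \<psi>"
| "sat w e (Disj \<phi> \<psi>) \<longleftrightarrow> sat w e \<phi> \<or> sat w e \<psi>"
| "sat w e (Impl \<phi> \<psi>) \<longleftrightarrow> (\<forall>v. w \<preceq> v \<longrightarrow> sat v e \<phi> \<longrightarrow> sat v e \<psi>)"
| "sat w e (Forall \<phi>) \<longleftrightarrow> (\<forall>v. w \<preceq> v \<longrightarrow> (\<forall>d\<in>D v. sat v (case_nat d e) \<phi>))"
| "sat w e (Exists \<phi>) \<longleftrightarrow> (\<exists>d\<in>D w. sat w (case_nat d e) \<phi>)"

end

locale kripke_model = kripke_structure le D fn isV isM isT
  for le :: "'w \<Rightarrow> 'w \<Rightarrow> bool" (infix "\<preceq>" 50)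
    and D :: "'w \<Rightarrow> 'd set"
    and fn :: "prfun \<Rightarrow> 'd list \<Rightarrow> 'd"
    and isV isM isT :: "'w \<Rightarrow> 'd \<Rightarrow> bool" +
  fixes Xi :: prfun
  assumes axiom_sat: "axiom Xi \<phi> \<Longrightarrow> (\<And>i. e i \<in> D w) \<Longrightarrow> sat w e \<phi>"


section \<open>Free variables and levels\<close>

instance prfun :: countable by countable_datatype
instance tm :: countable by countable_datatype
instance fm :: countable by countable_datatype

primrec fv_tm :: "tm \<Rightarrow> nat set" where
  "fv_tm (Var i) = {i}"
| "fv_tm Zero = {}"
| "fv_tm (Succ t) = fv_tm t"
| "fv_tm (Fn f ts) = \<Union> (set (map fv_tm ts))"

primrec fv :: "fm \<Rightarrow> nat set" where
  "fv (Equal s t) = fv_tm s \<union> fv_tm t"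
| "fv (VV t) = fv_tm t"
| "fv (MM t) = fv_tm t"
| "fv (TT t) = fv_tm t"
| "fv Falsum = {}"
| "fv (Conj \<phi> \<psi>) = fv \<phi> \<union> fv \<psi>"
| "fv (Disj \<phi> \<psi>) = fv \<phi> \<union> fv \<psi>"
| "fv (Impl \<phi> \<psi>) = fv \<phi> \<union> fv \<psi>"
| "fv (Forall \<phi>) = {i. Suc i \<in> fv \<phi>}"
| "fv (Exists \<phi>) = {i. Suc i \<in> fv \<phi>}"

lemma finite_fv_tm: "finite (fv_tm t)"
  by (induction t) auto

lemma finite_fv: "finite (fv \<phi>)"
  by (induction \<phi>) (auto simp: finite_fv_tm finite_vimageI[of _ Suc, unfolded vimage_def])

lemma sub_tm_cong: "(\<And>i. i \<in> fv_tm t \<Longrightarrow> \<sigma> i = \<tau> i) \<Longrightarrow> sub_tm \<sigma> t = sub_tm \<tau> t"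
  by (induction t) auto

lemma sub_cong: "(\<And>i. i \<in> fv \<phi> \<Longrightarrow> \<sigma> i = \<tau> i) \<Longrightarrow> sub \<sigma> \<phi> = sub \<tau> \<phi>"
proof (induction \<phi> arbitrary: \<sigma> \<tau>)
  case (Forall \<phi>)
  have "up \<sigma> i = up \<tau> i" if "i \<in> fv \<phi>" for i
    using that Forall.prems by (cases i) auto
  then show ?case using Forall.IH[of "up \<sigma>" "up \<tau>"] by simp
next
  case (Exists \<phi>)
  have "up \<sigma> i = up \<tau> i" if "i \<in> fv \<phi>" for i
    using that Exists.prems by (cases i) auto
  then show ?case using Exists.IH[of "up \<sigma>" "up \<tau>"] by simp
next
  case (Conj \<phi> \<psi>)
  show ?case using Conj.IH[of \<sigma> \<tau>] Conj.prems by simp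
next
  case (Disj \<phi> \<psi>)
  show ?case using Disj.IH[of \<sigma> \<tau>] Disj.prems by simp
next
  case (Impl \<phi> \<psi>)
  show ?case using Impl.IH[of \<sigma> \<tau>] Impl.prems by simp
qed (auto intro: sub_tm_cong)

lemma fv_tm_sub: "fv_tm (sub_tm \<sigma> t) = (\<Union>i\<in>fv_tm t. fv_tm (\<sigma> i))"
  by (induction t) auto

lemma fv_up: "{i. \<exists>j\<in>A. Suc i \<in> fv_tm (up \<sigma> j)} = (\<Union>j\<in>{i. Suc i \<in> A}. fv_tm (\<sigma> j))"
proof -
  have "Suc i \<in> fv_tm (up \<sigma> j) \<longleftrightarrow> (\<exists>k. j = Suc k \<and> i \<in> fv_tm (\<sigma> k))" for i j
    by (cases j) (auto simp: fv_tm_sub)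
  then show ?thesis by auto
qed

lemma fv_sub: "fv (sub \<sigma> \<phi>) = (\<Union>i\<in>fv \<phi>. fv_tm (\<sigma> i))"
  by (induction \<phi> arbitrary: \<sigma>) (simp_all add: fv_tm_sub fv_up UN_Un)

text \<open>The first Cantor component of a variable is its level, so every level has infinitely many variables:
  passing to the next level provides fresh variables for the witnesses of a prime theory.\<close>

definition vars_below :: "nat \<Rightarrow> nat set" where
  "vars_below n = {v. fst (prod_decode v) < n}"

definition tms :: "nat \<Rightarrow> tm set" where
  "tms n = {t. fv_tm t \<subseteq> vars_below n}"

definition fms :: "nat \<Rightarrow> fm set" where
  "fms n = {\<phi>. fv \<phi> \<subseteq> vars_below n}"

lemma vars_below_mono: "m \<le> n \<Longrightarrow> vars_below m \<subseteq> vars_below n"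
  by (auto simp: vars_below_def)

lemma tms_mono: "m \<le> n \<Longrightarrow> t \<in> tms m \<Longrightarrow> t \<in> tms n"
  using vars_below_mono[of m n] by (auto simp: tms_def)

lemma fms_mono: "m \<le> n \<Longrightarrow> \<phi> \<in> fms m \<Longrightarrow> \<phi> \<in> fms n"
  using vars_below_mono[of m n] by (auto simp: fms_def)

lemma sub_tm_tms: "(\<And>i. \<sigma> i \<in> tms n) \<Longrightarrow> sub_tm \<sigma> t \<in> tms n"
  by (auto simp: tms_def fv_tm_sub)

lemma sub_fms: "(\<And>i. \<sigma> i \<in> tms n) \<Longrightarrow> sub \<sigma> \<phi> \<in> fms n"
  by (auto simp: tms_def fms_def fv_sub)

lemma inst_fms: "t \<in> tms n \<Longrightarrow> Exists \<phi> \<in> fms n \<Longrightarrow> inst t \<phi> \<in> fms n"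
  by (force simp: tms_def fms_def fv_sub inst_def split: nat.splits)

lemma fresh_var:
  assumes "finite A"
  obtains v where "v \<in> vars_below (Suc n)" "v \<notin> vars_below n" "v \<notin> A"
proof -
  have "infinite (range (\<lambda>j. prod_encode (n, j)))"
    by (auto simp: inj_def dest: finite_imageD)
  then have "\<not> range (\<lambda>j. prod_encode (n, j)) \<subseteq> A" using assms finite_subset by metis
  then obtain j where "prod_encode (n, j) \<notin> A" by auto
  then show ?thesis by (intro that[of "prod_encode (n, j)"]) (auto simp: vars_below_def)
qed

section \<open>Ordinary variables as eigenvariables\<close>

lemma sub_fresh: "v \<notin> fv \<phi> \<Longrightarrow> sub (\<lambda>i. if i = v then t else Var (Suc i)) \<phi> = lift \<phi>"
  by (auto intro: sub_cong)

text \<open>The substitution sends \<open>v\<close> to index 0 and shifts everything else. On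
  formulas without \<open>v\<close> it is a lifting, and it undoes instantiation by a fresh
  \<open>v\<close>; together these give the two rules below.\<close>

lemma sub_fresh_inst:
  assumes "Suc v \<notin> fv \<phi>"
  shows "sub (\<lambda>i. if i = v then Var 0 else Var (Suc i)) (inst (Var v) \<phi>) = \<phi>"
proof -
  have "sub (\<lambda>i. if i = v then Var 0 else Var (Suc i)) (inst (Var v) \<phi>)
    = sub (\<lambda>i. sub_tm (\<lambda>i. if i = v then Var 0 else Var (Suc i)) (case_nat (Var v) Var i)) \<phi>"
    by (simp add: inst_def sub_comp)
  also have "\<dots> = sub Var \<phi>"
    by (rule sub_cong) (use assms in \<open>auto split: nat.split\<close>)
  finally show ?thesis by simp
qed

lemma deduces_Forall_fresh:
  assumes "deduces Xi \<Gamma> (inst (Var v) \<phi>)" "Suc v \<notin> fv \<phi>" "\<And>\<gamma>. \<gamma> \<in> \<Gamma> \<Longrightarrow> v \<notin> fv \<gamma>"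
  shows "deduces Xi \<Gamma> (Forall \<phi>)"
proof -
  let ?\<sigma> = "\<lambda>i. if i = v then Var 0 else Var (Suc i)"
  have "sub ?\<sigma> ` \<Gamma> = lift ` \<Gamma>" using assms(3) by (auto simp: sub_fresh intro!: image_cong)
  then show ?thesis
    using deduces_sub[OF assms(1), of ?\<sigma>] by (simp add: sub_fresh_inst assms(2) deduces.ForallI)
qed

lemma deduces_Exists_fresh:
  assumes "deduces Xi \<Gamma> (Exists \<phi>)" "deduces Xi (insert (inst (Var v) \<phi>) \<Gamma>) \<psi>"
    "Suc v \<notin> fv \<phi>" "\<And>\<gamma>. \<gamma> \<in> \<Gamma> \<Longrightarrow> v \<notin> fv \<gamma>" "v \<notin> fv \<psi>"
  shows "deduces Xi \<Gamma> \<psi>"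
proof -
  let ?\<sigma> = "\<lambda>i. if i = v then Var 0 else Var (Suc i)"
  have "sub ?\<sigma> ` \<Gamma> = lift ` \<Gamma>" using assms(4) by (auto simp: sub_fresh intro!: image_cong)
  then show ?thesis
    using deduces_sub[OF assms(2), of ?\<sigma>] assms
    by (auto simp: sub_fresh_inst sub_fresh intro: deduces.ExistsE)
qed


section \<open>Prime theories\<close>

text \<open>Closure under deduction and witnesses are confined to the language of level
  \<open>n\<close>, so that the variables of level \<open>n\<close> and above remain fresh for
  extensions.\<close>

definition prime_theory :: "prfun \<Rightarrow> nat \<Rightarrow> fm set \<Rightarrow> bool" where
  "prime_theory Xi n \<Gamma> \<longleftrightarrow> \<Gamma> \<subseteq> fms n \<and> (\<forall>\<phi>\<in>fms n. deduces Xi \<Gamma> \<phi> \<longrightarrow> \<phi> \<in> \<Gamma>) \<and> Falsum \<notin> \<Gamma> \<and>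
     (\<forall>\<phi> \<psi>. Disj \<phi> \<psi> \<in> \<Gamma> \<longrightarrow> \<phi> \<in> \<Gamma> \<or> \<psi> \<in> \<Gamma>) \<and>
     (\<forall>\<phi>. Exists \<phi> \<in> \<Gamma> \<longrightarrow> (\<exists>t\<in>tms n. inst t \<phi> \<in> \<Gamma>))"

text \<open>One stage of a Henkin construction: \<open>\<chi>\<close> is added, with a witness if it
  is existential, unless that would derive \<open>\<phi>\<close>. The invariant
  \<open>finite (\<Delta> - \<Gamma>)\<close> keeps fresh variables available.\<close>

lemma prime_theory_step:
  assumes "finite (\<Delta> - \<Gamma>)" "\<Gamma> \<subseteq> fms n" "\<Delta> \<subseteq> fms (Suc n)" "\<not> deduces Xi \<Delta> \<phi>"
  obtains \<Delta>' where "\<Delta> \<subseteq> \<Delta>'" "finite (\<Delta>' - \<Gamma>)" "\<Delta>' \<subseteq> fms (Suc n)" "\<not> deduces Xi \<Delta>' \<phi>"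
    "\<And>\<psi>. \<chi> = Exists \<psi> \<Longrightarrow> \<chi> \<in> \<Delta>' \<Longrightarrow> \<exists>t\<in>tms (Suc n). inst t \<psi> \<in> \<Delta>'"
    "\<chi> \<in> fms (Suc n) \<Longrightarrow> \<chi> \<in> \<Delta>' \<or> deduces Xi (insert \<chi> \<Delta>) \<phi>"
proof (cases "\<chi> \<in> fms (Suc n) \<and> \<not> deduces Xi (insert \<chi> \<Delta>) \<phi>")
  case False
  show ?thesis
  proof (rule that[of \<Delta>])
    fix \<psi> assume "\<chi> = Exists \<psi>" "\<chi> \<in> \<Delta>"
    then show "\<exists>t\<in>tms (Suc n). inst t \<psi> \<in> \<Delta>"
      using False assms by (auto simp: insert_absorb)
  qed (use False assms in auto)
next
  case True
  note \<chi> = this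
  show ?thesis
  proof (cases "\<exists>\<psi>. \<chi> = Exists \<psi>")
    case False
    then show ?thesis using \<chi> assms by (intro that[of "insert \<chi> \<Delta>"]) (auto simp: insert_Diff_if)
  next
    case True
    then obtain \<psi> where \<psi>: "\<chi> = Exists \<psi>" by auto
    \<comment> \<open>The variables of \<open>\<Gamma>\<close> lie below level \<open>n\<close>, so
      only the finitely many formulas added so far and \<open>\<phi>\<close> have to be
      avoided.\<close>
    have "finite (fv \<phi> \<union> fv (Exists \<psi>) \<union> (\<Union>\<gamma>\<in>\<Delta> - \<Gamma>. fv \<gamma>))"
      using assms(1) finite_fv by blast
    then obtain v where v: "v \<in> vars_below (Suc n)" "v \<notin> vars_below n"
      "v \<notin> fv \<phi> \<union> fv (Exists \<psi>) \<union> (\<Union>\<gamma>\<in>\<Delta> - \<Gamma>. fv \<gamma>)"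
      by (rule fresh_var)
    have fresh: "v \<notin> fv \<gamma>" if "\<gamma> \<in> insert \<chi> \<Delta>" for \<gamma>
      using that v \<psi> assms(2) by (cases "\<gamma> \<in> \<Gamma>") (auto simp: fms_def)
    let ?\<Delta> = "insert (inst (Var v) \<psi>) (insert \<chi> \<Delta>)"
    have tm: "Var v \<in> tms (Suc n)" using v(1) by (simp add: tms_def)
    have "\<not> deduces Xi ?\<Delta> \<phi>"
    proof
      assume "deduces Xi ?\<Delta> \<phi>"
      then have "deduces Xi (insert \<chi> \<Delta>) \<phi>"
        by (rule deduces_Exists_fresh[rotated]) (use fresh v(3) \<psi> in \<open>auto intro: deduces.Hyp\<close>)
      then show False using \<chi> by simp
    qed
    then show ?thesis
      using \<chi> \<psi> assms tm inst_fms[OF tm, of \<psi>]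
      by (intro that[of ?\<Delta>]) (auto simp: insert_Diff_if)
  qed
qed

text \<open>The limit of the stages is maximal among the sets of its language that do not derive
  \<open>\<phi>\<close>. Deductive closure and primeness both follow from this maximality.\<close>

lemma prime_theory_extension:
  assumes \<Gamma>: "\<Gamma> \<subseteq> fms n" and \<phi>: "\<phi> \<in> fms (Suc n)" and nd: "\<not> deduces Xi \<Gamma> \<phi>"
  obtains \<Delta> where "prime_theory Xi (Suc n) \<Delta>" "\<Gamma> \<subseteq> \<Delta>" "\<phi> \<notin> \<Delta>"
proof -
  define P where "P \<Delta> \<longleftrightarrow> \<Gamma> \<subseteq> \<Delta> \<and> finite (\<Delta> - \<Gamma>) \<and> \<Delta> \<subseteq> fms (Suc n) \<and> \<not> deduces Xi \<Delta> \<phi>" for \<Delta>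
  \<comment> \<open>Stage \<open>k\<close> treats the \<open>k\<close>-th formula of an enumeration
    of all formulas.\<close>
  define Q where "Q k \<Delta> \<Delta>' \<longleftrightarrow> \<Delta> \<subseteq> \<Delta>' \<and>
    (\<forall>\<psi>. from_nat k = Exists \<psi> \<and> from_nat k \<in> \<Delta>' \<longrightarrow> (\<exists>t\<in>tms (Suc n). inst t \<psi> \<in> \<Delta>')) \<and>
    (from_nat k \<in> fms (Suc n) \<longrightarrow> from_nat k \<in> \<Delta>' \<or> deduces Xi (insert (from_nat k) \<Delta>) \<phi>)" for k \<Delta> \<Delta>'
  have "\<exists>f. \<forall>k. P (f k) \<and> Q k (f k) (f (Suc k))"
  proof (rule dependent_nat_choice)
    show "\<exists>x. P x" using assms fms_mono[of n "Suc n"] by (auto simp: P_def intro!: exI[of _ \<Gamma>])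
  next
    fix \<Delta> k assume "P \<Delta>"
    then have *: "\<Gamma> \<subseteq> \<Delta>" "finite (\<Delta> - \<Gamma>)" "\<Delta> \<subseteq> fms (Suc n)" "\<not> deduces Xi \<Delta> \<phi>"
      by (auto simp: P_def)
    from prime_theory_step[OF *(2) \<Gamma> *(3,4), of "from_nat k"]
    obtain \<Delta>' where "\<Delta> \<subseteq> \<Delta>'" "finite (\<Delta>' - \<Gamma>)" "\<Delta>' \<subseteq> fms (Suc n)" "\<not> deduces Xi \<Delta>' \<phi>"
      "\<And>\<psi>. from_nat k = Exists \<psi> \<Longrightarrow> from_nat k \<in> \<Delta>' \<Longrightarrow> \<exists>t\<in>tms (Suc n). inst t \<psi> \<in> \<Delta>'"
      "from_nat k \<in> fms (Suc n) \<Longrightarrow> from_nat k \<in> \<Delta>' \<or> deduces Xi (insert (from_nat k) \<Delta>) \<phi>"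
      by blast
    then show "\<exists>\<Delta>'. P \<Delta>' \<and> Q k \<Delta> \<Delta>'"
      using *(1) by (intro exI[of _ \<Delta>']) (auto simp: P_def Q_def)
  qed
  then obtain f where f: "\<And>k. P (f k)" "\<And>k. Q k (f k) (f (Suc k))" by blast
  have incr: "f i \<subseteq> f j" if "i \<le> j" for i j
    by (rule lift_Suc_mono_le[OF _ that]) (use f(2) in \<open>auto simp: Q_def\<close>)
  define \<Delta> where "\<Delta> = (\<Union>k. f k)"
  have sub\<Delta>: "f k \<subseteq> \<Delta>" for k by (auto simp: \<Delta>_def)
  have fin: "\<exists>k. F \<subseteq> f k" if "finite F" "F \<subseteq> \<Delta>" for F
    using that
  proof (induction rule: finite_induct)
    case (insert x F)
    then obtain i j where "x \<in> f i" "F \<subseteq> f j" by (auto simp: \<Delta>_def)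
    then have "insert x F \<subseteq> f (max i j)"
      using incr[of i "max i j"] incr[of j "max i j"] by auto
    then show ?case by blast
  qed simp
  have nd: "\<not> deduces Xi \<Delta> \<phi>"
  proof
    assume "deduces Xi \<Delta> \<phi>"
    from deduces_finite[OF this]
    obtain F where F: "finite F" "F \<subseteq> \<Delta>" "deduces Xi F \<phi>" by blast
    then obtain k where "F \<subseteq> f k" using fin by blast
    then have "deduces Xi (f k) \<phi>" by (rule deduces_weaken[OF F(3)])
    then show False using f(1) by (auto simp: P_def)
  qed
  \<comment> \<open>A formula of the language was left out only because adding it would derive
    \<open>\<phi>\<close>.\<close>
  have max: "\<chi> \<in> \<Delta> \<or> deduces Xi (insert \<chi> \<Delta>) \<phi>" if "\<chi> \<in> fms (Suc n)" for \<chi>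
  proof -
    have "\<chi> \<in> f (Suc (to_nat \<chi>)) \<or> deduces Xi (insert \<chi> (f (to_nat \<chi>))) \<phi>"
      using f(2)[of "to_nat \<chi>"] that by (simp add: Q_def)
    moreover have "insert \<chi> (f k) \<subseteq> insert \<chi> \<Delta>" for k using sub\<Delta> by blast
    ultimately show ?thesis using sub\<Delta> deduces_weaken[of Xi "insert \<chi> (f (to_nat \<chi>))" \<phi> "insert \<chi> \<Delta>"] by auto
  qed
  have \<Delta>_fms: "\<Delta> \<subseteq> fms (Suc n)" using f(1) by (auto simp: \<Delta>_def P_def)
  have closed: "\<chi> \<in> \<Delta>" if "\<chi> \<in> fms (Suc n)" "deduces Xi \<Delta> \<chi>" for \<chi>
    using max[OF that(1)] deduces_cut[OF that(2), of \<phi>] nd by auto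
  have "prime_theory Xi (Suc n) \<Delta>"
    unfolding prime_theory_def
  proof (intro conjI allI impI ballI)
    show "Falsum \<notin> \<Delta>" using nd deduces.FalsumE[OF deduces.Hyp, of \<Delta> Xi \<phi>] by auto
  next
    fix \<chi> \<psi> assume *: "Disj \<chi> \<psi> \<in> \<Delta>"
    then have "\<chi> \<in> fms (Suc n)" "\<psi> \<in> fms (Suc n)" using subsetD[OF \<Delta>_fms] by (force simp: fms_def)+
    then show "\<chi> \<in> \<Delta> \<or> \<psi> \<in> \<Delta>"
      using max[of \<chi>] max[of \<psi>] deduces.DisjE[OF deduces.Hyp[OF *], of Xi \<phi>] nd by auto
  next
    fix \<psi> assume *: "Exists \<psi> \<in> \<Delta>"
    let ?k = "to_nat (Exists \<psi>)"
    \<comment> \<open>A member of the limit has been present since its own stage at the latest, and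
      that stage provided the witness.\<close>
    have "Exists \<psi> \<in> f (Suc ?k)"
    proof (rule ccontr)
      assume "Exists \<psi> \<notin> f (Suc ?k)"
      then have "deduces Xi (insert (Exists \<psi>) (f ?k)) \<phi>"
        using f(2)[of ?k] * \<Delta>_fms by (auto simp: Q_def)
      then have "deduces Xi \<Delta> \<phi>"
        by (rule deduces_weaken) (use * sub\<Delta> in auto)
      then show False using nd by simp
    qed
    then show "\<exists>t\<in>tms (Suc n). inst t \<psi> \<in> \<Delta>"
      using f(2)[of ?k] sub\<Delta> by (fastforce simp: Q_def)
  qed (use \<Delta>_fms closed in auto)
  moreover have "\<Gamma> \<subseteq> \<Delta>" using f(1)[of 0] sub\<Delta>[of 0] by (auto simp: P_def)
  moreover have "\<phi> \<notin> \<Delta>" using nd deduces.Hyp by blast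
  ultimately show ?thesis by (rule that)
qed

section \<open>The canonical model\<close>

text \<open>Worlds are chains of prime theories over growing languages, ordered by extension. Because equality
  is decidable, two terms of a language are never identified at a later world, so an element can be
  represented once and for all by the world at which it is born together with its class of names there.
  Hence equality and the function symbols have an interpretation that does not depend on the world.\<close>

lemma map_preimage: "set ds \<subseteq> f ` A \<Longrightarrow> \<exists>ts. set ts \<subseteq> A \<and> ds = map f ts"
proof (induction ds)
  case (Cons d ds)
  then obtain t ts where "t \<in> A" "d = f t" "set ts \<subseteq> A" "ds = map f ts" by auto
  then show ?case by (intro exI[of _ "t # ts"]) simp
qed simp

locale canonical =
  fixes Xi :: prfun and \<Gamma>\<^sub>0 :: "fm set"
  assumes root: "prime_theory Xi 1 \<Gamma>\<^sub>0"
begin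

text \<open>A world is the whole history of its last theory, and its length is the level of its
  language. So the past of a world is linearly ordered, which \<open>common_world\<close>
  exploits.\<close>

inductive_set worlds :: "fm set list set" where
  root_world: "[\<Gamma>\<^sub>0] \<in> worlds"
| snoc_world: "w \<in> worlds \<Longrightarrow> prime_theory Xi (Suc (length w)) \<Delta> \<Longrightarrow> last w \<subseteq> \<Delta> \<Longrightarrow> w @ [\<Delta>] \<in> worlds"

lemma world_prime: "w \<in> worlds \<Longrightarrow> prime_theory Xi (length w) (last w)"
  by (induction rule: worlds.induct) (use root in auto)

lemma world_nonempty: "w \<in> worlds \<Longrightarrow> w \<noteq> []"
  by (induction rule: worlds.induct) auto

lemma root_prefix: "w \<in> worlds \<Longrightarrow> prefix [\<Gamma>\<^sub>0] w"
  by (induction rule: worlds.induct) auto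

lemma prefix_world: "w \<in> worlds \<Longrightarrow> prefix u w \<Longrightarrow> u \<noteq> [] \<Longrightarrow> u \<in> worlds \<and> last u \<subseteq> last w"
proof (induction arbitrary: u rule: worlds.induct)
  case root_world
  then have "u = [\<Gamma>\<^sub>0]" by (cases u) (auto simp: prefix_def)
  then show ?case by (simp add: worlds.root_world)
next
  case (snoc_world w \<Delta>)
  then show ?case using worlds.snoc_world by (force simp: prefix_snoc)
qed

lemma world_closed: "w \<in> worlds \<Longrightarrow> \<phi> \<in> fms (length w) \<Longrightarrow> deduces Xi (last w) \<phi> \<Longrightarrow> \<phi> \<in> last w"
  using world_prime by (auto simp: prime_theory_def)

lemma world_fms: "w \<in> worlds \<Longrightarrow> \<phi> \<in> last w \<Longrightarrow> \<phi> \<in> fms (length w)"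
  using world_prime[of w] by (auto simp: prime_theory_def)

lemma Equal_fms: "Equal s t \<in> fms n \<longleftrightarrow> s \<in> tms n \<and> t \<in> tms n"
  by (simp add: fms_def tms_def)

lemma Equal_refl_world: "w \<in> worlds \<Longrightarrow> t \<in> tms (length w) \<Longrightarrow> Equal t t \<in> last w"
  by (rule world_closed) (auto simp: Equal_fms deduces.Equal_refl)

lemma Equal_sym_world: "w \<in> worlds \<Longrightarrow> Equal s t \<in> last w \<Longrightarrow> Equal t s \<in> last w"
  using world_fms[of w "Equal s t"]
  by (auto intro!: world_closed simp: Equal_fms intro: deduces_Equal_sym deduces.Hyp)

lemma Equal_trans_world:
  assumes "w \<in> worlds" "Equal s t \<in> last w" "Equal t u \<in> last w"
  shows "Equal s u \<in> last w"
  using world_fms[OF assms(1,2)] world_fms[OF assms(1,3)]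
    deduces_Equal_trans[OF deduces.Hyp[OF assms(2)] deduces.Hyp[OF assms(3)]] assms(1)
  by (auto intro!: world_closed simp: Equal_fms)

text \<open>Decidability of equality enters here: the theory at \<open>u\<close> contains the
  equation or its negation, and the negation would persist to \<open>w\<close> and make the theory
  there inconsistent.\<close>

lemma Equal_prefix:
  assumes w: "w \<in> worlds" and u: "u \<in> worlds" and uw: "prefix u w"
    and st: "s \<in> tms (length u)" "t \<in> tms (length u)"
  shows "Equal s t \<in> last w \<longleftrightarrow> Equal s t \<in> last u"
proof
  assume eq: "Equal s t \<in> last w"
  have "Disj (Equal s t) (Neg (Equal s t)) \<in> last u"
    using st by (intro world_closed[OF u]) (auto simp: fms_def tms_def Neg_def deduces_Equal_decidable[unfolded Neg_def])
  then have "Equal s t \<in> last u \<or> Neg (Equal s t) \<in> last u"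
    using world_prime[OF u] by (auto simp: prime_theory_def)
  moreover have "Neg (Equal s t) \<notin> last w"
  proof
    assume "Neg (Equal s t) \<in> last w"
    then have "deduces Xi (last w) Falsum"
      using deduces.ImplE[OF deduces.Hyp deduces.Hyp[OF eq]] by (simp add: Neg_def)
    then have "Falsum \<in> last w" by (intro world_closed[OF w]) (auto simp: fms_def)
    then show False using world_prime[OF w] by (auto simp: prime_theory_def)
  qed
  ultimately show "Equal s t \<in> last u"
    using prefix_world[OF w uw world_nonempty[OF u]] by auto
next
  assume "Equal s t \<in> last u"
  then show "Equal s t \<in> last w" using prefix_world[OF w uw world_nonempty[OF u]] by auto
qed

section \<open>Elements and functions of the canonical model\<close>

text \<open>The lower bound 1 is the level of the root; it keeps \<open>take (birth w t) w\<close>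
  from being the empty list, which is no world.\<close>

definition birth :: "fm set list \<Rightarrow> tm \<Rightarrow> nat" where
  "birth w t = (LEAST m. 1 \<le> m \<and> (\<exists>s\<in>tms m. Equal s t \<in> last w))"

definition elt :: "fm set list \<Rightarrow> tm \<Rightarrow> fm set list \<times> tm set" where
  "elt w t = (take (birth w t) w, {s \<in> tms (birth w t). Equal s t \<in> last w})"

lemma length_world: "w \<in> worlds \<Longrightarrow> 1 \<le> length w"
  using world_nonempty by (cases w) auto

lemma birth:
  assumes "w \<in> worlds" "t \<in> tms (length w)"
  shows "1 \<le> birth w t" "birth w t \<le> length w" "\<exists>s\<in>tms (birth w t). Equal s t \<in> last w"
proof -
  let ?P = "\<lambda>m. 1 \<le> m \<and> (\<exists>s\<in>tms m. Equal s t \<in> last w)"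
  have "?P (length w)" using assms Equal_refl_world length_world by blast
  then have "?P (birth w t)" "birth w t \<le> length w"
    unfolding birth_def by (rule LeastI, rule Least_le)
  then show "1 \<le> birth w t" "birth w t \<le> length w" "\<exists>s\<in>tms (birth w t). Equal s t \<in> last w" by auto
qed

text \<open>The class of names at birth is nonempty, and a name common to both classes links
  \<open>s\<close> with \<open>t\<close>.\<close>

lemma elt_eq_iff:
  assumes w: "w \<in> worlds" and st: "s \<in> tms (length w)" "t \<in> tms (length w)"
  shows "elt w s = elt w t \<longleftrightarrow> Equal s t \<in> last w"
proof
  assume "elt w s = elt w t"
  then have *: "take (birth w s) w = take (birth w t) w"
    "{r \<in> tms (birth w s). Equal r s \<in> last w} = {r \<in> tms (birth w t). Equal r t \<in> last w}"
    by (auto simp: elt_def)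
  obtain r where "r \<in> tms (birth w s)" "Equal r s \<in> last w" using birth[OF w st(1)] by blast
  with *(2) have "Equal r s \<in> last w" "Equal r t \<in> last w" by blast+
  then show "Equal s t \<in> last w" using Equal_sym_world Equal_trans_world w by blast
next
  assume eq: "Equal s t \<in> last w"
  then have "Equal r s \<in> last w \<longleftrightarrow> Equal r t \<in> last w" for r
    using Equal_sym_world Equal_trans_world w by blast
  then show "elt w s = elt w t" by (simp add: elt_def birth_def)
qed

text \<open>By \<open>Equal_prefix\<close> the later world adds no equation between terms of the
  language of \<open>u\<close>, so birth level and names stay the same.\<close>

lemma elt_prefix:
  assumes w: "w \<in> worlds" and u: "u \<in> worlds" and uw: "prefix u w" and t: "t \<in> tms (length u)"
  shows "elt w t = elt u t"
proof -
  have len: "length u \<le> length w" using uw by (simp add: prefix_length_le)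
  have eq: "Equal s t \<in> last w \<longleftrightarrow> Equal s t \<in> last u" if "s \<in> tms m" "m \<le> length u" for s m
    using Equal_prefix[OF w u uw _ t] tms_mono that by blast
  let ?b = "birth u t"
  have "birth w t = ?b"
    unfolding birth_def[of w]
  proof (rule Least_equality)
    show "1 \<le> ?b \<and> (\<exists>s\<in>tms ?b. Equal s t \<in> last w)" using birth[OF u t] eq by blast
  next
    fix m assume m: "1 \<le> m \<and> (\<exists>s\<in>tms m. Equal s t \<in> last w)"
    show "?b \<le> m"
    proof (cases "m \<le> length u")
      case True
      then have "1 \<le> m \<and> (\<exists>s\<in>tms m. Equal s t \<in> last u)" using m eq by blast
      then show ?thesis unfolding birth_def by (rule Least_le)
    next
      case False
      then show ?thesis using birth(2)[OF u t] by simp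
    qed
  qed
  moreover have "take ?b w = take ?b u"
    using uw birth(2)[OF u t] by (auto simp: prefix_def)
  ultimately show ?thesis using eq birth(2)[OF u t] by (auto simp: elt_def)
qed

definition dom_of :: "fm set list \<Rightarrow> (fm set list \<times> tm set) set" where
  "dom_of w = elt w ` tms (length w)"

lemma elt_dom_of: "t \<in> tms (length w) \<Longrightarrow> elt w t \<in> dom_of w"
  by (simp add: dom_of_def)

lemma ex_dom_of: "(\<exists>d\<in>dom_of w. P d) \<longleftrightarrow> (\<exists>t\<in>tms (length w). P (elt w t))"
  by (simp add: dom_of_def)

lemma dom_of_prefix:
  assumes "w \<in> worlds" "u \<in> worlds" "prefix u w"
  shows "dom_of u \<subseteq> dom_of w"
proof
  fix d assume "d \<in> dom_of u"
  then obtain t where "t \<in> tms (length u)" "d = elt u t" by (auto simp: dom_of_def)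
  then have "d = elt w t" "t \<in> tms (length w)"
    using elt_prefix[OF assms, of t] tms_mono[OF prefix_length_le[OF assms(3)], of t] by auto
  then show "d \<in> dom_of w" by (auto simp: dom_of_def)
qed

lemma birth_world:
  assumes "w \<in> worlds" "d \<in> dom_of w"
  shows "prefix (fst d) w" "fst d \<in> worlds" "d \<in> dom_of (fst d)"
proof -
  obtain t where t: "t \<in> tms (length w)" "d = elt w t" using assms by (auto simp: dom_of_def)
  let ?u = "take (birth w t) w"
  have len: "length ?u = birth w t" using birth(2)[OF assms(1) t(1)] by simp
  have fst: "fst d = ?u" using t by (simp add: elt_def)
  show pre: "prefix (fst d) w" by (simp add: fst take_is_prefix)
  have "?u \<noteq> []" using birth(1)[OF assms(1) t(1)] len by (metis list.size(3) not_one_le_zero)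
  then show u: "fst d \<in> worlds" using prefix_world[OF assms(1) pre] by (simp add: fst)
  obtain s where s: "s \<in> tms (birth w t)" "Equal s t \<in> last w" using birth(3)[OF assms(1) t(1)] by blast
  then have "d = elt w s"
    using t elt_eq_iff[OF assms(1) _ t(1)] tms_mono birth(2)[OF assms(1) t(1)] by metis
  also have "\<dots> = elt ?u s" using elt_prefix[OF assms(1) _ pre] u s(1) len fst by simp
  finally show "d \<in> dom_of (fst d)" using s(1) len fst by (auto simp: dom_of_def)
qed

text \<open>The birth worlds of the listed elements are all prefixes of both worlds, hence
  comparable; the longest of them knows all elements. The root serves for the empty list.\<close>

lemma common_world:
  assumes "u \<in> worlds" "w \<in> worlds" "set ds \<subseteq> dom_of u" "set ds \<subseteq> dom_of w"
  shows "\<exists>v\<in>worlds. prefix v u \<and> prefix v w \<and> set ds \<subseteq> dom_of v"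
  using assms(3,4)
proof (induction ds)
  case Nil
  show ?case using assms(1,2) root_prefix worlds.root_world by auto
next
  case (Cons d ds)
  then obtain v where v: "v \<in> worlds" "prefix v u" "prefix v w" "set ds \<subseteq> dom_of v" by auto
  let ?b = "fst d"
  have b: "prefix ?b u" "prefix ?b w" "?b \<in> worlds" "d \<in> dom_of ?b"
    using birth_world[OF assms(1), of d] birth_world[OF assms(2), of d] Cons.prems by auto
  then have "prefix ?b v \<or> prefix v ?b" using v(2) prefix_same_cases by blast
  then show ?case
  proof
    assume "prefix ?b v"
    then have "d \<in> dom_of v" using dom_of_prefix[OF v(1) b(3)] b(4) by blast
    then show ?thesis using v by auto
  next
    assume "prefix v ?b"
    then have "set ds \<subseteq> dom_of ?b" using dom_of_prefix[OF b(3) v(1)] v(4) by blast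
    then show ?thesis using b by auto
  qed
qed

definition fn_of :: "prfun \<Rightarrow> (fm set list \<times> tm set) list \<Rightarrow> fm set list \<times> tm set" where
  "fn_of f ds = (let (w, ts) = SOME (w, ts). w \<in> worlds \<and> set ts \<subseteq> tms (length w) \<and> ds = map (elt w) ts
     in elt w (Fn f ts))"

lemma Fn_tms: "Fn f ts \<in> tms n \<longleftrightarrow> set ts \<subseteq> tms n"
  by (auto simp: tms_def)

lemma elt_Fn_cong:
  assumes w: "w \<in> worlds" and ts: "set ss \<subseteq> tms (length w)" "set ts \<subseteq> tms (length w)"
    and eq: "map (elt w) ss = map (elt w) ts"
  shows "elt w (Fn f ss) = elt w (Fn f ts)"
proof -
  have len: "length ss = length ts" using eq map_eq_imp_length_eq by blast
  have "deduces Xi (last w) (Equal (ss ! i) (ts ! i))" if i: "i < length ss" for i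
  proof (rule deduces.Hyp)
    have "elt w (ss ! i) = elt w (ts ! i)" using eq i len nth_map by metis
    moreover have "ss ! i \<in> tms (length w)" "ts ! i \<in> tms (length w)"
      using subsetD[OF ts(1) nth_mem[of i]] subsetD[OF ts(2) nth_mem[of i]] i len by simp_all
    ultimately show "Equal (ss ! i) (ts ! i) \<in> last w" using elt_eq_iff[OF w] by simp
  qed
  then have "list_all2 (\<lambda>s t. deduces Xi (last w) (Equal s t)) ss ts"
    using len by (simp add: list_all2_conv_all_nth)
  from deduces_Equal_Fn[OF this, of f] show ?thesis
    using elt_eq_iff[OF w] world_closed[OF w] ts by (auto simp: Fn_tms Equal_fms)
qed

text \<open>Independence of the choice in \<open>fn_of\<close>: the chosen world and
  \<open>w\<close> have a common earlier world where the arguments already have names, and both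
  results are compared with the one computed there.\<close>

lemma fn_of_elt:
  assumes w: "w \<in> worlds" and ts: "set ts \<subseteq> tms (length w)"
  shows "fn_of f (map (elt w) ts) = elt w (Fn f ts)"
proof -
  let ?ds = "map (elt w) ts"
  let ?P = "\<lambda>(u, ss). u \<in> worlds \<and> set ss \<subseteq> tms (length u) \<and> ?ds = map (elt u) ss"
  obtain u ss where us: "(SOME p. ?P p) = (u, ss)" by (cases "SOME p. ?P p")
  have "?P (SOME p. ?P p)" by (rule someI[of ?P "(w, ts)"]) (use assms in auto)
  then have u: "u \<in> worlds" and ss: "set ss \<subseteq> tms (length u)" and ds: "?ds = map (elt u) ss"
    by (simp_all add: us)
  have "set ?ds \<subseteq> dom_of w" using ts by (auto simp: dom_of_def)
  moreover have "set ?ds \<subseteq> dom_of u" unfolding ds using ss by (auto simp: dom_of_def)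
  ultimately obtain v where v: "v \<in> worlds" "prefix v u" "prefix v w" "set ?ds \<subseteq> dom_of v"
    using common_world[OF u w] by blast
  then have "\<exists>rs. set rs \<subseteq> tms (length v) \<and> ?ds = map (elt v) rs"
    by (intro map_preimage) (simp add: dom_of_def)
  then obtain rs where rs: "set rs \<subseteq> tms (length v)" "?ds = map (elt v) rs" by blast
  have *: "elt x (Fn f qs) = elt v (Fn f rs)"
    if x: "x \<in> worlds" "prefix v x" and qs: "set qs \<subseteq> tms (length x)" "map (elt x) qs = ?ds" for x qs
  proof -
    have rs': "set rs \<subseteq> tms (length x)" using rs(1) tms_mono[OF prefix_length_le[OF x(2)]] by blast
    have "map (elt x) rs = map (elt v) rs"
      using elt_prefix[OF x(1) v(1) x(2)] rs(1) by auto
    then have "elt x (Fn f qs) = elt x (Fn f rs)"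
      using elt_Fn_cong[OF x(1) qs(1) rs'] qs(2) rs(2) by simp
    also have "\<dots> = elt v (Fn f rs)" using elt_prefix[OF x(1) v(1) x(2)] rs(1) by (simp add: Fn_tms)
    finally show ?thesis .
  qed
  have "fn_of f ?ds = elt u (Fn f ss)"
    using us by (simp add: fn_of_def)
  then show ?thesis using *[OF u v(2) ss ds[symmetric]] *[OF w v(3) ts refl] by simp
qed

text \<open>A list that is not a world is treated as the root, so that the model needs no carrier of worlds.\<close>

definition nrm :: "fm set list \<Rightarrow> fm set list" where
  "nrm w = (if w \<in> worlds then w else [\<Gamma>\<^sub>0])"

lemma nrm_worlds [simp]: "nrm w \<in> worlds"
  by (simp add: nrm_def worlds.root_world)

lemma nrm_id [simp]: "w \<in> worlds \<Longrightarrow> nrm w = w"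
  by (simp add: nrm_def)

definition le :: "fm set list \<Rightarrow> fm set list \<Rightarrow> bool" where
  "le u w = prefix (nrm u) (nrm w)"

definition atom_of :: "(tm \<Rightarrow> fm) \<Rightarrow> fm set list \<Rightarrow> fm set list \<times> tm set \<Rightarrow> bool" where
  "atom_of A w d \<longleftrightarrow> (\<exists>t\<in>tms (length (nrm w)). d = elt (nrm w) t \<and> A t \<in> last (nrm w))"

lemma atom_of_mono: "le u w \<Longrightarrow> atom_of A u d \<Longrightarrow> atom_of A w d"
  using elt_prefix[of "nrm w" "nrm u"] prefix_world[of "nrm w" "nrm u"] world_nonempty[of "nrm u"]
    tms_mono[OF prefix_length_le[of "nrm u" "nrm w"]]
  unfolding atom_of_def le_def by (metis nrm_worlds subsetD)

sublocale kripke_structure le "\<lambda>w. dom_of (nrm w)" fn_of "atom_of VV" "atom_of MM" "atom_of TT"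
proof
  show "fn_of f ds \<in> dom_of (nrm w)" if "set ds \<subseteq> dom_of (nrm w)" for ds w f
  proof -
    have "\<exists>ts. set ts \<subseteq> tms (length (nrm w)) \<and> ds = map (elt (nrm w)) ts"
      using that by (intro map_preimage) (simp add: dom_of_def)
    then obtain ts where "set ts \<subseteq> tms (length (nrm w))" "ds = map (elt (nrm w)) ts" by blast
    then show ?thesis using fn_of_elt[of "nrm w" ts f] by (auto simp: dom_of_def Fn_tms)
  qed
  show "x \<in> dom_of (nrm w)" if "le v w" "x \<in> dom_of (nrm v)" for v w x
    using that dom_of_prefix[of "nrm w" "nrm v"] by (auto simp: le_def)
qed (auto simp: le_def intro: atom_of_mono[unfolded le_def])

section \<open>The truth lemma\<close>

text \<open>The semantics reads \<open>Zero\<close> and \<open>Succ\<close> as the symbols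
  \<open>PZero\<close> and \<open>PSucc\<close>; the axioms for these symbols identify the two
  readings.\<close>

lemma tval_elt:
  assumes "w \<in> worlds" "\<And>i. \<sigma> i \<in> tms (length w)"
  shows "tval (\<lambda>i. elt w (\<sigma> i)) t = elt w (sub_tm \<sigma> t)"
proof (induction t)
  case Zero
  have "fn_of PZero [] = elt w (Fn PZero [])" using fn_of_elt[OF assms(1), of "[]"] by simp
  also have "\<dots> = elt w Zero"
    using assms(1) by (subst elt_eq_iff) (auto simp: tms_def fms_def intro!: world_closed deduces.Ax axiom.PZero)
  finally show ?case by simp
next
  case (Succ t)
  let ?t = "sub_tm \<sigma> t"
  have t: "?t \<in> tms (length w)" using assms(2) by (rule sub_tm_tms)
  have "fn_of PSucc [elt w ?t] = elt w (Fn PSucc [?t])" using fn_of_elt[OF assms(1), of "[?t]"] t by simp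
  also have "deduces Xi (last w) (Equal (Fn PSucc [?t]) (Succ ?t))"
    using deduces.Ax[OF axiom.PSucc[of Xi "[?t]"]] by (simp add: arg_def)
  then have "elt w (Fn PSucc [?t]) = elt w (Succ ?t)"
    using assms(1) t by (subst elt_eq_iff) (auto simp: tms_def fms_def intro!: world_closed)
  finally show ?case using Succ by simp
next
  case (Fn f ts)
  have "map (tval (\<lambda>i. elt w (\<sigma> i))) ts = map (elt w) (map (sub_tm \<sigma>) ts)" using Fn by simp
  moreover have "set (map (sub_tm \<sigma>) ts) \<subseteq> tms (length w)" using sub_tm_tms[of \<sigma>, OF assms(2)] by auto
  ultimately show ?case using fn_of_elt[OF assms(1), of "map (sub_tm \<sigma>) ts" f] by (simp del: map_map)
qed auto

lemma atom_of_elt: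
  assumes "w \<in> worlds" "t \<in> tms (length w)"
    and "\<And>\<Gamma> s t. deduces Xi \<Gamma> (Equal s t) \<Longrightarrow> deduces Xi \<Gamma> (A s) \<Longrightarrow> deduces Xi \<Gamma> (A t)"
    and "\<And>t. fv (A t) = fv_tm t"
  shows "atom_of A w (elt w t) \<longleftrightarrow> A t \<in> last w"
proof
  assume "atom_of A w (elt w t)"
  then obtain s where s: "s \<in> tms (length w)" "elt w t = elt w s" "A s \<in> last w"
    using assms(1) by (auto simp: atom_of_def)
  then have "Equal s t \<in> last w" using elt_eq_iff[OF assms(1) s(1) assms(2)] by simp
  from assms(3)[OF deduces.Hyp[OF this] deduces.Hyp[OF s(3)]]
  show "A t \<in> last w" using assms by (auto intro!: world_closed simp: fms_def tms_def)
qed (use assms in \<open>auto simp: atom_of_def\<close>)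

lemma world_extension:
  assumes w: "w \<in> worlds" and \<Gamma>: "last w \<subseteq> \<Gamma>" "\<Gamma> \<subseteq> fms (length w)"
    and \<phi>: "\<phi> \<in> fms (Suc (length w))" "\<not> deduces Xi \<Gamma> \<phi>"
  obtains v where "v \<in> worlds" "prefix w v" "\<Gamma> \<subseteq> last v" "\<phi> \<notin> last v" "length v = Suc (length w)"
proof -
  obtain \<Delta> where \<Delta>: "prime_theory Xi (Suc (length w)) \<Delta>" "\<Gamma> \<subseteq> \<Delta>" "\<phi> \<notin> \<Delta>"
    using prime_theory_extension[OF \<Gamma>(2) \<phi>] .
  then have "w @ [\<Delta>] \<in> worlds" using w \<Gamma>(1) by (intro worlds.snoc_world) auto
  then show ?thesis using \<Delta> by (intro that[of "w @ [\<Delta>]"]) auto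
qed

lemma sat_nrm: "sat w e \<phi> \<longleftrightarrow> sat (nrm w) e \<phi>"
  by (induction \<phi> arbitrary: e) (simp_all add: atom_of_def le_def)

text \<open>Only implication and universal quantification look at later worlds. If one of them is
  not in the theory, an extension of the history by one prime theory refutes it.\<close>

lemma truth:
  assumes "w \<in> worlds" "\<And>i. \<sigma> i \<in> tms (length w)"
  shows "sat w (\<lambda>i. elt w (\<sigma> i)) \<phi> \<longleftrightarrow> sub \<sigma> \<phi> \<in> last w"
  using assms
proof (induction \<phi> arbitrary: w \<sigma>)
  case (Equal s t)
  then show ?case by (simp add: tval_elt elt_eq_iff sub_tm_tms)
next
  case (VV t)
  then show ?case by (simp add: tval_elt) (intro atom_of_elt sub_tm_tms; auto intro: deduces_atom_cong)
next
  case (MM t)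
  then show ?case by (simp add: tval_elt) (intro atom_of_elt sub_tm_tms; auto intro: deduces_atom_cong)
next
  case (TT t)
  then show ?case by (simp add: tval_elt) (intro atom_of_elt sub_tm_tms; auto intro: deduces_atom_cong)
next
  case Falsum
  then show ?case using world_prime by (auto simp: prime_theory_def)
next
  case (Conj \<phi> \<psi>)
  have fms: "sub \<sigma> \<phi> \<in> fms (length w)" "sub \<sigma> \<psi> \<in> fms (length w)" using Conj.prems by (auto intro: sub_fms)
  then have fms': "Conj (sub \<sigma> \<phi>) (sub \<sigma> \<psi>) \<in> fms (length w)" by (simp add: fms_def)
  have "Conj (sub \<sigma> \<phi>) (sub \<sigma> \<psi>) \<in> last w \<longleftrightarrow> sub \<sigma> \<phi> \<in> last w \<and> sub \<sigma> \<psi> \<in> last w"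
    using world_closed[OF Conj.prems(1)] fms fms'
      deduces.ConjE1[OF deduces.Hyp] deduces.ConjE2[OF deduces.Hyp] deduces.ConjI[OF deduces.Hyp deduces.Hyp]
    by metis
  then show ?case using Conj by simp
next
  case (Disj \<phi> \<psi>)
  have "sub \<sigma> \<phi> \<in> fms (length w)" "sub \<sigma> \<psi> \<in> fms (length w)" using Disj.prems by (auto intro: sub_fms)
  then have fms': "Disj (sub \<sigma> \<phi>) (sub \<sigma> \<psi>) \<in> fms (length w)" by (simp add: fms_def)
  have "Disj (sub \<sigma> \<phi>) (sub \<sigma> \<psi>) \<in> last w \<longleftrightarrow> sub \<sigma> \<phi> \<in> last w \<or> sub \<sigma> \<psi> \<in> last w"
    using world_closed[OF Disj.prems(1) fms'] deduces.DisjI1[OF deduces.Hyp] deduces.DisjI2[OF deduces.Hyp]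
      world_prime[OF Disj.prems(1)]
    by (metis prime_theory_def)
  then show ?case using Disj by simp
next
  case (Impl \<phi> \<psi>)
  note w = Impl.prems(1)
  have fms: "sub \<sigma> \<phi> \<in> fms (length w)" "sub \<sigma> \<psi> \<in> fms (length w)" using Impl.prems by (auto intro: sub_fms)
  have later: "sat v (\<lambda>i. elt w (\<sigma> i)) \<chi> \<longleftrightarrow> sub \<sigma> \<chi> \<in> last (nrm v)"
    if "le w v" "\<chi> = \<phi> \<or> \<chi> = \<psi>" for v \<chi>
  proof -
    have pre: "prefix w (nrm v)" using that w by (simp add: le_def)
    have "\<sigma> i \<in> tms (length (nrm v))" for i using Impl.prems(2) tms_mono[OF prefix_length_le[OF pre]] by blast
    moreover have "(\<lambda>i. elt w (\<sigma> i)) = (\<lambda>i. elt (nrm v) (\<sigma> i))"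
      using elt_prefix[OF nrm_worlds w pre] Impl.prems(2) by auto
    moreover have "sat v e \<chi> = sat (nrm v) e \<chi>" for e
      by (rule sat_nrm)
    ultimately show ?thesis using that(2) Impl.IH[of "nrm v" \<sigma>] by auto
  qed
  show ?case
  proof
    assume sat: "sat w (\<lambda>i. elt w (\<sigma> i)) (Impl \<phi> \<psi>)"
    show "sub \<sigma> (Impl \<phi> \<psi>) \<in> last w"
    proof (rule ccontr)
      assume "sub \<sigma> (Impl \<phi> \<psi>) \<notin> last w"
      then have "\<not> deduces Xi (last w) (Impl (sub \<sigma> \<phi>) (sub \<sigma> \<psi>))"
        using world_closed[OF w, of "Impl (sub \<sigma> \<phi>) (sub \<sigma> \<psi>)"] fms by (auto simp: fms_def)
      then have "\<not> deduces Xi (insert (sub \<sigma> \<phi>) (last w)) (sub \<sigma> \<psi>)" using deduces.ImplI by blast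
      moreover have "insert (sub \<sigma> \<phi>) (last w) \<subseteq> fms (length w)" using fms world_fms[OF w] by blast
      moreover have "sub \<sigma> \<psi> \<in> fms (Suc (length w))" using fms_mono[OF _ fms(2)] by simp
      ultimately obtain v where "v \<in> worlds" "prefix w v" "insert (sub \<sigma> \<phi>) (last w) \<subseteq> last v"
        "sub \<sigma> \<psi> \<notin> last v"
        using world_extension[OF w subset_insertI, of "sub \<sigma> \<phi>" "sub \<sigma> \<psi>"] by metis
      then show False using sat later[of v \<phi>] later[of v \<psi>] w by (auto simp: le_def)
    qed
  next
    assume imp: "sub \<sigma> (Impl \<phi> \<psi>) \<in> last w"
    show "sat w (\<lambda>i. elt w (\<sigma> i)) (Impl \<phi> \<psi>)"
    proof (simp, intro allI impI)
      fix v assume v: "le w v" "sat v (\<lambda>i. elt w (\<sigma> i)) \<phi>"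
      have pre: "prefix w (nrm v)" using v w by (simp add: le_def)
      have "Impl (sub \<sigma> \<phi>) (sub \<sigma> \<psi>) \<in> last (nrm v)" "sub \<sigma> \<phi> \<in> last (nrm v)"
        using imp prefix_world[OF nrm_worlds pre world_nonempty[OF w]] later v by auto
      then have "deduces Xi (last (nrm v)) (sub \<sigma> \<psi>)"
        using deduces.ImplE[OF deduces.Hyp deduces.Hyp] by blast
      then have "sub \<sigma> \<psi> \<in> last (nrm v)"
        using world_closed[OF nrm_worlds] fms_mono[OF prefix_length_le[OF pre]] fms by blast
      then show "sat v (\<lambda>i. elt w (\<sigma> i)) \<psi>" using later v by simp
    qed
  qed
next
  case (Forall \<phi>)
  note w = Forall.prems(1)
  have fms: "sub \<sigma> (Forall \<phi>) \<in> fms (length w)" using Forall.prems by (auto intro!: sub_fms simp del: sub.simps)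
  have later: "sat v (case_nat (elt (nrm v) t) (\<lambda>i. elt w (\<sigma> i))) \<phi> \<longleftrightarrow> inst t (sub (up \<sigma>) \<phi>) \<in> last (nrm v)"
    if "le w v" "t \<in> tms (length (nrm v))" for v t
  proof -
    have pre: "prefix w (nrm v)" using that w by (simp add: le_def)
    have "case_nat t \<sigma> i \<in> tms (length (nrm v))" for i
      using Forall.prems(2) tms_mono[OF prefix_length_le[OF pre]] that(2) by (auto split: nat.split)
    moreover have "case_nat (elt (nrm v) t) (\<lambda>i. elt w (\<sigma> i)) = (\<lambda>i. elt (nrm v) (case_nat t \<sigma> i))"
      using elt_prefix[OF nrm_worlds w pre] Forall.prems(2) by (auto split: nat.split)
    moreover have "sat v e \<phi> = sat (nrm v) e \<phi>" for e
      by (rule sat_nrm)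
    ultimately show ?thesis using Forall.IH[of "nrm v" "case_nat t \<sigma>"] by (simp add: sub_inst_up)
  qed
  show ?case
  proof
    assume sat: "sat w (\<lambda>i. elt w (\<sigma> i)) (Forall \<phi>)"
    show "sub \<sigma> (Forall \<phi>) \<in> last w"
    proof (rule ccontr)
      assume "sub \<sigma> (Forall \<phi>) \<notin> last w"
      then have nd: "\<not> deduces Xi (last w) (Forall (sub (up \<sigma>) \<phi>))"
        using world_closed[OF w] fms by auto
      \<comment> \<open>A variable of level \<open>length w\<close> is foreign to the language of
        \<open>w\<close> but belongs to that of the next world, where it names a generic
        element.\<close>
      obtain v where v: "v \<in> vars_below (Suc (length w))" "v \<notin> vars_below (length w)"
        by (rule fresh_var[of "{}"]) simp
      let ?\<psi> = "inst (Var v) (sub (up \<sigma>) \<phi>)"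
      have fresh: "v \<notin> fv \<gamma>" if "\<gamma> \<in> insert (Forall (sub (up \<sigma>) \<phi>)) (last w)" for \<gamma>
        using that world_fms[OF w] fms v(2) by (auto simp: fms_def)
      then have "\<not> deduces Xi (last w) ?\<psi>"
        using nd deduces_Forall_fresh[of Xi "last w" v "sub (up \<sigma>) \<phi>"] by fastforce
      moreover have "?\<psi> \<in> fms (Suc (length w))"
        using Forall.prems(2) v(1) tms_mono[of "length w" "Suc (length w)"] unfolding sub_inst_up
        by (intro sub_fms) (auto simp: tms_def split: nat.split)
      moreover have "last w \<subseteq> fms (length w)" using world_fms[OF w] by blast
      ultimately obtain u where u: "u \<in> worlds" "prefix w u" "?\<psi> \<notin> last u" "length u = Suc (length w)"
        using world_extension[OF w order_refl, of ?\<psi>] by metis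
      have tm: "Var v \<in> tms (length u)" using v(1) u(4) by (simp add: tms_def)
      then have "sat u (case_nat (elt u (Var v)) (\<lambda>i. elt w (\<sigma> i))) \<phi>"
        using sat u w elt_dom_of[OF tm] by (simp add: le_def)
      then show False using later[of u "Var v"] u tm w by (simp add: le_def)
    qed
  next
    assume all: "sub \<sigma> (Forall \<phi>) \<in> last w"
    show "sat w (\<lambda>i. elt w (\<sigma> i)) (Forall \<phi>)"
    proof (simp, intro allI impI ballI)
      fix v d assume v: "le w v" "d \<in> dom_of (nrm v)"
      then obtain t where t: "t \<in> tms (length (nrm v))" "d = elt (nrm v) t" by (auto simp: dom_of_def)
      have pre: "prefix w (nrm v)" using v w by (simp add: le_def)
      have "Forall (sub (up \<sigma>) \<phi>) \<in> last (nrm v)"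
        using all prefix_world[OF nrm_worlds pre world_nonempty[OF w]] by auto
      then have "deduces Xi (last (nrm v)) (inst t (sub (up \<sigma>) \<phi>))" by (intro deduces.ForallE deduces.Hyp)
      moreover have "inst t (sub (up \<sigma>) \<phi>) \<in> fms (length (nrm v))"
        using Forall.prems(2) t tms_mono[OF prefix_length_le[OF pre]] unfolding sub_inst_up
        by (intro sub_fms) (auto split: nat.split)
      ultimately have "inst t (sub (up \<sigma>) \<phi>) \<in> last (nrm v)" by (intro world_closed) auto
      then show "sat v (case_nat d (\<lambda>i. elt w (\<sigma> i))) \<phi>" using later[OF v(1) t(1)] t(2) by simp
    qed
  qed
next
  case (Exists \<phi>)
  note w = Exists.prems(1)
  have fms: "sub \<sigma> (Exists \<phi>) \<in> fms (length w)" using Exists.prems by (auto intro!: sub_fms simp del: sub.simps)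
  have *: "sat w (case_nat (elt w t) (\<lambda>i. elt w (\<sigma> i))) \<phi> \<longleftrightarrow> inst t (sub (up \<sigma>) \<phi>) \<in> last w"
    if "t \<in> tms (length w)" for t
  proof -
    have "case_nat (elt w t) (\<lambda>i. elt w (\<sigma> i)) = (\<lambda>i. elt w (case_nat t \<sigma> i))"
      by (auto split: nat.split)
    moreover have "case_nat t \<sigma> i \<in> tms (length w)" for i
      using Exists.prems(2) that by (auto split: nat.split)
    ultimately show ?thesis using Exists.IH[OF w, of "case_nat t \<sigma>"] by (simp add: sub_inst_up)
  qed
  have "Exists (sub (up \<sigma>) \<phi>) \<in> last w \<longleftrightarrow> (\<exists>t\<in>tms (length w). inst t (sub (up \<sigma>) \<phi>) \<in> last w)"
    using world_prime[OF w] world_closed[OF w] fms deduces.ExistsI[OF deduces.Hyp]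
    by (auto simp: prime_theory_def)
  then show ?case using * w by (simp add: ex_dom_of)
qed

lemma env_elt:
  fixes e :: "nat \<Rightarrow> _"
  assumes "\<And>i. e i \<in> dom_of (nrm w)"
  shows "\<exists>\<sigma>. (\<forall>i. \<sigma> i \<in> tms (length (nrm w))) \<and> e = (\<lambda>i. elt (nrm w) (\<sigma> i))"
proof -
  have "\<forall>i. \<exists>t. t \<in> tms (length (nrm w)) \<and> e i = elt (nrm w) t" using assms by (auto simp: dom_of_def)
  from choice[OF this] obtain \<sigma> where "\<forall>i. \<sigma> i \<in> tms (length (nrm w)) \<and> e i = elt (nrm w) (\<sigma> i)" ..
  then show ?thesis by (intro exI[of _ \<sigma>]) auto
qed

sublocale kripke_model le "\<lambda>w. dom_of (nrm w)" fn_of "atom_of VV" "atom_of MM" "atom_of TT" Xi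
proof
  fix \<phi> w and e :: "nat \<Rightarrow> _" assume ax: "axiom Xi \<phi>" and e: "\<And>i. e i \<in> dom_of (nrm w)"
  obtain \<sigma> where \<sigma>: "\<And>i. \<sigma> i \<in> tms (length (nrm w))" "e = (\<lambda>i. elt (nrm w) (\<sigma> i))"
    using env_elt[of e w] e by auto
  have "sub \<sigma> \<phi> \<in> last (nrm w)"
    by (rule world_closed[OF nrm_worlds sub_fms[of \<sigma>, OF \<sigma>(1)] deduces.Ax[OF axiom_sub[OF ax]]])
  then show "sat w e \<phi>" using truth[of "nrm w" \<sigma> \<phi>] \<sigma> sat_nrm[of w] by simp
qed

end

text \<open>The types of worlds and elements are those of the canonical model, since the hypothesis
  cannot quantify over types.\<close>

theorem kripke_completeness:
  fixes Xi :: prfun and \<phi> :: fm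
  assumes valid: "\<And>(le :: fm set list \<Rightarrow> fm set list \<Rightarrow> bool) D (fn :: prfun \<Rightarrow> (fm set list \<times> tm set) list \<Rightarrow> _)
      isV isM isT w e. kripke_model le D fn isV isM isT Xi \<Longrightarrow> (\<And>i. e i \<in> D w) \<Longrightarrow>
      kripke_structure.sat le D fn isV isM isT w e \<phi>"
  shows "deduces Xi {} \<phi>"
proof (rule ccontr)
  assume nd: "\<not> deduces Xi {} \<phi>"
  \<comment> \<open>All variables move to level 0, which leaves the higher levels fresh; the second
    Cantor projection is the inverse renaming.\<close>
  let ?\<rho> = "\<lambda>i. Var (prod_encode (0, i))"
  have "\<not> deduces Xi {} (sub ?\<rho> \<phi>)"
  proof
    assume "deduces Xi {} (sub ?\<rho> \<phi>)"
    from deduces_sub[OF this, of "\<lambda>i. Var (snd (prod_decode i))"] nd show False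
      by (simp add: sub_comp)
  qed
  moreover have \<rho>: "?\<rho> i \<in> tms (Suc 0)" for i by (simp add: tms_def vars_below_def)
  ultimately obtain \<Gamma> where \<Gamma>: "prime_theory Xi (Suc 0) \<Gamma>" "sub ?\<rho> \<phi> \<notin> \<Gamma>"
    using prime_theory_extension[of "{}" 0 "sub ?\<rho> \<phi>" Xi] sub_fms[of ?\<rho>] by auto
  then interpret canonical Xi \<Gamma> by unfold_locales simp
  have root: "[\<Gamma>] \<in> worlds" by (rule root_world)
  have "sat [\<Gamma>] (\<lambda>i. elt [\<Gamma>] (?\<rho> i)) \<phi>"
    by (rule valid[OF kripke_model_axioms]) (use root \<rho> in \<open>simp add: dom_of_def\<close>)
  then show False using truth[of "[\<Gamma>]" ?\<rho> \<phi>] root \<rho> \<Gamma>(2) by simp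
qed

section \<open>Forcing\<close>

context kripke_structure
begin

lemma sat_mono: "v \<preceq> w \<Longrightarrow> sat v e \<phi> \<Longrightarrow> sat w e \<phi>"
proof (induction \<phi> arbitrary: e)
  case (Impl \<phi> \<psi>)
  then show ?case using le_trans by auto
next
  case (Forall \<phi>)
  then show ?case using le_trans by auto
qed (auto intro: isV_mono isM_mono isT_mono D_mono)

lemma tval_sub: "tval e (sub_tm \<sigma> t) = tval (\<lambda>i. tval e (\<sigma> i)) t"
  by (induction t) (auto cong: map_cong simp: comp_def)

lemma tval_up: "(\<lambda>i. tval (case_nat d e) (up \<sigma> i)) = case_nat d (\<lambda>i. tval e (\<sigma> i))"
proof
  fix i show "tval (case_nat d e) (up \<sigma> i) = case_nat d (\<lambda>i. tval e (\<sigma> i)) i"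
    by (cases i) (simp_all add: tval_sub)
qed

lemma sat_sub: "sat w e (sub \<sigma> \<phi>) \<longleftrightarrow> sat w (\<lambda>i. tval e (\<sigma> i)) \<phi>"
  by (induction \<phi> arbitrary: w e \<sigma>) (simp_all add: tval_sub tval_up)

lemma tval_D: "(\<And>i. e i \<in> D w) \<Longrightarrow> tval e t \<in> D w"
  by (induction t) (auto intro!: fn_D)

lemma tval_lift: "tval (case_nat d e) (lift_tm t) = tval e t"
  by (simp add: tval_sub)

abbreviation zero :: 'd where "zero \<equiv> fn PZero []"
abbreviation suc :: "'d \<Rightarrow> 'd" where "suc x \<equiv> fn PSucc [x]"
abbreviation pr :: "'d \<Rightarrow> 'd \<Rightarrow> 'd" where "pr x y \<equiv> fn p_pair [x, y]"
abbreviation lf :: "'d \<Rightarrow> 'd" where "lf x \<equiv> fn p_left [x]"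
abbreviation rt :: "'d \<Rightarrow> 'd" where "rt x \<equiv> fn p_right [x]"

lemma tval_defs [simp]:
  "tval e (pairt s t) = pr (tval e s) (tval e t)"
  "tval e (leftt s) = lf (tval e s)"
  "tval e (rightt s) = rt (tval e s)"
  by (simp_all add: pairt_def leftt_def rightt_def)

lemma fn_D_simps [simp]:
  "fn f [] \<in> D w" "x \<in> D w \<Longrightarrow> fn f [x] \<in> D w" "x \<in> D w \<Longrightarrow> y \<in> D w \<Longrightarrow> fn f [x, y] \<in> D w"
  "x \<in> D w \<Longrightarrow> y \<in> D w \<Longrightarrow> z \<in> D w \<Longrightarrow> fn f [x, y, z] \<in> D w"
  by (auto intro!: fn_D)

definition App :: "'w \<Rightarrow> 'd \<Rightarrow> 'd \<Rightarrow> 'd \<Rightarrow> bool" where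
  "App w a n k \<longleftrightarrow> sat w (case_nat a (case_nat n (\<lambda>_. k))) (app (Var 0) (Var 1) (Var 2))"

lemma sat_app [simp]: "sat w e (app s t u) \<longleftrightarrow> App w (tval e s) (tval e t) (tval e u)"
proof -
  have "app s t u = sub (case_nat s (case_nat t (\<lambda>_. u))) (app (Var 0) (Var 1) (Var 2))"
    by (simp add: numeral_eq_Suc)
  moreover have "(\<lambda>i. tval e (case_nat s (case_nat t (\<lambda>_. u)) i))
    = case_nat (tval e s) (case_nat (tval e t) (\<lambda>_. tval e u))"
    by (auto split: nat.split)
  ultimately show ?thesis by (simp only: sat_sub App_def)
qed

lemma App_mono: "v \<preceq> w \<Longrightarrow> App v a n k \<Longrightarrow> App w a n k"
  unfolding App_def by (rule sat_mono)

text \<open>A quantifier followed by an implication produces two nested quantifiers over later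
  worlds; growth of the domains makes one suffice. This keeps the forcing conditions of all later
  formulas readable.\<close>

lemma all_imp_merge [simp]:
  "(\<forall>v. w \<preceq> v \<longrightarrow> (\<forall>x\<in>D v. \<forall>u. v \<preceq> u \<longrightarrow> P u x \<longrightarrow> Q u x)) \<longleftrightarrow>
   (\<forall>v. w \<preceq> v \<longrightarrow> (\<forall>x\<in>D v. P v x \<longrightarrow> Q v x))"
  by (meson D_mono le_refl le_trans)

lemma all_all_merge [simp]:
  "(\<forall>v. w \<preceq> v \<longrightarrow> (\<forall>x\<in>D v. \<forall>u. v \<preceq> u \<longrightarrow> (\<forall>y\<in>D u. P u x y))) \<longleftrightarrow>
   (\<forall>v. w \<preceq> v \<longrightarrow> (\<forall>x\<in>D v. \<forall>y\<in>D v. P v x y))"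
  by (meson D_mono le_refl le_trans)

lemma all_all_imp_merge [simp]:
  "(\<forall>v. w \<preceq> v \<longrightarrow> (\<forall>x\<in>D v. \<forall>y\<in>D v. \<forall>u. v \<preceq> u \<longrightarrow> P u x y \<longrightarrow> Q u x y)) \<longleftrightarrow>
   (\<forall>v. w \<preceq> v \<longrightarrow> (\<forall>x\<in>D v. \<forall>y\<in>D v. P v x y \<longrightarrow> Q v x y))"
  by (meson D_mono le_refl le_trans)


subsection \<open>Definable families\<close>

text \<open>A family of propositions is definable over \<open>w\<^sub>0\<close> if it is given by a formula with parameters that exist
  at \<open>w\<^sub>0\<close>. The arguments and the parameters share an environment: the former occupy its even positions, the
  latter its odd ones.\<close>

definition mix :: "(nat \<Rightarrow> 'd) \<Rightarrow> (nat \<Rightarrow> 'd) \<Rightarrow> nat \<Rightarrow> 'd" where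
  "mix e \<rho> i = (if even i then e (i div 2) else \<rho> (i div 2))"

definition definable :: "(fm \<Rightarrow> bool) \<Rightarrow> 'w \<Rightarrow> ('w \<Rightarrow> (nat \<Rightarrow> 'd) \<Rightarrow> bool) \<Rightarrow> bool" where
  "definable C w\<^sub>0 P \<longleftrightarrow> (\<exists>\<phi> \<rho>. C \<phi> \<and> (\<forall>i. \<rho> i \<in> D w\<^sub>0) \<and>
     (\<forall>w e. w\<^sub>0 \<preceq> w \<longrightarrow> (\<forall>i. e i \<in> D w) \<longrightarrow> P w e = sat w (mix e \<rho>) \<phi>))"

definition definable_tm :: "'w \<Rightarrow> ((nat \<Rightarrow> 'd) \<Rightarrow> 'd) \<Rightarrow> bool" where
  "definable_tm w\<^sub>0 \<tau> \<longleftrightarrow> (\<exists>t \<rho>. (\<forall>i. \<rho> i \<in> D w\<^sub>0) \<and> (\<forall>e. \<tau> e = tval (mix e \<rho>) t))"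

text \<open>The closure properties shared by the class of all formulas and the class of almost
  negative ones. Disjunction and existence are therefore absent, apart from the existential
  quantifier inside \<open>app\<close>.\<close>

definition fm_class :: "(fm \<Rightarrow> bool) \<Rightarrow> bool" where
  "fm_class C \<longleftrightarrow> (\<forall>\<sigma> \<phi>. C \<phi> \<longrightarrow> C (sub \<sigma> \<phi>)) \<and> (\<forall>\<phi> \<psi>. C \<phi> \<longrightarrow> C \<psi> \<longrightarrow> C (Conj \<phi> \<psi>) \<and> C (Impl \<phi> \<psi>)) \<and>
     (\<forall>\<phi>. C \<phi> \<longrightarrow> C (Forall \<phi>)) \<and> (\<forall>s t. C (Equal s t)) \<and> (\<forall>t. C (VV t) \<and> C (MM t) \<and> C (TT t)) \<and>
     (\<forall>s t u. C (app s t u)) \<and> C Falsum"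

lemma fm_class_any [simp]: "fm_class (\<lambda>_. True)"
  by (simp add: fm_class_def)

lemma fm_class_almost_negative [simp]: "fm_class almost_negative"
  by (auto simp: fm_class_def intro: almost_negative.intros almost_negative_sub sigma1_app sigma1.intros delta0.intros)

text \<open>Parameter \<open>k\<close> of \<open>\<rho>\<close> stands at position 2k + 1 of
  \<open>mix e \<rho>\<close>. In the merged list \<open>mix \<rho> \<rho>'\<close> it has position
  2k, hence 4k + 1 in the whole environment; a parameter of \<open>\<rho>'\<close> goes to 4k +
  3.\<close>

lemma mix_left: "mix e \<rho> = (\<lambda>i. tval (mix e (mix \<rho> \<rho>')) (Var (if even i then i else 4 * (i div 2) + 1)))"
proof
  fix i
  show "mix e \<rho> i = tval (mix e (mix \<rho> \<rho>')) (Var (if even i then i else 4 * (i div 2) + 1))"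
  proof (cases "even i")
    case False
    then obtain k where k: "i = 2 * k + 1" by (rule oddE)
    have "(4 * k + 1) div 2 = 2 * k + 0" by simp
    then show ?thesis using k by (simp add: mix_def)
  qed (simp add: mix_def)
qed

lemma mix_right: "mix e \<rho>' = (\<lambda>i. tval (mix e (mix \<rho> \<rho>')) (Var (if even i then i else 4 * (i div 2) + 3)))"
proof
  fix i
  show "mix e \<rho>' i = tval (mix e (mix \<rho> \<rho>')) (Var (if even i then i else 4 * (i div 2) + 3))"
  proof (cases "even i")
    case False
    then obtain k where k: "i = 2 * k + 1" by (rule oddE)
    have "(4 * k + 3) div 2 = 2 * k + 1" by simp
    then show ?thesis using k by (simp add: mix_def)
  qed (simp add: mix_def)
qed

text \<open>A new first argument moves the other arguments up by two positions but is bound by a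
  single quantifier. So the argument at an even position i > 0 is read at i - 1, while a parameter
  shifts by one.\<close>

lemma mix_Suc: "mix (case_nat x e) \<rho> = (\<lambda>i. tval (case_nat x (mix e \<rho>))
    (Var (if even i then (if i = 0 then 0 else i - 1) else i + 1)))"
proof
  fix i
  show "mix (case_nat x e) \<rho> i = tval (case_nat x (mix e \<rho>))
    (Var (if even i then (if i = 0 then 0 else i - 1) else i + 1))"
  proof (cases "even i")
    case True
    then obtain k where "i = 2 * k" by blast
    then show ?thesis by (cases k) (auto simp: mix_def)
  next
    case False
    then obtain k where "i = 2 * k + 1" by (auto elim: oddE)
    then show ?thesis by (auto simp: mix_def)
  qed
qed

lemma mix_D: "(\<And>i. \<rho> i \<in> D w) \<Longrightarrow> (\<And>i. \<rho>' i \<in> D w) \<Longrightarrow> mix \<rho> \<rho>' i \<in> D w"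
  by (simp add: mix_def)

text \<open>A connective can join two formulas only over one list of parameters, so the two lists
  are interleaved.\<close>

lemma definable_pair:
  assumes C: "fm_class C" and "definable C w\<^sub>0 P" "definable C w\<^sub>0 Q"
  obtains \<phi> \<psi> \<rho> where "C \<phi>" "C \<psi>" "\<forall>i. \<rho> i \<in> D w\<^sub>0"
    "\<forall>w e. w\<^sub>0 \<preceq> w \<longrightarrow> (\<forall>i. e i \<in> D w) \<longrightarrow>
      P w e = sat w (mix e \<rho>) \<phi> \<and> Q w e = sat w (mix e \<rho>) \<psi>"
proof -
  obtain \<phi> \<rho> where P: "C \<phi>" "\<forall>i. \<rho> i \<in> D w\<^sub>0"
    "\<forall>w e. w\<^sub>0 \<preceq> w \<longrightarrow> (\<forall>i. e i \<in> D w) \<longrightarrow> P w e = sat w (mix e \<rho>) \<phi>"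
    using assms(2) by (auto simp: definable_def)
  obtain \<psi> \<rho>' where Q: "C \<psi>" "\<forall>i. \<rho>' i \<in> D w\<^sub>0"
    "\<forall>w e. w\<^sub>0 \<preceq> w \<longrightarrow> (\<forall>i. e i \<in> D w) \<longrightarrow> Q w e = sat w (mix e \<rho>') \<psi>"
    using assms(3) by (auto simp: definable_def)
  let ?l = "\<lambda>i. Var (if even i then i else 4 * (i div 2) + 1)"
  let ?r = "\<lambda>i. Var (if even i then i else 4 * (i div 2) + 3)"
  have "sat w (mix e \<rho>) \<phi> = sat w (mix e (mix \<rho> \<rho>')) (sub ?l \<phi>)" for w e
    by (simp only: sat_sub mix_left[symmetric])
  moreover have "sat w (mix e \<rho>') \<psi> = sat w (mix e (mix \<rho> \<rho>')) (sub ?r \<psi>)" for w e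
    by (simp only: sat_sub mix_right[symmetric])
  moreover have "C (sub ?l \<phi>)" "C (sub ?r \<psi>)" using C P(1) Q(1) by (auto simp: fm_class_def)
  ultimately show ?thesis using P Q mix_D[of \<rho> w\<^sub>0 \<rho>']
    by (intro that[of "sub ?l \<phi>" "sub ?r \<psi>" "mix \<rho> \<rho>'"]) auto
qed

lemma definable_tm_pair:
  assumes "definable_tm w\<^sub>0 \<sigma>" "definable_tm w\<^sub>0 \<tau>"
  obtains s t \<rho> where "\<forall>i. \<rho> i \<in> D w\<^sub>0" "\<forall>e. \<sigma> e = tval (mix e \<rho>) s" "\<forall>e. \<tau> e = tval (mix e \<rho>) t"
proof -
  obtain s \<rho> where s: "\<forall>i. \<rho> i \<in> D w\<^sub>0" "\<forall>e. \<sigma> e = tval (mix e \<rho>) s"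
    using assms(1) by (auto simp: definable_tm_def)
  obtain t \<rho>' where t: "\<forall>i. \<rho>' i \<in> D w\<^sub>0" "\<forall>e. \<tau> e = tval (mix e \<rho>') t"
    using assms(2) by (auto simp: definable_tm_def)
  let ?l = "\<lambda>i. Var (if even i then i else 4 * (i div 2) + 1)"
  let ?r = "\<lambda>i. Var (if even i then i else 4 * (i div 2) + 3)"
  have "tval (mix e \<rho>) s = tval (mix e (mix \<rho> \<rho>')) (sub_tm ?l s)" for e
    by (simp only: tval_sub mix_left[symmetric])
  moreover have "tval (mix e \<rho>') t = tval (mix e (mix \<rho> \<rho>')) (sub_tm ?r t)" for e
    by (simp only: tval_sub mix_right[symmetric])
  ultimately show ?thesis using s t mix_D[of \<rho> w\<^sub>0 \<rho>']
    by (intro that[of "mix \<rho> \<rho>'" "sub_tm ?l s" "sub_tm ?r t"]) auto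
qed

lemma definable_tm_triple:
  assumes "definable_tm w\<^sub>0 \<sigma>" "definable_tm w\<^sub>0 \<tau>" "definable_tm w\<^sub>0 \<upsilon>"
  obtains s t u \<rho> where "\<forall>i. \<rho> i \<in> D w\<^sub>0" "\<forall>e. \<sigma> e = tval (mix e \<rho>) s"
    "\<forall>e. \<tau> e = tval (mix e \<rho>) t" "\<forall>e. \<upsilon> e = tval (mix e \<rho>) u"
proof -
  obtain s t \<rho> where st: "\<forall>i. \<rho> i \<in> D w\<^sub>0" "\<forall>e. \<sigma> e = tval (mix e \<rho>) s" "\<forall>e. \<tau> e = tval (mix e \<rho>) t"
    using definable_tm_pair[OF assms(1,2)] .
  obtain u \<rho>' where u: "\<forall>i. \<rho>' i \<in> D w\<^sub>0" "\<forall>e. \<upsilon> e = tval (mix e \<rho>') u"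
    using assms(3) by (auto simp: definable_tm_def)
  let ?l = "\<lambda>i. Var (if even i then i else 4 * (i div 2) + 1)"
  let ?r = "\<lambda>i. Var (if even i then i else 4 * (i div 2) + 3)"
  have "tval (mix e \<rho>) s = tval (mix e (mix \<rho> \<rho>')) (sub_tm ?l s)" for e s
    by (simp only: tval_sub mix_left[symmetric])
  moreover have "tval (mix e \<rho>') t = tval (mix e (mix \<rho> \<rho>')) (sub_tm ?r t)" for e t
    by (simp only: tval_sub mix_right[symmetric])
  ultimately show ?thesis using st u mix_D[of \<rho> w\<^sub>0 \<rho>']
    by (intro that[of "mix \<rho> \<rho>'" "sub_tm ?l s" "sub_tm ?l t" "sub_tm ?r u"]) auto
qed

lemma definable_tm_var: "definable_tm w\<^sub>0 (\<lambda>e. e i)"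
  unfolding definable_tm_def
  by (rule exI[of _ "Var (2 * i)"], rule exI[of _ "\<lambda>_. zero"]) (simp add: mix_def)

lemma definable_tm_const: "c \<in> D w\<^sub>0 \<Longrightarrow> definable_tm w\<^sub>0 (\<lambda>e. c)"
  unfolding definable_tm_def
  by (rule exI[of _ "Var 1"], rule exI[of _ "\<lambda>_. c"]) (simp add: mix_def)

lemma definable_tm_fn0: "definable_tm w\<^sub>0 (\<lambda>e. fn f [])"
  by (rule definable_tm_const) simp

lemma definable_tm_fn1: "definable_tm w\<^sub>0 \<sigma> \<Longrightarrow> definable_tm w\<^sub>0 (\<lambda>e. fn f [\<sigma> e])"
  unfolding definable_tm_def by (elim exE conjE) (rule exI[of _ "Fn f [t]" for t], auto)

lemma definable_tm_fn2:
  assumes "definable_tm w\<^sub>0 \<sigma>" "definable_tm w\<^sub>0 \<tau>"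
  shows "definable_tm w\<^sub>0 (\<lambda>e. fn f [\<sigma> e, \<tau> e])"
proof -
  obtain s t \<rho> where "\<forall>i. \<rho> i \<in> D w\<^sub>0" "\<forall>e. \<sigma> e = tval (mix e \<rho>) s" "\<forall>e. \<tau> e = tval (mix e \<rho>) t"
    using definable_tm_pair[OF assms] .
  then show ?thesis unfolding definable_tm_def
    by (intro exI[of _ "Fn f [s, t]"] exI[of _ \<rho>]) simp
qed

lemmas definable_tm_intros = definable_tm_var definable_tm_fn0 definable_tm_fn1 definable_tm_fn2 definable_tm_const

lemma definable_eq:
  assumes "fm_class C" "definable_tm w\<^sub>0 \<sigma>" "definable_tm w\<^sub>0 \<tau>"
  shows "definable C w\<^sub>0 (\<lambda>w e. \<sigma> e = \<tau> e)"
proof -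
  obtain s t \<rho> where "\<forall>i. \<rho> i \<in> D w\<^sub>0" "\<forall>e. \<sigma> e = tval (mix e \<rho>) s" "\<forall>e. \<tau> e = tval (mix e \<rho>) t"
    using definable_tm_pair[OF assms(2,3)] .
  then show ?thesis unfolding definable_def
    using assms(1) by (intro exI[of _ "Equal s t"] exI[of _ \<rho>]) (auto simp: fm_class_def)
qed

lemma definable_atom:
  assumes "fm_class C" "definable_tm w\<^sub>0 \<tau>"
  shows "definable C w\<^sub>0 (\<lambda>w e. isV w (\<tau> e))" "definable C w\<^sub>0 (\<lambda>w e. isM w (\<tau> e))"
    "definable C w\<^sub>0 (\<lambda>w e. isT w (\<tau> e))"
proof -
  obtain t \<rho> where *: "\<forall>i. \<rho> i \<in> D w\<^sub>0" "\<forall>e. \<tau> e = tval (mix e \<rho>) t"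
    using assms(2) by (auto simp: definable_tm_def)
  show "definable C w\<^sub>0 (\<lambda>w e. isV w (\<tau> e))" unfolding definable_def
    using assms(1) * by (intro exI[of _ "VV t"] exI[of _ \<rho>]) (auto simp: fm_class_def)
  show "definable C w\<^sub>0 (\<lambda>w e. isM w (\<tau> e))" unfolding definable_def
    using assms(1) * by (intro exI[of _ "MM t"] exI[of _ \<rho>]) (auto simp: fm_class_def)
  show "definable C w\<^sub>0 (\<lambda>w e. isT w (\<tau> e))" unfolding definable_def
    using assms(1) * by (intro exI[of _ "TT t"] exI[of _ \<rho>]) (auto simp: fm_class_def)
qed

lemma definable_App:
  assumes "fm_class C" "definable_tm w\<^sub>0 \<sigma>" "definable_tm w\<^sub>0 \<tau>" "definable_tm w\<^sub>0 \<upsilon>"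
  shows "definable C w\<^sub>0 (\<lambda>w e. App w (\<sigma> e) (\<tau> e) (\<upsilon> e))"
proof -
  obtain s t u \<rho> where "\<forall>i. \<rho> i \<in> D w\<^sub>0" "\<forall>e. \<sigma> e = tval (mix e \<rho>) s"
    "\<forall>e. \<tau> e = tval (mix e \<rho>) t" "\<forall>e. \<upsilon> e = tval (mix e \<rho>) u"
    using definable_tm_triple[OF assms(2-4)] .
  then show ?thesis unfolding definable_def
    using assms(1) by (intro exI[of _ "app s t u"] exI[of _ \<rho>]) (auto simp: fm_class_def)
qed

lemma definable_False: "fm_class C \<Longrightarrow> definable C w\<^sub>0 (\<lambda>w e. False)"
  unfolding definable_def
  by (rule exI[of _ Falsum], rule exI[of _ "\<lambda>_. zero"]) (simp add: fm_class_def)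

lemma definable_conj:
  assumes "fm_class C" "definable C w\<^sub>0 P" "definable C w\<^sub>0 Q"
  shows "definable C w\<^sub>0 (\<lambda>w e. P w e \<and> Q w e)"
proof -
  obtain \<phi> \<psi> \<rho> where "C \<phi>" "C \<psi>" "\<forall>i. \<rho> i \<in> D w\<^sub>0"
    "\<forall>w e. w\<^sub>0 \<preceq> w \<longrightarrow> (\<forall>i. e i \<in> D w) \<longrightarrow> P w e = sat w (mix e \<rho>) \<phi> \<and> Q w e = sat w (mix e \<rho>) \<psi>"
    using definable_pair[OF assms] .
  then show ?thesis unfolding definable_def
    using assms(1) by (intro exI[of _ "Conj \<phi> \<psi>"] exI[of _ \<rho>]) (auto simp: fm_class_def)
qed

lemma definable_disj:
  assumes "definable (\<lambda>_. True) w\<^sub>0 P" "definable (\<lambda>_. True) w\<^sub>0 Q"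
  shows "definable (\<lambda>_. True) w\<^sub>0 (\<lambda>w e. P w e \<or> Q w e)"
proof -
  obtain \<phi> \<psi> \<rho> where "\<forall>i. \<rho> i \<in> D w\<^sub>0"
    "\<forall>w e. w\<^sub>0 \<preceq> w \<longrightarrow> (\<forall>i. e i \<in> D w) \<longrightarrow> P w e = sat w (mix e \<rho>) \<phi> \<and> Q w e = sat w (mix e \<rho>) \<psi>"
    using definable_pair[OF fm_class_any assms] .
  then show ?thesis unfolding definable_def
    by (intro exI[of _ "Disj \<phi> \<psi>"] exI[of _ \<rho>]) auto
qed

lemma definable_imp:
  assumes "fm_class C" "definable C w\<^sub>0 P" "definable C w\<^sub>0 Q"
  shows "definable C w\<^sub>0 (\<lambda>w e. \<forall>v. w \<preceq> v \<longrightarrow> P v e \<longrightarrow> Q v e)"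
proof -
  obtain \<phi> \<psi> \<rho> where *: "C \<phi>" "C \<psi>" "\<forall>i. \<rho> i \<in> D w\<^sub>0"
    "\<forall>w e. w\<^sub>0 \<preceq> w \<longrightarrow> (\<forall>i. e i \<in> D w) \<longrightarrow> P w e = sat w (mix e \<rho>) \<phi> \<and> Q w e = sat w (mix e \<rho>) \<psi>"
    using definable_pair[OF assms] .
  have "P v e = sat v (mix e \<rho>) \<phi>" "Q v e = sat v (mix e \<rho>) \<psi>"
    if "w\<^sub>0 \<preceq> w" "\<forall>i. e i \<in> D w" "w \<preceq> v" for w v e
    using *(4)[rule_format, OF le_trans[OF that(1,3)], of e] D_mono[OF that(3)] that by auto
  then show ?thesis unfolding definable_def
    using assms(1) * by (intro exI[of _ "Impl \<phi> \<psi>"] exI[of _ \<rho>]) (auto simp: fm_class_def)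
qed

text \<open>The bound element is argument 0 of the inner family and the old arguments are shifted.
  Applied backwards, beta reduction thus does the renumbering of de Bruijn indices.\<close>

lemma definable_quant:
  assumes C: "fm_class C" and "definable C w\<^sub>0 (\<lambda>w e. P w (\<lambda>i. e (Suc i)) (e 0))"
  obtains \<phi> \<rho> where "C \<phi>" "\<forall>i. \<rho> i \<in> D w\<^sub>0"
    "\<forall>w e x. w\<^sub>0 \<preceq> w \<longrightarrow> (\<forall>i. e i \<in> D w) \<longrightarrow> x \<in> D w \<longrightarrow> P w e x = sat w (case_nat x (mix e \<rho>)) \<phi>"
proof -
  let ?r = "\<lambda>i. Var (if even i then (if i = 0 then 0 else i - 1) else i + 1)"
  obtain \<phi> \<rho> where *: "C \<phi>" "\<forall>i. \<rho> i \<in> D w\<^sub>0"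
    "\<forall>w e. w\<^sub>0 \<preceq> w \<longrightarrow> (\<forall>i. e i \<in> D w) \<longrightarrow> P w (\<lambda>i. e (Suc i)) (e 0) = sat w (mix e \<rho>) \<phi>"
    using assms(2) by (auto simp: definable_def)
  have "P w e x = sat w (case_nat x (mix e \<rho>)) (sub ?r \<phi>)"
    if "w\<^sub>0 \<preceq> w" "\<forall>i. e i \<in> D w" "x \<in> D w" for w e x
  proof -
    have "P w e x = sat w (mix (case_nat x e) \<rho>) \<phi>"
      using *(3)[rule_format, of w "case_nat x e"] that by (auto split: nat.split)
    then show ?thesis by (simp only: sat_sub mix_Suc)
  qed
  moreover have "C (sub ?r \<phi>)" using C *(1) by (auto simp: fm_class_def)
  ultimately show ?thesis using *(2) by (intro that[of "sub ?r \<phi>" \<rho>]) auto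
qed

lemma definable_all:
  assumes "fm_class C" "definable C w\<^sub>0 (\<lambda>w e. P w (\<lambda>i. e (Suc i)) (e 0))"
  shows "definable C w\<^sub>0 (\<lambda>w e. \<forall>v. w \<preceq> v \<longrightarrow> (\<forall>x\<in>D v. P v e x))"
proof -
  obtain \<phi> \<rho> where *: "C \<phi>" "\<forall>i. \<rho> i \<in> D w\<^sub>0"
    "\<forall>w e x. w\<^sub>0 \<preceq> w \<longrightarrow> (\<forall>i. e i \<in> D w) \<longrightarrow> x \<in> D w \<longrightarrow> P w e x = sat w (case_nat x (mix e \<rho>)) \<phi>"
    using definable_quant[where P=P, OF assms] .
  have "P v e x = sat v (case_nat x (mix e \<rho>)) \<phi>"
    if "w\<^sub>0 \<preceq> w" "\<forall>i. e i \<in> D w" "w \<preceq> v" "x \<in> D v" for w v e x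
    using *(3)[rule_format, OF le_trans[OF that(1,3)], of e x] D_mono[OF that(3)] that by auto
  then show ?thesis unfolding definable_def
    using assms(1) * by (intro exI[of _ "Forall \<phi>"] exI[of _ \<rho>]) (auto simp: fm_class_def)
qed

lemma definable_ex:
  assumes "definable (\<lambda>_. True) w\<^sub>0 (\<lambda>w e. P w (\<lambda>i. e (Suc i)) (e 0))"
  shows "definable (\<lambda>_. True) w\<^sub>0 (\<lambda>w e. \<exists>x\<in>D w. P w e x)"
proof -
  obtain \<phi> \<rho> where *: "\<forall>i. \<rho> i \<in> D w\<^sub>0"
    "\<forall>w e x. w\<^sub>0 \<preceq> w \<longrightarrow> (\<forall>i. e i \<in> D w) \<longrightarrow> x \<in> D w \<longrightarrow> P w e x = sat w (case_nat x (mix e \<rho>)) \<phi>"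
    using definable_quant[where P=P, OF fm_class_any assms] .
  then show ?thesis unfolding definable_def
    by (intro exI[of _ "Exists \<phi>"] exI[of _ \<rho>]) auto
qed

lemma definable_all_imp:
  assumes C: "fm_class C" and P: "definable C w\<^sub>0 (\<lambda>w e. P w (\<lambda>i. e (Suc i)) (e 0))"
    and Q: "definable C w\<^sub>0 (\<lambda>w e. Q w (\<lambda>i. e (Suc i)) (e 0))"
  shows "definable C w\<^sub>0 (\<lambda>w e. \<forall>v. w \<preceq> v \<longrightarrow> (\<forall>x\<in>D v. P v e x \<longrightarrow> Q v e x))"
  using definable_all[where P="\<lambda>w e x. \<forall>v. w \<preceq> v \<longrightarrow> P v e x \<longrightarrow> Q v e x", OF C definable_imp[OF C P Q]]
  by simp

lemma definable_all_all_imp: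
  assumes C: "fm_class C"
    and P: "definable C w\<^sub>0 (\<lambda>w e. P w (\<lambda>i. e (Suc (Suc i))) (e (Suc 0)) (e 0))"
    and Q: "definable C w\<^sub>0 (\<lambda>w e. Q w (\<lambda>i. e (Suc (Suc i))) (e (Suc 0)) (e 0))"
  shows "definable C w\<^sub>0 (\<lambda>w e. \<forall>v. w \<preceq> v \<longrightarrow> (\<forall>x\<in>D v. \<forall>y\<in>D v. P v e x y \<longrightarrow> Q v e x y))"
proof -
  have "definable C w\<^sub>0 (\<lambda>w e. \<forall>v. w \<preceq> v \<longrightarrow> (\<forall>x\<in>D v. \<forall>u. v \<preceq> u \<longrightarrow> (\<forall>y\<in>D u. P u e x y \<longrightarrow> Q u e x y)))"
    by (rule definable_all[OF C], rule definable_all_imp[OF C]) (rule P Q)+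
  then show ?thesis by simp
qed

text \<open>Repeated application builds the defining formula from the shape of the family. The order
  matters: the merged quantifier rules precede the plain ones, and a variable is tried before a
  constant parameter.\<close>

lemmas definable_intros =
  fm_class_any fm_class_almost_negative
  definable_eq definable_atom definable_App definable_False definable_conj definable_disj
  definable_imp definable_all_all_imp definable_all_imp definable_all definable_ex definable_tm_intros

lemma definable1:
  assumes "fm_class C" "definable C w\<^sub>0 (\<lambda>w e. P w (e 0))"
  obtains \<phi> \<rho> where "C \<phi>" "\<forall>i. \<rho> i \<in> D w\<^sub>0"
    "\<forall>w x. w\<^sub>0 \<preceq> w \<longrightarrow> x \<in> D w \<longrightarrow> P w x = sat w (case_nat x \<rho>) \<phi>"
proof -
  obtain \<phi> \<rho> where *: "C \<phi>" "\<forall>i. \<rho> i \<in> D w\<^sub>0"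
    "\<forall>w e x. w\<^sub>0 \<preceq> w \<longrightarrow> (\<forall>i. e i \<in> D w) \<longrightarrow> x \<in> D w \<longrightarrow> P w x = sat w (case_nat x (mix e \<rho>)) \<phi>"
    using definable_quant[where P="\<lambda>w e x. P w x", OF assms] .
  then show ?thesis using mix_D[of "\<lambda>_. zero" w\<^sub>0 \<rho>]
    by (intro that[of \<phi> "mix (\<lambda>_. zero) \<rho>"]) auto
qed

lemma definable2:
  assumes "fm_class C" "definable C w\<^sub>0 (\<lambda>w e. P w (e (Suc 0)) (e 0))"
  obtains \<phi> \<rho> where "C \<phi>" "\<forall>i. \<rho> i \<in> D w\<^sub>0"
    "\<forall>w x y. w\<^sub>0 \<preceq> w \<longrightarrow> x \<in> D w \<longrightarrow> y \<in> D w \<longrightarrow> P w x y = sat w (case_nat y (case_nat x \<rho>)) \<phi>"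
proof -
  \<comment> \<open>Below the last argument, position 0 is \<open>x\<close>, found at index 1; an
    odd position holds a parameter, found two places further; the remaining even positions hold the
    dummy \<open>zero\<close>, which index \<open>i\<close> also reads from the padding.\<close>
  let ?r = "\<lambda>i. case_nat (Var 0) (\<lambda>i. Var (if even i then (if i = 0 then 1 else i) else Suc (Suc i))) i"
  obtain \<phi> \<rho> where *: "C \<phi>" "\<forall>i. \<rho> i \<in> D w\<^sub>0"
    "\<forall>w e x. w\<^sub>0 \<preceq> w \<longrightarrow> (\<forall>i. e i \<in> D w) \<longrightarrow> x \<in> D w \<longrightarrow> P w (e 0) x = sat w (case_nat x (mix e \<rho>)) \<phi>"
    using definable_quant[where P="\<lambda>w e x. P w (e 0) x", OF assms] .
  have eq: "(\<lambda>i. tval (case_nat y (case_nat x (mix (\<lambda>_. zero) \<rho>))) (?r i)) = case_nat y (mix (case_nat x (\<lambda>_. zero)) \<rho>)" for x y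
  proof
    fix i
    show "tval (case_nat y (case_nat x (mix (\<lambda>_. zero) \<rho>))) (?r i) = case_nat y (mix (case_nat x (\<lambda>_. zero)) \<rho>) i"
    proof (cases i)
      case (Suc j)
      show ?thesis
      proof (cases "even j")
        case True
        then obtain k where "j = 2 * k" by blast
        then show ?thesis using Suc by (cases k) (auto simp: mix_def)
      next
        case False
        then show ?thesis using Suc by (auto simp: mix_def)
      qed
    qed simp
  qed
  have "P w x y = sat w (case_nat y (case_nat x (mix (\<lambda>_. zero) \<rho>))) (sub ?r \<phi>)"
    if "w\<^sub>0 \<preceq> w" "x \<in> D w" "y \<in> D w" for w x y
  proof -
    have "P w (case_nat x (\<lambda>_. zero) 0) y = sat w (case_nat y (mix (case_nat x (\<lambda>_. zero)) \<rho>)) \<phi>"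
      using *(3)[rule_format, of w "case_nat x (\<lambda>_. zero)" y] that by (auto split: nat.split)
    then show ?thesis by (simp only: sat_sub eq) simp
  qed
  moreover have "C (sub ?r \<phi>)" using assms(1) *(1) by (auto simp: fm_class_def)
  ultimately show ?thesis using *(2) mix_D[of "\<lambda>_. zero" w\<^sub>0 \<rho>]
    by (intro that[of "sub ?r \<phi>" "mix (\<lambda>_. zero) \<rho>"]) auto
qed

end

section \<open>Consequences of the axioms in a model\<close>

context kripke_model
begin

lemma tval_case_nat [simp]: "(\<lambda>i. tval e (case_nat t \<sigma> i)) = case_nat (tval e t) (\<lambda>i. tval e (\<sigma> i))"
  by (auto split: nat.split)

text \<open>The base case is demanded at \<open>w\<^sub>0\<close> only, because a definable family
  persists to later worlds.\<close>

lemma D_induct [consumes 2, case_names definable zero suc]: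
  assumes "w\<^sub>0 \<preceq> w" "x \<in> D w"
    and "definable (\<lambda>_. True) w\<^sub>0 (\<lambda>w e. P w (e 0))"
    and "P w\<^sub>0 zero"
    and "\<And>w x. w\<^sub>0 \<preceq> w \<Longrightarrow> x \<in> D w \<Longrightarrow> P w x \<Longrightarrow> P w (suc x)"
  shows "P w x"
proof -
  obtain \<phi> \<rho> where *: "\<forall>i. \<rho> i \<in> D w\<^sub>0" "\<forall>w x. w\<^sub>0 \<preceq> w \<longrightarrow> x \<in> D w \<longrightarrow> P w x = sat w (case_nat x \<rho>) \<phi>"
    using definable1[where P=P, OF fm_class_any assms(3)] .
  have "sat w\<^sub>0 \<rho> (Impl (inst Zero \<phi>)
    (Impl (Forall (Impl \<phi> (sub (case_nat (Succ (Var 0)) (\<lambda>i. Var (Suc i))) \<phi>))) (Forall \<phi>)))"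
    by (rule axiom_sat[OF axiom.induction]) (use * in simp)
  moreover have "sat w\<^sub>0 \<rho> (inst Zero \<phi>)" using * assms(4) by (simp add: inst_def sat_sub)
  moreover have "sat v (case_nat (suc x) \<rho>) \<phi>" if "w\<^sub>0 \<preceq> v" "x \<in> D v" "sat v (case_nat x \<rho>) \<phi>" for v x
    using assms(5)[of v x] * that by simp
  then have "sat w\<^sub>0 \<rho> (Forall (Impl \<phi> (sub (case_nat (Succ (Var 0)) (\<lambda>i. Var (Suc i))) \<phi>)))"
    by (simp add: sat_sub)
  ultimately have "sat w\<^sub>0 \<rho> (Forall \<phi>)"
    unfolding sat.simps(8) using le_refl by blast
  then have "\<forall>v. w\<^sub>0 \<preceq> v \<longrightarrow> (\<forall>x\<in>D v. sat v (case_nat x \<rho>) \<phi>)" by simp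
  then show ?thesis using * assms(1,2) by simp
qed

lemma isV_I:
  assumes "x \<in> D w" "\<And>v n. w \<preceq> v \<Longrightarrow> n \<in> D v \<Longrightarrow> \<exists>k\<in>D v. App v x n k \<and> isM v (rt k) \<and>
      (\<forall>u. v \<preceq> u \<longrightarrow> isT u (rt k) \<longrightarrow> isV u (lf k))"
  shows "isV w x"
proof -
  have "sat w (\<lambda>_. zero) (Forall (Impl (vset_step (VV (Var 0))) (VV (Var 0))))"
    by (rule axiom_sat[OF axiom.V1]) simp
  then show ?thesis using assms by (simp add: vset_step_def numeral_eq_Suc)
qed

lemma isV_induct [consumes 3, case_names definable step]:
  assumes "w\<^sub>0 \<preceq> w" "x \<in> D w" "isV w x"
    and "definable (\<lambda>_. True) w\<^sub>0 (\<lambda>w e. P w (e 0))"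
    and "\<And>w x. w\<^sub>0 \<preceq> w \<Longrightarrow> x \<in> D w \<Longrightarrow> (\<And>v n. w \<preceq> v \<Longrightarrow> n \<in> D v \<Longrightarrow>
      \<exists>k\<in>D v. App v x n k \<and> isM v (rt k) \<and> (\<forall>u. v \<preceq> u \<longrightarrow> isT u (rt k) \<longrightarrow> P u (lf k))) \<Longrightarrow> P w x"
  shows "P w x"
proof -
  obtain \<phi> \<rho> where *: "\<forall>i. \<rho> i \<in> D w\<^sub>0" "\<forall>w x. w\<^sub>0 \<preceq> w \<longrightarrow> x \<in> D w \<longrightarrow> P w x = sat w (case_nat x \<rho>) \<phi>"
    using definable1[where P=P, OF fm_class_any assms(4)] .
  have ax: "sat w\<^sub>0 \<rho> (Impl (Forall (Impl (vset_step \<phi>) \<phi>)) (Forall (Impl (VV (Var 0)) \<phi>)))"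
    by (rule axiom_sat[OF axiom.V2]) (use * in simp)
  have "sat v (case_nat x \<rho>) \<phi>" if v: "w\<^sub>0 \<preceq> v" "x \<in> D v" "sat v (case_nat x \<rho>) (vset_step \<phi>)" for v x
  proof -
    have "\<exists>k\<in>D u. App u x n k \<and> isM u (rt k) \<and> (\<forall>t. u \<preceq> t \<longrightarrow> isT t (rt k) \<longrightarrow> P t (lf k))"
      if "v \<preceq> u" "n \<in> D u" for u n
    proof -
      have "\<exists>k\<in>D u. App u x n k \<and> isM u (rt k) \<and>
          (\<forall>t. u \<preceq> t \<longrightarrow> isT t (rt k) \<longrightarrow> sat t (case_nat (lf k) \<rho>) \<phi>)"
        using v(3) that by (simp add: vset_step_def sat_sub numeral_eq_Suc)
      then obtain k where k: "k \<in> D u" "App u x n k" "isM u (rt k)"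
        "\<forall>t. u \<preceq> t \<longrightarrow> isT t (rt k) \<longrightarrow> sat t (case_nat (lf k) \<rho>) \<phi>" by blast
      have "P t (lf k) = sat t (case_nat (lf k) \<rho>) \<phi>" if t: "u \<preceq> t" for t
        using * le_trans[OF le_trans[OF v(1) \<open>v \<preceq> u\<close>] t] D_mono[OF t k(1)] by simp
      then show ?thesis using k by auto
    qed
    from assms(5)[OF v(1,2) this] show ?thesis using * v by simp
  qed
  then have "sat w\<^sub>0 \<rho> (Forall (Impl (vset_step \<phi>) \<phi>))" by simp
  with ax have "sat w\<^sub>0 \<rho> (Forall (Impl (VV (Var 0)) \<phi>))"
    unfolding sat.simps(8) using le_refl by blast
  then have "\<forall>v. w\<^sub>0 \<preceq> v \<longrightarrow> (\<forall>x\<in>D v. isV v x \<longrightarrow> sat v (case_nat x \<rho>) \<phi>)" by simp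
  then show ?thesis using * assms(1-3) by simp
qed

lemma ECT:
  assumes P: "definable almost_negative w (\<lambda>w e. P w (e 0))"
    and Q: "definable (\<lambda>_. True) w (\<lambda>w e. Q w (e (Suc 0)) (e 0))"
    and PQ: "\<And>v n. w \<preceq> v \<Longrightarrow> n \<in> D v \<Longrightarrow> P v n \<Longrightarrow> \<exists>m\<in>D v. Q v n m"
  shows "\<exists>a\<in>D w. \<forall>v n. w \<preceq> v \<longrightarrow> n \<in> D v \<longrightarrow> P v n \<longrightarrow> (\<exists>k\<in>D v. App v a n k \<and> Q v n k)"
proof -
  obtain \<phi> \<rho> where \<phi>: "almost_negative \<phi>" "\<forall>i. \<rho> i \<in> D w"
    "\<forall>v x. w \<preceq> v \<longrightarrow> x \<in> D v \<longrightarrow> P v x = sat v (case_nat x \<rho>) \<phi>"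
    using definable1[where P=P, OF fm_class_almost_negative P] .
  obtain \<psi> \<rho>' where \<psi>: "\<forall>i. \<rho>' i \<in> D w"
    "\<forall>v x y. w \<preceq> v \<longrightarrow> x \<in> D v \<longrightarrow> y \<in> D v \<longrightarrow> Q v x y = sat v (case_nat y (case_nat x \<rho>')) \<psi>"
    using definable2[where P=Q, OF fm_class_any Q] .
  \<comment> \<open>In the shared list \<open>mix \<rho> \<rho>'\<close> the entry
    \<open>\<rho> i\<close> has position 2i and \<open>\<rho>' i\<close> has 2i + 1. They are
    shifted by one and by two bound variables, giving 2i + 1 and 2i + 3.\<close>
  let ?l = "case_nat (Var 0) (\<lambda>i. Var (Suc (2 * i)))"
  let ?r = "case_nat (Var 0) (case_nat (Var 1) (\<lambda>i. Var (Suc (Suc (Suc (2 * i))))))"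
  let ?e = "mix \<rho> \<rho>'"
  define \<phi>' where "\<phi>' = sub ?l \<phi>"
  define \<psi>' where "\<psi>' = sub ?r \<psi>"
  have P': "P v x = sat v (case_nat x ?e) \<phi>'" if "w \<preceq> v" "x \<in> D v" for v x
    using \<phi>(3) that by (simp add: \<phi>'_def sat_sub mix_def)
  have Q': "Q v x y = sat v (case_nat y (case_nat x ?e)) \<psi>'" if "w \<preceq> v" "x \<in> D v" "y \<in> D v" for v x y
    using \<psi>(2) that by (simp add: \<psi>'_def sat_sub mix_def)
  have "almost_negative \<phi>'" using \<phi>(1) by (simp add: \<phi>'_def almost_negative_sub)
  from axiom_sat[OF axiom.ECT[OF this, of Xi \<psi>'], of ?e w] \<phi>(2) \<psi>(1) mix_D[of \<rho> w \<rho>']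
  have "sat w ?e (Impl (Forall (Impl \<phi>' (Exists \<psi>')))
      (Exists (Forall
        (Impl (sub (case_nat (Var 0) (\<lambda>i. Var (i + 2))) \<phi>')
          (Exists (Conj (app (Var 2) (Var 1) (Var 0))
            (sub (case_nat (Var 0) (case_nat (Var 1) (\<lambda>i. Var (i + 3)))) \<psi>')))))))"
    by blast
  moreover have "sat w ?e (Forall (Impl \<phi>' (Exists \<psi>')))"
    using PQ P' Q' by auto
  ultimately have "sat w ?e (Exists (Forall
        (Impl (sub (case_nat (Var 0) (\<lambda>i. Var (i + 2))) \<phi>')
          (Exists (Conj (app (Var 2) (Var 1) (Var 0))
            (sub (case_nat (Var 0) (case_nat (Var 1) (\<lambda>i. Var (i + 3)))) \<psi>'))))))"
    unfolding sat.simps(8) using le_refl by blast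
  then have "\<exists>a\<in>D w. \<forall>v. w \<preceq> v \<longrightarrow> (\<forall>n\<in>D v. sat v (case_nat n ?e) \<phi>' \<longrightarrow>
      (\<exists>k\<in>D v. App v a n k \<and> sat v (case_nat k (case_nat n ?e)) \<psi>'))"
    by (simp add: sat_sub numeral_eq_Suc)
  then obtain a where a: "a \<in> D w" "\<forall>v. w \<preceq> v \<longrightarrow> (\<forall>n\<in>D v. sat v (case_nat n ?e) \<phi>' \<longrightarrow>
      (\<exists>k\<in>D v. App v a n k \<and> sat v (case_nat k (case_nat n ?e)) \<psi>'))"
    by blast
  then show ?thesis using P' Q' by (intro bexI[of _ a]) auto
qed

section \<open>Truth and meaningfulness of the conditions built by \<open>Xi\<close>\<close>

abbreviation xi :: "'d \<Rightarrow> 'd \<Rightarrow> 'd" where "xi f g \<equiv> fn Xi [f, g]"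

lemma isT_xi:
  assumes "f \<in> D w" "g \<in> D w" "isM w (xi f g)"
  shows "isT w (xi f g) \<longleftrightarrow> (\<forall>v. w \<preceq> v \<longrightarrow> (\<forall>n\<in>D v.
    (\<exists>k\<in>D v. App v f n k \<and> isT v k) \<longrightarrow> (\<exists>k\<in>D v. App v g n k \<and> isT v k)))"
proof -
  have "sat w (\<lambda>_. zero) (Forall (Forall
    (Impl (MM (Fn Xi [Var 1, Var 0]))
      (Iff (TT (Fn Xi [Var 1, Var 0]))
        (Forall
          (Impl (Exists (Conj (app (Var 3) (Var 1) (Var 0)) (TT (Var 0))))
                (Exists (Conj (app (Var 2) (Var 1) (Var 0)) (TT (Var 0))))))))))"
    by (rule axiom_sat[OF axiom.X1]) simp
  then have "sat w (case_nat g (case_nat f (\<lambda>_. zero)))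
    (Impl (MM (Fn Xi [Var 1, Var 0]))
      (Iff (TT (Fn Xi [Var 1, Var 0]))
        (Forall
          (Impl (Exists (Conj (app (Var 3) (Var 1) (Var 0)) (TT (Var 0))))
                (Exists (Conj (app (Var 2) (Var 1) (Var 0)) (TT (Var 0))))))))"
    using assms(1,2) le_refl unfolding sat.simps(9) by blast
  moreover have "sat w (case_nat g (case_nat f (\<lambda>_. zero))) (MM (Fn Xi [Var 1, Var 0]))"
    using assms(3) by simp
  ultimately have "sat w (case_nat g (case_nat f (\<lambda>_. zero))) (TT (Fn Xi [Var 1, Var 0])) \<longleftrightarrow>
      sat w (case_nat g (case_nat f (\<lambda>_. zero)))
        (Forall
          (Impl (Exists (Conj (app (Var 3) (Var 1) (Var 0)) (TT (Var 0))))
                (Exists (Conj (app (Var 2) (Var 1) (Var 0)) (TT (Var 0))))))"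
    unfolding Iff_def sat.simps(6,8) using le_refl by blast
  then show ?thesis by (simp add: numeral_eq_Suc)
qed

lemma isM_xi:
  assumes "f \<in> D w" "g \<in> D w"
    and "\<And>v n k. w \<preceq> v \<Longrightarrow> n \<in> D v \<Longrightarrow> k \<in> D v \<Longrightarrow> App v f n k \<Longrightarrow> isM v k"
    and "\<And>v n k l. w \<preceq> v \<Longrightarrow> n \<in> D v \<Longrightarrow> k \<in> D v \<Longrightarrow> l \<in> D v \<Longrightarrow> App v f n k \<Longrightarrow> App v g n l \<Longrightarrow>
      isT v k \<Longrightarrow> isM v l"
  shows "isM w (xi f g)"
proof -
  have "sat w (\<lambda>_. zero) (Forall (Forall
    (Impl (Conj
        (Forall (Forall (Impl (app (Var 3) (Var 1) (Var 0)) (MM (Var 0)))))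
        (Forall (Forall (Forall
          (Impl (Conj (app (Var 4) (Var 2) (Var 1))
                  (Conj (app (Var 3) (Var 2) (Var 0)) (TT (Var 1))))
                (MM (Var 0)))))))
      (MM (Fn Xi [Var 1, Var 0])))))"
    by (rule axiom_sat[OF axiom.X2]) simp
  then have "sat w (case_nat g (case_nat f (\<lambda>_. zero))) (Impl (Conj
        (Forall (Forall (Impl (app (Var 3) (Var 1) (Var 0)) (MM (Var 0)))))
        (Forall (Forall (Forall
          (Impl (Conj (app (Var 4) (Var 2) (Var 1))
                  (Conj (app (Var 3) (Var 2) (Var 0)) (TT (Var 1))))
                (MM (Var 0)))))))
      (MM (Fn Xi [Var 1, Var 0])))"
    using assms(1,2) le_refl unfolding sat.simps(9) by blast
  moreover have "sat w (case_nat g (case_nat f (\<lambda>_. zero))) (Conj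
        (Forall (Forall (Impl (app (Var 3) (Var 1) (Var 0)) (MM (Var 0)))))
        (Forall (Forall (Forall
          (Impl (Conj (app (Var 4) (Var 2) (Var 1))
                  (Conj (app (Var 3) (Var 2) (Var 0)) (TT (Var 1))))
                (MM (Var 0)))))))"
    using assms(3,4) by (auto simp: numeral_eq_Suc)
  ultimately have "sat w (case_nat g (case_nat f (\<lambda>_. zero))) (MM (Fn Xi [Var 1, Var 0]))"
    unfolding sat.simps(8) using le_refl by blast
  then show ?thesis by simp
qed


section \<open>Arithmetic in a model\<close>

text \<open>The axioms for function symbols speak of terms. Naming the entries of a list by the
  variables 0, 1, ... turns them into equations between elements; \<open>zero\<close> is the value
  of a missing argument.\<close>

lemma env_list:
  assumes "set xs \<subseteq> D w"
  obtains e where "\<And>i. e i \<in> D w" "map (tval e) (map Var [0..<length xs]) = xs"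
    "\<And>i. tval e (arg Zero (map Var [0..<length xs]) i) = arg zero xs i"
proof -
  let ?e = "arg zero xs"
  have "?e i \<in> D w" for i using assms by (auto simp: arg_def)
  moreover have "map (tval ?e) (map Var [0..<length xs]) = xs"
    by (rule nth_equalityI) (auto simp: arg_def)
  ultimately show ?thesis by (intro that[of ?e]) (auto simp: arg_def)
qed

lemma axiom_eq:
  assumes "axiom Xi (Equal s t)" "\<And>i. e i \<in> D w"
  shows "tval e s = tval e t"
  using axiom_sat[OF assms(1), of e w] assms(2) by simp

lemma fn_PProj: "set xs \<subseteq> D w \<Longrightarrow> fn (PProj i) xs = arg zero xs i"
  by (rule env_list[of xs w], assumption)
    (metis axiom_eq[OF axiom.PProj] tval.simps(4))

lemma fn_PComp:
  assumes "set xs \<subseteq> D w"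
  shows "fn (PComp f gs) xs = fn f (map (\<lambda>g. fn g xs) gs)"
proof -
  obtain e where e: "\<And>i. e i \<in> D w" "map (tval e) (map Var [0..<length xs]) = xs"
    using env_list[OF assms] by metis
  define ts where "ts = map Var [0..<length xs]"
  have "tval e (Fn (PComp f gs) ts) = tval e (Fn f (map (\<lambda>g. Fn g ts) gs))"
    using axiom_eq[OF axiom.PComp] e(1) by blast
  moreover have "map (tval e) ts = xs" using e(2) by (simp add: ts_def)
  ultimately show ?thesis by (simp add: comp_def)
qed

lemma fn_PRec:
  assumes "set xs \<subseteq> D w"
  shows "fn (PRec f g) (zero # xs) = fn f xs"
    and "x \<in> D w \<Longrightarrow> fn (PRec f g) (suc x # xs) = fn g (x # fn (PRec f g) (x # xs) # xs)"
proof -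
  obtain e where e: "\<And>i. e i \<in> D w" "map (tval e) (map Var [0..<length xs]) = xs"
    using env_list[OF assms] by metis
  from axiom_eq[OF axiom.PRec_Zero[of Xi f g "map Var [0..<length xs]"], of e w] e
  show "fn (PRec f g) (zero # xs) = fn f xs" by (simp del: map_map)
next
  assume "x \<in> D w"
  then have "set (x # xs) \<subseteq> D w" using assms by simp
  from env_list[OF this]
  obtain e where e: "\<And>i. e i \<in> D w" "map (tval e) (map Var [0..<length (x # xs)]) = x # xs" by metis
  have split: "map Var [0..<length (x # xs)] = Var 0 # map Var [1..<Suc (length xs)]"
    by (simp add: upt_conv_Cons del: upt_Suc)
  from e(2) have ex: "e 0 = x" "map (tval e) (map Var [1..<Suc (length xs)]) = xs"
    by (simp_all only: split) simp_all
  from axiom_eq[OF axiom.PRec_Succ[of Xi f g "Var 0" "map Var [1..<Suc (length xs)]"], of e w] e(1) ex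
  show "fn (PRec f g) (suc x # xs) = fn g (x # fn (PRec f g) (x # xs) # xs)" by (simp del: map_map upt_Suc)
qed

lemmas fn_simps = fn_PProj fn_PComp fn_PRec

lemma suc_inject:
  assumes "x \<in> D w" "y \<in> D w"
  shows "suc x = suc y \<longleftrightarrow> x = y"
proof -
  have "case_nat x (\<lambda>_. y) i \<in> D w" for i using assms by (auto split: nat.split)
  then show ?thesis
    using axiom_sat[OF axiom.Succ_inject[of Xi "Var 0" "Var 1"], of "case_nat x (\<lambda>_. y)" w] by auto
qed

lemma suc_not_zero: "x \<in> D w \<Longrightarrow> suc x \<noteq> zero"
  using axiom_sat[OF axiom.Succ_not_Zero[of Xi "Var 0"], of "\<lambda>_. x" w] by (auto simp: Neg_def)

lemma D_cases:
  assumes "x \<in> D w"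
  obtains "x = zero" | y where "y \<in> D w" "x = suc y"
proof -
  from le_refl assms have "x = zero \<or> (\<exists>y\<in>D w. x = suc y)"
  proof (induction rule: D_induct)
    case definable
    show ?case by (rule definable_intros)+
  qed auto
  then show ?thesis using that by auto
qed

section \<open>Addition, truncated subtraction and Cantor pairing\<close>

abbreviation add :: "'d \<Rightarrow> 'd \<Rightarrow> 'd" where "add x y \<equiv> fn p_add [x, y]"
abbreviation rsub :: "'d \<Rightarrow> 'd \<Rightarrow> 'd" where "rsub x y \<equiv> fn p_rsub [x, y]"
abbreviation tri :: "'d \<Rightarrow> 'd" where "tri x \<equiv> fn p_tri [x]"
abbreviation diag :: "'d \<Rightarrow> 'd" where "diag x \<equiv> fn p_diag [x]"

lemma add_zero: "y \<in> D w \<Longrightarrow> add zero y = y"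
  by (simp add: p_add_def fn_simps[where w=w] arg_def)

lemma add_suc: "x \<in> D w \<Longrightarrow> y \<in> D w \<Longrightarrow> add (suc x) y = suc (add x y)"
  by (simp add: p_add_def fn_simps[where w=w] arg_def)

text \<open>Only the closed term \<open>zero\<close> occurs, and it lives at every world, so the
  world of the computation rules may be \<open>undefined\<close>.\<close>

lemma pred_zero: "fn p_pred [zero] = zero"
  by (simp add: p_pred_def fn_simps[where w=undefined] arg_def)

lemma pred_suc: "x \<in> D w \<Longrightarrow> fn p_pred [suc x] = x"
  by (simp add: p_pred_def fn_simps[where w=w] arg_def)

lemma rsub_zero: "x \<in> D w \<Longrightarrow> rsub zero x = x"
  by (simp add: p_rsub_def fn_simps[where w=w] arg_def)

lemma rsub_suc: "x \<in> D w \<Longrightarrow> y \<in> D w \<Longrightarrow> rsub (suc x) y = fn p_pred [rsub x y]"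
  by (simp add: p_rsub_def fn_simps[where w=w] arg_def)

lemma if0_zero: "x \<in> D w \<Longrightarrow> y \<in> D w \<Longrightarrow> fn p_if0 [zero, x, y] = x"
  by (simp add: p_if0_def fn_simps[where w=w] arg_def)

lemma if0_suc: "n \<in> D w \<Longrightarrow> x \<in> D w \<Longrightarrow> y \<in> D w \<Longrightarrow> fn p_if0 [suc n, x, y] = y"
  by (simp add: p_if0_def fn_simps[where w=w] arg_def)

lemma tri_zero: "tri zero = zero"
  by (simp add: p_tri_def fn_simps[where w=undefined] arg_def)

lemma tri_suc: "x \<in> D w \<Longrightarrow> tri (suc x) = add (suc x) (tri x)"
  by (simp add: p_tri_def fn_simps[where w=w] arg_def)

lemma diag_zero: "diag zero = zero"
  by (simp add: p_diag_def fn_simps[where w=undefined] arg_def)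

lemma diag_suc:
  "x \<in> D w \<Longrightarrow> diag (suc x) =
    fn p_if0 [rsub (suc x) (tri (suc (diag x))), suc (diag x), diag x]"
  by (simp add: p_diag_def fn_simps[where w=w] arg_def)

lemma add_zero_right: "x \<in> D w \<Longrightarrow> add x zero = x"
  using le_refl
proof (induction rule: D_induct)
  case definable
  show ?case by (rule definable_intros)+
qed (simp_all add: add_zero[where w=w] add_suc)

lemma add_suc_right:
  assumes "x \<in> D w" and y: "y \<in> D w"
  shows "add x (suc y) = suc (add x y)"
  using le_refl assms(1)
proof (induction rule: D_induct)
  case definable
  show ?case by (rule definable_intros y)+
next
  case (suc v x)
  then show ?case using D_mono[OF suc(1) y] by (simp add: add_suc[where w=v])
qed (use y in \<open>simp add: add_zero[where w=w]\<close>)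

lemma add_commute:
  assumes "x \<in> D w" and y: "y \<in> D w"
  shows "add x y = add y x"
  using le_refl assms(1)
proof (induction rule: D_induct)
  case definable
  show ?case by (rule definable_intros y)+
next
  case (suc v x)
  then show ?case using D_mono[OF suc(1) y] by (simp add: add_suc[where w=v] add_suc_right[where w=v])
qed (use y in \<open>simp add: add_zero[where w=w] add_zero_right[where w=w]\<close>)

lemma add_assoc:
  assumes "x \<in> D w" and y: "y \<in> D w" and z: "z \<in> D w"
  shows "add (add x y) z = add x (add y z)"
  using le_refl assms(1)
proof (induction rule: D_induct)
  case definable
  show ?case by (rule definable_intros y z)+
next
  case (suc v x)
  then show ?case using D_mono[OF suc(1)] y z by (simp add: add_suc[where w=v])
qed (use y z in \<open>simp add: add_zero[where w=w]\<close>)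

lemma rsub_suc_suc:
  assumes "x \<in> D w" and y: "y \<in> D w"
  shows "rsub (suc x) (suc y) = rsub x y"
  using le_refl assms(1)
proof (induction rule: D_induct)
  case definable
  show ?case by (rule definable_intros y)+
next
  case (suc v x)
  then show ?case using D_mono[OF suc(1) y] by (simp add: rsub_suc[where w=v])
qed (use y in \<open>simp add: rsub_suc[where w=w] rsub_zero[where w=w] pred_suc[where w=w]\<close>)

lemma rsub_add:
  assumes "x \<in> D w" and y: "y \<in> D w"
  shows "rsub x (add x y) = y"
  using le_refl assms(1)
proof (induction rule: D_induct)
  case definable
  show ?case by (rule definable_intros y)+
next
  case (suc v x)
  then show ?case using D_mono[OF suc(1) y] by (simp add: add_suc[where w=v] rsub_suc_suc[where w=v])
qed (use y in \<open>simp add: rsub_zero[where w=w] add_zero[where w=w]\<close>)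

lemma rsub_self: "x \<in> D w \<Longrightarrow> rsub x x = zero"
  using rsub_add[of x w zero] by (simp add: add_zero_right[where w=w])

lemma rsub_of_zero: "x \<in> D w \<Longrightarrow> rsub x zero = zero"
  using le_refl
proof (induction rule: D_induct)
  case definable
  show ?case by (rule definable_intros)+
qed (simp_all add: rsub_zero[where w=w] rsub_suc pred_zero)

text \<open>Outer induction on the diagonal, inner induction on the position \<open>x\<close> within
  it, following the Cantor enumeration one number at a time. This is the fact that makes the
  projections invert pairing.\<close>

lemma diag_pair:
  assumes "m \<in> D w" "n \<in> D w"
  shows "diag (add (tri (add m n)) m) = add m n"
proof -
  have "add m n \<in> D w" using assms by simp
  from le_refl this
  have "\<forall>v. w \<preceq> v \<longrightarrow> (\<forall>x\<in>D v. \<forall>y\<in>D v. add x y = add m n \<longrightarrow> diag (add (tri (add m n)) x) = add m n)"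
  proof (induction rule: D_induct[where P="\<lambda>w d. \<forall>v. w \<preceq> v \<longrightarrow> (\<forall>x\<in>D v. \<forall>y\<in>D v. add x y = d \<longrightarrow>
      diag (add (tri d) x) = d)"])
    case definable
    show ?case by (rule definable_intros)+
  next
    case zero
    have "x = zero" if "x \<in> D v" "y \<in> D v" "add x y = zero" for v x y
      using that by (cases rule: D_cases[OF that(1)]) (auto simp: add_suc[where w=v] suc_not_zero[where w=v])
    then have "add (tri zero) x = zero" if "x \<in> D v" "y \<in> D v" "add x y = zero" for v x y
      using that add_zero[of zero w] by (metis fn_D_simps(1) tri_zero)
    then show ?case by (metis diag_zero)
  next
    case (suc w\<^sub>1 d)
    show ?case
    proof (intro allI impI ballI)
      fix v x y assume v: "w\<^sub>1 \<preceq> v" and xy: "x \<in> D v" "y \<in> D v" "add x y = suc d"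
      have d: "d \<in> D v" using D_mono[OF v suc(2)] .
      from le_refl xy(1)
      have "\<forall>u. v \<preceq> u \<longrightarrow> (\<forall>y\<in>D u. add x y = suc d \<longrightarrow> diag (add (tri (suc d)) x) = suc d)"
      proof (induction rule: D_induct[where P="\<lambda>v x. \<forall>u. v \<preceq> u \<longrightarrow> (\<forall>y\<in>D u. add x y = suc d \<longrightarrow>
          diag (add (tri (suc d)) x) = suc d)"])
        case definable
        show ?case by (rule definable_intros d)+
      next
        case zero
        \<comment> \<open>The last number of diagonal \<open>d\<close>; its successor opens the next
          diagonal, so the difference tested in \<open>diag_suc\<close> is zero there.\<close>
        let ?z = "add (tri d) d"
        have z: "?z \<in> D v" using d by simp
        have "diag ?z = d"
          using suc(3)[rule_format, OF v d, of zero] d by (simp add: add_zero_right[where w=v])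
        moreover have "tri (suc d) = fn PSucc [?z]"
          using d add_commute[of d v "tri d"] by (simp add: tri_suc[where w=v] add_suc[where w=v])
        ultimately have "diag (tri (suc d)) = suc d"
          using d z by (simp add: diag_suc[where w=v] rsub_self[where w=v] if0_zero[where w=v])
        then show ?case using d by (simp add: add_zero_right[where w=v])
      next
        case (suc u x)
        show ?case
        proof (intro allI impI ballI)
          fix t y assume t: "u \<preceq> t" and y: "y \<in> D t" "add (fn PSucc [x]) y = fn PSucc [d]"
          have x: "x \<in> D t" using D_mono[OF t suc(2)] .
          have d: "d \<in> D t" using D_mono[OF le_trans[OF suc(1) t] d] .
          let ?D = "fn PSucc [d]"
          let ?z = "add (tri ?D) x"
          have z: "?z \<in> D t" using x d by simp
          have sum: "add x (fn PSucc [y]) = ?D"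
            using y x by (simp add: add_suc[where w=t] add_suc_right[where w=t])
          then have dz: "diag ?z = ?D" using suc(3)[rule_format, OF t, of "fn PSucc [y]"] y by simp
          \<comment> \<open>The next diagonal is still at a positive distance, namely
            \<open>suc y\<close> beyond \<open>suc ?z\<close>, so \<open>diag\<close> keeps its
            value.\<close>
          have "tri (fn PSucc [?D]) = fn PSucc [add ?D (tri ?D)]"
            using d by (simp add: tri_suc[where w=t, of ?D] add_suc[where w=t])
          also have "add ?D (tri ?D) = add (tri ?D) ?D" using d add_commute[of ?D t "tri ?D"] by simp
          also have "\<dots> = add (tri ?D) (add x (fn PSucc [y]))" using sum by simp
          also have "\<dots> = add ?z (fn PSucc [y])" using x y d by (simp add: add_assoc[where w=t])
          finally have "rsub (fn PSucc [?z]) (tri (fn PSucc [?D])) = fn PSucc [y]"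
            using z y by (simp add: rsub_suc_suc[where w=t] rsub_add[where w=t])
          then have "diag (fn PSucc [?z]) = ?D"
            using z y d dz by (simp add: diag_suc[where w=t] if0_suc[where w=t])
          then show "diag (add (tri ?D) (fn PSucc [x])) = ?D"
            using x d by (simp add: add_suc_right[where w=t])
        qed
      qed
      then show "diag (add (tri (suc d)) x) = suc d" using xy by auto
    qed
  qed
  then show ?thesis using assms by auto
qed

lemma pr_eq: "m \<in> D w \<Longrightarrow> n \<in> D w \<Longrightarrow> pr m n = add (tri (add m n)) m"
  by (simp add: p_pair_def fn_simps[where w=w] arg_def)

lemma lf_eq: "z \<in> D w \<Longrightarrow> lf z = rsub (tri (diag z)) z"
  by (simp add: p_left_def fn_simps[where w=w] arg_def)

lemma rt_eq: "z \<in> D w \<Longrightarrow> rt z = rsub (lf z) (diag z)"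
  by (simp add: p_right_def fn_simps[where w=w] arg_def)

lemma lf_pr [simp]: "m \<in> D w \<Longrightarrow> n \<in> D w \<Longrightarrow> lf (pr m n) = m"
  by (simp add: pr_eq[where w=w] lf_eq[where w=w] diag_pair[where w=w] rsub_add[where w=w])

lemma rt_pr [simp]: "m \<in> D w \<Longrightarrow> n \<in> D w \<Longrightarrow> rt (pr m n) = n"
  using lf_pr[of m w n]
  by (simp add: pr_eq[where w=w] rt_eq[where w=w] diag_pair[where w=w] rsub_add[where w=w])

section \<open>The order on numbers\<close>

definition Lt :: "'d \<Rightarrow> 'd \<Rightarrow> bool" where
  "Lt x y \<longleftrightarrow> rsub y (suc x) = zero"

lemma sat_lt [simp]: "sat w e (lt s t) \<longleftrightarrow> Lt (tval e s) (tval e t)"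
  by (simp add: lt_def Lt_def)

lemma definable_Lt:
  "fm_class C \<Longrightarrow> definable_tm w \<sigma> \<Longrightarrow> definable_tm w \<tau> \<Longrightarrow> definable C w (\<lambda>w e. Lt (\<sigma> e) (\<tau> e))"
  unfolding Lt_def by (rule definable_intros | assumption)+

lemma not_Lt_zero: "x \<in> D w \<Longrightarrow> \<not> Lt x zero"
  using suc_not_zero[of x w] by (simp add: Lt_def rsub_zero[where w=w])

lemma Lt_suc:
  assumes "x \<in> D w" "y \<in> D w"
  shows "Lt x (suc y) \<longleftrightarrow> Lt x y \<or> x = y"
proof -
  from le_refl assms(2)
  have "\<forall>v. w \<preceq> v \<longrightarrow> (\<forall>x\<in>D v. (rsub y x = zero \<longrightarrow> rsub y (suc x) = zero \<or> x = y) \<and>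
      (rsub y (suc x) = zero \<or> x = y \<longrightarrow> rsub y x = zero))"
  proof (induction rule: D_induct[where P="\<lambda>w y. \<forall>v. w \<preceq> v \<longrightarrow> (\<forall>x\<in>D v. (rsub y x = zero \<longrightarrow>
      rsub y (suc x) = zero \<or> x = y) \<and> (rsub y (suc x) = zero \<or> x = y \<longrightarrow> rsub y x = zero))"])
    case definable
    \<comment> \<open>The claim uses implications at a single world, whereas definable ones range
      over later worlds. Equations do not depend on the world, so the two forms agree.\<close>
    have "definable (\<lambda>_. True) w (\<lambda>w e. \<forall>v. w \<preceq> v \<longrightarrow> (\<forall>x\<in>D v.
      (\<forall>u. v \<preceq> u \<longrightarrow> rsub (e 0) x = zero \<longrightarrow> rsub (e 0) (suc x) = zero \<or> x = e 0) \<and>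
      (\<forall>u. v \<preceq> u \<longrightarrow> rsub (e 0) (suc x) = zero \<or> x = e 0 \<longrightarrow> rsub (e 0) x = zero)))"
      by (rule definable_intros)+
    then show ?case by (rule back_subst[of "definable _ _"]) (use le_refl in blast)
  next
    case zero
    show ?case by (auto simp: rsub_zero rsub_zero[OF fn_D_simps(2)] dest: suc_not_zero)
  next
    case (suc w\<^sub>1 y)
    show ?case
    proof (intro allI impI ballI)
      fix v x assume v: "w\<^sub>1 \<preceq> v" and x: "x \<in> D v"
      have y: "y \<in> D v" using D_mono[OF v suc(2)] .
      show "(rsub (suc y) x = zero \<longrightarrow> rsub (suc y) (suc x) = zero \<or> x = suc y) \<and>
        (rsub (suc y) (suc x) = zero \<or> x = suc y \<longrightarrow> rsub (suc y) x = zero)"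
      proof (cases rule: D_cases[OF x])
        case 1
        then show ?thesis using y by (auto simp: rsub_suc_suc[where w=v] rsub_of_zero[where w=v])
      next
        case (2 z)
        then show ?thesis using suc(3) v y
          by (simp add: rsub_suc_suc[where w=v] suc_inject[where w=v])
      qed
    qed
  qed
  then have "rsub y x = zero \<longleftrightarrow> rsub y (suc x) = zero \<or> x = y" using assms(1) le_refl by blast
  then show ?thesis using assms by (simp add: Lt_def rsub_suc_suc[where w=w])
qed

lemma Lt_suc_self: "x \<in> D w \<Longrightarrow> Lt x (suc x)"
  by (simp add: Lt_suc)

lemma not_Lt_self: "x \<in> D w \<Longrightarrow> \<not> Lt x x"
proof -
  assume x: "x \<in> D w"
  have "rsub x (suc x) = suc zero"
    using rsub_add[OF x, of "suc zero"] x by (simp add: add_suc_right[where w=w] add_zero_right[where w=w])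
  then show ?thesis by (simp add: Lt_def suc_not_zero[of _ w])
qed

lemma Lt_trans:
  assumes x: "x \<in> D w" and y: "y \<in> D w" and "z \<in> D w" and xy: "Lt x y" and yz: "Lt y z"
  shows "Lt x z"
proof -
  from le_refl assms(3) have "\<forall>v. w \<preceq> v \<longrightarrow> Lt y z \<longrightarrow> Lt x z"
  proof (induction rule: D_induct[where P="\<lambda>w z. \<forall>v. w \<preceq> v \<longrightarrow> Lt y z \<longrightarrow> Lt x z"])
    case definable
    show ?case by (rule definable_intros definable_Lt x y)+
  next
    case zero
    show ?case using not_Lt_zero y by blast
  next
    case (suc v z)
    then show ?case using xy D_mono[OF suc(1)] x y by (auto simp: Lt_suc[where w=v])
  qed
  then show ?thesis using yz by blast
qed

lemma Lt_suc_mono: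
  assumes x: "x \<in> D w" and y: "y \<in> D w"
  shows "Lt (suc x) (suc y) \<longleftrightarrow> Lt x y"
  using assms by (simp add: Lt_def rsub_suc_suc[where w=w])

lemma Lt_linear:
  assumes "x \<in> D w" "y \<in> D w"
  shows "Lt x y \<or> x = y \<or> Lt y x"
  using le_refl assms(1)
proof (induction rule: D_induct)
  case definable
  show ?case by (rule definable_intros definable_Lt assms(2))+
next
  case zero
  from le_refl assms(2) have "zero = y \<or> Lt zero y"
  proof (induction rule: D_induct)
    case definable
    show ?case by (rule definable_intros definable_Lt)+
  next
    case (suc u y)
    then show ?case using Lt_suc[of zero u y] by auto
  qed simp
  then show ?case by auto
next
  case (suc v x)
  have y: "y \<in> D v" using D_mono[OF suc(1) assms(2)] .
  show ?case
  proof (cases rule: D_cases[OF y])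
    case 1
    from le_refl suc(2) have "Lt zero (suc x)"
    proof (induction rule: D_induct)
      case definable
      show ?case by (rule definable_intros definable_Lt)+
    next
      case (suc u x)
      then show ?case by (simp add: Lt_suc[where w=u])
    qed (simp add: Lt_suc_self[where w=v])
    then show ?thesis using 1 by simp
  next
    case (2 z)
    show ?thesis using suc(3)
    proof (elim disjE)
      assume "Lt x y"
      then have "Lt (suc x) (suc y)" using suc(2) y by (simp add: Lt_suc_mono[where w=v])
      then show ?thesis using suc(2) y by (auto simp: Lt_suc[where w=v])
    next
      assume "x = y"
      then show ?thesis using suc(2) by (simp add: Lt_suc_self)
    next
      assume "Lt y x"
      then show ?thesis using suc(2) y by (simp add: Lt_suc[where w=v])
    qed
  qed
qed

end

section \<open>Kleene application in a model\<close>

context kripke_model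
begin

primrec num :: "nat \<Rightarrow> 'd" where
  "num 0 = zero"
| "num (Suc n) = suc (num n)"

lemma num_D [simp]: "num n \<in> D w"
  by (induction n) simp_all

lemma num_eq_iff [simp]: "num m = num n \<longleftrightarrow> m = n"
proof (induction m arbitrary: n)
  case 0
  then show ?case using not_sym[OF suc_not_zero[where w=undefined, OF num_D]] by (cases n) auto
next
  case (Suc m)
  then show ?case
    using suc_not_zero[where w=undefined, OF num_D] suc_inject[where w=undefined, OF num_D num_D] by (cases n) auto
qed

lemma tval_numt [simp]: "tval e (numt n) = num n"
  by (induction n) simp_all

abbreviation nd :: "'d \<Rightarrow> 'd \<Rightarrow> 'd" where "nd s i \<equiv> fn p_nth [i, s]"
abbreviation ix :: "'d \<Rightarrow> 'd" where "ix c \<equiv> lf c"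
abbreviation ar :: "'d \<Rightarrow> 'd" where "ar c \<equiv> lf (rt c)"
abbreviation vl :: "'d \<Rightarrow> 'd" where "vl c \<equiv> rt (rt c)"

definition Initial :: "'d \<Rightarrow> bool" where
  "Initial c \<longleftrightarrow> lf (ix c) = num 0 \<and> vl c = zero \<or> lf (ix c) = num 1 \<and> vl c = suc (ar c) \<or>
     lf (ix c) = num 2 \<and> vl c = lf (ar c) \<or> lf (ix c) = num 3 \<and> vl c = rt (ar c)"

definition Compound :: "'d \<Rightarrow> 'd \<Rightarrow> 'd \<Rightarrow> bool" where
  "Compound c p q \<longleftrightarrow>
     (let e = ix c; n = ar c; k = vl c; d = rt e; a = lf d; b = rt d;
          m = pr (lf n) (fn p_pred [rt n]) in
      lf e = num 4 \<and> (ix p = a \<and> ar p = n) \<and> (ix q = b \<and> ar q = n) \<and> k = pr (vl p) (vl q) \<or>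
      lf e = num 5 \<and> (ix p = b \<and> ar p = n) \<and> (ix q = a \<and> ar q = vl p) \<and> k = vl q \<or>
      lf e = num 6 \<and> rt n = zero \<and> (ix p = a \<and> ar p = lf n) \<and> k = vl p \<or>
      lf e = num 6 \<and> rt n \<noteq> zero \<and> (ix p = e \<and> ar p = m) \<and> (ix q = b \<and> ar q = pr m (vl p)) \<and> k = vl q \<or>
      lf e = num 7 \<and> (ix p = d \<and> ar p = n) \<and> vl p = zero \<and> k = rt n \<or>
      lf e = num 7 \<and> (ix p = d \<and> ar p = n) \<and> vl p \<noteq> zero \<and> (ix q = e \<and> ar q = pr (lf n) (suc (rt n))) \<and> k = vl q)"

lemma sat_initial_step: "sat w e (initial_step t) \<longleftrightarrow> Initial (tval e t)"
  by (simp add: initial_step_def Initial_def has_tag_def node_idx_def node_arg_def node_val_def Let_def)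

text \<open>Equality is rigid, so its negation at a world is plain inequality. This is why
  \<open>Initial\<close> and \<open>Compound\<close> carry no world.\<close>

lemma sat_Neg_Equal: "sat w e (Neg (Equal s t)) \<longleftrightarrow> tval e s \<noteq> tval e t"
  using le_refl by (auto simp: Neg_def)

lemma sat_compound_step:
  "sat w e (compound_step c p q) \<longleftrightarrow> Compound (tval e c) (tval e p) (tval e q)"
  by (simp add: compound_step_def Compound_def has_tag_def evaluates_def sat_Neg_Equal predt_def
      node_idx_def node_arg_def node_val_def Let_def)

definition Step :: "'w \<Rightarrow> 'd \<Rightarrow> 'd \<Rightarrow> bool" where
  "Step w s i \<longleftrightarrow> Initial (nd s i) \<or>
     (\<exists>p\<in>D w. Lt p i \<and> (\<exists>q\<in>D w. Lt q i \<and> Compound (nd s i) (nd s p) (nd s q)))"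

lemma sat_computation_step: "sat w e (computation_step s i) \<longleftrightarrow> Step w (tval e s) (tval e i)"
  by (simp add: computation_step_def Step_def BExists_def sat_initial_step sat_compound_step tval_lift ntht_def)

lemma App_iff:
  "App w a n k \<longleftrightarrow> (\<exists>z\<in>D w. (\<forall>v. w \<preceq> v \<longrightarrow> (\<forall>i\<in>D v. Lt i (suc (lf z)) \<longrightarrow> Step v (rt z) i)) \<and>
     nd (rt z) (lf z) = pr a (pr n k))"
  by (simp add: App_def app_def BForall_def sat_computation_step ntht_def numeral_eq_Suc)

lemma Initial_det:
  "Initial c \<Longrightarrow> Initial c' \<Longrightarrow> ix c = ix c' \<Longrightarrow> ar c = ar c' \<Longrightarrow> vl c = vl c'"
  by (auto simp: Initial_def simp del: num.simps)

lemma Initial_Compound_disjoint: "Initial c \<Longrightarrow> Compound c' p q \<Longrightarrow> ix c = ix c' \<Longrightarrow> False"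
  by (auto simp: Initial_def Compound_def Let_def simp del: num.simps)

lemma Compound_det:
  assumes "Compound c p q" "Compound c' p' q'" "ix c = ix c'" "ar c = ar c'"
    and "ix p = ix p' \<Longrightarrow> ar p = ar p' \<Longrightarrow> vl p = vl p'"
    and "ix q = ix q' \<Longrightarrow> ar q = ar q' \<Longrightarrow> vl q = vl q'"
  shows "vl c = vl c'"
  using assms unfolding Compound_def Let_def by (elim disjE) (simp_all del: num.simps)

text \<open>Course-of-values induction along the first computation, against all nodes of the second:
  nodes with equal index and argument have equal value. The premises of a node precede it, so the
  induction hypothesis covers them.\<close>

lemma App_det:
  assumes "a \<in> D w" "n \<in> D w" "k \<in> D w" "k' \<in> D w" and "App w a n k" "App w a n k'"
  shows "k = k'"
proof -
  obtain z where z: "z \<in> D w" "\<forall>v. w \<preceq> v \<longrightarrow> (\<forall>i\<in>D v. Lt i (suc (lf z)) \<longrightarrow> Step v (rt z) i)"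
    "nd (rt z) (lf z) = pr a (pr n k)" using assms(5) by (auto simp: App_iff)
  obtain z' where z': "z' \<in> D w" "\<forall>v. w \<preceq> v \<longrightarrow> (\<forall>i\<in>D v. Lt i (suc (lf z')) \<longrightarrow> Step v (rt z') i)"
    "nd (rt z') (lf z') = pr a (pr n k')" using assms(6) by (auto simp: App_iff)
  let ?s = "rt z" and ?l = "lf z" and ?s' = "rt z'" and ?l' = "lf z'"
  have "suc ?l \<in> D w" using z(1) by simp
  from le_refl this
  \<comment> \<open>The first bound is the instance \<open>suc ?l\<close> of the induction variable
    \<open>N\<close>; the second stays fixed during the induction. Hence the repeated
    conjunct.\<close>
  have "\<forall>v. w \<preceq> v \<longrightarrow> (\<forall>i\<in>D v. \<forall>j\<in>D v. Lt i (suc ?l) \<and> Lt i (suc ?l) \<and> Lt j (suc ?l') \<and>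
      ix (nd ?s i) = ix (nd ?s' j) \<and> ar (nd ?s i) = ar (nd ?s' j) \<longrightarrow> vl (nd ?s i) = vl (nd ?s' j))"
  proof (induction rule: D_induct[where P="\<lambda>w N. \<forall>v. w \<preceq> v \<longrightarrow> (\<forall>i\<in>D v. \<forall>j\<in>D v.
      Lt i N \<and> Lt i (suc ?l) \<and> Lt j (suc ?l') \<and> ix (nd ?s i) = ix (nd ?s' j) \<and> ar (nd ?s i) = ar (nd ?s' j) \<longrightarrow>
      vl (nd ?s i) = vl (nd ?s' j))"])
    case definable
    show ?case by (rule definable_intros definable_Lt z(1) z'(1))+
  next
    case zero
    show ?case using not_Lt_zero by blast
  next
    case (suc u N)
    show ?case
    proof (intro allI impI ballI, elim conjE)
      fix v i j
      assume v: "u \<preceq> v" and ij: "i \<in> D v" "j \<in> D v" "Lt i (suc N)" "Lt i (suc ?l)" "Lt j (suc ?l')"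
        and eq: "ix (nd ?s i) = ix (nd ?s' j)" "ar (nd ?s i) = ar (nd ?s' j)"
      have wv: "w \<preceq> v" using le_trans[OF suc(1) v] .
      have N: "N \<in> D v" using D_mono[OF v suc(2)] .
      have l: "suc ?l \<in> D v" "suc ?l' \<in> D v" using D_mono[OF wv] z(1) z'(1) by auto
      have IH: "vl (nd ?s p) = vl (nd ?s' p')"
        if "p \<in> D v" "p' \<in> D v" "Lt p N" "Lt p (suc ?l)" "Lt p' (suc ?l')"
          "ix (nd ?s p) = ix (nd ?s' p')" "ar (nd ?s p) = ar (nd ?s' p')" for p p'
        using suc(3) v that by blast
      show "vl (nd ?s i) = vl (nd ?s' j)"
      proof (cases "Lt i N")
        case True
        then show ?thesis using IH ij eq by blast
      next
        case False
        then have i: "i = N" using ij Lt_suc[OF ij(1) N] by blast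
        have st: "Step v ?s i" using z(2) wv ij by blast
        have st': "Step v ?s' j" using z'(2) wv ij by blast
        show ?thesis
        proof (cases "Initial (nd ?s i)")
          case True
          then have "Initial (nd ?s' j)"
            using st' Initial_Compound_disjoint eq(1) unfolding Step_def by blast
          then show ?thesis using Initial_det True eq by blast
        next
          case False
          then obtain p q where pq: "p \<in> D v" "q \<in> D v" "Lt p i" "Lt q i" "Compound (nd ?s i) (nd ?s p) (nd ?s q)"
            using st unfolding Step_def by blast
          then have "\<not> Initial (nd ?s' j)" using Initial_Compound_disjoint eq(1) by metis
          then obtain p' q' where pq': "p' \<in> D v" "q' \<in> D v" "Lt p' j" "Lt q' j"
            "Compound (nd ?s' j) (nd ?s' p') (nd ?s' q')"
            using st' unfolding Step_def by blast
          have "Lt p (suc ?l)" "Lt q (suc ?l)" "Lt p' (suc ?l')" "Lt q' (suc ?l')"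
            using Lt_trans[OF _ ij(1) l(1) _ ij(4)] Lt_trans[OF _ ij(2) l(2) _ ij(5)] pq pq' by blast+
          then show ?thesis
            using Compound_det[OF pq(5) pq'(5) eq] IH pq pq' i by blast
        qed
      qed
    qed
  qed
  from this[rule_format, OF le_refl, of ?l ?l'] have "vl (nd ?s ?l) = vl (nd ?s' ?l')"
    using z(1) z'(1) assms(1-4) unfolding z(3) z'(3)
    by (simp add: Lt_suc_self[where w=w] lf_pr[where w=w] rt_pr[where w=w])
  then show ?thesis using z(3) z'(3) assms by (simp add: rt_pr[where w=w])
qed

text \<open>The clauses use the tags 0 to 7, so with tag 8 the last node of a computation has no
  justification.\<close>

lemma App_nowhere_defined:
  assumes "n \<in> D w" "k \<in> D w"
  shows "\<not> App w (pr (num 8) zero) n k"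
proof
  assume "App w (pr (num 8) zero) n k"
  then obtain z where z: "z \<in> D w" "\<forall>v. w \<preceq> v \<longrightarrow> (\<forall>i\<in>D v. Lt i (suc (lf z)) \<longrightarrow> Step v (rt z) i)"
    "nd (rt z) (lf z) = pr (pr (num 8) zero) (pr n k)" by (auto simp: App_iff)
  then have "Step w (rt z) (lf z)" using Lt_suc_self[of "lf z" w] le_refl by simp
  moreover have "lf (ix (nd (rt z) (lf z))) = num 8"
    using z(3) assms by (simp add: lf_pr[where w=w] del: num.simps)
  ultimately show False
    by (auto simp: Step_def Initial_def Compound_def Let_def simp del: num.simps)
qed

end

section \<open>Conditions and v-sets in a model\<close>

context kripke_model
begin

lemma definable_later:
  assumes "definable C w P" "w \<preceq> v"
  shows "definable C v P"
  using assms D_mono[OF assms(2)] le_trans[OF assms(2)] unfolding definable_def by blast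

lemma definable_inst2:
  assumes "definable (\<lambda>_. True) w\<^sub>0 (\<lambda>w e. B w (e (Suc 0)) (e 0))" "definable_tm w\<^sub>0 \<sigma>" "definable_tm w\<^sub>0 \<tau>"
  shows "definable (\<lambda>_. True) w\<^sub>0 (\<lambda>w e. B w (\<sigma> e) (\<tau> e))"
proof -
  obtain s t \<rho> where st: "\<forall>i. \<rho> i \<in> D w\<^sub>0" "\<forall>e. \<sigma> e = tval (mix e \<rho>) s" "\<forall>e. \<tau> e = tval (mix e \<rho>) t"
    using definable_tm_pair[OF assms(2,3)] .
  obtain \<phi> \<rho>' where \<phi>: "\<forall>i. \<rho>' i \<in> D w\<^sub>0"
    "\<forall>w x y. w\<^sub>0 \<preceq> w \<longrightarrow> x \<in> D w \<longrightarrow> y \<in> D w \<longrightarrow> B w x y = sat w (case_nat y (case_nat x \<rho>')) \<phi>"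
    using definable2[where P=B, OF fm_class_any assms(1)] .
  let ?l = "\<lambda>i. Var (if even i then i else 4 * (i div 2) + 1)"
  \<comment> \<open>\<open>?l\<close> moves the parameters of the two terms into the merged list,
    where the parameters of \<open>\<phi>\<close> sit at the positions 4i + 3.\<close>
  let ?\<theta> = "case_nat (sub_tm ?l t) (case_nat (sub_tm ?l s) (\<lambda>i. Var (4 * i + 3)))"
  have l: "tval (mix e \<rho>) r = tval (mix e (mix \<rho> \<rho>')) (sub_tm ?l r)" for e r
    by (simp only: tval_sub mix_left[symmetric])
  have r: "(\<lambda>i. mix e (mix \<rho> \<rho>') (4 * i + 3)) = \<rho>'" for e
  proof
    fix i
    have "(4 * i + 3) div 2 = 2 * i + (1::nat)" by simp
    then show "mix e (mix \<rho> \<rho>') (4 * i + 3) = \<rho>' i" by (simp add: mix_def)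
  qed
  have "B w (\<sigma> e) (\<tau> e) = sat w (mix e (mix \<rho> \<rho>')) (sub ?\<theta> \<phi>)" if "w\<^sub>0 \<preceq> w" "\<forall>i. e i \<in> D w" for w e
  proof -
    have "mix e \<rho> i \<in> D w" for i using that st(1) D_mono by (intro mix_D) auto
    then have "\<sigma> e \<in> D w" "\<tau> e \<in> D w" using st tval_D by auto
    then have "B w (\<sigma> e) (\<tau> e) = sat w (case_nat (\<tau> e) (case_nat (\<sigma> e) \<rho>')) \<phi>" using \<phi>(2) that(1) by blast
    also have "\<dots> = sat w (mix e (mix \<rho> \<rho>')) (sub ?\<theta> \<phi>)"
      by (simp only: sat_sub tval_case_nat l[symmetric] tval.simps(1) r st(2,3)[rule_format])
    finally show ?thesis .
  qed
  then show ?thesis unfolding definable_def using mix_D[of \<rho> w\<^sub>0 \<rho>'] st(1) \<phi>(1)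
    by (intro exI[of _ "sub ?\<theta> \<phi>"] exI[of _ "mix \<rho> \<rho>'"]) auto
qed

lemma CT:
  assumes "definable (\<lambda>_. True) w (\<lambda>w e. Q w (e (Suc 0)) (e 0))"
    and "\<And>v n. w \<preceq> v \<Longrightarrow> n \<in> D v \<Longrightarrow> \<exists>m\<in>D v. Q v n m"
  shows "\<exists>a\<in>D w. \<forall>v n. w \<preceq> v \<longrightarrow> n \<in> D v \<longrightarrow> (\<exists>k\<in>D v. App v a n k \<and> Q v n k)"
proof -
  \<comment> \<open>Church's thesis on all numbers is the extended version with a trivially true
    equation as domain.\<close>
  have "\<exists>a\<in>D w. \<forall>v n. w \<preceq> v \<longrightarrow> n \<in> D v \<longrightarrow> zero = zero \<longrightarrow> (\<exists>k\<in>D v. App v a n k \<and> Q v n k)"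
    by (rule ECT[where P="\<lambda>_ _. zero = zero"], (rule definable_intros)+) (use assms in blast)+
  then show ?thesis by simp
qed

section \<open>Conditions with prescribed truth\<close>

text \<open>The equivalence is split into two implications over later worlds, the shape recognised
  by \<open>definable_all_imp\<close> and its relatives.\<close>

definition Rep :: "'w \<Rightarrow> 'd \<Rightarrow> ('w \<Rightarrow> bool) \<Rightarrow> bool" where
  "Rep w c Q \<longleftrightarrow> isM w c \<and> (\<forall>v. w \<preceq> v \<longrightarrow> isT v c \<longrightarrow> Q v) \<and> (\<forall>v. w \<preceq> v \<longrightarrow> Q v \<longrightarrow> isT v c)"

text \<open>With a nowhere defined index on both sides, the premises of \<open>X2\<close> and the
  truth condition of \<open>X1\<close> are vacuous.\<close>

lemma ex_true: "\<exists>c\<in>D w. isM w c \<and> isT w c"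
proof -
  let ?e = "pr (num 8) zero"
  have e: "?e \<in> D w" by simp
  have M: "isM w (xi ?e ?e)"
    by (rule isM_xi[OF e e]) (use App_nowhere_defined in blast)+
  moreover have "isT w (xi ?e ?e)"
    unfolding isT_xi[OF e e M] using App_nowhere_defined by blast
  ultimately show ?thesis using e by (intro bexI[of _ "xi ?e ?e"]) auto
qed

text \<open>An implication from a constantly true condition to a nowhere defined one: its premise
  holds at every input and its conclusion never exists.\<close>

lemma ex_false: "\<exists>c\<in>D w. isM w c \<and> (\<forall>v. w \<preceq> v \<longrightarrow> \<not> isT v c)"
proof -
  obtain t where t: "t \<in> D w" "isM w t" "isT w t" using ex_true by blast
  let ?e = "pr (num 8) zero"
  have e: "?e \<in> D v" for v by simp
  have "\<exists>f\<in>D w. \<forall>v n. w \<preceq> v \<longrightarrow> n \<in> D v \<longrightarrow> (\<exists>k\<in>D v. App v f n k \<and> k = t)"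
  proof (rule CT)
    show "definable (\<lambda>_. True) w (\<lambda>w e. e 0 = t)" by (rule definable_intros t(1))+
  qed (use D_mono t(1) in blast)
  then obtain f where f: "f \<in> D w" "\<And>v n. w \<preceq> v \<Longrightarrow> n \<in> D v \<Longrightarrow> App v f n t" by blast
  have M: "isM w (xi f ?e)"
  proof (rule isM_xi[OF f(1) e])
    show "isM v k" if "w \<preceq> v" "n \<in> D v" "k \<in> D v" "App v f n k" for v n k
      using App_det[OF D_mono[OF that(1) f(1)] that(2,3) D_mono[OF that(1) t(1)] that(4) f(2)[OF that(1,2)]]
        isM_mono[OF that(1) t(2)] by simp
  qed (use App_nowhere_defined in blast)
  moreover have "\<not> isT v (xi f ?e)" if v: "w \<preceq> v" for v
  proof
    assume "isT v (xi f ?e)"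
    then have "(\<exists>k\<in>D v. App v f zero k \<and> isT v k) \<longrightarrow> (\<exists>k\<in>D v. App v ?e zero k \<and> isT v k)"
      using isT_xi[OF D_mono[OF v f(1)] e isM_mono[OF v M]] le_refl fn_D_simps(1) by blast
    then show False
      using App_nowhere_defined[of zero v] f(2)[OF v, of zero] D_mono[OF v t(1)] isT_mono[OF v t(3)] by auto
  qed
  ultimately show ?thesis using f(1) e by (intro bexI[of _ "xi f ?e"]) auto
qed

text \<open>A conjunction whose second half need only have a condition once the first half is true.
  It is coded as two implications in one \<open>Xi\<close>: at input 0 "true implies c", at every
  other input "c implies Q".\<close>

lemma ex_cond_and:
  assumes c: "c \<in> D w" "isM w c"
    and def: "definable (\<lambda>_. True) w (\<lambda>w e. Q w)"
    and mono: "\<And>u v. w \<preceq> u \<Longrightarrow> u \<preceq> v \<Longrightarrow> Q u \<Longrightarrow> Q v"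
    and Q: "\<And>v. w \<preceq> v \<Longrightarrow> isT v c \<Longrightarrow> \<exists>d\<in>D v. Rep v d Q"
  shows "\<exists>d\<in>D w. Rep w d (\<lambda>v. isT v c \<and> Q v)"
proof -
  obtain t where t: "t \<in> D w" "isM w t" "isT w t" using ex_true by blast
  have cv: "c \<in> D v" "t \<in> D v" "isM v c" "isM v t" "isT v t" if "w \<preceq> v" for v
    using that c t D_mono isM_mono isT_mono by blast+
  \<comment> \<open>\<open>f\<close> lists the premises: a true condition at 0 and \<open>c\<close>
    elsewhere. Inequality is written as an implication over later worlds to stay definable.\<close>
  have "\<exists>f\<in>D w. \<forall>v n. w \<preceq> v \<longrightarrow> n \<in> D v \<longrightarrow> (\<exists>k\<in>D v. App v f n k \<and>
      (n = zero \<and> k = t \<or> (\<forall>u. v \<preceq> u \<longrightarrow> n = zero \<longrightarrow> False) \<and> k = c))"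
  proof (rule CT)
    show "definable (\<lambda>_. True) w (\<lambda>w e. e (Suc 0) = zero \<and> e 0 = t \<or>
        (\<forall>u. w \<preceq> u \<longrightarrow> e (Suc 0) = zero \<longrightarrow> False) \<and> e 0 = c)"
      by (rule definable_intros t(1) c(1))+
  qed (use cv in blast)
  then obtain f where f: "f \<in> D w" and fex: "\<And>v n. w \<preceq> v \<Longrightarrow> n \<in> D v \<Longrightarrow>
      \<exists>k\<in>D v. App v f n k \<and> (n = zero \<and> k = t \<or> n \<noteq> zero \<and> k = c)" by fast
  have fv: "n = zero \<and> k = t \<or> n \<noteq> zero \<and> k = c" if "w \<preceq> v" "n \<in> D v" "k \<in> D v" "App v f n k" for v n k
    using fex[OF that(1,2)] App_det[OF D_mono[OF that(1) f] that(2,3) _ that(4)] by blast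
  have fT: "\<forall>u. v \<preceq> u \<longrightarrow> (\<forall>k\<in>D u. App u f n k \<longrightarrow> isT u k)" if "w \<preceq> v" "n \<in> D v" "n \<noteq> zero \<Longrightarrow> isT v c" for v n
  proof (intro allI impI ballI)
    fix u k assume u: "v \<preceq> u" "k \<in> D u" "App u f n k"
    then show "isT u k"
      using fv[OF le_trans[OF that(1) u(1)] D_mono[OF u(1) that(2)] u(2,3)] isT_mono[OF u(1)] that(3)
        cv(5)[OF le_trans[OF that(1) u(1)]] by blast
  qed
  \<comment> \<open>\<open>g\<close> lists the conclusions. A condition for \<open>Q\<close> exists
    only when \<open>c\<close> is true, so \<open>g\<close> is chosen where \<open>f n\<close> is
    true, stated through all values of \<open>f n\<close> to be almost negative.\<close>
  have "\<exists>g\<in>D w. \<forall>v n. w \<preceq> v \<longrightarrow> n \<in> D v \<longrightarrow> (\<forall>u. v \<preceq> u \<longrightarrow> (\<forall>k\<in>D u. App u f n k \<longrightarrow> isT u k)) \<longrightarrow>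
      (\<exists>k\<in>D v. App v g n k \<and> (n = zero \<and> k = c \<or> (\<forall>u. v \<preceq> u \<longrightarrow> n = zero \<longrightarrow> False) \<and> Rep v k Q))"
  proof (rule ECT)
    show "definable almost_negative w (\<lambda>w e. \<forall>u. w \<preceq> u \<longrightarrow> (\<forall>k\<in>D u. App u f (e 0) k \<longrightarrow> isT u k))"
      by (rule definable_intros f)+
    show "definable (\<lambda>_. True) w (\<lambda>w e. e (Suc 0) = zero \<and> e 0 = c \<or>
        (\<forall>u. w \<preceq> u \<longrightarrow> e (Suc 0) = zero \<longrightarrow> False) \<and> Rep w (e 0) Q)"
      unfolding Rep_def by (rule definable_intros def c(1))+
    show "\<exists>m\<in>D v. n = zero \<and> m = c \<or> (\<forall>u. v \<preceq> u \<longrightarrow> n = zero \<longrightarrow> False) \<and> Rep v m Q"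
      if v: "w \<preceq> v" "n \<in> D v" "\<forall>u. v \<preceq> u \<longrightarrow> (\<forall>k\<in>D u. App u f n k \<longrightarrow> isT u k)" for v n
    proof (cases "n = zero")
      case True
      then show ?thesis using cv(1)[OF v(1)] by blast
    next
      case False
      then have "isT v c" using fex[OF v(1,2)] v(3) le_refl by blast
      then show ?thesis using Q[OF v(1)] False by blast
    qed
  qed
  then obtain g where g: "g \<in> D w" and gex: "\<And>v n. w \<preceq> v \<Longrightarrow> n \<in> D v \<Longrightarrow>
      (\<forall>u. v \<preceq> u \<longrightarrow> (\<forall>k\<in>D u. App u f n k \<longrightarrow> isT u k)) \<Longrightarrow>
      \<exists>k\<in>D v. App v g n k \<and> (n = zero \<and> k = c \<or> n \<noteq> zero \<and> Rep v k Q)" by fast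
  have gv: "n = zero \<and> l = c \<or> n \<noteq> zero \<and> Rep v l Q"
    if "w \<preceq> v" "n \<in> D v" "l \<in> D v" "App v g n l" "n \<noteq> zero \<Longrightarrow> isT v c" for v n l
    using gex[OF that(1,2) fT[OF that(1,2,5)]] App_det[OF D_mono[OF that(1) g] that(2,3) _ that(4)] by blast
  have M: "isM w (xi f g)"
  proof (rule isM_xi[OF f g])
    show "isM v k" if "w \<preceq> v" "n \<in> D v" "k \<in> D v" "App v f n k" for v n k
      using fv[OF that] cv[OF that(1)] by blast
    show "isM v l" if v: "w \<preceq> v" "n \<in> D v" "k \<in> D v" "l \<in> D v" "App v f n k" "App v g n l" "isT v k" for v n k l
    proof -
      have "n \<noteq> zero \<Longrightarrow> isT v c" using fv[OF v(1-3,5)] v(7) by blast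
      from gv[OF v(1,2,4,6) this] show ?thesis using cv[OF v(1)] by (auto simp: Rep_def)
    qed
  qed
  have T: "isT v (xi f g) \<longleftrightarrow> isT v c \<and> Q v" if v: "w \<preceq> v" for v
  proof -
    have iff: "isT v (xi f g) \<longleftrightarrow> (\<forall>u. v \<preceq> u \<longrightarrow> (\<forall>n\<in>D u.
        (\<exists>k\<in>D u. App u f n k \<and> isT u k) \<longrightarrow> (\<exists>k\<in>D u. App u g n k \<and> isT u k)))"
      by (rule isT_xi[OF D_mono[OF v f] D_mono[OF v g] isM_mono[OF v M]])
    show ?thesis
    proof
      assume "isT v (xi f g)"
      then have *: "(\<exists>k\<in>D v. App v f n k \<and> isT v k) \<Longrightarrow> (\<exists>k\<in>D v. App v g n k \<and> isT v k)" if "n \<in> D v" for n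
        using iff that le_refl by blast
      have "\<exists>k\<in>D v. App v f zero k \<and> isT v k" using fex[OF v, of zero] cv[OF v] by auto
      then obtain l where "l \<in> D v" "App v g zero l" "isT v l" using *[of zero] by auto
      then have Tc: "isT v c" using gv[OF v, of zero l] by auto
      \<comment> \<open>Input 0 has yielded \<open>c\<close>, which is the premise at any nonzero
        input; 1 is the one used.\<close>
      let ?o = "suc zero"
      have o: "?o \<in> D v" "?o \<noteq> zero" using suc_not_zero[of zero v] by auto
      have "\<exists>k\<in>D v. App v f ?o k \<and> isT v k" using fex[OF v o(1)] o(2) Tc by blast
      then obtain l where "l \<in> D v" "App v g ?o l" "isT v l" using *[OF o(1)] by auto
      then have "Q v" using gv[OF v o(1), of l] o(2) Tc by (auto simp: Rep_def)
      then show "isT v c \<and> Q v" using Tc by simp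
    next
      assume TQ: "isT v c \<and> Q v"
      show "isT v (xi f g)" unfolding iff
      proof (intro allI impI ballI)
        fix u n assume u: "v \<preceq> u" "n \<in> D u"
        have wu: "w \<preceq> u" using le_trans[OF v u(1)] .
        have Tc: "isT u c" "Q u" using TQ isT_mono[OF u(1)] mono[OF v u(1)] by auto
        then obtain l where "l \<in> D u" "App u g n l" "n = zero \<and> l = c \<or> n \<noteq> zero \<and> Rep u l Q"
          using gex[OF wu u(2) fT[OF wu u(2)]] by blast
        then show "\<exists>k\<in>D u. App u g n k \<and> isT u k" using Tc by (auto simp: Rep_def)
      qed
    qed
  qed
  show ?thesis using M T f g by (intro bexI[of _ "xi f g"]) (auto simp: Rep_def)
qed

section \<open>Inversion, elements and construction of v-sets\<close>

text \<open>Inversion of the closure axiom: induction on v-sets applied to the property stated here,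
  which implies being a v-set by one application of \<open>isV_I\<close>.\<close>

lemma isV_step:
  assumes "x \<in> D w" "isV w x"
  shows "\<forall>v. w \<preceq> v \<longrightarrow> (\<forall>n\<in>D v. \<exists>k\<in>D v. App v x n k \<and> isM v (rt k) \<and>
    (\<forall>u. v \<preceq> u \<longrightarrow> isT u (rt k) \<longrightarrow> isV u (lf k)))"
  using le_refl assms
proof (induction rule: isV_induct)
  case definable
  show ?case by (rule definable_intros)+
next
  case (step w\<^sub>1 x)
  show ?case
  proof (intro allI impI ballI)
    fix v n assume v: "w\<^sub>1 \<preceq> v" "n \<in> D v"
    from step(3)[OF this] obtain k where k: "k \<in> D v" "App v x n k" "isM v (rt k)"
      "\<forall>u. v \<preceq> u \<longrightarrow> isT u (rt k) \<longrightarrow> (\<forall>v. u \<preceq> v \<longrightarrow> (\<forall>n\<in>D v. \<exists>k'\<in>D v. App v (lf k) n k' \<and>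
        isM v (rt k') \<and> (\<forall>u. v \<preceq> u \<longrightarrow> isT u (rt k') \<longrightarrow> isV u (lf k'))))" by blast
    have "isV u (lf k)" if u: "v \<preceq> u" "isT u (rt k)" for u
      by (rule isV_I) (use D_mono[OF u(1) k(1)] k(4) u in auto)
    then show "\<exists>k\<in>D v. App v x n k \<and> isM v (rt k) \<and> (\<forall>u. v \<preceq> u \<longrightarrow> isT u (rt k) \<longrightarrow> isV u (lf k))"
      using k by blast
  qed
qed

lemma isV_total:
  assumes "x \<in> D w" "isV w x" "n \<in> D w"
  obtains k where "k \<in> D w" "App w x n k" "isM w (rt k)"
  using isV_step[OF assms(1,2)] assms(3) le_refl by blast

lemma isV_val:
  assumes "x \<in> D w" "isV w x" "n \<in> D w" "k \<in> D w" "App w x n k"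
  shows "isM w (rt k)" "isT w (rt k) \<Longrightarrow> isV w (lf k)"
proof -
  obtain l where l: "l \<in> D w" "App w x n l" "isM w (rt l)" "\<forall>u. w \<preceq> u \<longrightarrow> isT u (rt l) \<longrightarrow> isV u (lf l)"
    using isV_step[OF assms(1,2)] assms(3) le_refl by blast
  then have "k = l" using App_det assms by blast
  then show "isM w (rt k)" "isT w (rt k) \<Longrightarrow> isV w (lf k)" using l by auto
qed

definition EL :: "'w \<Rightarrow> 'd \<Rightarrow> 'd \<Rightarrow> bool" where
  "EL w a x \<longleftrightarrow> (\<exists>n\<in>D w. \<exists>k\<in>D w. App w x n k \<and> isT w (rt k) \<and> a = lf k)"

lemma sat_in_EL [simp]: "sat w e (in_EL s t) \<longleftrightarrow> EL w (tval e s) (tval e t)"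
  by (simp add: in_EL_def EL_def tval_sub numeral_eq_Suc)

lemma EL_mono: "v \<preceq> w \<Longrightarrow> EL v a x \<Longrightarrow> EL w a x"
  unfolding EL_def using D_mono App_mono isT_mono by blast

lemma EL_D: "EL w a x \<Longrightarrow> a \<in> D w"
  unfolding EL_def by auto

lemma EL_isV: "x \<in> D w \<Longrightarrow> isV w x \<Longrightarrow> EL w a x \<Longrightarrow> isV w a"
  unfolding EL_def using isV_val by blast

lemma definable_sat2:
  assumes "definable_tm w\<^sub>0 \<sigma>" "definable_tm w\<^sub>0 \<tau>"
  shows "definable (\<lambda>_. True) w\<^sub>0 (\<lambda>w e. sat w (case_nat (\<sigma> e) (\<lambda>_. \<tau> e)) \<phi>)"
proof -
  obtain s t \<rho> where *: "\<forall>i. \<rho> i \<in> D w\<^sub>0" "\<forall>e. \<sigma> e = tval (mix e \<rho>) s" "\<forall>e. \<tau> e = tval (mix e \<rho>) t"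
    using definable_tm_pair[OF assms] .
  show ?thesis unfolding definable_def
    using * by (intro exI[of _ "sub (case_nat s (\<lambda>_. t)) \<phi>"] exI[of _ \<rho>]) (simp add: sat_sub)
qed

lemma definable_EL:
  assumes "definable_tm w\<^sub>0 \<sigma>" "definable_tm w\<^sub>0 \<tau>"
  shows "definable (\<lambda>_. True) w\<^sub>0 (\<lambda>w e. EL w (\<sigma> e) (\<tau> e))"
  using definable_sat2[OF assms, of "in_EL (Var 0) (Var 1)"] by simp

text \<open>Church's thesis turns the total relation into an index and \<open>V1\<close> turns the
  index into a v-set; single-valuedness extends \<open>R\<close> to every value of it.\<close>

lemma ex_vset:
  assumes "definable (\<lambda>_. True) w (\<lambda>w e. R w (e (Suc 0)) (e 0))"
    and "\<And>v n. w \<preceq> v \<Longrightarrow> n \<in> D v \<Longrightarrow> \<exists>k\<in>D v. R v n k"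
    and "\<And>v n k. w \<preceq> v \<Longrightarrow> n \<in> D v \<Longrightarrow> k \<in> D v \<Longrightarrow> R v n k \<Longrightarrow>
      isM v (rt k) \<and> (\<forall>u. v \<preceq> u \<longrightarrow> isT u (rt k) \<longrightarrow> isV u (lf k))"
  obtains x where "x \<in> D w" "isV w x" "\<And>v n. w \<preceq> v \<Longrightarrow> n \<in> D v \<Longrightarrow> \<exists>k\<in>D v. App v x n k \<and> R v n k"
    "\<And>v n k. w \<preceq> v \<Longrightarrow> n \<in> D v \<Longrightarrow> k \<in> D v \<Longrightarrow> App v x n k \<Longrightarrow> R v n k"
proof -
  obtain x where x: "x \<in> D w" "\<And>v n. w \<preceq> v \<Longrightarrow> n \<in> D v \<Longrightarrow> \<exists>k\<in>D v. App v x n k \<and> R v n k"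
    using CT[where Q=R, OF assms(1,2)] by blast
  have "isV w x" by (rule isV_I[OF x(1)]) (use x(2) assms(3) in blast)
  moreover have "R v n k" if "w \<preceq> v" "n \<in> D v" "k \<in> D v" "App v x n k" for v n k
    using x(2)[OF that(1,2)] App_det[OF D_mono[OF that(1) x(1)] that(2,3) _ that(4)] by blast
  ultimately show ?thesis using that x by blast
qed

text \<open>Agreement as partial functions, used before a formula for extensional equality is at
  hand; \<open>Eq_same_values\<close> connects the two.\<close>

definition same_values :: "'w \<Rightarrow> 'd \<Rightarrow> 'd \<Rightarrow> bool" where
  "same_values w a b \<longleftrightarrow> (\<forall>v. w \<preceq> v \<longrightarrow> (\<forall>n\<in>D v. \<forall>k\<in>D v. App v a n k \<longleftrightarrow> App v b n k))"

lemma same_values_EL: "same_values w a b \<Longrightarrow> w \<preceq> v \<Longrightarrow> EL v c a \<longleftrightarrow> EL v c b"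
  unfolding same_values_def EL_def by blast

text \<open>A v-set that exists only under a condition \<open>c\<close> can be replaced by an index that exists outright and
  behaves like that v-set as soon as \<open>c\<close> is true: extended Church's thesis is applied on the almost negative
  domain \<open>\<T>(c)\<close>.\<close>

lemma ex_lazy_vset:
  assumes c: "c \<in> D w"
    and def: "definable (\<lambda>_. True) w (\<lambda>w e. B w (e 0))"
    and ex: "\<And>v. w \<preceq> v \<Longrightarrow> isT v c \<Longrightarrow> \<exists>b\<in>D v. isV v b \<and> B v b"
    and cong: "\<And>v a b. w \<preceq> v \<Longrightarrow> a \<in> D v \<Longrightarrow> b \<in> D v \<Longrightarrow> isV v a \<Longrightarrow> isV v b \<Longrightarrow> same_values v a b \<Longrightarrow>
      B v b \<Longrightarrow> B v a"
  shows "\<exists>a\<in>D w. \<forall>v. w \<preceq> v \<longrightarrow> isT v c \<longrightarrow> isV v a \<and> B v a"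
proof -
  \<comment> \<open>\<open>q\<close> returns a suitable v-set at any input, provided that
    \<open>c\<close> is true; below it is always asked at \<open>zero\<close>.\<close>
  have "\<exists>q\<in>D w. \<forall>v n. w \<preceq> v \<longrightarrow> n \<in> D v \<longrightarrow> isT v c \<longrightarrow> (\<exists>b\<in>D v. App v q n b \<and> (isV v b \<and> B v b))"
  proof (rule ECT)
    show "definable (\<lambda>_. True) w (\<lambda>w e. isV w (e 0) \<and> B w (e 0))"
      by (rule definable_intros def)+
    show "definable almost_negative w (\<lambda>w e. isT w c)" by (rule definable_intros c)+
  qed (use ex in blast)
  then obtain q where q: "q \<in> D w"
    "\<And>v. w \<preceq> v \<Longrightarrow> isT v c \<Longrightarrow> \<exists>b\<in>D v. App v q zero b \<and> isV v b \<and> B v b" by force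
  \<comment> \<open>\<open>a\<close> computes \<open>(q 0) n\<close> at input \<open>n\<close>. As a
    number it exists at \<open>w\<close>, although its values may come only with the truth of
    \<open>c\<close>.\<close>
  have "\<exists>a\<in>D w. \<forall>v n. w \<preceq> v \<longrightarrow> n \<in> D v \<longrightarrow> isT v c \<longrightarrow>
      (\<exists>k\<in>D v. App v a n k \<and> (\<exists>b\<in>D v. App v q zero b \<and> App v b n k))"
  proof (rule ECT)
    show "\<exists>k\<in>D v. \<exists>b\<in>D v. App v q zero b \<and> App v b n k" if "w \<preceq> v" "n \<in> D v" "isT v c" for v n
      using q(2)[OF that(1,3)] isV_total that(2) by metis
  qed (rule definable_intros c q(1))+
  then obtain a where a: "a \<in> D w" "\<And>v n. w \<preceq> v \<Longrightarrow> n \<in> D v \<Longrightarrow> isT v c \<Longrightarrow>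
      \<exists>k\<in>D v. App v a n k \<and> (\<exists>b\<in>D v. App v q zero b \<and> App v b n k)" by blast
  have "isV v a \<and> B v a" if v: "w \<preceq> v" "isT v c" for v
  proof -
    obtain b where b: "b \<in> D v" "App v q zero b" "isV v b" "B v b" using q(2)[OF v] by blast
    have av: "\<exists>k\<in>D u. App u a n k \<and> App u b n k" if u: "v \<preceq> u" "n \<in> D u" for u n
    proof -
      obtain k b' where "k \<in> D u" "App u a n k" "b' \<in> D u" "App u q zero b'" "App u b' n k"
        using a(2)[OF le_trans[OF v(1) u(1)] u(2) isT_mono[OF u(1) v(2)]] by blast
      moreover from this have "b' = b"
        using App_det[of q u zero b' b] D_mono[OF le_trans[OF v(1) u(1)] q(1)] D_mono[OF u(1) b(1)]
          App_mono[OF u(1) b(2)] by simp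
      ultimately show ?thesis by blast
    qed
    have same: "same_values v a b"
      unfolding same_values_def
    proof (intro allI impI ballI)
      fix u n k assume u: "v \<preceq> u" "n \<in> D u" "k \<in> D u"
      obtain l where l: "l \<in> D u" "App u a n l" "App u b n l" using av[OF u(1,2)] by blast
      have ab: "a \<in> D u" "b \<in> D u" using D_mono[OF le_trans[OF v(1) u(1)] a(1)] D_mono[OF u(1) b(1)] .
      show "App u a n k \<longleftrightarrow> App u b n k"
        using App_det[OF ab(1) u(2,3) l(1) _ l(2)] App_det[OF ab(2) u(2,3) l(1) _ l(3)] l by blast
    qed
    have "isV v a"
    proof (rule isV_I[OF D_mono[OF v(1) a(1)]])
      fix u n assume u: "v \<preceq> u" "n \<in> D u"
      then show "\<exists>k\<in>D u. App u a n k \<and> isM u (rt k) \<and> (\<forall>t. u \<preceq> t \<longrightarrow> isT t (rt k) \<longrightarrow> isV t (lf k))"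
        using isV_step[OF b(1,3)] same unfolding same_values_def by blast
    qed
    then show ?thesis using cong[OF v(1) D_mono[OF v(1) a(1)] b(1) _ b(3) same b(4)] by simp
  qed
  then show ?thesis using a(1) by blast
qed

text \<open>\<open>h\<close> keeps the conditions of \<open>x\<close> and replaces its elements,
  which are supplied lazily. The lazy index merely has the same values as a chosen v-set, whence the
  congruence assumption on \<open>B\<close>.\<close>

lemma ex_vset_over:
  assumes x: "x \<in> D w" "isV w x"
    and def: "definable (\<lambda>_. True) w (\<lambda>w e. B w (e (Suc 0)) (e 0))"
    and ex: "\<And>v n k. w \<preceq> v \<Longrightarrow> n \<in> D v \<Longrightarrow> k \<in> D v \<Longrightarrow> App v x n k \<Longrightarrow> isT v (rt k) \<Longrightarrow>
      \<exists>b\<in>D v. isV v b \<and> B v n b"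
    and cong: "\<And>v n a b. w \<preceq> v \<Longrightarrow> n \<in> D v \<Longrightarrow> a \<in> D v \<Longrightarrow> b \<in> D v \<Longrightarrow> isV v a \<Longrightarrow> isV v b \<Longrightarrow>
      same_values v a b \<Longrightarrow> B v n b \<Longrightarrow> B v n a"
  obtains h where "h \<in> D w" "isV w h"
    "\<And>v n k. w \<preceq> v \<Longrightarrow> n \<in> D v \<Longrightarrow> k \<in> D v \<Longrightarrow> App v h n k \<Longrightarrow> isT v (rt k) \<Longrightarrow>
      isV v (lf k) \<and> B v n (lf k) \<and> (\<exists>l\<in>D v. App v x n l \<and> isT v (rt l))"
    "\<And>v n k. w \<preceq> v \<Longrightarrow> n \<in> D v \<Longrightarrow> k \<in> D v \<Longrightarrow> App v x n k \<Longrightarrow> isT v (rt k) \<Longrightarrow>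
      \<exists>l\<in>D v. App v h n l \<and> isT v (rt l) \<and> isV v (lf l) \<and> B v n (lf l)"
proof -
  define R where "R v n k \<longleftrightarrow> (\<exists>l\<in>D v. App v x n l \<and> rt k = rt l) \<and>
    (\<forall>u. v \<preceq> u \<longrightarrow> isT u (rt k) \<longrightarrow> isV u (lf k) \<and> B u n (lf k))" for v n k
  have "definable (\<lambda>_. True) w (\<lambda>w e. R w (e (Suc 0)) (e 0))"
    unfolding R_def by (rule definable_intros definable_inst2[OF def] x(1))+
  moreover have "\<exists>k\<in>D v. R v n k" if v: "w \<preceq> v" "n \<in> D v" for v n
  proof -
    obtain l where l: "l \<in> D v" "App v x n l" using isV_total[OF D_mono[OF v(1) x(1)] isV_mono[OF v(1) x(2)] v(2)] .
    have "\<exists>a\<in>D v. \<forall>u. v \<preceq> u \<longrightarrow> isT u (rt l) \<longrightarrow> isV u a \<and> B u n a"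
    proof (rule ex_lazy_vset)
      show "\<exists>b\<in>D u. isV u b \<and> B u n b" if u: "v \<preceq> u" "isT u (rt l)" for u
        using ex[OF le_trans[OF v(1) u(1)] D_mono[OF u(1) v(2)] D_mono[OF u(1) l(1)] App_mono[OF u(1) l(2)] u(2)] .
      show "B u n a" if "v \<preceq> u" "a \<in> D u" "b \<in> D u" "isV u a" "isV u b" "same_values u a b" "B u n b" for u a b
        using cong[OF le_trans[OF v(1) that(1)] D_mono[OF that(1) v(2)] that(2-7)] .
      show "definable (\<lambda>_. True) v (\<lambda>w e. B w n (e 0))"
        by (rule definable_intros definable_inst2[OF definable_later[OF def v(1)]] v(2))+
    qed (use l(1) in simp)
    then obtain a where a: "a \<in> D v" "\<forall>u. v \<preceq> u \<longrightarrow> isT u (rt l) \<longrightarrow> isV u a \<and> B u n a" by blast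
    \<comment> \<open>The lazy element \<open>a\<close> is paired with the condition of the
      \<open>n\<close>-th entry of \<open>x\<close>.\<close>
    then show ?thesis using l unfolding R_def
      by (intro bexI[of _ "pr a (rt l)"]) (auto simp: lf_pr[where w=v] rt_pr[where w=v])
  qed
  moreover have "isM v (rt k) \<and> (\<forall>u. v \<preceq> u \<longrightarrow> isT u (rt k) \<longrightarrow> isV u (lf k))"
    if v: "w \<preceq> v" "n \<in> D v" "k \<in> D v" "R v n k" for v n k
    using v(4) isV_val(1)[OF D_mono[OF v(1) x(1)] isV_mono[OF v(1) x(2)] v(2)] unfolding R_def by auto
  ultimately obtain h where h: "h \<in> D w" "isV w h"
    "\<And>v n. w \<preceq> v \<Longrightarrow> n \<in> D v \<Longrightarrow> \<exists>k\<in>D v. App v h n k \<and> R v n k"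
    "\<And>v n k. w \<preceq> v \<Longrightarrow> n \<in> D v \<Longrightarrow> k \<in> D v \<Longrightarrow> App v h n k \<Longrightarrow> R v n k"
    by (rule ex_vset[where R=R]) blast+
  show ?thesis
  proof (rule that[OF h(1,2)])
    fix v n k assume v: "w \<preceq> v" "n \<in> D v" "k \<in> D v" "App v h n k" "isT v (rt k)"
    show "isV v (lf k) \<and> B v n (lf k) \<and> (\<exists>l\<in>D v. App v x n l \<and> isT v (rt l))"
      using h(4)[OF v(1-4)] v(5) le_refl unfolding R_def by auto
  next
    fix v n k assume v: "w \<preceq> v" "n \<in> D v" "k \<in> D v" "App v x n k" "isT v (rt k)"
    obtain l where l: "l \<in> D v" "App v h n l" "R v n l" using h(3)[OF v(1,2)] by blast
    then obtain k' where k': "k' \<in> D v" "App v x n k'" "rt l = rt k'" unfolding R_def by blast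
    then have "k' = k" using App_det[OF D_mono[OF v(1) x(1)] v(2)] v by blast
    then show "\<exists>l\<in>D v. App v h n l \<and> isT v (rt l) \<and> isV v (lf l) \<and> B v n (lf l)"
      using l k' v(5) le_refl unfolding R_def by auto
  qed
qed

end

section \<open>Soundness\<close>

context kripke_model
begin

text \<open>Serves to bring the extensionality of an arbitrary \<open>E\<close>, known as provable,
  into the model.\<close>

lemma soundness: "deduces Xi \<Gamma> \<phi> \<Longrightarrow> (\<And>i. e i \<in> D w) \<Longrightarrow> (\<And>\<gamma>. \<gamma> \<in> \<Gamma> \<Longrightarrow> sat w e \<gamma>) \<Longrightarrow> sat w e \<phi>"
proof (induction arbitrary: w e rule: deduces.induct)
  case (Ax \<phi> \<Gamma>)
  then show ?case by (intro axiom_sat)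
next
  case (DisjE \<Gamma> \<phi> \<psi> \<chi>)
  have "sat w e (Disj \<phi> \<psi>)" by (rule DisjE.IH(1); use DisjE.prems in blast)
  then show ?case
  proof (simp, elim disjE)
    assume "sat w e \<phi>"
    then show ?thesis by (intro DisjE.IH(2)) (use DisjE.prems in auto)
  next
    assume "sat w e \<psi>"
    then show ?thesis by (intro DisjE.IH(3)) (use DisjE.prems in auto)
  qed
next
  case (ImplI \<phi> \<Gamma> \<psi>)
  show ?case
  proof (simp, intro allI impI)
    fix v assume v: "w \<preceq> v" "sat v e \<phi>"
    show "sat v e \<psi>"
      by (rule ImplI.IH) (use v ImplI.prems D_mono sat_mono in auto)
  qed
next
  case (ImplE \<Gamma> \<phi> \<psi>)
  have "sat w e (Impl \<phi> \<psi>)" "sat w e \<phi>" by (rule ImplE.IH; use ImplE.prems in blast)+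
  then show ?case by auto
next
  case (ForallI \<Gamma> \<phi>)
  show ?case
  proof (simp, intro allI impI ballI)
    fix v d assume v: "w \<preceq> v" "d \<in> D v"
    show "sat v (case_nat d e) \<phi>"
    proof (rule ForallI.IH)
      show "case_nat d e i \<in> D v" for i using v ForallI.prems(1) D_mono by (auto split: nat.split)
      show "sat v (case_nat d e) \<gamma>" if "\<gamma> \<in> lift ` \<Gamma>" for \<gamma>
        using that ForallI.prems(2) sat_mono[OF v(1)] by (auto simp: sat_sub)
    qed
  qed
next
  case (ForallE \<Gamma> \<phi> t)
  have "sat w e (Forall \<phi>)" by (rule ForallE.IH; use ForallE.prems in blast)
  then show ?case using tval_D[of e w t] ForallE.prems(1) by (auto simp: inst_def sat_sub)
next
  case (ExistsI \<Gamma> t \<phi>)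
  have "sat w e (inst t \<phi>)" by (rule ExistsI.IH; use ExistsI.prems in blast)
  then show ?case using tval_D[of e w t] ExistsI.prems(1) by (auto simp: inst_def sat_sub)
next
  case (ExistsE \<Gamma> \<phi> \<psi>)
  have "sat w e (Exists \<phi>)" by (rule ExistsE.IH(1); use ExistsE.prems in blast)
  then obtain d where d: "d \<in> D w" "sat w (case_nat d e) \<phi>" by auto
  have "sat w (case_nat d e) (lift \<psi>)"
  proof (rule ExistsE.IH(2))
    show "case_nat d e i \<in> D w" for i using d ExistsE.prems(1) by (auto split: nat.split)
    show "sat w (case_nat d e) \<gamma>" if "\<gamma> \<in> insert \<phi> (lift ` \<Gamma>)" for \<gamma>
      using that ExistsE.prems(2) d(2) by (auto simp: sat_sub)
  qed
  then show ?case by (simp add: sat_sub)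
next
  case (Equal_subst \<Gamma> s t \<phi>)
  have "sat w e (Equal s t)" "sat w e (inst s \<phi>)" by (rule Equal_subst.IH; use Equal_subst.prems in blast)+
  then show ?case by (simp add: inst_def sat_sub)
qed auto

end


section \<open>Extensional equality as bisimilarity\<close>

text \<open>A bisimulation is given by an index \<open>p\<close> of a total function into the meaningful conditions, where
  \<open>\<T>(p \<langle>v, \<langle>a, b\<rangle>\<rangle>)\<close> says that \<open>v\<close> witnesses that \<open>a\<close> and \<open>b\<close> are related. The witnesses are needed because
  \<open>\<Xi>\<close> provides no existential conditions, so that a union of bisimulations has to remember from which of
  them a pair comes.\<close>

definition true_app :: "tm \<Rightarrow> tm \<Rightarrow> fm" where
  "true_app p z = Exists (Conj (app (lift_tm p) (lift_tm z) (Var 0)) (TT (Var 0)))"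

definition matched :: "tm \<Rightarrow> tm \<Rightarrow> tm \<Rightarrow> fm" where
  "matched p a b = Forall (Impl (in_EL (Var 0) (lift_tm a))
     (Exists (Conj (in_EL (Var 0) (lift_tm (lift_tm b)))
       (Exists (true_app (lift_tm (lift_tm (lift_tm p))) (pairt (Var 0) (pairt (Var 2) (Var 1))))))))"

definition bisimulation :: "tm \<Rightarrow> fm" where
  "bisimulation p = Conj
     (Forall (Exists (Conj (app (lift_tm (lift_tm p)) (Var 1) (Var 0)) (MM (Var 0)))))
     (Forall (Impl (true_app (lift_tm p) (Var 0))
       (Conj (matched (lift_tm p) (leftt (rightt (Var 0))) (rightt (rightt (Var 0))))
             (matched (lift_tm p) (rightt (rightt (Var 0))) (leftt (rightt (Var 0)))))))"

definition bisimilar :: fm where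
  "bisimilar = Exists (Exists (Conj (bisimulation (Var 1))
     (true_app (Var 1) (pairt (Var 0) (pairt (Var 2) (Var 3))))))"

context kripke_model
begin

definition Tap :: "'w \<Rightarrow> 'd \<Rightarrow> 'd \<Rightarrow> bool" where
  "Tap w p z \<longleftrightarrow> (\<exists>k\<in>D w. App w p z k \<and> isT w k)"

definition Matched :: "'w \<Rightarrow> 'd \<Rightarrow> 'd \<Rightarrow> 'd \<Rightarrow> bool" where
  "Matched w p a b \<longleftrightarrow> (\<forall>v. w \<preceq> v \<longrightarrow> (\<forall>a'\<in>D v. EL v a' a \<longrightarrow>
     (\<exists>b'\<in>D v. EL v b' b \<and> (\<exists>t\<in>D v. Tap v p (pr t (pr a' b'))))))"

definition Bisim :: "'w \<Rightarrow> 'd \<Rightarrow> bool" where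
  "Bisim w p \<longleftrightarrow> (\<forall>v. w \<preceq> v \<longrightarrow> (\<forall>z\<in>D v. \<exists>k\<in>D v. App v p z k \<and> isM v k)) \<and>
     (\<forall>v. w \<preceq> v \<longrightarrow> (\<forall>z\<in>D v. Tap v p z \<longrightarrow>
        Matched v p (lf (rt z)) (rt (rt z)) \<and> Matched v p (rt (rt z)) (lf (rt z))))"

lemma sat_true_app: "sat w e (true_app p z) \<longleftrightarrow> Tap w (tval e p) (tval e z)"
  by (simp add: true_app_def Tap_def tval_lift)

lemma sat_matched: "sat w e (matched p a b) \<longleftrightarrow> Matched w (tval e p) (tval e a) (tval e b)"
  by (simp add: matched_def Matched_def tval_lift sat_true_app numeral_eq_Suc)

lemma sat_bisimulation: "sat w e (bisimulation p) \<longleftrightarrow> Bisim w (tval e p)"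
  by (simp add: bisimulation_def Bisim_def tval_lift sat_true_app sat_matched)

lemma sat_bisimilar:
  "sat w (case_nat x (\<lambda>_. y)) bisimilar \<longleftrightarrow> (\<exists>p\<in>D w. \<exists>t\<in>D w. Bisim w p \<and> Tap w p (pr t (pr x y)))"
  by (simp add: bisimilar_def sat_bisimulation sat_true_app numeral_eq_Suc)

lemma Tap_mono: "v \<preceq> w \<Longrightarrow> Tap v p z \<Longrightarrow> Tap w p z"
  unfolding Tap_def using D_mono App_mono isT_mono by blast

lemma Bisim_mono:
  assumes "v \<preceq> w" "Bisim v p"
  shows "Bisim w p"
  using assms(2) le_trans[OF assms(1)] unfolding Bisim_def by simp

lemma definable_Tap:
  assumes "definable_tm w\<^sub>0 \<sigma>" "definable_tm w\<^sub>0 \<tau>"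
  shows "definable (\<lambda>_. True) w\<^sub>0 (\<lambda>w e. Tap w (\<sigma> e) (\<tau> e))"
  using definable_sat2[OF assms, of "true_app (Var 0) (Var 1)"] by (simp add: sat_true_app)

lemma definable_Bisim:
  assumes "definable_tm w\<^sub>0 \<sigma>"
  shows "definable (\<lambda>_. True) w\<^sub>0 (\<lambda>w e. Bisim w (\<sigma> e))"
  using definable_sat2[OF assms assms, of "bisimulation (Var 0)"] by (simp add: sat_bisimulation)

section \<open>Extensionality of a formula in a model\<close>

definition EqE :: "fm \<Rightarrow> 'w \<Rightarrow> 'd \<Rightarrow> 'd \<Rightarrow> bool" where
  "EqE E w x y \<longleftrightarrow> sat w (case_nat x (\<lambda>_. y)) E"

definition MatchE :: "fm \<Rightarrow> 'w \<Rightarrow> 'd \<Rightarrow> 'd \<Rightarrow> bool" where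
  "MatchE E w x y \<longleftrightarrow> (\<forall>v. w \<preceq> v \<longrightarrow> (\<forall>a\<in>D v. EL v a x \<longrightarrow> (\<exists>b\<in>D v. EL v b y \<and> EqE E v a b)))"

lemma sat_rel [simp]: "sat w e (rel E s t) \<longleftrightarrow> EqE E w (tval e s) (tval e t)"
  by (simp add: rel_def sat_sub EqE_def)

lemma EqE_mono: "v \<preceq> w \<Longrightarrow> EqE E v x y \<Longrightarrow> EqE E w x y"
  unfolding EqE_def by (rule sat_mono)

lemma MatchE_mono: "v \<preceq> w \<Longrightarrow> MatchE E v x y \<Longrightarrow> MatchE E w x y"
  unfolding MatchE_def using le_trans by blast

text \<open>V-sets remain v-sets at later worlds, so the nested quantifiers over worlds collapse,
  and the two implications become an equivalence at each world.\<close>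

lemma sat_extensionality:
  "sat w e (interp E extensionality) \<longleftrightarrow> (\<forall>v. w \<preceq> v \<longrightarrow> (\<forall>x\<in>D v. \<forall>y\<in>D v. isV v x \<and> isV v y \<longrightarrow>
     (EqE E v x y \<longleftrightarrow> MatchE E v x y \<and> MatchE E v y x)))" (is "?L \<longleftrightarrow> ?R")
proof -
  have "?L \<longleftrightarrow> (\<forall>v. w \<preceq> v \<longrightarrow> (\<forall>x\<in>D v. isV v x \<longrightarrow> (\<forall>u. v \<preceq> u \<longrightarrow> (\<forall>y\<in>D u. isV u y \<longrightarrow>
     (\<forall>t. u \<preceq> t \<longrightarrow> EqE E t x y \<longrightarrow> MatchE E t x y \<and> MatchE E t y x) \<and>
     (\<forall>t. u \<preceq> t \<longrightarrow> MatchE E t x y \<and> MatchE E t y x \<longrightarrow> EqE E t x y)))))"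
    by (simp add: extensionality_def Let_def MatchE_def numeral_eq_Suc)
  also have "\<dots> \<longleftrightarrow> ?R"
  proof
    assume L: "\<forall>v. w \<preceq> v \<longrightarrow> (\<forall>x\<in>D v. isV v x \<longrightarrow> (\<forall>u. v \<preceq> u \<longrightarrow> (\<forall>y\<in>D u. isV u y \<longrightarrow>
     (\<forall>t. u \<preceq> t \<longrightarrow> EqE E t x y \<longrightarrow> MatchE E t x y \<and> MatchE E t y x) \<and>
     (\<forall>t. u \<preceq> t \<longrightarrow> MatchE E t x y \<and> MatchE E t y x \<longrightarrow> EqE E t x y))))"
    show ?R
    proof (intro allI impI ballI)
      fix v x y assume v: "w \<preceq> v" "x \<in> D v" "y \<in> D v" "isV v x \<and> isV v y"
      then have "(\<forall>t. v \<preceq> t \<longrightarrow> EqE E t x y \<longrightarrow> MatchE E t x y \<and> MatchE E t y x) \<and>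
          (\<forall>t. v \<preceq> t \<longrightarrow> MatchE E t x y \<and> MatchE E t y x \<longrightarrow> EqE E t x y)"
        using L le_refl by blast
      then show "EqE E v x y \<longleftrightarrow> MatchE E v x y \<and> MatchE E v y x" using le_refl by blast
    qed
  next
    assume R: ?R
    show "\<forall>v. w \<preceq> v \<longrightarrow> (\<forall>x\<in>D v. isV v x \<longrightarrow> (\<forall>u. v \<preceq> u \<longrightarrow> (\<forall>y\<in>D u. isV u y \<longrightarrow>
     (\<forall>t. u \<preceq> t \<longrightarrow> EqE E t x y \<longrightarrow> MatchE E t x y \<and> MatchE E t y x) \<and>
     (\<forall>t. u \<preceq> t \<longrightarrow> MatchE E t x y \<and> MatchE E t y x \<longrightarrow> EqE E t x y))))"
    proof (intro allI impI ballI)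
      fix v x u y assume v: "w \<preceq> v" "x \<in> D v" "isV v x" "v \<preceq> u" "y \<in> D u" "isV u y"
      have "EqE E t x y \<longleftrightarrow> MatchE E t x y \<and> MatchE E t y x" if t: "u \<preceq> t" for t
        using R[rule_format, of t x y] le_trans[OF le_trans[OF v(1,4)] t] D_mono[OF le_trans[OF v(4) t] v(2)]
          D_mono[OF t v(5)] isV_mono[OF le_trans[OF v(4) t] v(3)] isV_mono[OF t v(6)] by blast
      then show "(\<forall>t. u \<preceq> t \<longrightarrow> EqE E t x y \<longrightarrow> MatchE E t x y \<and> MatchE E t y x) \<and>
          (\<forall>t. u \<preceq> t \<longrightarrow> MatchE E t x y \<and> MatchE E t y x \<longrightarrow> EqE E t x y)" by blast
    qed
  qed
  finally show ?thesis .
qed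

section \<open>Bisimilarity satisfies extensionality\<close>

text \<open>The answer \<open>m\<close> of \<open>q\<close> to a true index \<open>n\<close> of
  \<open>x\<close> has the form \<open>pr b (pr p t)\<close>: an element \<open>b\<close> of
  \<open>y\<close> matching the \<open>n\<close>-th element of \<open>x\<close>, a bisimulation
  \<open>p\<close> relating the two, and a witness \<open>t\<close> for it.\<close>

definition Strategy :: "'w \<Rightarrow> 'd \<Rightarrow> 'd \<Rightarrow> 'd \<Rightarrow> bool" where
  "Strategy w q x y \<longleftrightarrow> (\<forall>v n k. w \<preceq> v \<longrightarrow> n \<in> D v \<longrightarrow> k \<in> D v \<longrightarrow> App v x n k \<longrightarrow> isT v (rt k) \<longrightarrow>
     (\<exists>m\<in>D v. App v q n m \<and> EL v (lf m) y \<and> Bisim v (lf (rt m)) \<and>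
        Tap v (lf (rt m)) (pr (rt (rt m)) (pr (lf k) (lf m)))))"

lemma ex_strategy:
  assumes x: "x \<in> D w" "isV w x" and y: "y \<in> D w" and m: "MatchE bisimilar w x y"
  shows "\<exists>q\<in>D w. Strategy w q x y"
proof -
  \<comment> \<open>The domain expresses truth of the \<open>n\<close>-th condition of
    \<open>x\<close> through all its values, as an almost negative formula; totality of
    \<open>x\<close> recovers the value itself.\<close>
  have "\<exists>q\<in>D w. \<forall>v n. w \<preceq> v \<longrightarrow> n \<in> D v \<longrightarrow> (\<forall>u. v \<preceq> u \<longrightarrow> (\<forall>k\<in>D u. App u x n k \<longrightarrow> isT u (rt k))) \<longrightarrow>
      (\<exists>m\<in>D v. App v q n m \<and> (EL v (lf m) y \<and> Bisim v (lf (rt m)) \<and> (\<exists>k\<in>D v. App v x n k \<and>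
        Tap v (lf (rt m)) (pr (rt (rt m)) (pr (lf k) (lf m))))))"
  proof (rule ECT)
    show "definable almost_negative w (\<lambda>w e. \<forall>u. w \<preceq> u \<longrightarrow> (\<forall>k\<in>D u. App u x (e 0) k \<longrightarrow> isT u (rt k)))"
      by (rule definable_intros x)+
    show "definable (\<lambda>_. True) w (\<lambda>w e. EL w (lf (e 0)) y \<and> Bisim w (lf (rt (e 0))) \<and>
        (\<exists>k\<in>D w. App w x (e (Suc 0)) k \<and> Tap w (lf (rt (e 0))) (pr (rt (rt (e 0))) (pr (lf k) (lf (e 0))))))"
      by (rule definable_intros definable_EL definable_Bisim definable_Tap x y)+
    show "\<exists>m\<in>D v. EL v (lf m) y \<and> Bisim v (lf (rt m)) \<and>
        (\<exists>k\<in>D v. App v x n k \<and> Tap v (lf (rt m)) (pr (rt (rt m)) (pr (lf k) (lf m))))"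
      if v: "w \<preceq> v" "n \<in> D v" "\<forall>u. v \<preceq> u \<longrightarrow> (\<forall>k\<in>D u. App u x n k \<longrightarrow> isT u (rt k))" for v n
    proof -
      obtain k where k: "k \<in> D v" "App v x n k"
        using isV_total[OF D_mono[OF v(1) x(1)] isV_mono[OF v(1) x(2)] v(2)] .
      then have "EL v (lf k) x" using v(2,3) le_refl unfolding EL_def by blast
      then obtain b p t where b: "b \<in> D v" "EL v b y" "p \<in> D v" "t \<in> D v" "Bisim v p" "Tap v p (pr t (pr (lf k) b))"
        using m v(1) k(1) unfolding MatchE_def EqE_def sat_bisimilar by fastforce
      show ?thesis
        by (rule bexI[of _ "pr b (pr p t)"])
          (use b k in \<open>auto simp: lf_pr[where w=v] rt_pr[where w=v] intro!: bexI[of _ k]\<close>)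
    qed
  qed
  then obtain q where q: "q \<in> D w" "\<And>v n. w \<preceq> v \<Longrightarrow> n \<in> D v \<Longrightarrow>
      (\<forall>u. v \<preceq> u \<longrightarrow> (\<forall>k\<in>D u. App u x n k \<longrightarrow> isT u (rt k))) \<Longrightarrow>
      \<exists>m\<in>D v. App v q n m \<and> EL v (lf m) y \<and> Bisim v (lf (rt m)) \<and> (\<exists>k\<in>D v. App v x n k \<and>
        Tap v (lf (rt m)) (pr (rt (rt m)) (pr (lf k) (lf m))))" by blast
  have "Strategy w q x y" unfolding Strategy_def
  proof (intro allI impI)
    fix v n k assume v: "w \<preceq> v" "n \<in> D v" "k \<in> D v" "App v x n k" "isT v (rt k)"
    have det: "l = k" if "v \<preceq> u" "l \<in> D u" "App u x n l" for u l
      using App_det[of x u n l k] D_mono[OF that(1)] D_mono[OF v(1) x(1)] v that App_mono[OF that(1) v(4)] by blast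
    then have "\<forall>u. v \<preceq> u \<longrightarrow> (\<forall>l\<in>D u. App u x n l \<longrightarrow> isT u (rt l))" using isT_mono v(5) by blast
    from q(2)[OF v(1,2) this] show "\<exists>m\<in>D v. App v q n m \<and> EL v (lf m) y \<and> Bisim v (lf (rt m)) \<and>
        Tap v (lf (rt m)) (pr (rt (rt m)) (pr (lf k) (lf m)))"
      using det[OF le_refl] by blast
  qed
  then show ?thesis using q(1) by blast
qed

definition Via :: "'w \<Rightarrow> 'd \<Rightarrow> 'd \<Rightarrow> 'd \<Rightarrow> 'd \<Rightarrow> bool" where
  "Via w q x n z \<longleftrightarrow> (\<exists>k\<in>D w. App w x n k \<and> isT w (rt k)) \<and> (\<exists>m\<in>D w. App w q n m \<and> Tap w (lf (rt m)) z)"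

lemma Via_mono: "v \<preceq> w \<Longrightarrow> Via v q x n z \<Longrightarrow> Via w q x n z"
  unfolding Via_def using D_mono App_mono isT_mono Tap_mono by blast

lemma Rep_cong: "Rep w c P \<Longrightarrow> (\<And>v. w \<preceq> v \<Longrightarrow> P v \<longleftrightarrow> Q v) \<Longrightarrow> Rep w c Q"
  unfolding Rep_def by blast

text \<open>The bisimulation selected by \<open>q\<close> is available only if the
  \<open>n\<close>-th condition of \<open>x\<close> is true. Once it is, \<open>Bisim\<close>
  provides a meaningful condition at \<open>z\<close>, so the dependent conjunction
  \<open>ex_cond_and\<close> applies.\<close>

lemma ex_cond_Via:
  assumes x: "x \<in> D w" "isV w x" and q: "q \<in> D w" "Strategy w q x y" and n: "n \<in> D w" and z: "z \<in> D w"
  shows "\<exists>c\<in>D w. Rep w c (\<lambda>v. Via v q x n z)"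
proof -
  obtain k where k: "k \<in> D w" "App w x n k" "isM w (rt k)" using isV_total[OF x n] .
  have det: "l = k" if "w \<preceq> u" "l \<in> D u" "App u x n l" for u l
    using App_det[of x u n l k] D_mono[OF that(1)] x(1) n k(1) that App_mono[OF that(1) k(2)] by blast
  have "\<exists>c\<in>D w. Rep w c (\<lambda>v. isT v (rt k) \<and> (\<exists>m\<in>D v. App v q n m \<and> Tap v (lf (rt m)) z))"
  proof (rule ex_cond_and)
    show "definable (\<lambda>_. True) w (\<lambda>v e. \<exists>m\<in>D v. App v q n m \<and> Tap v (lf (rt m)) z)"
      by (rule definable_intros definable_Tap q n z)+
    show "\<exists>m\<in>D v. App v q n m \<and> Tap v (lf (rt m)) z"
      if "w \<preceq> u" "u \<preceq> v" "\<exists>m\<in>D u. App u q n m \<and> Tap u (lf (rt m)) z" for u v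
      using that D_mono App_mono Tap_mono by blast
    show "\<exists>d\<in>D v. Rep v d (\<lambda>v. \<exists>m\<in>D v. App v q n m \<and> Tap v (lf (rt m)) z)"
      if v: "w \<preceq> v" "isT v (rt k)" for v
    proof -
      obtain m where m: "m \<in> D v" "App v q n m" "Bisim v (lf (rt m))"
        using q(2) v D_mono[OF v(1) n] D_mono[OF v(1) k(1)] App_mono[OF v(1) k(2)] unfolding Strategy_def by blast
      then obtain d where d: "d \<in> D v" "App v (lf (rt m)) z d" "isM v d"
        using D_mono[OF v(1) z] le_refl unfolding Bisim_def by blast
      have "isT u d \<longleftrightarrow> (\<exists>m\<in>D u. App u q n m \<and> Tap u (lf (rt m)) z)" if u: "v \<preceq> u" for u
      proof
        assume "isT u d"
        then show "\<exists>m\<in>D u. App u q n m \<and> Tap u (lf (rt m)) z"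
          using m d D_mono[OF u] App_mono[OF u] unfolding Tap_def by blast
      next
        assume "\<exists>m\<in>D u. App u q n m \<and> Tap u (lf (rt m)) z"
        then obtain m' d' where *: "m' \<in> D u" "App u q n m'" "d' \<in> D u" "App u (lf (rt m')) z d'" "isT u d'"
          unfolding Tap_def by blast
        have wu: "w \<preceq> u" using le_trans[OF v(1) u] .
        have mu: "m \<in> D u" "App u q n m" using D_mono[OF u] App_mono[OF u] m by blast+
        have "m' = m" using App_det[OF D_mono[OF wu q(1)] D_mono[OF wu n] *(1) mu(1) *(2) mu(2)] .
        then have "d' = d"
          using App_det[of "lf (rt m)" u z d' d] mu(1) D_mono[OF wu z] *(3,4) D_mono[OF u d(1)] App_mono[OF u d(2)] by simp
        then show "isT u d" using * by simp
      qed
      then show ?thesis using d unfolding Rep_def by blast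
    qed
  qed (use k in auto)
  then obtain c where c: "c \<in> D w" "Rep w c (\<lambda>v. isT v (rt k) \<and> (\<exists>m\<in>D v. App v q n m \<and> Tap v (lf (rt m)) z))"
    by blast
  have "Rep w c (\<lambda>v. Via v q x n z)"
  proof (rule Rep_cong[OF c(2)])
    fix v assume v: "w \<preceq> v"
    have "isT v (rt k) \<longleftrightarrow> (\<exists>l\<in>D v. App v x n l \<and> isT v (rt l))"
      using det[OF v] D_mono[OF v k(1)] App_mono[OF v k(2)] by blast
    then show "(isT v (rt k) \<and> (\<exists>m\<in>D v. App v q n m \<and> Tap v (lf (rt m)) z)) \<longleftrightarrow> Via v q x n z"
      unfolding Via_def by blast
  qed
  then show ?thesis using c(1) by blast
qed

lemma bisimilar_unfold:
  assumes "EqE bisimilar w x y" "x \<in> D w" "y \<in> D w"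
  shows "MatchE bisimilar w x y \<and> MatchE bisimilar w y x"
proof -
  obtain p t where p: "p \<in> D w" "t \<in> D w" "Bisim w p" "Tap w p (pr t (pr x y))"
    using assms(1) unfolding EqE_def sat_bisimilar by blast
  have *: "MatchE bisimilar w a b" if m: "Matched w p a b" for a b
    unfolding MatchE_def
  proof (intro allI impI ballI)
    fix v a' assume v: "w \<preceq> v" "a' \<in> D v" "EL v a' a"
    then obtain b' s where "b' \<in> D v" "EL v b' b" "s \<in> D v" "Tap v p (pr s (pr a' b'))"
      using m unfolding Matched_def by blast
    then show "\<exists>b'\<in>D v. EL v b' b \<and> EqE bisimilar v a' b'"
      unfolding EqE_def sat_bisimilar using D_mono[OF v(1) p(1)] Bisim_mono[OF v(1) p(3)] by blast
  qed
  have "pr t (pr x y) \<in> D w" using p assms by simp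
  then have "Matched w p (lf (rt (pr t (pr x y)))) (rt (rt (pr t (pr x y)))) \<and>
      Matched w p (rt (rt (pr t (pr x y)))) (lf (rt (pr t (pr x y))))"
    using p(3,4) le_refl unfolding Bisim_def by blast
  then have "Matched w p x y \<and> Matched w p y x"
    using p(2) assms by (simp add: lf_pr[where w=w] rt_pr[where w=w])
  then show ?thesis using * by blast
qed

text \<open>The new bisimulation relates \<open>x\<close> with \<open>y\<close> and contains all the
  bisimulations selected by a strategy in either direction. Its witnesses record which component a
  pair comes from.\<close>

lemma bisimilar_fold:
  assumes x: "x \<in> D w" "isV w x" and y: "y \<in> D w" "isV w y"
    and xy: "MatchE bisimilar w x y" and yx: "MatchE bisimilar w y x"
  shows "EqE bisimilar w x y"
proof -
  obtain q where q: "q \<in> D w" "Strategy w q x y" using ex_strategy[OF x y(1) xy] by blast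
  obtain r where r: "r \<in> D w" "Strategy w r y x" using ex_strategy[OF y x(1) yx] by blast
  \<comment> \<open>A point has the form \<open>pr (pr t (pr n s)) (pr a b)\<close>. The tag
    \<open>t\<close> is 0 for the root pair, 1 for the component picked by \<open>q\<close> at index
    \<open>n\<close> of \<open>x\<close>, 2 for that picked by \<open>r\<close> at index
    \<open>n\<close> of \<open>y\<close>. \<open>sub_z\<close> is the corresponding point
    \<open>pr s (pr a b)\<close> of the component.\<close>
  define sub_z where "sub_z z = pr (rt (rt (lf z))) (pr (lf (rt z)) (rt (rt z)))" for z
  define Root where "Root z \<longleftrightarrow> lf (lf z) = zero \<and> lf (rt z) = x \<and> rt (rt z) = y" for z
  define \<Phi> where "\<Phi> v z \<longleftrightarrow> Root z \<or> lf (lf z) = suc zero \<and> Via v q x (lf (rt (lf z))) (sub_z z) \<or>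
    lf (lf z) = suc (suc zero) \<and> Via v r y (lf (rt (lf z))) (sub_z z)" for v z
  have sub_z_D: "z \<in> D v \<Longrightarrow> sub_z z \<in> D v" for v z by (simp add: sub_z_def)
  have tags: "suc zero \<noteq> zero" "suc (suc zero) \<noteq> zero" "suc (suc zero) \<noteq> suc zero"
    using num_eq_iff[of 1 0] num_eq_iff[of 2 0] num_eq_iff[of 2 1] by (simp_all add: numeral_eq_Suc)
  have "\<exists>c\<in>D v. Rep v c (\<lambda>v. \<Phi> v z)" if v: "w \<preceq> v" and z: "z \<in> D v" for v z
  proof -
    have xv: "x \<in> D v" "isV v x" "y \<in> D v" "isV v y" "q \<in> D v" "r \<in> D v" "Strategy v q x y" "Strategy v r y x"
      using D_mono[OF v] isV_mono[OF v] x y q r le_trans[OF v] unfolding Strategy_def by blast+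
    have n: "lf (rt (lf z)) \<in> D v" using z by simp
    \<comment> \<open>The cases are equalities of numbers, which do not depend on the world, so one
      distinction settles \<open>\<Phi>\<close> at all later worlds.\<close>
    consider "Root z" | "\<not> Root z" "lf (lf z) = suc zero" | "\<not> Root z" "lf (lf z) = suc (suc zero)"
      | "\<not> Root z" "lf (lf z) \<noteq> suc zero" "lf (lf z) \<noteq> suc (suc zero)" by blast
    then show ?thesis
    proof cases
      case 1
      then show ?thesis using ex_true[of v] isT_mono unfolding Rep_def \<Phi>_def by blast
    next
      case 2
      have "\<Phi> u z \<longleftrightarrow> Via u q x (lf (rt (lf z))) (sub_z z)" for u
        using 2 tags unfolding \<Phi>_def by auto
      then show ?thesis using ex_cond_Via[OF xv(1,2,5,7) n sub_z_D[OF z]] by simp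
    next
      case 3
      have "\<Phi> u z \<longleftrightarrow> Via u r y (lf (rt (lf z))) (sub_z z)" for u
        using 3 tags unfolding \<Phi>_def by auto
      then show ?thesis using ex_cond_Via[OF xv(3,4,6,8) n sub_z_D[OF z]] by simp
    next
      case 4
      then have "\<not> \<Phi> u z" for u unfolding \<Phi>_def by blast
      then show ?thesis using ex_false[of v] unfolding Rep_def by blast
    qed
  qed
  then have "\<exists>p\<in>D w. \<forall>v z. w \<preceq> v \<longrightarrow> z \<in> D v \<longrightarrow> (\<exists>c\<in>D v. App v p z c \<and> Rep v c (\<lambda>v. \<Phi> v z))"
  proof (intro CT)
    show "definable (\<lambda>_. True) w (\<lambda>w e. Rep w (e 0) (\<lambda>v. \<Phi> v (e (Suc 0))))"
      unfolding Rep_def \<Phi>_def Root_def Via_def sub_z_def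
      by (rule definable_intros definable_Tap x y q r)+
  qed
  then obtain p where p: "p \<in> D w"
    "\<And>v z. w \<preceq> v \<Longrightarrow> z \<in> D v \<Longrightarrow> \<exists>c\<in>D v. App v p z c \<and> Rep v c (\<lambda>v. \<Phi> v z)" by blast
  have Tap_p: "Tap v p z \<longleftrightarrow> \<Phi> v z" if v: "w \<preceq> v" "z \<in> D v" for v z
  proof -
    obtain c where c: "c \<in> D v" "App v p z c" "Rep v c (\<lambda>v. \<Phi> v z)" using p(2)[OF v] by blast
    have "Tap v p z \<longleftrightarrow> isT v c"
      unfolding Tap_def using App_det[OF D_mono[OF v(1) p(1)] v(2) _ c(1) _ c(2)] c by blast
    then show ?thesis using c(3) le_refl unfolding Rep_def by blast
  qed
  \<comment> \<open>A move inside a component is answered in the same component: tag and index stay,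
    only the inner witness changes.\<close>
  have matched: "Matched v p a b"
    if v: "w \<preceq> v" and s: "Matched v s a b" and t: "t = suc zero \<or> t = suc (suc zero)" and n: "n \<in> D v"
      and step: "\<And>u z. v \<preceq> u \<Longrightarrow> z \<in> D u \<Longrightarrow> lf (lf z) = t \<Longrightarrow> lf (rt (lf z)) = n \<Longrightarrow> Tap u s (sub_z z) \<Longrightarrow> \<Phi> u z"
    for v a b s t n
    unfolding Matched_def
  proof (intro allI impI ballI)
    fix u a' assume u: "v \<preceq> u" "a' \<in> D u" "EL u a' a"
    then obtain b' j where b: "b' \<in> D u" "EL u b' b" "j \<in> D u" "Tap u s (pr j (pr a' b'))"
      using s unfolding Matched_def by blast
    let ?j = "pr t (pr n j)"
    let ?z = "pr ?j (pr a' b')"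
    have D: "t \<in> D u" "n \<in> D u" using t D_mono[OF u(1) n] by auto
    have j: "?j \<in> D u" using D b(3) by simp
    have z: "?z \<in> D u" using j u(2) b(1) by simp
    have "lf (lf ?z) = t" "lf (rt (lf ?z)) = n" "sub_z ?z = pr j (pr a' b')"
      using D b(1,3) u(2) by (simp_all add: sub_z_def lf_pr[where w=u] rt_pr[where w=u])
    then have "\<Phi> u ?z" using step[OF u(1) z] b(4) by simp
    then have "Tap u p ?z" using Tap_p[OF le_trans[OF v u(1)] z] by simp
    then show "\<exists>b'\<in>D u. EL u b' b \<and> (\<exists>t\<in>D u. Tap u p (pr t (pr a' b')))" using b j by blast
  qed
  \<comment> \<open>A move from the root is answered by the strategy, which thereby selects the
    component to continue in.\<close>
  have root: "Matched v p a b"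
    if v: "w \<preceq> v" and a: "a \<in> D v" and s: "s \<in> D v" "Strategy v s a b" and t: "t = suc zero \<or> t = suc (suc zero)"
      and step: "\<And>u z. v \<preceq> u \<Longrightarrow> z \<in> D u \<Longrightarrow> lf (lf z) = t \<Longrightarrow> Via u s a (lf (rt (lf z))) (sub_z z) \<Longrightarrow> \<Phi> u z"
    for v a b s t
    unfolding Matched_def
  proof (intro allI impI ballI)
    fix u a' assume u: "v \<preceq> u" "a' \<in> D u" "EL u a' a"
    then obtain n k where k: "n \<in> D u" "k \<in> D u" "App u a n k" "isT u (rt k)" "a' = lf k" unfolding EL_def by blast
    then obtain m where m: "m \<in> D u" "App u s n m" "EL u (lf m) b" "Tap u (lf (rt m)) (pr (rt (rt m)) (pr (lf k) (lf m)))"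
      using s(2) u(1) unfolding Strategy_def by blast
    let ?j = "pr t (pr n (rt (rt m)))"
    let ?z = "pr ?j (pr a' (lf m))"
    have D: "t \<in> D u" using t by auto
    have j: "?j \<in> D u" using D k(1) m(1) by simp
    have z: "?z \<in> D u" using j u(2) m(1) by simp
    have "lf (lf ?z) = t" "lf (rt (lf ?z)) = n" "sub_z ?z = pr (rt (rt m)) (pr a' (lf m))"
      using D k(1) m(1) u(2) by (simp_all add: sub_z_def lf_pr[where w=u] rt_pr[where w=u])
    then have "\<Phi> u ?z" using step[OF u(1) z] k m unfolding Via_def by auto
    then have "Tap u p ?z" using Tap_p[OF le_trans[OF v u(1)] z] by simp
    then show "\<exists>b'\<in>D u. EL u b' b \<and> (\<exists>t\<in>D u. Tap u p (pr t (pr a' b')))" using m j by (intro bexI[of _ "lf m"]) auto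
  qed
  have step1: "\<Phi> u z" if "lf (lf z) = suc zero" "Via u q x (lf (rt (lf z))) (sub_z z)" for u z
    using that unfolding \<Phi>_def by blast
  have step2: "\<Phi> u z" if "lf (lf z) = suc (suc zero)" "Via u r y (lf (rt (lf z))) (sub_z z)" for u z
    using that unfolding \<Phi>_def by blast
  have sub: "Matched v p (lf (rt z)) (rt (rt z)) \<and> Matched v p (rt (rt z)) (lf (rt z))"
    if v: "w \<preceq> v" and z: "z \<in> D v" and s: "s \<in> D w" "Strategy w s a b" and a: "a \<in> D w" and t: "t = suc zero \<or> t = suc (suc zero)"
      and via: "Via v s a (lf (rt (lf z))) (sub_z z)"
      and step: "\<And>u z. lf (lf z) = t \<Longrightarrow> Via u s a (lf (rt (lf z))) (sub_z z) \<Longrightarrow> \<Phi> u z" for v z s a b t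
  proof -
    let ?n = "lf (rt (lf z))"
    have n: "?n \<in> D v" using z by simp
    obtain k m where k: "k \<in> D v" "App v a ?n k" "isT v (rt k)" and m: "m \<in> D v" "App v s ?n m" "Tap v (lf (rt m)) (sub_z z)"
      using via unfolding Via_def by blast
    obtain m' where m': "m' \<in> D v" "App v s ?n m'" "Bisim v (lf (rt m'))"
      using s(2) v n k unfolding Strategy_def by blast
    have "m' = m" using App_det[OF D_mono[OF v s(1)] n m'(1) m(1) m'(2) m(2)] .
    then have "Matched v (lf (rt m)) (lf (rt (sub_z z))) (rt (rt (sub_z z))) \<and>
        Matched v (lf (rt m)) (rt (rt (sub_z z))) (lf (rt (sub_z z)))"
      using m'(3) m(3) sub_z_D[OF z] le_refl unfolding Bisim_def by blast
    then have M: "Matched v (lf (rt m)) (lf (rt z)) (rt (rt z))" "Matched v (lf (rt m)) (rt (rt z)) (lf (rt z))"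
      using z by (simp_all add: sub_z_def lf_pr[where w=v] rt_pr[where w=v])
    have st: "\<Phi> u z'" if u: "v \<preceq> u" "z' \<in> D u" "lf (lf z') = t" "lf (rt (lf z')) = ?n" "Tap u (lf (rt m)) (sub_z z')" for u z'
    proof (rule step[OF u(3)])
      show "Via u s a (lf (rt (lf z'))) (sub_z z')"
        unfolding Via_def u(4) using k m u D_mono[OF u(1)] App_mono[OF u(1)] isT_mono[OF u(1)] by blast
    qed
    show ?thesis using matched[OF v M(1) t n st] matched[OF v M(2) t n st] by blast
  qed
  have "Bisim w p"
    unfolding Bisim_def
  proof (intro conjI allI impI ballI)
    fix v z assume v: "w \<preceq> v" "z \<in> D v"
    show "\<exists>k\<in>D v. App v p z k \<and> isM v k" using p(2)[OF v] unfolding Rep_def by blast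
  next
    fix v z assume v: "w \<preceq> v" "z \<in> D v" and "Tap v p z"
    then have "\<Phi> v z" using Tap_p by simp
    then have "Matched v p (lf (rt z)) (rt (rt z)) \<and> Matched v p (rt (rt z)) (lf (rt z))"
      unfolding \<Phi>_def
    proof (elim disjE conjE)
      assume "Root z"
      then have ab: "lf (rt z) = x" "rt (rt z) = y" unfolding Root_def by auto
      have later: "x \<in> D v" "y \<in> D v" "q \<in> D v" "r \<in> D v" "Strategy v q x y" "Strategy v r y x"
        using D_mono[OF v(1)] x y q r le_trans[OF v(1)] unfolding Strategy_def by blast+
      have "Matched v p x y" by (rule root[OF v(1) later(1,3,5), of "suc zero"]) (use step1 in auto)
      moreover have "Matched v p y x" by (rule root[OF v(1) later(2,4,6), of "suc (suc zero)"]) (use step2 in auto)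
      ultimately show ?thesis unfolding ab by blast
    next
      assume "lf (lf z) = suc zero" "Via v q x (lf (rt (lf z))) (sub_z z)"
      then show ?thesis using sub[OF v q x(1), of "suc zero"] step1 by blast
    next
      assume "lf (lf z) = suc (suc zero)" "Via v r y (lf (rt (lf z))) (sub_z z)"
      then show ?thesis using sub[OF v r y(1), of "suc (suc zero)"] step2 by blast
    qed
    then show "Matched v p (lf (rt z)) (rt (rt z))" "Matched v p (rt (rt z)) (lf (rt z))" by auto
  qed
  moreover have "Tap w p (pr (pr zero zero) (pr x y))"
    unfolding Tap_p[OF le_refl, of "pr (pr zero zero) (pr x y)", OF fn_D_simps(3)[OF fn_D_simps(3)[OF fn_D_simps(1) fn_D_simps(1)] fn_D_simps(3)[OF x(1) y(1)]]]
    using x(1) y(1) by (simp add: \<Phi>_def Root_def lf_pr[where w=w] rt_pr[where w=w])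
  ultimately show ?thesis unfolding EqE_def sat_bisimilar
    using p(1) by (intro bexI[of _ p] bexI[of _ "pr zero zero"]) auto
qed

lemma bisimilar_extensionality: "sat w e (interp bisimilar extensionality)"
  unfolding sat_extensionality using bisimilar_unfold bisimilar_fold by blast

end

lemma vset_equality_bisimilar: "vset_equality Xi bisimilar"
  unfolding vset_equality_def provable_def
  by (rule kripke_completeness) (rule kripke_model.bisimilar_extensionality)

section \<open>Set theory in a model\<close>

text \<open>\<open>E\<close> may be any formula; the laws of equality, membership and pairs are
  derived from its extensionality alone, with the help of induction on v-sets.\<close>

locale vset_model = kripke_model le D fn isV isM isT Xi
  for le :: "'w \<Rightarrow> 'w \<Rightarrow> bool" (infix "\<preceq>" 50)
    and D :: "'w \<Rightarrow> 'd set"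
    and fn :: "prfun \<Rightarrow> 'd list \<Rightarrow> 'd"
    and isV isM isT :: "'w \<Rightarrow> 'd \<Rightarrow> bool"
    and Xi :: prfun +
  fixes E :: fm
  assumes extensionality_sat: "(\<And>i. e i \<in> D w) \<Longrightarrow> sat w e (interp E extensionality)"
begin

abbreviation Eq :: "'w \<Rightarrow> 'd \<Rightarrow> 'd \<Rightarrow> bool" where "Eq \<equiv> EqE E"

definition VS :: "'w \<Rightarrow> 'd \<Rightarrow> bool" where
  "VS w x \<longleftrightarrow> x \<in> D w \<and> isV w x"

lemma VS_mono: "v \<preceq> w \<Longrightarrow> VS v x \<Longrightarrow> VS w x"
  unfolding VS_def using D_mono isV_mono by blast

lemma VS_D: "VS w x \<Longrightarrow> x \<in> D w"
  by (simp add: VS_def)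

lemma EL_VS: "VS w x \<Longrightarrow> EL w a x \<Longrightarrow> VS w a"
  unfolding VS_def using EL_D EL_isV by blast

lemma Eq_iff: "VS w x \<Longrightarrow> VS w y \<Longrightarrow> Eq w x y \<longleftrightarrow> MatchE E w x y \<and> MatchE E w y x"
  using extensionality_sat[of "\<lambda>_. zero" w, OF fn_D_simps(1)] le_refl
  unfolding sat_extensionality VS_def by blast

text \<open>The right-hand side of extensionality is symmetric, so symmetry takes no
  induction.\<close>

lemma Eq_sym: "VS w x \<Longrightarrow> VS w y \<Longrightarrow> Eq w x y \<Longrightarrow> Eq w y x"
  using Eq_iff by blast

lemma MatchE_D: "MatchE E w x y \<Longrightarrow> EL w a x \<Longrightarrow> \<exists>b. EL w b y \<and> Eq w a b"
  unfolding MatchE_def using EL_D le_refl by blast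

lemma definable_Eq:
  assumes "definable_tm w\<^sub>0 \<sigma>" "definable_tm w\<^sub>0 \<tau>"
  shows "definable (\<lambda>_. True) w\<^sub>0 (\<lambda>w e. Eq w (\<sigma> e) (\<tau> e))"
  unfolding EqE_def by (rule definable_sat2[OF assms])

text \<open>\<open>V2\<close> as induction over membership. The property is strengthened by
  \<open>isV\<close> so that the step may assume \<open>x\<close> to be a v-set, and
  single-valuedness identifies an element with the value treated by the axiom.\<close>

lemma VS_induct [consumes 2, case_names definable step]:
  assumes "w\<^sub>0 \<preceq> w" "VS w x"
    and def: "definable (\<lambda>_. True) w\<^sub>0 (\<lambda>w e. P w (e 0))"
    and step: "\<And>w x. w\<^sub>0 \<preceq> w \<Longrightarrow> VS w x \<Longrightarrow> (\<And>v a. w \<preceq> v \<Longrightarrow> EL v a x \<Longrightarrow> P v a) \<Longrightarrow> P w x"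
  shows "P w x"
proof -
  have "x \<in> D w" "isV w x" using assms(2) by (auto simp: VS_def)
  with assms(1) have "isV w x \<and> P w x"
  proof (induction rule: isV_induct)
    case definable
    show ?case by (rule definable_intros def)+
  next
    case (step w\<^sub>1 x)
    have V: "isV w\<^sub>1 x" by (rule isV_I[OF step(2)]) (use step(3) in blast)
    moreover have "P w\<^sub>1 x"
    proof (rule assms(4)[OF step(1)])
      show "VS w\<^sub>1 x" using V step(2) by (simp add: VS_def)
      fix v a assume v: "w\<^sub>1 \<preceq> v" "EL v a x"
      then obtain n k where k: "n \<in> D v" "k \<in> D v" "App v x n k" "isT v (rt k)" "a = lf k" unfolding EL_def by blast
      obtain l where l: "l \<in> D v" "App v x n l" "\<forall>u. v \<preceq> u \<longrightarrow> isT u (rt l) \<longrightarrow> isV u (lf l) \<and> P u (lf l)"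
        using step(3)[OF v(1) k(1)] by blast
      have "l = k" using App_det[OF D_mono[OF v(1) step(2)] k(1) l(1) k(2) l(2) k(3)] .
      then show "P v a" using l(3) k(4,5) le_refl by blast
    qed
    ultimately show ?case by simp
  qed
  then show ?thesis by simp
qed

lemma Eq_refl: "VS w x \<Longrightarrow> Eq w x x"
proof -
  assume "VS w x"
  with le_refl show ?thesis
  proof (induction rule: VS_induct)
    case definable
    show ?case by (rule definable_intros definable_Eq)+
  next
    case (step v x)
    have "MatchE E v x x" unfolding MatchE_def using step(3) by blast
    then show ?case using Eq_iff[OF step(2,2)] by blast
  qed
qed

text \<open>Induction on \<open>x\<close> with \<open>y\<close> and \<open>z\<close> arbitrary at
  later worlds. When an element of \<open>z\<close> is to be matched, the chain is still read from
  the element of \<open>x\<close> and then reversed.\<close>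

lemma Eq_trans:
  assumes "VS w x" "VS w y" "VS w z" "Eq w x y" "Eq w y z"
  shows "Eq w x z"
proof -
  from le_refl assms(1)
  have "\<forall>v. w \<preceq> v \<longrightarrow> (\<forall>y\<in>D v. \<forall>z\<in>D v. isV v y \<and> isV v z \<and> Eq v x y \<and> Eq v y z \<longrightarrow> Eq v x z)"
  proof (induction rule: VS_induct[where P="\<lambda>w x. \<forall>v. w \<preceq> v \<longrightarrow> (\<forall>y\<in>D v. \<forall>z\<in>D v.
      isV v y \<and> isV v z \<and> Eq v x y \<and> Eq v y z \<longrightarrow> Eq v x z)"])
    case definable
    show ?case by (rule definable_intros definable_Eq)+
  next
    case (step w\<^sub>1 x)
    show ?case
    proof (intro allI impI ballI, elim conjE)
      fix v y z assume v: "w\<^sub>1 \<preceq> v" and yz: "y \<in> D v" "z \<in> D v" "isV v y" "isV v z" and eq: "Eq v x y" "Eq v y z"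
      have V: "VS v x" "VS v y" "VS v z" using yz VS_mono[OF v step(2)] by (auto simp: VS_def)
      have M: "MatchE E v x y" "MatchE E v y x" "MatchE E v y z" "MatchE E v z y"
        using eq Eq_iff V by blast+
      have IH: "Eq u a c" if "v \<preceq> u" "EL u a x" "VS u b" "VS u c" "Eq u a b" "Eq u b c" for u a b c
        using step(3)[OF le_trans[OF v that(1)] that(2)] that le_refl unfolding VS_def by blast
      have "MatchE E v x z"
        unfolding MatchE_def
      proof (intro allI impI ballI)
        fix u a assume u: "v \<preceq> u" "a \<in> D u" "EL u a x"
        obtain b where b: "EL u b y" "Eq u a b" using MatchE_D[OF MatchE_mono[OF u(1) M(1)] u(3)] by blast
        obtain c where c: "EL u c z" "Eq u b c" using MatchE_D[OF MatchE_mono[OF u(1) M(3)] b(1)] by blast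
        have "VS u b" "VS u c" using EL_VS VS_mono[OF u(1)] V b(1) c(1) by blast+
        then show "\<exists>c\<in>D u. EL u c z \<and> Eq u a c" using IH[OF u(1,3) _ _ b(2) c(2)] c(1) EL_D by blast
      qed
      moreover have "MatchE E v z x"
        unfolding MatchE_def
      proof (intro allI impI ballI)
        fix u c assume u: "v \<preceq> u" "c \<in> D u" "EL u c z"
        obtain b where b: "EL u b y" "Eq u c b" using MatchE_D[OF MatchE_mono[OF u(1) M(4)] u(3)] by blast
        obtain a where a: "EL u a x" "Eq u b a" using MatchE_D[OF MatchE_mono[OF u(1) M(2)] b(1)] by blast
        have "VS u a" "VS u b" "VS u c" using EL_VS VS_mono[OF u(1)] V a(1) b(1) u(3) by blast+
        then show "\<exists>a\<in>D u. EL u a x \<and> Eq u c a" using IH[OF u(1) a(1)] a b Eq_sym EL_D by meson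
      qed
      ultimately show "Eq v x z" using Eq_iff V by blast
    qed
  qed
  then show ?thesis using assms le_refl unfolding VS_def by blast
qed

lemma Eq_same_values:
  assumes "VS w a" "VS w b" "same_values w a b"
  shows "Eq w a b"
proof -
  have "EL v c a \<longleftrightarrow> EL v c b" if "w \<preceq> v" for v c using same_values_EL[OF assms(3) that] .
  then have "MatchE E w a b" "MatchE E w b a"
    unfolding MatchE_def using Eq_refl EL_VS VS_mono assms(1,2) by blast+
  then show ?thesis using Eq_iff assms by blast
qed

definition Mem :: "'w \<Rightarrow> 'd \<Rightarrow> 'd \<Rightarrow> bool" where
  "Mem w x y \<longleftrightarrow> (\<exists>b\<in>D w. EL w b y \<and> Eq w x b)"

lemma Mem_mono: "v \<preceq> w \<Longrightarrow> Mem v x y \<Longrightarrow> Mem w x y"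
  unfolding Mem_def using D_mono EL_mono EqE_mono by blast

lemma EL_Mem: "VS w x \<Longrightarrow> EL w a x \<Longrightarrow> Mem w a x"
  unfolding Mem_def using EL_D EL_VS Eq_refl by blast

lemma Mem_Eq_left: "VS w x \<Longrightarrow> VS w x' \<Longrightarrow> VS w y \<Longrightarrow> Eq w x x' \<Longrightarrow> Mem w x y \<Longrightarrow> Mem w x' y"
  unfolding Mem_def using Eq_sym Eq_trans EL_VS by meson

lemma Mem_Eq_right:
  assumes "VS w x" "VS w y" "VS w y'" "Eq w y y'" "Mem w x y"
  shows "Mem w x y'"
proof -
  obtain b where b: "EL w b y" "Eq w x b" using assms(5) unfolding Mem_def by blast
  obtain c where c: "EL w c y'" "Eq w b c" using MatchE_D[OF _ b(1)] assms(2-4) Eq_iff by blast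
  show ?thesis unfolding Mem_def
    using b c Eq_trans[OF assms(1) EL_VS[OF assms(2) b(1)] EL_VS[OF assms(3) c(1)]] EL_D by blast
qed

lemma Eq_I:
  assumes "VS w x" "VS w y"
    and "\<And>v a. w \<preceq> v \<Longrightarrow> EL v a x \<Longrightarrow> Mem v a y"
    and "\<And>v a. w \<preceq> v \<Longrightarrow> EL v a y \<Longrightarrow> Mem v a x"
  shows "Eq w x y"
proof -
  have "MatchE E w x y" "MatchE E w y x" using assms(3,4) unfolding MatchE_def Mem_def by blast+
  then show ?thesis using Eq_iff assms(1,2) by blast
qed

text \<open>If \<open>x\<close> is equal to an element \<open>b\<close> of itself, then
  \<open>b\<close> is a member of itself, against the induction hypothesis.\<close>

lemma Mem_irrefl: "VS w x \<Longrightarrow> \<not> Mem w x x"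
proof -
  assume "VS w x"
  with le_refl have "\<forall>v. w \<preceq> v \<longrightarrow> Mem v x x \<longrightarrow> False"
  proof (induction rule: VS_induct[where P="\<lambda>w x. \<forall>v. w \<preceq> v \<longrightarrow> Mem v x x \<longrightarrow> False"])
    case definable
    show ?case unfolding Mem_def by (rule definable_intros definable_Eq definable_EL)+
  next
    case (step w\<^sub>1 x)
    show ?case
    proof (intro allI impI)
      fix v assume v: "w\<^sub>1 \<preceq> v" and m: "Mem v x x"
      have x: "VS v x" using VS_mono[OF v step(2)] .
      obtain b where b: "EL v b x" "Eq v x b" using m unfolding Mem_def by blast
      have bV: "VS v b" using EL_VS[OF x b(1)] .
      have "Mem v b b" using Mem_Eq_right[OF bV x bV b(2) Mem_Eq_left[OF x bV x b(2) m]] .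
      then show False using step(3)[OF v b(1)] le_refl by blast
    qed
  qed
  then show ?thesis using le_refl by blast
qed

subsection \<open>Pairs\<close>

definition Upair :: "'w \<Rightarrow> 'd \<Rightarrow> 'd \<Rightarrow> 'd \<Rightarrow> bool" where
  "Upair w u a b \<longleftrightarrow> Mem w a u \<and> Mem w b u \<and>
     (\<forall>v. w \<preceq> v \<longrightarrow> (\<forall>c\<in>D v. EL v c u \<longrightarrow> Eq v c a \<or> Eq v c b))"

definition Opair :: "'w \<Rightarrow> 'd \<Rightarrow> 'd \<Rightarrow> 'd \<Rightarrow> bool" where
  "Opair w p a b \<longleftrightarrow> (\<exists>u\<in>D w. isV w u \<and> (\<exists>u'\<in>D w. isV w u' \<and>
     Upair w u a a \<and> Upair w u' a b \<and> Upair w p u u'))"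

lemma sat_upair: "sat w e (interp E (s_upair u a b)) \<longleftrightarrow> Upair w (e u) (e a) (e b)"
  by (simp add: s_upair_def Upair_def Mem_def)

lemma sat_opair: "sat w e (interp E (s_opair p a b)) \<longleftrightarrow> Opair w (e p) (e a) (e b)"
  by (simp add: s_opair_def Opair_def sat_upair numeral_eq_Suc)

lemma Upair_mono: "v \<preceq> w \<Longrightarrow> Upair v u a b \<Longrightarrow> Upair w u a b"
  unfolding Upair_def using Mem_mono le_trans by blast

lemma Upair_Mem:
  assumes "VS w u" "VS w a" "VS w b" "VS w c" "Upair w u a b"
  shows "Mem w c u \<longleftrightarrow> Eq w c a \<or> Eq w c b"
proof
  assume "Mem w c u"
  then obtain d where d: "EL w d u" "Eq w c d" unfolding Mem_def by blast
  have "Eq w d a \<or> Eq w d b" using assms(5) d(1) EL_D le_refl unfolding Upair_def by blast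
  then show "Eq w c a \<or> Eq w c b" using Eq_trans[OF assms(4) EL_VS[OF assms(1) d(1)]] assms(2,3) d(2) by blast
next
  assume "Eq w c a \<or> Eq w c b"
  then show "Mem w c u" using assms Mem_Eq_left Eq_sym unfolding Upair_def by meson
qed

lemma Upair_cong:
  assumes V: "VS w u" "VS w u'" "VS w a" "VS w a'" "VS w b" "VS w b'"
    and eq: "Eq w u u'" "Eq w a a'" "Eq w b b'" and U: "Upair w u a b"
  shows "Upair w u' a' b'"
proof -
  have "Eq v c a' \<or> Eq v c b'" if v: "w \<preceq> v" "EL v c u'" for v c
  proof -
    note V' = V[THEN VS_mono[OF v(1)]]
    note eq' = eq[THEN EqE_mono[OF v(1)]]
    have c: "VS v c" using EL_VS[OF V'(2) v(2)] .
    have "Mem v c u" using Mem_Eq_right[OF c V'(2,1)] EL_Mem[OF V'(2) v(2)] Eq_sym V'(1,2) eq'(1) by blast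
    then have "Eq v c a \<or> Eq v c b" using Upair_Mem[OF V'(1,3,5) c Upair_mono[OF v(1) U]] by blast
    then show ?thesis using Eq_trans[OF c V'(3,4)] Eq_trans[OF c V'(5,6)] eq' by blast
  qed
  moreover have "Mem w a' u" "Mem w b' u"
    using U Mem_Eq_left[OF V(3,4,1) eq(2)] Mem_Eq_left[OF V(5,6,1) eq(3)] unfolding Upair_def by blast+
  then have "Mem w a' u'" "Mem w b' u'" using Mem_Eq_right[OF _ V(1,2) eq(1)] V by blast+
  ultimately show ?thesis unfolding Upair_def by blast
qed

lemma Opair_cong:
  assumes V: "VS w p" "VS w p'" "VS w a" "VS w a'" "VS w b" "VS w b'"
    and eq: "Eq w p p'" "Eq w a a'" "Eq w b b'" and O: "Opair w p a b"
  shows "Opair w p' a' b'"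
proof -
  obtain u u' where u: "VS w u" "VS w u'" "Upair w u a a" "Upair w u' a b" "Upair w p u u'"
    using O unfolding Opair_def VS_def by blast
  have "Upair w u a' a'" "Upair w u' a' b'" "Upair w p' u u'"
    using Upair_cong[OF u(1,1) V(3,4,3,4) Eq_refl[OF u(1)] eq(2,2) u(3)]
      Upair_cong[OF u(2,2) V(3,4,5,6) Eq_refl[OF u(2)] eq(2,3) u(4)]
      Upair_cong[OF V(1,2) u(1,1,2,2) eq(1) Eq_refl[OF u(1)] Eq_refl[OF u(2)] u(5)] .
  then show ?thesis using u(1,2) unfolding Opair_def VS_def by blast
qed

text \<open>Kuratowski's argument, split by which of \<open>t\<close>, \<open>t'\<close> equals
  \<open>u\<close> and which equals \<open>u'\<close>. These disjunctions hold outright at the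
  world; whether \<open>a\<close> equals \<open>b\<close> is never decided.\<close>

lemma Opair_inject:
  assumes V: "VS w p" "VS w a" "VS w b" "VS w c" "VS w d" and ab: "Opair w p a b" and cd: "Opair w p c d"
  shows "Eq w a c \<and> Eq w b d"
proof -
  obtain u u' where u: "VS w u" "VS w u'" "Upair w u a a" "Upair w u' a b" "Upair w p u u'"
    using ab unfolding Opair_def VS_def by blast
  obtain t t' where t: "VS w t" "VS w t'" "Upair w t c c" "Upair w t' c d" "Upair w p t t'"
    using cd unfolding Opair_def VS_def by blast
  have mu: "Mem w x u \<longleftrightarrow> Eq w x a" "Mem w x u' \<longleftrightarrow> Eq w x a \<or> Eq w x b"
    "Mem w x t \<longleftrightarrow> Eq w x c" "Mem w x t' \<longleftrightarrow> Eq w x c \<or> Eq w x d" if "VS w x" for x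
    using Upair_Mem[OF u(1) V(2,2) that u(3)] Upair_Mem[OF u(2) V(2,3) that u(4)]
      Upair_Mem[OF t(1) V(4,4) that t(3)] Upair_Mem[OF t(2) V(4,5) that t(4)] by auto
  have p: "Eq w u t \<or> Eq w u t'" "Eq w u' t \<or> Eq w u' t'" "Eq w t' u \<or> Eq w t' u'"
    using Upair_Mem[OF V(1) t(1,2) u(1) t(5)] Upair_Mem[OF V(1) t(1,2) u(2) t(5)]
      Upair_Mem[OF V(1) u(1,2) t(2) u(5)] u(5) t(5) unfolding Upair_def by blast+
  have mcong: "Mem w x y \<Longrightarrow> Mem w x z" if "Eq w y z" "VS w x" "VS w y" "VS w z" for x y z
    using Mem_Eq_right[OF that(2-4,1)] .
  note r = Eq_refl[OF V(2)] Eq_refl[OF V(3)] Eq_refl[OF V(4)] Eq_refl[OF V(5)]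
  have ac: "Eq w a c"
    using p(1)
  proof
    assume "Eq w u t"
    then show ?thesis using mcong[OF _ V(2) u(1) t(1)] mu V r by blast
  next
    assume "Eq w u t'"
    then have "Mem w c u" using mcong[OF Eq_sym[OF u(1) t(2)] V(4) t(2) u(1)] mu V r by blast
    then show ?thesis using mu(1)[OF V(4)] Eq_sym[OF V(4,2)] by blast
  qed
  have "Eq w b d"
    using p(2)
  proof
    assume 1: "Eq w u' t"
    have bc: "Eq w b c" using mcong[OF 1 V(3) u(2) t(1)] mu V r by blast
    from p(3) show ?thesis
    proof
      assume "Eq w t' u"
      then have "Eq w d a" using mcong[OF _ V(5) t(2) u(1)] mu V r by blast
      then show ?thesis using bc ac Eq_sym Eq_trans V by meson
    next
      assume "Eq w t' u'"
      then have "Mem w d u'" using mcong[OF _ V(5) t(2) u(2)] mu V r by blast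
      then have "Eq w d c" using mcong[OF 1 V(5) u(2) t(1)] mu V by blast
      then show ?thesis using bc Eq_sym Eq_trans V by meson
    qed
  next
    assume 2: "Eq w u' t'"
    have "Eq w b c \<or> Eq w b d" using mcong[OF 2 V(3) u(2) t(2)] mu V r by blast
    moreover have "Eq w d a \<or> Eq w d b"
      using mcong[OF Eq_sym[OF u(2) t(2) 2] V(5) t(2) u(2)] mu V r by blast
    ultimately show ?thesis using ac Eq_sym Eq_trans V by meson
  qed
  then show ?thesis using ac by blast
qed

text \<open>The v-set with entry \<open>a\<close> at index 0 and entry \<open>b\<close> at every
  other index, always under a true condition.\<close>

lemma ex_upair:
  assumes a: "VS w a" and b: "VS w b"
  obtains u where "VS w u" "Upair w u a b"
proof -
  obtain t where t: "t \<in> D w" "isM w t" "isT w t" using ex_true by blast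
  have D: "a \<in> D v" "b \<in> D v" "t \<in> D v" "isV v a" "isV v b" "isM v t" "isT v t" if "w \<preceq> v" for v
    using that a b t D_mono isM_mono isT_mono VS_mono unfolding VS_def by blast+
  obtain u where u: "u \<in> D w" "isV w u"
    "\<And>v n. w \<preceq> v \<Longrightarrow> n \<in> D v \<Longrightarrow> \<exists>k\<in>D v. App v u n k \<and>
      (n = zero \<and> k = pr a t \<or> (\<forall>u. v \<preceq> u \<longrightarrow> n = zero \<longrightarrow> False) \<and> k = pr b t)"
    "\<And>v n k. w \<preceq> v \<Longrightarrow> n \<in> D v \<Longrightarrow> k \<in> D v \<Longrightarrow> App v u n k \<Longrightarrow>
      n = zero \<and> k = pr a t \<or> (\<forall>u. v \<preceq> u \<longrightarrow> n = zero \<longrightarrow> False) \<and> k = pr b t"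
  proof (rule ex_vset[of w "\<lambda>v n k. n = zero \<and> k = pr a t \<or> (\<forall>u. v \<preceq> u \<longrightarrow> n = zero \<longrightarrow> False) \<and> k = pr b t"])
    show "definable (\<lambda>_. True) w (\<lambda>v e. e (Suc 0) = zero \<and> e 0 = pr a t \<or>
        (\<forall>u. v \<preceq> u \<longrightarrow> e (Suc 0) = zero \<longrightarrow> False) \<and> e 0 = pr b t)"
      by (rule definable_intros VS_D a b t)+
    show "\<exists>k\<in>D v. n = zero \<and> k = pr a t \<or> (\<forall>u. v \<preceq> u \<longrightarrow> n = zero \<longrightarrow> False) \<and> k = pr b t"
      if "w \<preceq> v" "n \<in> D v" for v n
      using D[OF that(1)] by (cases "n = zero") auto
    show "isM v (rt k) \<and> (\<forall>u. v \<preceq> u \<longrightarrow> isT u (rt k) \<longrightarrow> isV u (lf k))"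
      if "w \<preceq> v" "n \<in> D v" "k \<in> D v"
        "n = zero \<and> k = pr a t \<or> (\<forall>u. v \<preceq> u \<longrightarrow> n = zero \<longrightarrow> False) \<and> k = pr b t" for v n k
      using that(4) D[OF that(1)] isV_mono by (auto simp: lf_pr[where w=v] rt_pr[where w=v])
  qed blast
  have EL: "EL v a u" "EL v b u" if v: "w \<preceq> v" for v
  proof -
    have "App v u zero (pr a t)" using u(3)[OF v, of zero] le_refl by auto
    then show "EL v a u" unfolding EL_def using D[OF v]
      by (intro bexI[of _ zero] bexI[of _ "pr a t"]) (auto simp: lf_pr[where w=v] rt_pr[where w=v])
    have "App v u (suc zero) (pr b t)" using u(3)[OF v, of "suc zero"] suc_not_zero[of zero v] by auto
    then show "EL v b u" unfolding EL_def using D[OF v]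
      by (intro bexI[of _ "suc zero"] bexI[of _ "pr b t"]) (auto simp: lf_pr[where w=v] rt_pr[where w=v])
  qed
  have "c = a \<or> c = b" if v: "w \<preceq> v" and "EL v c u" for v c
  proof -
    obtain n k where k: "n \<in> D v" "k \<in> D v" "App v u n k" "c = lf k" using \<open>EL v c u\<close> unfolding EL_def by blast
    have "k = pr a t \<or> k = pr b t" using u(4)[OF v k(1-3)] by blast
    then show ?thesis using k(4) D[OF v] by (auto simp: lf_pr[where w=v])
  qed
  moreover have uV: "VS w u" using u by (simp add: VS_def)
  ultimately have "Upair w u a b"
    unfolding Upair_def using EL_Mem EL[OF le_refl] Eq_refl a b VS_mono by blast
  then show ?thesis using that uV by blast
qed

lemma ex_opair:
  assumes a: "VS w a" and b: "VS w b"
  obtains p where "VS w p" "Opair w p a b"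
proof -
  obtain u where u: "VS w u" "Upair w u a a" using ex_upair[OF a a] .
  obtain u' where u': "VS w u'" "Upair w u' a b" using ex_upair[OF a b] .
  obtain p where p: "VS w p" "Upair w p u u'" using ex_upair[OF u(1) u'(1)] .
  have "Opair w p a b" using u u' p unfolding Opair_def VS_def by blast
  then show ?thesis using that p by blast
qed

section \<open>Empty set and successor\<close>

lemma ex_empty:
  obtains z where "VS w z" "\<And>v c. w \<preceq> v \<Longrightarrow> \<not> EL v c z"
proof -
  obtain t where t: "t \<in> D w" "isM w t" "\<And>v. w \<preceq> v \<Longrightarrow> \<not> isT v t" using ex_false by blast
  have D: "t \<in> D v" "isM v t" if "w \<preceq> v" for v using that t D_mono isM_mono by blast+
  obtain z where z: "z \<in> D w" "isV w z"
    "\<And>v n k. w \<preceq> v \<Longrightarrow> n \<in> D v \<Longrightarrow> k \<in> D v \<Longrightarrow> App v z n k \<Longrightarrow> k = pr zero t"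
  proof (rule ex_vset[of w "\<lambda>v n k. k = pr zero t"])
    show "definable (\<lambda>_. True) w (\<lambda>v e. e 0 = pr zero t)" by (rule definable_intros t)+
    show "\<exists>k\<in>D v. k = pr zero t" if "w \<preceq> v" "n \<in> D v" for v n using D[OF that(1)] by auto
    show "isM v (rt k) \<and> (\<forall>u. v \<preceq> u \<longrightarrow> isT u (rt k) \<longrightarrow> isV u (lf k))"
      if "w \<preceq> v" "n \<in> D v" "k \<in> D v" "k = pr zero t" for v n k
      using that D[OF that(1)] t(3) le_trans[OF that(1)] by (auto simp: lf_pr[where w=v] rt_pr[where w=v])
  qed blast
  have "\<not> EL v c z" if v: "w \<preceq> v" for v c
    using z(3)[OF v] t(3)[OF v] D[OF v] unfolding EL_def by (metis fn_D_simps(1) rt_pr)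
  then show ?thesis using that z(1,2) by (auto simp: VS_def)
qed

text \<open>Members are compared as codes rather than up to \<open>Eq\<close>. This exact form is
  preserved along the numerals, so that smaller numerals are literally elements of larger
  ones.\<close>

definition Succ_of :: "'w \<Rightarrow> 'd \<Rightarrow> 'd \<Rightarrow> bool" where
  "Succ_of w s n \<longleftrightarrow> (\<forall>v. w \<preceq> v \<longrightarrow> (\<forall>c\<in>D v. EL v c s \<longrightarrow> EL v c n \<or> c = n)) \<and>
     (\<forall>v. w \<preceq> v \<longrightarrow> (\<forall>c\<in>D v. EL v c n \<or> c = n \<longrightarrow> EL v c s))"

text \<open>The entries of \<open>n\<close> are shifted by one index and \<open>n\<close> itself is
  put at index 0 under a true condition.\<close>

lemma ex_succ:
  assumes n: "VS w n"
  obtains s where "VS w s" "Succ_of w s n"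
proof -
  obtain t where t: "t \<in> D w" "isM w t" "isT w t" using ex_true by blast
  have D: "n \<in> D v" "t \<in> D v" "isV v n" "isM v t" "isT v t" if "w \<preceq> v" for v
    using that n t D_mono isM_mono isT_mono VS_mono unfolding VS_def by blast+
  obtain s where s: "s \<in> D w" "isV w s"
    "\<And>v i. w \<preceq> v \<Longrightarrow> i \<in> D v \<Longrightarrow> \<exists>k\<in>D v. App v s i k \<and>
      (i = zero \<and> k = pr n t \<or> (\<exists>j\<in>D v. i = suc j \<and> App v n j k))"
    "\<And>v i k. w \<preceq> v \<Longrightarrow> i \<in> D v \<Longrightarrow> k \<in> D v \<Longrightarrow> App v s i k \<Longrightarrow>
      i = zero \<and> k = pr n t \<or> (\<exists>j\<in>D v. i = suc j \<and> App v n j k)"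
  proof (rule ex_vset[of w "\<lambda>v i k. i = zero \<and> k = pr n t \<or> (\<exists>j\<in>D v. i = suc j \<and> App v n j k)"])
    show "definable (\<lambda>_. True) w (\<lambda>v e. e (Suc 0) = zero \<and> e 0 = pr n t \<or>
        (\<exists>j\<in>D v. e (Suc 0) = suc j \<and> App v n j (e 0)))"
      by (rule definable_intros VS_D n t)+
    show "\<exists>k\<in>D v. i = zero \<and> k = pr n t \<or> (\<exists>j\<in>D v. i = suc j \<and> App v n j k)" if v: "w \<preceq> v" "i \<in> D v" for v i
    proof (cases rule: D_cases[OF v(2)])
      case 1
      then show ?thesis using D[OF v(1)] by auto
    next
      case (2 j)
      then show ?thesis using isV_total[OF D(1,3)[OF v(1)] 2(1)] by metis
    qed
    show "isM v (rt k) \<and> (\<forall>u. v \<preceq> u \<longrightarrow> isT u (rt k) \<longrightarrow> isV u (lf k))"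
      if v: "w \<preceq> v" "i \<in> D v" "k \<in> D v" "i = zero \<and> k = pr n t \<or> (\<exists>j\<in>D v. i = suc j \<and> App v n j k)" for v i k
      using v(4)
    proof
      assume "i = zero \<and> k = pr n t"
      then show ?thesis using D[OF v(1)] isV_mono by (auto simp: lf_pr[where w=v] rt_pr[where w=v])
    next
      assume "\<exists>j\<in>D v. i = suc j \<and> App v n j k"
      then obtain j where j: "j \<in> D v" "App v n j k" by blast
      have "isV u (lf k)" if "v \<preceq> u" "isT u (rt k)" for u
        using isV_val(2)[OF D(1,3)[OF le_trans[OF v(1) that(1)]] D_mono[OF that(1) j(1)]
            D_mono[OF that(1) v(3)] App_mono[OF that(1) j(2)] that(2)] .
      then show ?thesis using isV_val(1)[OF D(1,3)[OF v(1)] j(1) v(3) j(2)] by blast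
    qed
  qed blast
  have "Succ_of w s n"
    unfolding Succ_of_def
  proof (intro conjI allI impI ballI)
    fix v c assume v: "w \<preceq> v" "c \<in> D v" "EL v c s"
    then obtain i k where k: "i \<in> D v" "k \<in> D v" "App v s i k" "isT v (rt k)" "c = lf k" unfolding EL_def by blast
    from s(4)[OF v(1) k(1-3)] show "EL v c n \<or> c = n"
      using k D[OF v(1)] unfolding EL_def by (auto simp: lf_pr[where w=v])
  next
    fix v c assume v: "w \<preceq> v" "c \<in> D v" "EL v c n \<or> c = n"
    from v(3) show "EL v c s"
    proof
      assume "EL v c n"
      then obtain j k where k: "j \<in> D v" "k \<in> D v" "App v n j k" "isT v (rt k)" "c = lf k" unfolding EL_def by blast
      have j: "suc j \<in> D v" "suc j \<noteq> zero" using k(1) suc_not_zero by auto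
      obtain l j' where l: "l \<in> D v" "App v s (suc j) l" "j' \<in> D v" "suc j = suc j'" "App v n j' l"
        using s(3)[OF v(1) j(1)] j(2) by blast
      have "j' = j" using l(3,4) k(1) suc_inject by blast
      then have "l = k" using App_det[OF D(1)[OF v(1)] k(1) l(1) k(2)] l(5) k(3) by blast
      then show ?thesis unfolding EL_def using j l k by blast
    next
      assume "c = n"
      moreover have "App v s zero (pr n t)"
        using s(3)[OF v(1), of zero] suc_not_zero[THEN not_sym, of _ v] by auto
      ultimately show ?thesis unfolding EL_def using D[OF v(1)]
        by (intro bexI[of _ zero] bexI[of _ "pr n t"]) (auto simp: lf_pr[where w=v] rt_pr[where w=v])
    qed
  qed
  then show ?thesis using that s(1,2) by (auto simp: VS_def)
qed

end

context vset_model
begin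

subsection \<open>Numerals\<close>

text \<open>\<open>z\<close> is the result of iterating \<open>g\<close> from
  \<open>z\<^sub>0\<close> exactly \<open>n\<close> times. Coding the sequence of iterates by an
  index \<open>f\<close> makes this definable; beyond \<open>n\<close> the sequence only has to be
  total.\<close>

definition Iter :: "'w \<Rightarrow> 'd \<Rightarrow> 'd \<Rightarrow> 'd \<Rightarrow> 'd \<Rightarrow> bool" where
  "Iter w g z\<^sub>0 n z \<longleftrightarrow> (\<exists>f\<in>D w. (\<forall>v. w \<preceq> v \<longrightarrow> (\<forall>i\<in>D v. \<exists>k\<in>D v. App v f i k)) \<and> App w f zero z\<^sub>0 \<and>
     (\<forall>v. w \<preceq> v \<longrightarrow> (\<forall>i\<in>D v. Lt i n \<longrightarrow> (\<exists>a\<in>D v. \<exists>b\<in>D v. App v f i a \<and> App v f (suc i) b \<and> App v g a b))) \<and>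
     App w f n z)"

lemma Iter_zero:
  assumes "z\<^sub>0 \<in> D w" "z \<in> D w" "Iter w g z\<^sub>0 zero z"
  shows "z = z\<^sub>0"
  using assms App_det fn_D_simps(1) unfolding Iter_def by blast

lemma Iter_suc:
  assumes n: "n \<in> D w" and z: "z \<in> D w" and it: "Iter w g z\<^sub>0 (suc n) z"
  shows "\<exists>y\<in>D w. Iter w g z\<^sub>0 n y \<and> App w g y z"
proof -
  obtain f where f: "f \<in> D w" "\<forall>v. w \<preceq> v \<longrightarrow> (\<forall>i\<in>D v. \<exists>k\<in>D v. App v f i k)" "App w f zero z\<^sub>0"
    "\<And>v i. w \<preceq> v \<Longrightarrow> i \<in> D v \<Longrightarrow> Lt i (suc n) \<Longrightarrow>
      \<exists>a\<in>D v. \<exists>b\<in>D v. App v f i a \<and> App v f (suc i) b \<and> App v g a b" "App w f (suc n) z"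
    using it unfolding Iter_def by blast
  obtain y b where y: "y \<in> D w" "b \<in> D w" "App w f n y" "App w f (suc n) b" "App w g y b"
    using f(4)[OF le_refl n Lt_suc_self[OF n]] by blast
  have "b = z" using App_det[OF f(1) _ y(2) z y(4) f(5)] n by simp
  moreover have "Lt i (suc n)" if "w \<preceq> v" "i \<in> D v" "Lt i n" for v i
    using that D_mono[OF that(1) n] by (simp add: Lt_suc[where w=v])
  then have "Iter w g z\<^sub>0 n y" unfolding Iter_def using f y by (intro bexI[of _ f]) auto
  ultimately show ?thesis using y by blast
qed

lemma Iter_unique:
  assumes g: "g \<in> D w" and z\<^sub>0: "z\<^sub>0 \<in> D w" and "n \<in> D w" "y \<in> D w" "z \<in> D w" "Iter w g z\<^sub>0 n y" "Iter w g z\<^sub>0 n z"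
  shows "y = z"
proof -
  from le_refl assms(3)
  have "\<forall>v. w \<preceq> v \<longrightarrow> (\<forall>y\<in>D v. \<forall>z\<in>D v. Iter v g z\<^sub>0 n y \<and> Iter v g z\<^sub>0 n z \<longrightarrow> y = z)"
  proof (induction rule: D_induct[where P="\<lambda>w n. \<forall>v. w \<preceq> v \<longrightarrow> (\<forall>y\<in>D v. \<forall>z\<in>D v.
      Iter v g z\<^sub>0 n y \<and> Iter v g z\<^sub>0 n z \<longrightarrow> y = z)"])
    case definable
    show ?case unfolding Iter_def by (rule definable_intros definable_Lt g z\<^sub>0)+
  next
    case zero
    show ?case using Iter_zero D_mono z\<^sub>0 by blast
  next
    case (suc u n)
    show ?case
    proof (intro allI impI ballI, elim conjE)
      fix v y z assume v: "u \<preceq> v" "y \<in> D v" "z \<in> D v" and it: "Iter v g z\<^sub>0 (suc n) y" "Iter v g z\<^sub>0 (suc n) z"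
      have n: "n \<in> D v" using D_mono[OF v(1) suc(2)] .
      obtain y' where y': "y' \<in> D v" "Iter v g z\<^sub>0 n y'" "App v g y' y" using Iter_suc[OF n v(2) it(1)] by blast
      obtain z' where z': "z' \<in> D v" "Iter v g z\<^sub>0 n z'" "App v g z' z" using Iter_suc[OF n v(3) it(2)] by blast
      have "y' = z'" using suc(3) v(1) y' z' by blast
      then show "y = z"
        using App_det[OF D_mono[OF le_trans[OF suc(1) v(1)] g] y'(1) v(2,3) y'(3)] z'(3) by blast
    qed
  qed
  then show ?thesis using assms le_refl by blast
qed

lemma Iter_exists:
  assumes g: "g \<in> D w" and z\<^sub>0: "z\<^sub>0 \<in> D w" "isV w z\<^sub>0" and n: "n \<in> D w"
    and step: "\<And>v a. w \<preceq> v \<Longrightarrow> a \<in> D v \<Longrightarrow> isV v a \<Longrightarrow> \<exists>b\<in>D v. App v g a b \<and> isV v b"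
  shows "\<exists>z\<in>D w. isV w z \<and> Iter w g z\<^sub>0 n z"
  using le_refl n
proof (induction rule: D_induct)
  case definable
  show ?case unfolding Iter_def by (rule definable_intros definable_Lt g z\<^sub>0)+
next
  case zero
  have "\<exists>f\<in>D w. \<forall>v n. w \<preceq> v \<longrightarrow> n \<in> D v \<longrightarrow> (\<exists>k\<in>D v. App v f n k \<and> k = z\<^sub>0)"
  proof (rule CT)
    show "definable (\<lambda>_. True) w (\<lambda>w e. e 0 = z\<^sub>0)" by (rule definable_intros z\<^sub>0)+
  qed (use D_mono z\<^sub>0 in blast)
  then obtain f where f: "f \<in> D w" "\<And>v n. w \<preceq> v \<Longrightarrow> n \<in> D v \<Longrightarrow> z\<^sub>0 \<in> D v \<and> App v f n z\<^sub>0" by blast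
  have "Iter w g z\<^sub>0 zero z\<^sub>0" unfolding Iter_def
  proof (intro bexI[OF _ f(1)] conjI allI impI ballI)
    show "App w f zero z\<^sub>0" "App w f zero z\<^sub>0" using f(2)[OF le_refl, of zero] by auto
    show "\<exists>k\<in>D v. App v f i k" if "w \<preceq> v" "i \<in> D v" for v i using f(2)[OF that] by blast
    show "\<exists>a\<in>D v. \<exists>b\<in>D v. App v f i a \<and> App v f (suc i) b \<and> App v g a b" if "w \<preceq> v" "i \<in> D v" "Lt i zero" for v i
      using that not_Lt_zero by blast
  qed
  then show ?case using z\<^sub>0 by blast
next
  case (suc u n)
  then obtain z f where z: "z \<in> D u" "isV u z" and f: "f \<in> D u" "\<And>v i. u \<preceq> v \<Longrightarrow> i \<in> D v \<Longrightarrow> \<exists>k\<in>D v. App v f i k"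
    "App u f zero z\<^sub>0" "\<And>v i. u \<preceq> v \<Longrightarrow> i \<in> D v \<Longrightarrow> Lt i n \<Longrightarrow>
      \<exists>a\<in>D v. \<exists>b\<in>D v. App v f i a \<and> App v f (suc i) b \<and> App v g a b" "App u f n z"
    unfolding Iter_def by blast
  obtain b where b: "b \<in> D u" "App u g z b" "isV u b" using step[OF suc(1) z] by blast
  have n': "suc n \<in> D u" using suc(2) by simp
  \<comment> \<open>The old sequence with its value at \<open>suc n\<close> replaced by the next
    iterate.\<close>
  have "\<exists>f'\<in>D u. \<forall>v i. u \<preceq> v \<longrightarrow> i \<in> D v \<longrightarrow> (\<exists>k\<in>D v. App v f' i k \<and>
      (i = suc n \<and> k = b \<or> (\<forall>t. v \<preceq> t \<longrightarrow> i = suc n \<longrightarrow> False) \<and> App v f i k))"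
  proof (rule CT)
    show "definable (\<lambda>_. True) u (\<lambda>v e. e (Suc 0) = suc n \<and> e 0 = b \<or>
        (\<forall>t. v \<preceq> t \<longrightarrow> e (Suc 0) = suc n \<longrightarrow> False) \<and> App v f (e (Suc 0)) (e 0))"
      by (rule definable_intros suc(2) b f)+
    show "\<exists>k\<in>D v. i = suc n \<and> k = b \<or> (\<forall>t. v \<preceq> t \<longrightarrow> i = suc n \<longrightarrow> False) \<and> App v f i k"
      if "u \<preceq> v" "i \<in> D v" for v i
      using f(2)[OF that] D_mono[OF that(1) b(1)] by (cases "i = suc n") auto
  qed
  then obtain f' where f': "f' \<in> D u" "\<And>v i. u \<preceq> v \<Longrightarrow> i \<in> D v \<Longrightarrow> \<exists>k\<in>D v. App v f' i k \<and>
      (i = suc n \<and> k = b \<or> (\<forall>t. v \<preceq> t \<longrightarrow> i = suc n \<longrightarrow> False) \<and> App v f i k)" by blast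
  have new: "App v f' (suc n) b" if "u \<preceq> v" for v
    using f'(2)[OF that D_mono[OF that n']] le_refl by blast
  have old: "App v f' i k" if v: "u \<preceq> v" "i \<in> D v" "k \<in> D v" "i \<noteq> suc n" "App v f i k" for v i k
    using f'(2)[OF v(1,2)] v(4) App_det[OF D_mono[OF v(1) f(1)] v(2,3) _ v(5)] by blast
  have "Iter u g z\<^sub>0 (suc n) b" unfolding Iter_def
  proof (intro bexI[OF _ f'(1)] conjI allI impI ballI)
    show "App u f' (suc n) b" by (rule new[OF le_refl])
    show "App u f' zero z\<^sub>0"
      using old[OF le_refl _ D_mono[OF suc(1) z\<^sub>0(1)] _ f(3)] suc_not_zero[OF suc(2)] by force
    show "\<exists>k\<in>D v. App v f' i k" if "u \<preceq> v" "i \<in> D v" for v i using f'(2)[OF that] by blast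
    show "\<exists>a\<in>D v. \<exists>b\<in>D v. App v f' i a \<and> App v f' (suc i) b \<and> App v g a b"
      if v: "u \<preceq> v" "i \<in> D v" "Lt i (suc n)" for v i
    proof -
      have nv: "n \<in> D v" using D_mono[OF v(1) suc(2)] .
      have ne: "i \<noteq> suc n" using v(3) not_Lt_self[of "suc n" v] nv by auto
      have "Lt i n \<or> i = n" using v nv Lt_suc by blast
      then show ?thesis
      proof
        assume lt: "Lt i n"
        then obtain a c where ac: "a \<in> D v" "c \<in> D v" "App v f i a" "App v f (suc i) c" "App v g a c"
          using f(4)[OF v(1,2)] by blast
        have "suc i \<noteq> suc n" using lt not_Lt_self[OF nv] suc_inject[OF v(2) nv] by auto
        then have "App v f' (suc i) c" using old[OF v(1) _ ac(2) _ ac(4)] v(2) by simp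
        then show ?thesis using old[OF v(1,2) ac(1) ne ac(3)] ac by blast
      next
        assume "i = n"
        moreover have "App v f' i z" using old[OF v(1,2) D_mono[OF v(1) z(1)] ne] App_mono[OF v(1) f(5)] \<open>i = n\<close> by simp
        ultimately show ?thesis
          using new[OF v(1)] App_mono[OF v(1) b(2)] D_mono[OF v(1) z(1)] D_mono[OF v(1) b(1)] by blast
      qed
    qed
  qed
  then show ?case using b by blast
qed

definition Numerals :: "'w \<Rightarrow> 'd \<Rightarrow> bool" where
  "Numerals w \<nu> \<longleftrightarrow> \<nu> \<in> D w \<and>
     (\<forall>v n. w \<preceq> v \<longrightarrow> n \<in> D v \<longrightarrow> (\<exists>z. VS v z \<and> App v \<nu> n z)) \<and>
     (\<forall>v z c. w \<preceq> v \<longrightarrow> z \<in> D v \<longrightarrow> App v \<nu> zero z \<longrightarrow> \<not> EL v c z) \<and>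
     (\<forall>v n z z'. w \<preceq> v \<longrightarrow> n \<in> D v \<longrightarrow> z \<in> D v \<longrightarrow> z' \<in> D v \<longrightarrow> App v \<nu> n z \<longrightarrow> App v \<nu> (suc n) z' \<longrightarrow>
        Succ_of v z' z)"

lemma ex_numerals: "\<exists>\<nu>. Numerals w \<nu>"
proof -
  obtain z\<^sub>0 where z\<^sub>0: "VS w z\<^sub>0" "\<And>v c. w \<preceq> v \<Longrightarrow> \<not> EL v c z\<^sub>0" using ex_empty[of w] by blast
  \<comment> \<open>Being a v-set is atomic, hence an almost negative domain on which a successor
    function can be chosen.\<close>
  have "\<exists>g\<in>D w. \<forall>v a. w \<preceq> v \<longrightarrow> a \<in> D v \<longrightarrow> isV v a \<longrightarrow> (\<exists>b\<in>D v. App v g a b \<and> (isV v b \<and> Succ_of v b a))"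
  proof (rule ECT)
    show "definable (\<lambda>_. True) w (\<lambda>v e. isV v (e 0) \<and> Succ_of v (e 0) (e (Suc 0)))"
      unfolding Succ_of_def by (rule definable_intros definable_EL)+
    show "\<exists>b\<in>D v. isV v b \<and> Succ_of v b a" if "w \<preceq> v" "a \<in> D v" "isV v a" for v a
      using ex_succ[of v a] that unfolding VS_def by metis
  qed (rule definable_intros)+
  then obtain g where g: "g \<in> D w"
    "\<And>v a. w \<preceq> v \<Longrightarrow> a \<in> D v \<Longrightarrow> isV v a \<Longrightarrow> \<exists>b\<in>D v. App v g a b \<and> isV v b \<and> Succ_of v b a" by blast
  have z: "z\<^sub>0 \<in> D w" "isV w z\<^sub>0" using z\<^sub>0(1) by (auto simp: VS_def)
  have "\<exists>\<nu>\<in>D w. \<forall>v n. w \<preceq> v \<longrightarrow> n \<in> D v \<longrightarrow> (\<exists>k\<in>D v. App v \<nu> n k \<and> (isV v k \<and> Iter v g z\<^sub>0 n k))"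
  proof (rule CT)
    show "definable (\<lambda>_. True) w (\<lambda>v e. isV v (e 0) \<and> Iter v g z\<^sub>0 (e (Suc 0)) (e 0))"
      unfolding Iter_def by (rule definable_intros definable_Lt g z)+
    show "\<exists>k\<in>D v. isV v k \<and> Iter v g z\<^sub>0 n k" if "w \<preceq> v" "n \<in> D v" for v n
      by (rule Iter_exists) (use g(2) z that D_mono[OF that(1)] isV_mono[OF that(1)] g(1) le_trans[OF that(1)] in blast)+
  qed
  then obtain \<nu> where \<nu>: "\<nu> \<in> D w" "\<And>v n. w \<preceq> v \<Longrightarrow> n \<in> D v \<Longrightarrow> \<exists>k\<in>D v. App v \<nu> n k \<and> isV v k \<and> Iter v g z\<^sub>0 n k"
    by blast
  have val: "isV v k \<and> Iter v g z\<^sub>0 n k" if "w \<preceq> v" "n \<in> D v" "k \<in> D v" "App v \<nu> n k" for v n k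
    using \<nu>(2)[OF that(1,2)] App_det[OF D_mono[OF that(1) \<nu>(1)] that(2,3) _ that(4)] by blast
  have "Numerals w \<nu>"
    unfolding Numerals_def
  proof (intro conjI allI impI)
    show "\<nu> \<in> D w" by (rule \<nu>(1))
    show "\<exists>z. VS v z \<and> App v \<nu> n z" if "w \<preceq> v" "n \<in> D v" for v n
      using \<nu>(2)[OF that] unfolding VS_def by blast
    show "\<not> EL v c z" if "w \<preceq> v" "z \<in> D v" "App v \<nu> zero z" for v z c
      using val[OF that(1) _ that(2,3)] Iter_zero[OF D_mono[OF that(1) z(1)] that(2)] z\<^sub>0(2)[OF that(1)] by auto
    show "Succ_of v z' z" if v: "w \<preceq> v" "n \<in> D v" "z \<in> D v" "z' \<in> D v" "App v \<nu> n z" "App v \<nu> (suc n) z'" for v n z z'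
    proof -
      have n': "suc n \<in> D v" using v(2) by simp
      obtain y where y: "y \<in> D v" "Iter v g z\<^sub>0 n y" "App v g y z'"
        using Iter_suc[OF v(2,4)] val[OF v(1) n' v(4,6)] by blast
      have gz: "g \<in> D v" "z\<^sub>0 \<in> D v" using D_mono[OF v(1)] g(1) z(1) by auto
      have "y = z" using Iter_unique[OF gz v(2) y(1) v(3) y(2)] val[OF v(1-3,5)] by blast
      moreover obtain b where b: "b \<in> D v" "App v g z b" "Succ_of v b z" using g(2)[OF v(1,3)] val[OF v(1-3,5)] by blast
      ultimately show ?thesis using App_det[OF gz(1) v(3) b(1) v(4) b(2)] y(3) by blast
    qed
  qed
  then show ?thesis by blast
qed

lemma Numerals_mono:
  assumes "v \<preceq> w" "Numerals v \<nu>"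
  shows "Numerals w \<nu>"
  using assms(2) le_trans[OF assms(1)] D_mono[OF assms(1)] unfolding Numerals_def by simp

lemma Numerals_D: "Numerals w \<nu> \<Longrightarrow> \<nu> \<in> D w"
  by (simp add: Numerals_def)

lemma Numerals_total: "Numerals w \<nu> \<Longrightarrow> n \<in> D w \<Longrightarrow> \<exists>z. VS w z \<and> App w \<nu> n z"
  unfolding Numerals_def by auto

lemma Numerals_VS: "Numerals w \<nu> \<Longrightarrow> n \<in> D w \<Longrightarrow> z \<in> D w \<Longrightarrow> App w \<nu> n z \<Longrightarrow> VS w z"
  using Numerals_total[of w \<nu> n] App_det[OF Numerals_D, of w \<nu> n z] VS_D by blast

lemma Numerals_zero: "Numerals w \<nu> \<Longrightarrow> z \<in> D w \<Longrightarrow> App w \<nu> zero z \<Longrightarrow> \<not> EL w c z"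
  unfolding Numerals_def by auto

lemma Numerals_suc:
  "Numerals w \<nu> \<Longrightarrow> n \<in> D w \<Longrightarrow> z \<in> D w \<Longrightarrow> z' \<in> D w \<Longrightarrow> App w \<nu> n z \<Longrightarrow> App w \<nu> (suc n) z' \<Longrightarrow> Succ_of w z' z"
  unfolding Numerals_def using le_refl by blast

text \<open>Induction on \<open>n\<close> with the exact successor: an element of the numeral
  before, or that numeral itself, is an element of the next.\<close>

lemma Numerals_less:
  assumes \<nu>: "Numerals w \<nu>" and m: "m \<in> D w" and n: "n \<in> D w" and "Lt m n" "a \<in> D w" "b \<in> D w"
    "App w \<nu> m a" "App w \<nu> n b"
  shows "EL w a b"
proof -
  from le_refl n
  have "\<forall>v. w \<preceq> v \<longrightarrow> (\<forall>a\<in>D v. \<forall>b\<in>D v. Lt m n \<and> App v \<nu> m a \<and> App v \<nu> n b \<longrightarrow> EL v a b)"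
  proof (induction rule: D_induct[where P="\<lambda>w n. \<forall>v. w \<preceq> v \<longrightarrow> (\<forall>a\<in>D v. \<forall>b\<in>D v.
      Lt m n \<and> App v \<nu> m a \<and> App v \<nu> n b \<longrightarrow> EL v a b)"])
    case definable
    show ?case by (rule definable_intros definable_Lt definable_EL m Numerals_D[OF \<nu>])+
  next
    case zero
    show ?case using not_Lt_zero[OF m] by blast
  next
    case (suc u n)
    show ?case
    proof (intro allI impI ballI, elim conjE)
      fix v a b assume v: "u \<preceq> v" "a \<in> D v" "b \<in> D v" "Lt m (suc n)" "App v \<nu> m a" "App v \<nu> (suc n) b"
      have wv: "w \<preceq> v" using le_trans[OF suc(1) v(1)] .
      have D: "n \<in> D v" "m \<in> D v" "Numerals v \<nu>"
        using D_mono[OF v(1) suc(2)] D_mono[OF wv m] Numerals_mono[OF wv \<nu>] .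
      obtain c where c: "VS v c" "App v \<nu> n c" using Numerals_total[OF D(3,1)] by blast
      have s: "Succ_of v b c" using Numerals_suc[OF D(3,1) VS_D[OF c(1)] v(3) c(2) v(6)] .
      have "Lt m n \<or> m = n" using v(4) Lt_suc[OF D(2,1)] by blast
      then have "EL v a c \<or> a = c"
        using suc(3) v c VS_D[OF c(1)] App_det[OF Numerals_D[OF D(3)] D(2) v(2) VS_D[OF c(1)] v(5)] by blast
      then show "EL v a b" using s v(2) le_refl unfolding Succ_of_def by blast
    qed
  qed
  then show ?thesis using assms le_refl by blast
qed

text \<open>Of two distinct numbers one is smaller, and its numeral would be a member of an equal
  set, against irreflexivity.\<close>

lemma Numerals_inject:
  assumes \<nu>: "Numerals w \<nu>" and D: "m \<in> D w" "n \<in> D w" "a \<in> D w" "b \<in> D w"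
    and app: "App w \<nu> m a" "App w \<nu> n b" and eq: "Eq w a b"
  shows "m = n"
proof -
  have V: "VS w a" "VS w b" using Numerals_VS[OF \<nu>] D app by blast+
  have "\<not> Lt m n"
  proof
    assume "Lt m n"
    then have "Mem w a b" using Numerals_less[OF \<nu> D(1,2) _ D(3,4) app] EL_Mem[OF V(2)] by blast
    then show False using Mem_irrefl[OF V(1)] Mem_Eq_right[OF V(1,2,1) Eq_sym[OF V eq]] by blast
  qed
  moreover have "\<not> Lt n m"
  proof
    assume "Lt n m"
    then have "Mem w b a" using Numerals_less[OF \<nu> D(2,1) _ D(4,3) app(2,1)] EL_Mem[OF V(1)] by blast
    then show False using Mem_irrefl[OF V(2)] Mem_Eq_right[OF V(2,1,2) eq] by blast
  qed
  ultimately show ?thesis using Lt_linear[OF D(1,2)] by blast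
qed

section \<open>Inductive sets and omega\<close>

definition Sub :: "'w \<Rightarrow> 'd \<Rightarrow> 'd \<Rightarrow> bool" where
  "Sub w x y \<longleftrightarrow> (\<forall>v. w \<preceq> v \<longrightarrow> (\<forall>c\<in>D v. EL v c x \<longrightarrow> Mem v c y))"

definition IsSucc :: "'w \<Rightarrow> 'd \<Rightarrow> 'd \<Rightarrow> bool" where
  "IsSucc w s n \<longleftrightarrow> Sub w n s \<and> Mem w n s \<and> (\<forall>v. w \<preceq> v \<longrightarrow> (\<forall>c\<in>D v. EL v c s \<longrightarrow> Mem v c n \<or> Eq v c n))"

definition Inductive :: "'w \<Rightarrow> 'd \<Rightarrow> bool" where
  "Inductive w u \<longleftrightarrow> (\<exists>z\<in>D w. EL w z u \<and> (\<forall>v. w \<preceq> v \<longrightarrow> (\<forall>c\<in>D v. \<not> EL v c z))) \<and>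
     (\<forall>v. w \<preceq> v \<longrightarrow> (\<forall>n\<in>D v. EL v n u \<longrightarrow> (\<exists>s\<in>D v. EL v s u \<and> IsSucc v s n)))"

lemma sat_mem: "sat w e (interp E (SMem x y)) \<longleftrightarrow> Mem w (e x) (e y)"
  by (simp add: Mem_def)

lemma sat_subset: "sat w e (interp E (s_subset x y)) \<longleftrightarrow> Sub w (e x) (e y)"
  by (simp add: s_subset_def Sub_def Mem_def)

lemma sat_succ: "sat w e (interp E (s_succ s n)) \<longleftrightarrow> IsSucc w (e s) (e n)"
  by (simp add: s_succ_def IsSucc_def sat_subset Mem_def)

lemma sat_inductive: "sat w e (interp E (s_inductive u)) \<longleftrightarrow> Inductive w (e u)"
  using all_imp_merge[where Q="\<lambda>_ _. False"] by (simp add: s_inductive_def Inductive_def sat_succ)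

lemma Inductive_mono:
  assumes "v \<preceq> w" "Inductive v u"
  shows "Inductive w u"
proof -
  have "sat v (\<lambda>_. u) (interp E (s_inductive 0))" using assms(2) by (simp add: sat_inductive)
  from sat_mono[OF assms(1) this] show ?thesis by (simp add: sat_inductive)
qed

lemma Succ_of_IsSucc:
  assumes "VS w s" "VS w n" "Succ_of w s n"
  shows "IsSucc w s n"
proof -
  have "Mem v c s" if "w \<preceq> v" "EL v c n \<or> c = n" for v c
    using that assms(3) EL_D EL_Mem[OF VS_mono[OF that(1) assms(1)]] VS_D[OF VS_mono[OF that(1) assms(2)]]
    unfolding Succ_of_def by blast
  moreover have "Mem v c n \<or> Eq v c n" if "w \<preceq> v" "EL v c s" for v c
    using that assms(3) EL_D EL_Mem[OF VS_mono[OF that(1) assms(2)]] Eq_refl[OF VS_mono[OF that(1) assms(2)]]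
    unfolding Succ_of_def by blast
  ultimately show ?thesis unfolding IsSucc_def Sub_def using le_refl by blast
qed

text \<open>Bridges the two notions of successor: numerals have exact successors, while an arbitrary
  inductive set provides them only up to equality.\<close>

lemma Succ_unique:
  assumes V: "VS w s" "VS w n" "VS w s'" "VS w n'" and s: "Succ_of w s n" and s': "IsSucc w s' n'" and eq: "Eq w n n'"
  shows "Eq w s s'"
proof (rule Eq_I[OF V(1,3)])
  fix v a assume v: "w \<preceq> v" and a: "EL v a s"
  note V' = V[THEN VS_mono[OF v]]
  note eq' = EqE_mono[OF v eq]
  have aV: "VS v a" using EL_VS[OF V'(1) a] .
  have sub: "Mem v c s'" if c: "EL v c n'" for c
    using s' v c EL_D unfolding IsSucc_def Sub_def by blast
  have n's': "Mem v n' s'" using s' Mem_mono[OF v] unfolding IsSucc_def by blast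
  have "EL v a n \<or> a = n" using s v a EL_D unfolding Succ_of_def by blast
  then show "Mem v a s'"
  proof
    assume "EL v a n"
    then have "Mem v a n'" using Mem_Eq_right[OF aV V'(2,4) eq'] EL_Mem[OF V'(2)] by blast
    then obtain c where c: "EL v c n'" "Eq v a c" unfolding Mem_def by blast
    have cV: "VS v c" using EL_VS[OF V'(4) c(1)] .
    show ?thesis using Mem_Eq_left[OF cV aV V'(3) Eq_sym[OF aV cV c(2)] sub[OF c(1)]] .
  next
    assume "a = n"
    then show ?thesis using Mem_Eq_left[OF V'(4,2,3) Eq_sym[OF V'(2,4) eq'] n's'] by simp
  qed
next
  fix v a assume v: "w \<preceq> v" and a: "EL v a s'"
  note V' = V[THEN VS_mono[OF v]]
  note eq' = EqE_mono[OF v eq]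
  have aV: "VS v a" using EL_VS[OF V'(3) a] .
  have sub: "EL v c s" if "EL v c n \<or> c = n" for c
    using s v that EL_D VS_D[OF V'(2)] unfolding Succ_of_def by blast
  have "Mem v a n' \<or> Eq v a n'" using s' v a EL_D unfolding IsSucc_def by blast
  then show "Mem v a s"
  proof
    assume "Mem v a n'"
    then have "Mem v a n" using Mem_Eq_right[OF aV V'(4,2) Eq_sym[OF V'(2,4) eq']] by blast
    then show ?thesis unfolding Mem_def using sub by blast
  next
    assume "Eq v a n'"
    then have "Eq v a n" using Eq_trans[OF aV V'(4,2)] Eq_sym[OF V'(2,4) eq'] by blast
    then show ?thesis unfolding Mem_def using sub VS_D[OF V'(2)] by blast
  qed
qed

lemma Numerals_in_inductive:
  assumes \<nu>: "Numerals w \<nu>" and u: "VS w u" "Inductive w u" and n: "n \<in> D w" and c: "c \<in> D w" "App w \<nu> n c"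
  shows "Mem w c u"
proof -
  from le_refl n have "\<forall>v. w \<preceq> v \<longrightarrow> (\<forall>c\<in>D v. App v \<nu> n c \<longrightarrow> Mem v c u)"
  proof (induction rule: D_induct[where P="\<lambda>w n. \<forall>v. w \<preceq> v \<longrightarrow> (\<forall>c\<in>D v. App v \<nu> n c \<longrightarrow> Mem v c u)"])
    case definable
    show ?case unfolding Mem_def by (rule definable_intros definable_EL definable_Eq Numerals_D[OF \<nu>] VS_D[OF u(1)])+
  next
    case zero
    show ?case
    proof (intro allI impI ballI)
      fix v c assume v: "w \<preceq> v" "c \<in> D v" "App v \<nu> zero c"
      have uv: "VS v u" "Inductive v u" "Numerals v \<nu>"
        using VS_mono[OF v(1) u(1)] Inductive_mono[OF v(1) u(2)] Numerals_mono[OF v(1) \<nu>] .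
      obtain z where z: "EL v z u" "\<And>t d. v \<preceq> t \<Longrightarrow> \<not> EL t d z" using uv(2) EL_D unfolding Inductive_def by metis
      have "Eq v c z"
      proof (rule Eq_I)
        show "VS v c" using Numerals_VS[OF uv(3) _ v(2,3)] by simp
        show "VS v z" using EL_VS[OF uv(1) z(1)] .
        show "Mem t a z" if t: "v \<preceq> t" "EL t a c" for t a
          using Numerals_zero[OF Numerals_mono[OF t(1) uv(3)] D_mono[OF t(1) v(2)] App_mono[OF t(1) v(3)]] t(2) by blast
      qed (use z(2) in blast)
      then show "Mem v c u" unfolding Mem_def using z(1) EL_D by blast
    qed
  next
    case (suc t n)
    show ?case
    proof (intro allI impI ballI)
      fix v c assume v: "t \<preceq> v" "c \<in> D v" "App v \<nu> (suc n) c"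
      have wv: "w \<preceq> v" using le_trans[OF suc(1) v(1)] .
      have uv: "VS v u" "Inductive v u" "Numerals v \<nu>" "n \<in> D v"
        using VS_mono[OF wv u(1)] Inductive_mono[OF wv u(2)] Numerals_mono[OF wv \<nu>] D_mono[OF v(1) suc(2)] .
      obtain d where d: "VS v d" "App v \<nu> n d" using Numerals_total[OF uv(3,4)] by blast
      have "Mem v d u" using suc(3) v(1) d VS_D by blast
      then obtain b where b: "EL v b u" "Eq v d b" unfolding Mem_def by blast
      then obtain s where s: "EL v s u" "IsSucc v s b" using uv(2) EL_D le_refl unfolding Inductive_def by blast
      have cV: "VS v c" using Numerals_VS[OF uv(3) _ v(2,3)] uv(4) by simp
      have "Eq v c s"
        using Succ_unique[OF cV d(1) EL_VS[OF uv(1) s(1)] EL_VS[OF uv(1) b(1)] _ s(2) b(2)]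
          Numerals_suc[OF uv(3,4) VS_D[OF d(1)] v(2) d(2) v(3)] by blast
      then show "Mem v c u" unfolding Mem_def using s(1) EL_D by blast
    qed
  qed
  then show ?thesis using c le_refl by blast
qed

text \<open>The \<open>n\<close>-th entry is the numeral of \<open>n\<close> under a true condition.
  Minimality is \<open>Numerals_in_inductive\<close>.\<close>

lemma ex_omega:
  assumes \<nu>: "Numerals w \<nu>"
  obtains om where "VS w om" "Inductive w om"
    "\<And>v u. w \<preceq> v \<Longrightarrow> VS v u \<Longrightarrow> Inductive v u \<Longrightarrow> Sub v om u"
    "\<And>v n c. w \<preceq> v \<Longrightarrow> n \<in> D v \<Longrightarrow> c \<in> D v \<Longrightarrow> App v \<nu> n c \<Longrightarrow> EL v c om"
proof -
  obtain t where t: "t \<in> D w" "isM w t" "isT w t" using ex_true by blast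
  have D: "t \<in> D v" "isM v t" "isT v t" "Numerals v \<nu>" if "w \<preceq> v" for v
    using that t D_mono isM_mono isT_mono Numerals_mono[OF that \<nu>] by blast+
  obtain om where om: "om \<in> D w" "isV w om"
    "\<And>v n. w \<preceq> v \<Longrightarrow> n \<in> D v \<Longrightarrow> \<exists>k\<in>D v. App v om n k \<and> (\<exists>z\<in>D v. App v \<nu> n z \<and> k = pr z t)"
    "\<And>v n k. w \<preceq> v \<Longrightarrow> n \<in> D v \<Longrightarrow> k \<in> D v \<Longrightarrow> App v om n k \<Longrightarrow> \<exists>z\<in>D v. App v \<nu> n z \<and> k = pr z t"
  proof (rule ex_vset[of w "\<lambda>v n k. \<exists>z\<in>D v. App v \<nu> n z \<and> k = pr z t"])
    show "definable (\<lambda>_. True) w (\<lambda>v e. \<exists>z\<in>D v. App v \<nu> (e (Suc 0)) z \<and> e 0 = pr z t)"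
      by (rule definable_intros t Numerals_D[OF \<nu>])+
    show "\<exists>k\<in>D v. \<exists>z\<in>D v. App v \<nu> n z \<and> k = pr z t" if v: "w \<preceq> v" "n \<in> D v" for v n
    proof -
      obtain z where "VS v z" "App v \<nu> n z" using Numerals_total[OF D(4)[OF v(1)] v(2)] by blast
      then show ?thesis using D[OF v(1)] VS_D by (intro bexI[of _ "pr z t"] bexI[of _ z]) auto
    qed
    show "isM v (rt k) \<and> (\<forall>u. v \<preceq> u \<longrightarrow> isT u (rt k) \<longrightarrow> isV u (lf k))"
      if v: "w \<preceq> v" "n \<in> D v" "k \<in> D v" "\<exists>z\<in>D v. App v \<nu> n z \<and> k = pr z t" for v n k
    proof -
      obtain z where z: "z \<in> D v" "App v \<nu> n z" "k = pr z t" using v(4) by blast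
      have "isV v z" using Numerals_VS[OF D(4)[OF v(1)] v(2) z(1,2)] by (simp add: VS_def)
      then show ?thesis using z D[OF v(1)] isV_mono by (auto simp: lf_pr[where w=v] rt_pr[where w=v])
    qed
  qed blast
  have EL_o: "EL v c om" if v: "w \<preceq> v" "n \<in> D v" "c \<in> D v" "App v \<nu> n c" for v n c
  proof -
    obtain k z where k: "k \<in> D v" "App v om n k" "z \<in> D v" "App v \<nu> n z" "k = pr z t" using om(3)[OF v(1,2)] by blast
    have "z = c" using App_det[OF Numerals_D[OF D(4)[OF v(1)]] v(2) k(3) v(3) k(4) v(4)] .
    then show ?thesis unfolding EL_def using k v D[OF v(1)]
      by (intro bexI[of _ n] bexI[of _ k]) (auto simp: lf_pr[where w=v] rt_pr[where w=v])
  qed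
  have o_EL: "\<exists>n\<in>D v. c \<in> D v \<and> App v \<nu> n c" if v: "w \<preceq> v" "EL v c om" for v c
  proof -
    obtain n k where k: "n \<in> D v" "k \<in> D v" "App v om n k" "c = lf k" using v(2) unfolding EL_def by blast
    obtain z where "z \<in> D v" "App v \<nu> n z" "k = pr z t" using om(4)[OF v(1) k(1-3)] by blast
    then show ?thesis using k(1,4) D[OF v(1)] by (auto simp: lf_pr[where w=v])
  qed
  have "Inductive w om"
    unfolding Inductive_def
  proof (intro conjI allI impI ballI)
    obtain z where z: "VS w z" "App w \<nu> zero z" using Numerals_total[OF \<nu>, of zero] by auto
    have "\<not> EL v c z" if "w \<preceq> v" for v c
      using Numerals_zero[OF D(4)[OF that] D_mono[OF that VS_D[OF z(1)]] App_mono[OF that z(2)]] .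
    then show "\<exists>z\<in>D w. EL w z om \<and> (\<forall>v. w \<preceq> v \<longrightarrow> (\<forall>c\<in>D v. \<not> EL v c z))"
      using EL_o[OF le_refl _ VS_D[OF z(1)] z(2)] VS_D[OF z(1)] by auto
  next
    fix v c assume v: "w \<preceq> v" "c \<in> D v" "EL v c om"
    obtain n where n: "n \<in> D v" "App v \<nu> n c" using o_EL[OF v(1,3)] by blast
    have n': "suc n \<in> D v" using n(1) by simp
    obtain s where s: "VS v s" "App v \<nu> (suc n) s" using Numerals_total[OF D(4)[OF v(1)] n'] by blast
    have "IsSucc v s c"
      using Succ_of_IsSucc[OF s(1) Numerals_VS[OF D(4)[OF v(1)] n(1) v(2) n(2)]]
        Numerals_suc[OF D(4)[OF v(1)] n(1) v(2) VS_D[OF s(1)] n(2) s(2)] by blast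
    then show "\<exists>s\<in>D v. EL v s om \<and> IsSucc v s c" using EL_o[OF v(1) n' VS_D[OF s(1)] s(2)] VS_D[OF s(1)] by blast
  qed
  moreover have "Sub v om u" if v: "w \<preceq> v" "VS v u" "Inductive v u" for v u
    unfolding Sub_def
  proof (intro allI impI ballI)
    fix s c assume s: "v \<preceq> s" "c \<in> D s" "EL s c om"
    obtain n where n: "n \<in> D s" "App s \<nu> n c" using o_EL[OF le_trans[OF v(1) s(1)] s(3)] by blast
    show "Mem s c u"
      by (rule Numerals_in_inductive[OF D(4)[OF le_trans[OF v(1) s(1)]] VS_mono[OF s(1) v(2)]
            Inductive_mono[OF s(1) v(3)] n(1) s(2) n(2)])
  qed
  ultimately show ?thesis using that[of om] om(1,2) EL_o by (simp add: VS_def)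
qed

end

context vset_model
begin

subsection \<open>Indexed families over a v-set\<close>

definition At :: "'w \<Rightarrow> 'd \<Rightarrow> 'd \<Rightarrow> 'd \<Rightarrow> bool" where
  "At w x n c \<longleftrightarrow> (\<exists>k\<in>D w. App w x n k \<and> isT w (rt k) \<and> c = lf k)"

lemma EL_iff_At: "EL w c x \<longleftrightarrow> (\<exists>n\<in>D w. At w x n c)"
  by (simp add: EL_def At_def)

lemma At_det: "x \<in> D w \<Longrightarrow> n \<in> D w \<Longrightarrow> At w x n c \<Longrightarrow> At w x n d \<Longrightarrow> c = d"
  unfolding At_def using App_det by blast

lemma At_VS: "VS w x \<Longrightarrow> n \<in> D w \<Longrightarrow> At w x n c \<Longrightarrow> VS w c"
  using EL_VS EL_iff_At by blast

lemma At_EL: "n \<in> D w \<Longrightarrow> At w x n c \<Longrightarrow> EL w c x"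
  using EL_iff_At by blast

text \<open>\<open>ex_vset_over\<close> in terms of present members. Congruence of \<open>B\<close>
  under equality is enough, since v-sets with the same values are equal.\<close>

lemma ex_family:
  assumes x: "VS w x"
    and def: "definable (\<lambda>_. True) w (\<lambda>w e. B w (e (Suc 0)) (e 0))"
    and ex: "\<And>v n c. w \<preceq> v \<Longrightarrow> n \<in> D v \<Longrightarrow> At v x n c \<Longrightarrow> \<exists>b. VS v b \<and> B v n b"
    and cong: "\<And>v n a b. w \<preceq> v \<Longrightarrow> n \<in> D v \<Longrightarrow> VS v a \<Longrightarrow> VS v b \<Longrightarrow> Eq v a b \<Longrightarrow> B v n b \<Longrightarrow> B v n a"
  obtains h where "VS w h"
    "\<And>v n c. w \<preceq> v \<Longrightarrow> n \<in> D v \<Longrightarrow> At v h n c \<Longrightarrow> B v n c \<and> (\<exists>d. At v x n d)"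
    "\<And>v n c. w \<preceq> v \<Longrightarrow> n \<in> D v \<Longrightarrow> At v x n c \<Longrightarrow> \<exists>d. At v h n d"
proof -
  have xV: "x \<in> D w" "isV w x" using x by (auto simp: VS_def)
  obtain h where h: "h \<in> D w" "isV w h"
    "\<And>v n k. w \<preceq> v \<Longrightarrow> n \<in> D v \<Longrightarrow> k \<in> D v \<Longrightarrow> App v h n k \<Longrightarrow> isT v (rt k) \<Longrightarrow>
      isV v (lf k) \<and> B v n (lf k) \<and> (\<exists>l\<in>D v. App v x n l \<and> isT v (rt l))"
    "\<And>v n k. w \<preceq> v \<Longrightarrow> n \<in> D v \<Longrightarrow> k \<in> D v \<Longrightarrow> App v x n k \<Longrightarrow> isT v (rt k) \<Longrightarrow>
      \<exists>l\<in>D v. App v h n l \<and> isT v (rt l) \<and> isV v (lf l) \<and> B v n (lf l)"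
  proof (rule ex_vset_over[OF xV def])
    show "\<exists>b\<in>D v. isV v b \<and> B v n b"
      if "w \<preceq> v" "n \<in> D v" "k \<in> D v" "App v x n k" "isT v (rt k)" for v n k
      using ex[OF that(1,2), of "lf k"] that unfolding At_def VS_def by blast
    show "B v n a" if "w \<preceq> v" "n \<in> D v" "a \<in> D v" "b \<in> D v" "isV v a" "isV v b" "same_values v a b" "B v n b" for v n a b
      using cong[OF that(1,2)] Eq_same_values that unfolding VS_def by blast
  qed blast
  show ?thesis
  proof (rule that[of h])
    show "VS w h" using h by (simp add: VS_def)
    show "B v n c \<and> (\<exists>d. At v x n d)" if v: "w \<preceq> v" "n \<in> D v" "At v h n c" for v n c
      using v(3) h(3)[OF v(1,2)] unfolding At_def by blast
    show "\<exists>d. At v h n d" if v: "w \<preceq> v" "n \<in> D v" "At v x n c" for v n c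
      using v(3) h(4)[OF v(1,2)] unfolding At_def by blast
  qed
qed

section \<open>Relations, functions and the theorem in a model\<close>

definition Related :: "'w \<Rightarrow> 'd \<Rightarrow> 'd \<Rightarrow> 'd \<Rightarrow> bool" where
  "Related w g a b \<longleftrightarrow> (\<exists>p\<in>D w. EL w p g \<and> Opair w p a b)"

lemma sat_related: "sat w e (interp E (s_related g a b)) \<longleftrightarrow> Related w (e g) (e a) (e b)"
  by (simp add: s_related_def Related_def sat_opair)

lemma sat_relation: "sat w e (interp E (s_relation g)) \<longleftrightarrow> (\<forall>v. w \<preceq> v \<longrightarrow> (\<forall>p\<in>D v. EL v p (e g) \<longrightarrow>
    (\<exists>a\<in>D v. isV v a \<and> (\<exists>b\<in>D v. isV v b \<and> Opair v p a b))))"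
  by (simp add: s_relation_def sat_opair numeral_eq_Suc)

lemma sat_domain_includes: "sat w e (interp E (s_domain_includes g y)) \<longleftrightarrow>
    (\<forall>v. w \<preceq> v \<longrightarrow> (\<forall>a\<in>D v. EL v a (e y) \<longrightarrow> (\<exists>b\<in>D v. isV v b \<and> Related v (e g) a b)))"
  by (simp add: s_domain_includes_def sat_related numeral_eq_Suc)

lemma sat_SAll_SAll_I:
  assumes "\<And>v a b. w \<preceq> v \<Longrightarrow> VS v a \<Longrightarrow> VS v b \<Longrightarrow> sat v (case_nat b (case_nat a e)) (interp E \<phi>) \<Longrightarrow>
    sat v (case_nat b (case_nat a e)) (interp E \<psi>)"
  shows "sat w e (interp E (SAll (SAll (SImpl \<phi> \<psi>))))"
proof (simp, intro allI impI ballI)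
  fix v a u b t
  assume *: "w \<preceq> v" "a \<in> D v" "isV v a" "v \<preceq> u" "b \<in> D u" "isV u b" "u \<preceq> t"
    "sat t (case_nat b (case_nat a e)) (interp E \<phi>)"
  have t: "v \<preceq> t" "w \<preceq> t" using * le_trans by blast+
  have "VS t a" "VS t b"
    using * D_mono[OF t(1)] isV_mono[OF t(1)] D_mono[OF *(7)] isV_mono[OF *(7)] by (auto simp: VS_def)
  then show "sat t (case_nat b (case_nat a e)) (interp E \<psi>)" using assms t(2) *(8) by blast
qed

lemma sat_SAll_SAll_SAll_I:
  assumes "\<And>v a b c. w \<preceq> v \<Longrightarrow> VS v a \<Longrightarrow> VS v b \<Longrightarrow> VS v c \<Longrightarrow>
    sat v (case_nat c (case_nat b (case_nat a e))) (interp E \<phi>) \<Longrightarrow>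
    sat v (case_nat c (case_nat b (case_nat a e))) (interp E \<psi>)"
  shows "sat w e (interp E (SAll (SAll (SAll (SImpl \<phi> \<psi>)))))"
proof (simp, intro allI impI ballI)
  fix v a u b t c s
  assume *: "w \<preceq> v" "a \<in> D v" "isV v a" "v \<preceq> u" "b \<in> D u" "isV u b" "u \<preceq> t" "c \<in> D t" "isV t c" "t \<preceq> s"
    "sat s (case_nat c (case_nat b (case_nat a e))) (interp E \<phi>)"
  have s: "u \<preceq> s" "v \<preceq> s" "w \<preceq> s" using * le_trans by blast+
  have "VS s a" "VS s b" "VS s c"
    using * D_mono[OF s(1)] isV_mono[OF s(1)] D_mono[OF s(2)] isV_mono[OF s(2)] D_mono[OF *(10)] isV_mono[OF *(10)]
    by (auto simp: VS_def)
  then show "sat s (case_nat c (case_nat b (case_nat a e))) (interp E \<psi>)" using assms s(3) *(11) by blast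
qed

text \<open>Shared by the surjection and the choice function: \<open>y\<close> and \<open>h\<close>
  are families over the true indices of \<open>x\<close>, with the numeral of \<open>n\<close> and a
  pair starting with this numeral as \<open>n\<close>-th members.\<close>

lemma sat_function_on:
  assumes \<nu>: "Numerals w \<nu>" and x: "VS w x" and y: "VS w y" and h: "VS w h" and e: "e i = h" "e j = y"
    and y1: "\<And>v n a. w \<preceq> v \<Longrightarrow> n \<in> D v \<Longrightarrow> At v y n a \<Longrightarrow> (\<exists>z\<in>D v. App v \<nu> n z \<and> Eq v a z) \<and> (\<exists>d. At v x n d)"
    and y2: "\<And>v n d. w \<preceq> v \<Longrightarrow> n \<in> D v \<Longrightarrow> At v x n d \<Longrightarrow> \<exists>a. At v y n a"
    and h1: "\<And>v n p. w \<preceq> v \<Longrightarrow> n \<in> D v \<Longrightarrow> At v h n p \<Longrightarrow>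
      (\<exists>z\<in>D v. App v \<nu> n z \<and> (\<exists>c. VS v c \<and> Opair v p z c)) \<and> (\<exists>d. At v x n d)"
    and h2: "\<And>v n d. w \<preceq> v \<Longrightarrow> n \<in> D v \<Longrightarrow> At v x n d \<Longrightarrow> \<exists>p. At v h n p"
  shows "sat w e (interp E (s_function_on i j))"
proof -
  have key: "\<exists>n\<in>D v. \<exists>p z. At v h n p \<and> VS v p \<and> Opair v p a b \<and> z \<in> D v \<and> App v \<nu> n z \<and> VS v z \<and> Eq v a z"
    if v: "w \<preceq> v" "VS v a" "VS v b" "Related v h a b" for v a b
  proof -
    note N = Numerals_mono[OF v(1) \<nu>]
    obtain p n where p: "n \<in> D v" "At v h n p" "Opair v p a b" using v(4) EL_iff_At unfolding Related_def by blast
    obtain z c where z: "z \<in> D v" "App v \<nu> n z" "VS v c" "Opair v p z c" using h1[OF v(1) p(1,2)] by blast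
    have pV: "VS v p" using At_VS[OF VS_mono[OF v(1) h] p(1,2)] .
    have zV: "VS v z" using Numerals_VS[OF N p(1) z(1,2)] .
    show ?thesis using Opair_inject[OF pV v(2,3) zV z(3) p(3) z(4)] p z pV zV by blast
  qed
  have "sat w e (interp E (s_relation i))"
    unfolding sat_relation e
  proof (intro allI impI ballI)
    fix v p assume v: "w \<preceq> v" "p \<in> D v" "EL v p h"
    obtain n where n: "n \<in> D v" "At v h n p" using v(3) EL_iff_At by blast
    obtain z c where z: "z \<in> D v" "App v \<nu> n z" "VS v c" "Opair v p z c" using h1[OF v(1) n] by blast
    have "VS v z" using Numerals_VS[OF Numerals_mono[OF v(1) \<nu>] n(1) z(1,2)] .
    then show "\<exists>a\<in>D v. isV v a \<and> (\<exists>b\<in>D v. isV v b \<and> Opair v p a b)" using z unfolding VS_def by blast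
  qed
  moreover have "sat w e (interp E (SAll (SAll (SImpl (s_related (i + 2) 1 0) (SMem 1 (j + 2))))))"
  proof (rule sat_SAll_SAll_I)
    fix v a b assume v: "w \<preceq> v" "VS v a" "VS v b"
      and "sat v (case_nat b (case_nat a e)) (interp E (s_related (i + 2) 1 0))"
    then have "Related v h a b" by (simp add: sat_related e)
    then obtain n p z where n: "n \<in> D v" "At v h n p" "App v \<nu> n z" "z \<in> D v" "VS v z" "Eq v a z" using key[OF v] by blast
    have yv: "VS v y" using VS_mono[OF v(1) y] .
    \<comment> \<open>The \<open>n\<close>-th members of \<open>h\<close> and \<open>y\<close> are
      present together, namely when that of \<open>x\<close> is.\<close>
    obtain a' where a': "At v y n a'" using h1[OF v(1) n(1,2)] y2[OF v(1) n(1)] by blast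
    then obtain z' where z': "z' \<in> D v" "App v \<nu> n z'" "Eq v a' z'" using y1[OF v(1) n(1)] by blast
    have "z' = z" using App_det[OF Numerals_D[OF Numerals_mono[OF v(1) \<nu>]] n(1) z'(1) n(4) z'(2) n(3)] .
    then have "Eq v a a'" using Eq_trans[OF v(2) n(5) At_VS[OF yv n(1) a'] n(6)] z'(3) Eq_sym[OF At_VS[OF yv n(1) a'] n(5)] by blast
    then have "Mem v a y" unfolding Mem_def using At_EL[OF n(1) a'] EL_D by blast
    then show "sat v (case_nat b (case_nat a e)) (interp E (SMem 1 (j + 2)))" unfolding sat_mem by (simp add: e)
  qed
  moreover have "sat w e (interp E (s_domain_includes i j))"
    unfolding sat_domain_includes e
  proof (intro allI impI ballI)
    fix v a assume v: "w \<preceq> v" "a \<in> D v" "EL v a y"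
    obtain n where n: "n \<in> D v" "At v y n a" using v(3) EL_iff_At by blast
    have aV: "VS v a" using EL_VS[OF VS_mono[OF v(1) y] v(3)] .
    obtain z where z: "z \<in> D v" "App v \<nu> n z" "Eq v a z" using y1[OF v(1) n] by blast
    obtain p where p: "At v h n p" using y1[OF v(1) n] h2[OF v(1) n(1)] by blast
    obtain z' c where z': "z' \<in> D v" "App v \<nu> n z'" "VS v c" "Opair v p z' c" using h1[OF v(1) n(1) p] by blast
    have "z' = z" using App_det[OF Numerals_D[OF Numerals_mono[OF v(1) \<nu>]] n(1) z'(1) z(1) z'(2) z(2)] .
    moreover have zV: "VS v z" using Numerals_VS[OF Numerals_mono[OF v(1) \<nu>] n(1) z(1,2)] .
    moreover have pV: "VS v p" using At_VS[OF VS_mono[OF v(1) h] n(1) p] .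
    ultimately have "Opair v p a c"
      using Opair_cong[OF pV pV zV aV z'(3,3) Eq_refl[OF pV] Eq_sym[OF aV zV z(3)] Eq_refl[OF z'(3)]] z'(4) by blast
    then show "\<exists>b\<in>D v. isV v b \<and> Related v h a b"
      unfolding Related_def using z'(3) At_EL[OF n(1) p] EL_D unfolding VS_def by blast
  qed
  moreover have "sat w e (interp E (SAll (SAll (SAll (SImpl (SConj (s_related (i + 3) 2 1) (s_related (i + 3) 2 0)) (SEq 1 0))))))"
  proof (rule sat_SAll_SAll_SAll_I)
    fix v a b c assume v: "w \<preceq> v" "VS v a" "VS v b" "VS v c"
      and "sat v (case_nat c (case_nat b (case_nat a e))) (interp E (SConj (s_related (i + 3) 2 1) (s_related (i + 3) 2 0)))"
    then have r: "Related v h a b" "Related v h a c" by (simp_all add: sat_related e numeral_eq_Suc)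
    obtain n p z where n: "n \<in> D v" "At v h n p" "VS v p" "Opair v p a b" "z \<in> D v" "App v \<nu> n z" "VS v z" "Eq v a z"
      using key[OF v(1-3) r(1)] by blast
    obtain m q y where m: "m \<in> D v" "At v h m q" "VS v q" "Opair v q a c" "y \<in> D v" "App v \<nu> m y" "VS v y" "Eq v a y"
      using key[OF v(1,2,4) r(2)] by blast
    have "Eq v z y" using Eq_trans[OF n(7) v(2) m(7) Eq_sym[OF v(2) n(7,8)] m(8)] .
    \<comment> \<open>Single-valuedness rests on this: equal first components come from the same
      index, and one index carries one pair.\<close>
    then have "n = m" using Numerals_inject[OF Numerals_mono[OF v(1) \<nu>] n(1) m(1) n(5) m(5) n(6) m(6)] by blast
    then have "p = q" using At_det[OF VS_D[OF VS_mono[OF v(1) h]] n(1,2)] m(2) by blast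
    then have "Eq v b c" using Opair_inject[OF n(3) v(2,3,2,4) n(4)] m(4) by blast
    then show "sat v (case_nat c (case_nat b (case_nat a e))) (interp E (SEq 1 0))" by simp
  qed
  ultimately show ?thesis unfolding s_function_on_def interp.simps sat.simps by blast
qed

lemma sat_subset_omega:
  assumes \<nu>: "Numerals w \<nu>" and y: "VS w y" "e j = y"
    and y1: "\<And>v n a. w \<preceq> v \<Longrightarrow> n \<in> D v \<Longrightarrow> At v y n a \<Longrightarrow> \<exists>z\<in>D v. App v \<nu> n z \<and> Eq v a z"
  shows "sat w e (interp E (s_subset_omega j))"
proof -
  obtain om where om: "VS w om" "Inductive w om" "\<And>v u. w \<preceq> v \<Longrightarrow> VS v u \<Longrightarrow> Inductive v u \<Longrightarrow> Sub v om u"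
    "\<And>v n c. w \<preceq> v \<Longrightarrow> n \<in> D v \<Longrightarrow> c \<in> D v \<Longrightarrow> App v \<nu> n c \<Longrightarrow> EL v c om" using ex_omega[OF \<nu>] by blast
  have "Sub w y om" unfolding Sub_def Mem_def
    using y1 om(4) EL_iff_At by meson
  moreover have "Sub u om t" if "w \<preceq> v" "t \<in> D v" "isV v t" "v \<preceq> u" "Inductive u t" for v u t
    using om(3)[of u t] le_trans[OF that(1,4)] D_mono[OF that(4,2)] isV_mono[OF that(4,3)] that(5) by (simp add: VS_def)
  ultimately show ?thesis
    using om(1,2) y(2) unfolding s_subset_omega_def s_omega_def VS_def
    by (auto simp: sat_inductive sat_subset intro!: bexI[of _ om])
qed

theorem enough_subcountable_projectives_sat: "sat w e (interp E enough_subcountable_projectives)"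
proof -
  have "\<exists>y\<in>D w. isV w y \<and> (\<exists>f\<in>D w. isV w f \<and> sat w (case_nat f (case_nat y (case_nat x e)))
      (interp E (SConj (s_subset_omega 1) (SConj (s_surjection 0 1 2) (s_projective 1)))))"
    if xD: "x \<in> D w" "isV w x" for w x
  proof -
    have x: "VS w x" using xD by (simp add: VS_def)
    obtain \<nu> where \<nu>: "Numerals w \<nu>" using ex_numerals by blast
    have \<nu>D: "\<nu> \<in> D w" using Numerals_D[OF \<nu>] .
    \<comment> \<open>The \<open>n\<close>-th member of \<open>y\<close> is the numeral of
      \<open>n\<close>, up to equality, present under the \<open>n\<close>-th condition of
      \<open>x\<close>.\<close>
    obtain y where y: "VS w y"
      "\<And>v n a. w \<preceq> v \<Longrightarrow> n \<in> D v \<Longrightarrow> At v y n a \<Longrightarrow> (\<exists>z\<in>D v. App v \<nu> n z \<and> Eq v a z) \<and> (\<exists>d. At v x n d)"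
      "\<And>v n d. w \<preceq> v \<Longrightarrow> n \<in> D v \<Longrightarrow> At v x n d \<Longrightarrow> \<exists>a. At v y n a"
    proof (rule ex_family[OF x, of "\<lambda>v n b. \<exists>z\<in>D v. App v \<nu> n z \<and> Eq v b z"])
      show "definable (\<lambda>_. True) w (\<lambda>v e. \<exists>z\<in>D v. App v \<nu> (e (Suc 0)) z \<and> Eq v (e 0) z)"
        by (rule definable_intros definable_Eq \<nu>D)+
      show "\<exists>b. VS v b \<and> (\<exists>z\<in>D v. App v \<nu> n z \<and> Eq v b z)" if v: "w \<preceq> v" "n \<in> D v" "At v x n c" for v n c
        using Numerals_total[OF Numerals_mono[OF v(1) \<nu>] v(2)] Eq_refl VS_D by blast
      show "\<exists>z\<in>D v. App v \<nu> n z \<and> Eq v a z"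
        if v: "w \<preceq> v" "n \<in> D v" "VS v a" "VS v b" "Eq v a b" "\<exists>z\<in>D v. App v \<nu> n z \<and> Eq v b z" for v n a b
        using v(6) Eq_trans[OF v(3,4) _ v(5)] Numerals_VS[OF Numerals_mono[OF v(1) \<nu>] v(2)] by blast
    qed blast
    \<comment> \<open>The graph of the map from the numeral of \<open>n\<close> to the
      \<open>n\<close>-th element of \<open>x\<close>, again indexed by \<open>n\<close>.\<close>
    obtain f where f: "VS w f"
      "\<And>v n p. w \<preceq> v \<Longrightarrow> n \<in> D v \<Longrightarrow> At v f n p \<Longrightarrow>
        (\<exists>z\<in>D v. App v \<nu> n z \<and> (\<exists>c\<in>D v. At v x n c \<and> Opair v p z c)) \<and> (\<exists>d. At v x n d)"
      "\<And>v n d. w \<preceq> v \<Longrightarrow> n \<in> D v \<Longrightarrow> At v x n d \<Longrightarrow> \<exists>p. At v f n p"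
    proof (rule ex_family[OF x, of "\<lambda>v n p. \<exists>z\<in>D v. App v \<nu> n z \<and> (\<exists>c\<in>D v. At v x n c \<and> Opair v p z c)"])
      show "definable (\<lambda>_. True) w (\<lambda>v e. \<exists>z\<in>D v. App v \<nu> (e (Suc 0)) z \<and>
          (\<exists>c\<in>D v. At v x (e (Suc 0)) c \<and> Opair v (e 0) z c))"
        unfolding At_def Opair_def Upair_def Mem_def
        by (rule definable_intros definable_Eq definable_EL \<nu>D xD)+
      show "\<exists>b. VS v b \<and> (\<exists>z\<in>D v. App v \<nu> n z \<and> (\<exists>c\<in>D v. At v x n c \<and> Opair v b z c))"
        if v: "w \<preceq> v" "n \<in> D v" "At v x n c" for v n c
      proof -
        have c: "VS v c" using At_VS[OF VS_mono[OF v(1) x] v(2,3)] .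
        obtain z where z: "VS v z" "App v \<nu> n z" using Numerals_total[OF Numerals_mono[OF v(1) \<nu>] v(2)] by blast
        obtain p where "VS v p" "Opair v p z c" using ex_opair[OF z(1) c] .
        then show ?thesis using z c v(3) VS_D by blast
      qed
      show "\<exists>z\<in>D v. App v \<nu> n z \<and> (\<exists>c\<in>D v. At v x n c \<and> Opair v a z c)"
        if v: "w \<preceq> v" "n \<in> D v" "VS v a" "VS v b" "Eq v a b"
          "\<exists>z\<in>D v. App v \<nu> n z \<and> (\<exists>c\<in>D v. At v x n c \<and> Opair v b z c)" for v n a b
      proof -
        obtain z c where z: "z \<in> D v" "App v \<nu> n z" "c \<in> D v" "At v x n c" "Opair v b z c" using v(6) by blast
        have zV: "VS v z" "VS v c"
          using Numerals_VS[OF Numerals_mono[OF v(1) \<nu>] v(2) z(1,2)] At_VS[OF VS_mono[OF v(1) x] v(2) z(4)] .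
        have "Opair v a z c"
          using Opair_cong[OF v(4,3) zV(1,1,2,2) Eq_sym[OF v(3,4,5)] Eq_refl[OF zV(1)] Eq_refl[OF zV(2)] z(5)] .
        then show ?thesis using z by blast
      qed
    qed blast
    have yx: "\<exists>z\<in>D v. App v \<nu> n z \<and> Eq v a z" if "w \<preceq> v" "n \<in> D v" "At v y n a" for v n a
      using y(2)[OF that] by blast
    let ?e = "case_nat f (case_nat y (case_nat x e))"
    have "sat w ?e (interp E (s_subset_omega 1))"
      by (rule sat_subset_omega[OF \<nu> y(1)]) (use yx in auto)
    moreover have "sat w ?e (interp E (s_surjection 0 1 2))"
    proof -
      have "sat w ?e (interp E (s_function_on 0 1))"
      proof (rule sat_function_on[OF \<nu> x y(1) f(1)])
        show "(\<exists>z\<in>D v. App v \<nu> n z \<and> (\<exists>c. VS v c \<and> Opair v p z c)) \<and> (\<exists>d. At v x n d)"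
          if v: "w \<preceq> v" "n \<in> D v" "At v f n p" for v n p
          using f(2)[OF v] At_VS[OF VS_mono[OF v(1) x] v(2)] by blast
      qed (use y(2,3) f(3) in auto)
      moreover have "sat w ?e (interp E (SAll (SAll (SImpl (s_related (0 + 2) 1 0) (SMem 0 (2 + 2))))))"
      proof (rule sat_SAll_SAll_I)
        fix v a b assume v: "w \<preceq> v" "VS v a" "VS v b"
          and "sat v (case_nat b (case_nat a ?e)) (interp E (s_related (0 + 2) 1 0))"
        then have "Related v f a b" by (simp add: sat_related)
        then obtain p n where p: "n \<in> D v" "At v f n p" "Opair v p a b" using EL_iff_At unfolding Related_def by blast
        obtain z c where z: "z \<in> D v" "App v \<nu> n z" "At v x n c" "Opair v p z c" using f(2)[OF v(1) p(1,2)] by blast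
        have V: "VS v p" "VS v z" "VS v c"
          using At_VS[OF VS_mono[OF v(1) f(1)] p(1,2)] Numerals_VS[OF Numerals_mono[OF v(1) \<nu>] p(1) z(1,2)]
            At_VS[OF VS_mono[OF v(1) x] p(1) z(3)] .
        have "Eq v b c" using Opair_inject[OF V(1) v(2,3) V(2,3) p(3) z(4)] by blast
        then have "Mem v b x" unfolding Mem_def using At_EL[OF p(1) z(3)] EL_D by blast
        then show "sat v (case_nat b (case_nat a ?e)) (interp E (SMem 0 (2 + 2)))"
          unfolding sat_mem by (simp add: numeral_eq_Suc)
      qed
      moreover have "sat w ?e (interp E (SBAll 2 (SBEx (Suc 1) (s_related (0 + 2) 0 1))))"
      proof -
        have "\<exists>a\<in>D v. EL v a y \<and> Related v f a c" if v: "w \<preceq> v" "c \<in> D v" "EL v c x" for v c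
        proof -
          obtain n where n: "n \<in> D v" "At v x n c" using v(3) EL_iff_At by blast
          obtain a where a: "At v y n a" using y(3)[OF v(1) n] by blast
          obtain p where p: "At v f n p" using f(3)[OF v(1) n] by blast
          obtain z c' where z: "z \<in> D v" "App v \<nu> n z" "At v x n c'" "Opair v p z c'" using f(2)[OF v(1) n(1) p] by blast
          have "c' = c" using At_det[OF VS_D[OF VS_mono[OF v(1) x]] n(1) z(3) n(2)] .
          obtain z' where z': "z' \<in> D v" "App v \<nu> n z'" "Eq v a z'" using yx[OF v(1) n(1) a] by blast
          have zz: "z' = z" using App_det[OF Numerals_D[OF Numerals_mono[OF v(1) \<nu>]] n(1) z'(1) z(1) z'(2) z(2)] .
          have V: "VS v p" "VS v z" "VS v c" "VS v a"
            using At_VS[OF VS_mono[OF v(1) f(1)] n(1) p] Numerals_VS[OF Numerals_mono[OF v(1) \<nu>] n(1) z(1,2)]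
              At_VS[OF VS_mono[OF v(1) x] n] At_VS[OF VS_mono[OF v(1) y(1)] n(1) a] .
          have "Opair v p a c"
            using Opair_cong[OF V(1,1,2,4,3,3) Eq_refl[OF V(1)] Eq_sym[OF V(4,2)] Eq_refl[OF V(3)]]
              z(4) z'(3) zz \<open>c' = c\<close> by blast
          then show ?thesis unfolding Related_def using At_EL[OF n(1) p] At_EL[OF n(1) a] EL_D by blast
        qed
        then show ?thesis by (simp add: sat_related numeral_eq_Suc)
      qed
      ultimately show ?thesis unfolding s_surjection_def interp.simps sat.simps by blast
    qed
    moreover have "sat w ?e (interp E (s_projective 1))"
    proof -
      have "\<exists>h\<in>D v. isV v h \<and> Sub v h g \<and> sat v (case_nat h (case_nat g ?e)) (interp E (s_function_on 0 3))"
        if wv: "w \<preceq> v" and g: "VS v g" and dom: "\<forall>u. v \<preceq> u \<longrightarrow> (\<forall>a\<in>D u. EL u a y \<longrightarrow> (\<exists>b\<in>D u. isV u b \<and> Related u g a b))"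
        for v g
      proof -
        have \<nu>v: "Numerals v \<nu>" and xv: "VS v x" and yv: "VS v y"
          using Numerals_mono[OF wv \<nu>] VS_mono[OF wv x] VS_mono[OF wv y(1)] .
        \<comment> \<open>The \<open>n\<close>-th member is chosen to be equal to a member of
          \<open>g\<close>, which gives inclusion in \<open>g\<close>, and to be a pair starting
          with the numeral of \<open>n\<close>, which gives the function. Choosing by
          \<open>n\<close> and not by sets is what makes Church's thesis applicable.\<close>
        obtain h where h: "VS v h"
          "\<And>u n p. v \<preceq> u \<Longrightarrow> n \<in> D u \<Longrightarrow> At u h n p \<Longrightarrow> ((\<exists>q\<in>D u. EL u q g \<and> Eq u p q) \<and>
            (\<exists>z\<in>D u. App u \<nu> n z \<and> (\<exists>c\<in>D u. isV u c \<and> Opair u p z c))) \<and> (\<exists>d. At u x n d)"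
          "\<And>u n d. v \<preceq> u \<Longrightarrow> n \<in> D u \<Longrightarrow> At u x n d \<Longrightarrow> \<exists>p. At u h n p"
        proof (rule ex_family[OF xv, of "\<lambda>u n p. (\<exists>q\<in>D u. EL u q g \<and> Eq u p q) \<and>
            (\<exists>z\<in>D u. App u \<nu> n z \<and> (\<exists>c\<in>D u. isV u c \<and> Opair u p z c))"])
          show "definable (\<lambda>_. True) v (\<lambda>u e. (\<exists>q\<in>D u. EL u q g \<and> Eq u (e 0) q) \<and>
              (\<exists>z\<in>D u. App u \<nu> (e (Suc 0)) z \<and> (\<exists>c\<in>D u. isV u c \<and> Opair u (e 0) z c)))"
            unfolding Opair_def Upair_def Mem_def
            by (rule definable_intros definable_Eq definable_EL Numerals_D[OF \<nu>v] VS_D[OF g])+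
          show "\<exists>b. VS u b \<and> (\<exists>q\<in>D u. EL u q g \<and> Eq u b q) \<and>
              (\<exists>z\<in>D u. App u \<nu> n z \<and> (\<exists>c\<in>D u. isV u c \<and> Opair u b z c))"
            if u: "v \<preceq> u" "n \<in> D u" "At u x n d" for u n d
          proof -
            have wu: "w \<preceq> u" using le_trans[OF wv u(1)] .
            obtain a where a: "At u y n a" using y(3)[OF wu u(2,3)] by blast
            \<comment> \<open>The domain hypothesis speaks of the member \<open>a\<close> of
              \<open>y\<close>; replacing it by the exact numeral \<open>z\<close> brings the pair
              into the form required of \<open>h\<close>.\<close>
            obtain z where z: "z \<in> D u" "App u \<nu> n z" "Eq u a z" using yx[OF wu u(2) a] by blast
            have aEL: "EL u a y" using At_EL[OF u(2) a] .
            obtain b where b: "b \<in> D u" "isV u b" "Related u g a b" using dom u(1) aEL EL_D[OF aEL] by blast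
            then obtain p where p: "EL u p g" "Opair u p a b" unfolding Related_def by blast
            have V: "VS u p" "VS u a" "VS u z" "VS u b"
              using EL_VS[OF VS_mono[OF u(1) g] p(1)] EL_VS[OF VS_mono[OF u(1) yv] aEL]
                Numerals_VS[OF Numerals_mono[OF u(1) \<nu>v] u(2) z(1,2)] b(1,2) by (auto simp: VS_def)
            have "Opair u p z b"
              using Opair_cong[OF V(1,1,2,3,4,4) Eq_refl[OF V(1)] z(3) Eq_refl[OF V(4)] p(2)] .
            then show ?thesis using V(1) Eq_refl[OF V(1)] p(1) EL_D[OF p(1)] z b(1,2) by blast
          qed
          show "(\<exists>q\<in>D u. EL u q g \<and> Eq u a q) \<and> (\<exists>z\<in>D u. App u \<nu> n z \<and> (\<exists>c\<in>D u. isV u c \<and> Opair u a z c))"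
            if u: "v \<preceq> u" "n \<in> D u" "VS u a" "VS u b" "Eq u a b" "(\<exists>q\<in>D u. EL u q g \<and> Eq u b q) \<and>
              (\<exists>z\<in>D u. App u \<nu> n z \<and> (\<exists>c\<in>D u. isV u c \<and> Opair u b z c))" for u n a b
          proof -
            obtain q z c where q: "q \<in> D u" "EL u q g" "Eq u b q" and z: "z \<in> D u" "App u \<nu> n z" "c \<in> D u" "isV u c" "Opair u b z c"
              using u(6) by blast
            have V: "VS u q" "VS u z" "VS u c"
              using EL_VS[OF VS_mono[OF u(1) g] q(2)] Numerals_VS[OF Numerals_mono[OF u(1) \<nu>v] u(2) z(1,2)] z(3,4)
              by (auto simp: VS_def)
            have "Opair u a z c"
              using Opair_cong[OF u(4,3) V(2,2,3,3) Eq_sym[OF u(3,4,5)] Eq_refl[OF V(2)] Eq_refl[OF V(3)] z(5)] .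
            then show ?thesis using Eq_trans[OF u(3,4) V(1) u(5) q(3)] q z by blast
          qed
        qed blast
        have "Sub v h g" unfolding Sub_def Mem_def
        proof (intro allI impI ballI)
          fix u c assume u: "v \<preceq> u" "c \<in> D u" "EL u c h"
          then show "\<exists>b\<in>D u. EL u b g \<and> Eq u c b" using h(2)[OF u(1)] EL_iff_At by blast
        qed
        moreover have "sat v (case_nat h (case_nat g ?e)) (interp E (s_function_on 0 3))"
        proof (rule sat_function_on[OF \<nu>v xv yv h(1)])
          show "(\<exists>z\<in>D u. App u \<nu> n z \<and> (\<exists>c. VS u c \<and> Opair u p z c)) \<and> (\<exists>d. At u x n d)"
            if u: "v \<preceq> u" "n \<in> D u" "At u h n p" for u n p
            using h(2)[OF u] unfolding VS_def by blast
          show "\<exists>p. At u h n p" if "v \<preceq> u" "n \<in> D u" "At u x n d" for u n d using h(3)[OF that] .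
          show "(\<exists>z\<in>D u. App u \<nu> n z \<and> Eq u a z) \<and> (\<exists>d. At u x n d)" if "v \<preceq> u" "n \<in> D u" "At u y n a" for u n a
            using y(2)[OF le_trans[OF wv that(1)] that(2,3)] .
          show "\<exists>a. At u y n a" if "v \<preceq> u" "n \<in> D u" "At u x n d" for u n d
            using y(3)[OF le_trans[OF wv that(1)] that(2,3)] .
        qed (simp_all add: numeral_eq_Suc)
        ultimately show ?thesis using h(1) unfolding VS_def by blast
      qed
      note main = this
      show ?thesis unfolding s_projective_def interp.simps sat.simps
      proof (intro allI impI ballI)
        fix v g u t
        assume v: "w \<preceq> v" "g \<in> D v" "v \<preceq> u" "isV u (tval (case_nat g ?e) (Var 0))" "u \<preceq> t"
          and hyp: "sat t (case_nat g ?e) (interp E (s_relation 0)) \<and>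
            sat t (case_nat g ?e) (interp E (s_domain_includes 0 (Suc 1)))"
        \<comment> \<open>\<open>g\<close> enters at \<open>v\<close>, is known as a v-set from
          \<open>u\<close> on, and has its domain property from \<open>t\<close> on; the selection
          is made at \<open>t\<close>.\<close>
        have "VS t g" using D_mono[OF le_trans[OF v(3,5)] v(2)] isV_mono[OF v(5,4)] by (simp add: VS_def)
        moreover have "\<forall>s. t \<preceq> s \<longrightarrow> (\<forall>a\<in>D s. EL s a y \<longrightarrow> (\<exists>b\<in>D s. isV s b \<and> Related s g a b))"
          using hyp by (simp add: sat_domain_includes)
        ultimately obtain h where "h \<in> D t" "isV t h" "Sub t h g"
          "sat t (case_nat h (case_nat g ?e)) (interp E (s_function_on 0 3))"
          using main[OF le_trans[OF le_trans[OF v(1,3)] v(5)]] by blast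
        then show "\<exists>h\<in>D t. isV t (tval (case_nat h (case_nat g ?e)) (Var 0)) \<and>
            sat t (case_nat h (case_nat g ?e)) (interp E (s_subset 0 1)) \<and>
            sat t (case_nat h (case_nat g ?e)) (interp E (s_function_on 0 (1 + 2)))"
          unfolding sat_subset by (intro bexI[of _ h]) (simp_all add: numeral_3_eq_3)
      qed
    qed
    ultimately show ?thesis
      using y(1) f(1) unfolding VS_def interp.simps sat.simps by blast
  qed
  then show ?thesis unfolding enough_subcountable_projectives_def interp.simps sat.simps
    using le_refl by auto
qed

end

theorem theorem16:
  fixes Xi :: prfun
  assumes "inj (\<lambda>(f, g). peval Xi [f, g])"
  shows "(\<exists>E. vset_equality Xi E) \<and>
         (\<forall>E. vset_equality Xi E \<longrightarrow> provable Xi (interp E enough_subcountable_projectives))"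
proof (intro conjI allI impI)
  show "\<exists>E. vset_equality Xi E" using vset_equality_bisimilar by blast
next
  fix E assume E: "vset_equality Xi E"
  show "provable Xi (interp E enough_subcountable_projectives)"
    unfolding provable_def
  proof (rule kripke_completeness)
    fix le :: "fm set list \<Rightarrow> fm set list \<Rightarrow> bool" and D
      and fn :: "prfun \<Rightarrow> (fm set list \<times> tm set) list \<Rightarrow> fm set list \<times> tm set" and isV isM isT w e
    assume "kripke_model le D fn isV isM isT Xi"
    then interpret kripke_model le D fn isV isM isT Xi .
    interpret vset_model le D fn isV isM isT Xi E
      \<comment> \<open>The provable extensionality of \<open>E\<close> becomes true in the given
        model.\<close>
      by unfold_locales (use soundness[OF E[unfolded vset_equality_def provable_def]] in blast)
    show "sat w e (interp E enough_subcountable_projectives)"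
      by (rule enough_subcountable_projectives_sat)
  qed
qed

end
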